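(* Let $\Pi_1(t)$ be the block containing $1$ of the partition $\Pi(t)$ arising from the destruction up to time $t$ of an infinite random recursive tree (see context). (i) For every $t\ge0$, the limit $$\lim_{n\to\infty}n^{-\mathrm{e}^{-t}}\#\{j\le n:j\in\Pi_1(t)\}=X_1(t)$$ exists in $(0,\infty)$ almost surely. The variable $X_1(t)$ has the Mittag-Leffler distribution with parameter $\mathrm{e}^{-t}$; that is, for $t>0$ it has the density, for $x>0$, $$\mathbb{P}(X_1(t)\in\mathrm{d}x)/\mathrm{d}x=\frac{\mathrm{e}^t}{\pi}\sum_{k=0}^\infty\frac{(-1)^{k+1}}{k!}\Gamma(k\mathrm{e}^{-t}+1)\,x^{k-1}\sin(\pi k\mathrm{e}^{-t});$$ equivalently, for every $t\geq 0$, its Mellin transform is given by $$\mathbb{E}(X_1^q(t))=\frac{\Gamma(q+1)}{\Gamma(\mathrm{e}^{-t}q+1)},\qquad q\ge0.$$ (ii) The process $(X_1(t):t\ge0)$ is Markovian; its semigroup $P_t(x,\cdot)$ is given by $$P_t(x,\cdot)=\mathbb{P}\left(x^{\mathrm{e}^{-t}}X_1(t)\in\cdot\right).$$ (iii) The process $Y(t)=\ln X_1(t)$, $t\ge0$, is of Ornstein-Uhlenbeck type. More precisely, $$L(t)=Y(t)+\int_0^tY(s)\,\mathrm{d}s,\qquad t\ge0,$$ is a spectrally negative Lévy process with cumulant-generating function $$\kappa(q)=\ln\mathbb{E}(\exp(qL(1))),\qquad q\ge0,$$ given by $\kappa(q)=q\,\psi(q+1)$, where $\psi$ denotes the digamma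 function, i.e. the logarithmic derivative of the gamma function.
   Context: $\mathbb{N}=\{1,2,\ldots\}$. The infinite random recursive tree $\mathbb{T}$ has vertex set $\mathbb{N}$ and root $1$; for each $i\ge2$ the parent $u_i$ of $i$ is uniform on $\{1,\ldots,i-1\}$, independently over $i$; $e_i$ is the edge joining $i$ to $u_i$. Let $(\epsilon_i:i\ge2)$ be i.i.d. standard exponential variables independent of $\mathbb{T}$. Edge $e_i$ is removed at time $\epsilon_i$, and $\Pi(t)$ is the partition of $\mathbb{N}$ into the connected components of the forest obtained by deleting all edges $e_i$ with $\epsilon_i\le t$. Its block containing the root $1$ is denoted $\Pi_1(t)$. A Lévy process is spectrally negative if it has no positive jumps. *)

theory Defs
  imports "HOL-Probability.Probability"
begin

text \<open>
  Destruction of a recursive tree, for one realisation: \<open>u i\<close> is the parent of the vertex \<open>i \<ge> 2\<close>,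
  and \<open>\<epsilon> i\<close> is the time at which the edge joining \<open>i\<close> to \<open>u i\<close> is removed.  The values at
  \<open>i < 2\<close> are never used.  The vertices are the positive integers, hence the carrier \<open>{1..}\<close>.
\<close>

definition remaining_edges :: "(nat \<Rightarrow> nat) \<Rightarrow> (nat \<Rightarrow> real) \<Rightarrow> real \<Rightarrow> (nat \<times> nat) set" where
  "remaining_edges u \<epsilon> t = {(i, u i) | i. 2 \<le> i \<and> \<not> \<epsilon> i \<le> t}"

definition connected_vertices :: "(nat \<Rightarrow> nat) \<Rightarrow> (nat \<Rightarrow> real) \<Rightarrow> real \<Rightarrow> (nat \<times> nat) set" where
  "connected_vertices u \<epsilon> t =
     (remaining_edges u \<epsilon> t \<union> (remaining_edges u \<epsilon> t)\<inverse>)\<^sup>* \<inter> ({1..} \<times> {1..})"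

definition component_partition :: "(nat \<Rightarrow> nat) \<Rightarrow> (nat \<Rightarrow> real) \<Rightarrow> real \<Rightarrow> nat set set" where
  "component_partition u \<epsilon> t = {1..} // connected_vertices u \<epsilon> t"

definition root_block :: "(nat \<Rightarrow> nat) \<Rightarrow> (nat \<Rightarrow> real) \<Rightarrow> real \<Rightarrow> nat set" where
  "root_block u \<epsilon> t = (THE B. B \<in> component_partition u \<epsilon> t \<and> 1 \<in> B)"

lemma equiv_connected_vertices: "equiv {1..} (connected_vertices u \<epsilon> t)"
proof (rule equivI)
  let ?E = "remaining_edges u \<epsilon> t"
  show "connected_vertices u \<epsilon> t \<subseteq> {1..} \<times> {1..}"
    by (auto simp: connected_vertices_def)
  show "refl_on {1..} (connected_vertices u \<epsilon> t)"
    by (auto simp: refl_on_def connected_vertices_def)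
  have "sym ((?E \<union> ?E\<inverse>)\<^sup>*)"
    by (rule sym_rtrancl) (auto simp: sym_def)
  then show "sym (connected_vertices u \<epsilon> t)"
    by (auto simp: connected_vertices_def sym_def)
  show "trans (connected_vertices u \<epsilon> t)"
    by (rule transI) (auto simp: connected_vertices_def intro: rtrancl_trans)
qed

lemma root_block_eq: "root_block u \<epsilon> t = connected_vertices u \<epsilon> t `` {1}"
  unfolding root_block_def
proof (rule the_equality)
  let ?R = "connected_vertices u \<epsilon> t"
  have eq: "equiv {1..} ?R" by (rule equiv_connected_vertices)
  show "?R `` {1} \<in> component_partition u \<epsilon> t \<and> 1 \<in> ?R `` {1}"
    using equiv_class_self[OF eq, of 1] by (auto simp: component_partition_def intro: quotientI)
  fix B assume B: "B \<in> component_partition u \<epsilon> t \<and> 1 \<in> B"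
  then obtain x where x: "x \<in> {1..}" "B = ?R `` {x}"
    by (auto simp: component_partition_def elim: quotientE)
  with B have "(x, 1) \<in> ?R" by auto
  from equiv_class_eq[OF eq this] x show "B = ?R `` {1}" by simp
qed

locale random_tree_destruction = prob_space M
  for M :: "'a measure" +
  fixes u :: "nat \<Rightarrow> 'a \<Rightarrow> nat" and \<epsilon> :: "nat \<Rightarrow> 'a \<Rightarrow> real"
  assumes u_measurable: "\<And>i. 2 \<le> i \<Longrightarrow> u i \<in> measurable M (count_space UNIV)"
    and u_uniform: "\<And>i. 2 \<le> i \<Longrightarrow>
          distr M (count_space UNIV) (u i) = measure_pmf (pmf_of_set {1..<i})"
    and u_indep: "indep_vars (\<lambda>_. count_space UNIV) u {2..}"
    and \<epsilon>_exponential: "\<And>i. 2 \<le> i \<Longrightarrow> distributed M lborel (\<epsilon> i) (exponential_density 1)"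
    and \<epsilon>_indep: "indep_vars (\<lambda>_. borel) \<epsilon> {2..}"
    and u_\<epsilon>_indep: "indep_set
          (sets (vimage_algebra (space M) (\<lambda>\<omega>. \<lambda>i\<in>{2..}. u i \<omega>) (\<Pi>\<^sub>M i\<in>{2..}. count_space UNIV)))
          (sets (vimage_algebra (space M) (\<lambda>\<omega>. \<lambda>i\<in>{2..}. \<epsilon> i \<omega>) (\<Pi>\<^sub>M i\<in>{2..}. borel)))"

definition scaled_count ::
    "(nat \<Rightarrow> 'a \<Rightarrow> nat) \<Rightarrow> (nat \<Rightarrow> 'a \<Rightarrow> real) \<Rightarrow> real \<Rightarrow> 'a \<Rightarrow> nat \<Rightarrow> real" where
  "scaled_count u \<epsilon> t \<omega> n =
     real n powr (- exp (- t)) *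
     real (card {j. j \<le> n \<and> j \<in> root_block (\<lambda>i. u i \<omega>) (\<lambda>i. \<epsilon> i \<omega>) t})"

definition X\<^sub>1 :: "(nat \<Rightarrow> 'a \<Rightarrow> nat) \<Rightarrow> (nat \<Rightarrow> 'a \<Rightarrow> real) \<Rightarrow> real \<Rightarrow> 'a \<Rightarrow> real" where
  "X\<^sub>1 u \<epsilon> t \<omega> = lim (scaled_count u \<epsilon> t \<omega>)"

definition Y :: "(nat \<Rightarrow> 'a \<Rightarrow> nat) \<Rightarrow> (nat \<Rightarrow> 'a \<Rightarrow> real) \<Rightarrow> real \<Rightarrow> 'a \<Rightarrow> real" where
  "Y u \<epsilon> t \<omega> = ln (X\<^sub>1 u \<epsilon> t \<omega>)"

text \<open>
  \<open>Y\<close> and \<open>L\<close> are built pathwise from the limit \<open>X\<^sub>1\<close> itself, not from a regularised version of it.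
\<close>

definition L :: "(nat \<Rightarrow> 'a \<Rightarrow> nat) \<Rightarrow> (nat \<Rightarrow> 'a \<Rightarrow> real) \<Rightarrow> real \<Rightarrow> 'a \<Rightarrow> real" where
  "L u \<epsilon> t \<omega> = Y u \<epsilon> t \<omega> + (LBINT s:{0..t}. Y u \<epsilon> s \<omega>)"

definition mittag_leffler_term :: "real \<Rightarrow> real \<Rightarrow> nat \<Rightarrow> real" where
  "mittag_leffler_term t x k =
     (-1) ^ (k + 1) / fact k * Gamma (real k * exp (- t) + 1) * x powi (int k - 1)
       * sin (pi * real k * exp (- t))"

definition mittag_leffler_density :: "real \<Rightarrow> real \<Rightarrow> real" where
  "mittag_leffler_density t x =
     (if 0 < x then exp t / pi * (\<Sum>k. mittag_leffler_term t x k) else 0)"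

text \<open>
  Real-valued processes in continuous time.  The state space \<open>E\<close> of a Markov process is a set of
  reals in which the process lies almost surely at each time; the kernels are measures on \<open>borel\<close>
  that are concentrated on \<open>E\<close>.
\<close>

definition markov_semigroup :: "real set \<Rightarrow> (real \<Rightarrow> real \<Rightarrow> real measure) \<Rightarrow> bool" where
  "markov_semigroup E P \<longleftrightarrow>
     (\<forall>t\<ge>0. \<forall>x\<in>E. prob_space (P t x) \<and> sets (P t x) = sets borel \<and> (AE y in P t x. y \<in> E)) \<and>
     (\<forall>t\<ge>0. \<forall>A\<in>sets borel. (\<lambda>x. emeasure (P t x) A) \<in> borel_measurable (restrict_space borel E)) \<and>
     (\<forall>x\<in>E. P 0 x = return borel x) \<and>
     (\<forall>s\<ge>0. \<forall>t\<ge>0. \<forall>x\<in>E. \<forall>A\<in>sets borel.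
        emeasure (P (s + t) x) A = (\<integral>\<^sup>+ y\<in>E. emeasure (P t y) A \<partial>P s x))"

definition natural_filtration :: "'a measure \<Rightarrow> (real \<Rightarrow> 'a \<Rightarrow> real) \<Rightarrow> real \<Rightarrow> 'a measure" where
  "natural_filtration M X s =
     sigma (space M) {X r -` A \<inter> space M | r A. 0 \<le> r \<and> r \<le> s \<and> A \<in> sets borel}"

definition markov_process ::
    "'a measure \<Rightarrow> real set \<Rightarrow> (real \<Rightarrow> 'a \<Rightarrow> real) \<Rightarrow> (real \<Rightarrow> real \<Rightarrow> real measure) \<Rightarrow> bool" where
  "markov_process M E X P \<longleftrightarrow>
     markov_semigroup E P \<and>
     (\<forall>t\<ge>0. X t \<in> borel_measurable M \<and> (AE \<omega> in M. X t \<omega> \<in> E)) \<and>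
     (\<forall>s\<ge>0. \<forall>t\<ge>0. \<forall>A\<in>sets borel. AE \<omega> in M.
        real_cond_exp M (natural_filtration M X s) (\<lambda>\<omega>. indicator A (X (s + t) \<omega>)) \<omega>
          = measure (P t (X s \<omega>)) A)"

definition cadlag :: "(real \<Rightarrow> real) \<Rightarrow> bool" where
  "cadlag f \<longleftrightarrow>
     (\<forall>t\<ge>0. (f \<longlongrightarrow> f t) (at_right t)) \<and> (\<forall>t>0. \<exists>l. (f \<longlongrightarrow> l) (at_left t))"

definition levy_process :: "'a measure \<Rightarrow> (real \<Rightarrow> 'a \<Rightarrow> real) \<Rightarrow> bool" where
  "levy_process M Z \<longleftrightarrow>
     (\<forall>t\<ge>0. Z t \<in> borel_measurable M) \<and>
     (AE \<omega> in M. Z 0 \<omega> = 0) \<and>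
     (AE \<omega> in M. cadlag (\<lambda>t. Z t \<omega>)) \<and>
     (\<forall>n (\<tau> :: nat \<Rightarrow> real). 0 \<le> \<tau> 0 \<and> (\<forall>k<n. \<tau> k \<le> \<tau> (Suc k)) \<longrightarrow>
        prob_space.indep_vars M (\<lambda>_. borel) (\<lambda>k \<omega>. Z (\<tau> (Suc k)) \<omega> - Z (\<tau> k) \<omega>) {..<n}) \<and>
     (\<forall>s\<ge>0. \<forall>t\<ge>0. distr M borel (\<lambda>\<omega>. Z (s + t) \<omega> - Z s \<omega>) = distr M borel (\<lambda>\<omega>. Z t \<omega> - Z 0 \<omega>))"

definition spectrally_negative_levy_process :: "'a measure \<Rightarrow> (real \<Rightarrow> 'a \<Rightarrow> real) \<Rightarrow> bool" where
  "spectrally_negative_levy_process M Z \<longleftrightarrow>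
     levy_process M Z \<and>
     (AE \<omega> in M. \<forall>t>0. \<forall>l. ((\<lambda>s. Z s \<omega>) \<longlongrightarrow> l) (at_left t) \<longrightarrow> Z t \<omega> \<le> l)"

end

theory Submission
  imports Defs "HOL-Complex_Analysis.Complex_Analysis"
begin

text \<open>
  All objects of the theorem are functions of the marks \<open>(u i, \<epsilon> i)\<close>, \<open>i \<ge> 2\<close>, which are
  independent.  The arguments take place on the product space \<open>rrt\<close> of mark sequences, where
  \<open>mass\<close>, \<open>log_mass\<close> and \<open>levy\<close> are the versions of \<open>X\<^sub>1\<close>, \<open>Y\<close> and \<open>L\<close>, and are
  transferred at the end.  Let \<open>N n t\<close> be the number of vertices up to \<open>n\<close> in the root block at
  time \<open>t\<close> (\<open>root_count\<close>).

  The structural fact is a branching Markov property.  Number the vertices of the root block at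
  time \<open>s\<close> by their rank and subtract \<open>s\<close> from their clocks.  A vertex that is attached to the
  root block chooses its parent uniformly in it, and its clock is memoryless; hence the
  renumbered tree (\<open>shift s\<close>) is again a tree with law \<open>rrt\<close>, and it is independent of the
  history of the root block up to \<open>s\<close> (\<open>prob_root_alg_shift\<close>).  Since \<open>N n (s + r)\<close> is the count
  at time \<open>r\<close> in the shifted tree among its first \<open>N n s\<close> vertices, the limit satisfies
  \<open>X (s + r) = X s powr exp (- r) * X' r\<close> with \<open>X'\<close> an independent copy (\<open>mass_shift\<close>).  This is
  the Markov property with the stated semigroup.  In logarithms it reads
  \<open>Y (s + r) = exp (- r) * Y s + Y' r\<close>, and integrating gives \<open>L (s + r) - L s = L' r\<close>
  (\<open>levy_shift\<close>), so \<open>L\<close> has stationary independent increments.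

  The limit itself comes from two families of martingales.  Put
  \<open>G q k = Gamma (k + q) / (Gamma k * Gamma (q + 1))\<close> (\<open>rising\<close>), which is of order \<open>k powr q\<close>.
  Vertex \<open>n + 1\<close> joins the root block with probability \<open>exp (- t) * N n t / n\<close>, so \<open>G q (N n t)\<close>
  has mean \<open>G (exp (- t) * q) n\<close>; by the Markov property \<open>G (p * exp t) (N n t)\<close> is, for fixed
  \<open>n\<close>, a martingale in \<open>t\<close>.  The paths of \<open>L\<close> are built from the pointwise limits, so convergence is
  needed at all times simultaneously.  Doob's inequality in \<open>t\<close> reduces uniform estimates on a time
  interval to its right end; there, \<open>L\<^sup>2\<close> bounds for \<open>G (exp t) (N n t) / n\<close> and the Borel-Cantelli
  lemma yield uniform convergence along the polynomial sequence \<open>n = k ^ a\<close>, a negative \<open>p\<close> keeps the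
  limit away from zero, and monotonicity of \<open>N n t\<close> in \<open>n\<close> fills the gaps
  (\<open>AE_uniformly_convergent_log_count\<close>).  A uniform limit inherits right-continuity, left limits
  and the absence of upward jumps from the counts, which decrease in \<open>t\<close>.

  The means of \<open>G q (N n t)\<close> converge to the moments of \<open>X\<close> (\<open>moments_mass\<close>), for negative exponents
  near zero as well.  The series of the Mittag-Leffler density is an integral of Hankel type
  along a rotated ray (\<open>ray_kernel_series\<close>); exchanging two integrals and using the reflection
  formula shows that its Mellin transform on those negative exponents is the same
  (\<open>ray_kernel_Mellin\<close>), and Mellin transforms determine the law (\<open>Mellin_unique\<close>).

  Finally \<open>L 1\<close> is the limit of the sums over \<open>j < n\<close> of
  \<open>Y ((j + 1) / n) - exp (- 1 / n) * Y (j / n)\<close>.  The summands are independent copies of \<open>Y (1 / n)\<close>,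
  whence the exponential moment of \<open>q * L 1\<close> is the limit of
  \<open>(Gamma (q + 1) / Gamma (exp (- 1 / n) * q + 1)) ^ n\<close>, a derivative at zero (\<open>cumulant_levy\<close>).
\<close>

section \<open>The root block of a deterministic tree\<close>

definition par :: "nat \<Rightarrow> (nat \<Rightarrow> nat \<times> real) \<Rightarrow> nat" where
  "par i z = fst (z i)"

definition cut :: "nat \<Rightarrow> (nat \<Rightarrow> nat \<times> real) \<Rightarrow> real" where
  "cut i z = snd (z i)"

definition in_root :: "real \<Rightarrow> (nat \<Rightarrow> nat \<times> real) \<Rightarrow> nat \<Rightarrow> bool" where
  "in_root t z i \<longleftrightarrow> i \<in> root_block (\<lambda>i. par i z) (\<lambda>i. cut i z) t"

definition root_count :: "nat \<Rightarrow> real \<Rightarrow> (nat \<Rightarrow> nat \<times> real) \<Rightarrow> nat" where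
  "root_count n t z = card {j. j \<le> n \<and> in_root t z j}"

abbreviation edges :: "real \<Rightarrow> (nat \<Rightarrow> nat \<times> real) \<Rightarrow> (nat \<times> nat) set" where
  "edges t z \<equiv> remaining_edges (\<lambda>i. par i z) (\<lambda>i. cut i z) t"

definition valid :: "(nat \<Rightarrow> nat \<times> real) \<Rightarrow> bool" where
  "valid z \<longleftrightarrow> (\<forall>i\<ge>2. par i z \<in> {1..<i})"

lemma in_root_iff_path:
  "in_root t z i \<longleftrightarrow> 1 \<le> i \<and> (1, i) \<in> (edges t z \<union> (edges t z)\<inverse>)\<^sup>*"
  by (auto simp: in_root_def root_block_eq connected_vertices_def)

text \<open>
  In a valid tree a vertex belongs to the root block iff its whole ancestral line survives.  The
  recursive form is what inductions over the vertices need.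
\<close>

inductive alive :: "real \<Rightarrow> (nat \<Rightarrow> nat \<times> real) \<Rightarrow> nat \<Rightarrow> bool" for t z where
  root: "alive t z 1"
| child: "2 \<le> i \<Longrightarrow> t < cut i z \<Longrightarrow> alive t z (par i z) \<Longrightarrow> alive t z i"

lemma in_root_iff_alive:
  assumes "valid z"
  shows "in_root t z i \<longleftrightarrow> alive t z i"
proof
  assume "alive t z i"
  then show "in_root t z i"
  proof induction
    case root then show ?case by (simp add: in_root_iff_path)
  next
    case (child i)
    have "(par i z, i) \<in> edges t z \<union> (edges t z)\<inverse>"
      using child by (auto simp: remaining_edges_def)
    then have "(1, i) \<in> (edges t z \<union> (edges t z)\<inverse>)\<^sup>*"
      using child unfolding in_root_iff_path by (meson rtrancl.rtrancl_into_rtrancl)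
    with child show ?case by (simp add: in_root_iff_path)
  qed
next
  assume "in_root t z i"
  then have "(1, i) \<in> (edges t z \<union> (edges t z)\<inverse>)\<^sup>*" by (simp add: in_root_iff_path)
  then show "alive t z i"
  proof (induction rule: rtrancl_induct)
    case base show ?case by (rule alive.root)
  next
    case (step a b)
    then show ?case
    proof (cases "(a, b) \<in> edges t z")
      case True
      then have a: "2 \<le> a" "b = par a z" by (auto simp: remaining_edges_def)
      with step.IH show ?thesis by (auto elim: alive.cases)
    next
      case False
      with step have "(b, a) \<in> edges t z" by auto
      with step.IH show ?thesis by (auto simp: remaining_edges_def intro!: alive.child)
    qed
  qed
qed

lemma in_root_1 [simp]: "in_root t z (Suc 0)"
  by (simp add: in_root_iff_path)

lemma not_in_root_0 [simp]: "\<not> in_root t z 0"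
  by (simp add: in_root_iff_path)

lemma in_root_rec:
  assumes "valid z" "2 \<le> i"
  shows "in_root t z i \<longleftrightarrow> t < cut i z \<and> in_root t z (par i z)"
  using assms alive.simps[of t z i] by (simp add: in_root_iff_alive)

lemma in_root_cong:
  assumes "valid z" "valid z'" "\<And>j. 2 \<le> j \<Longrightarrow> j \<le> i \<Longrightarrow> z j = z' j"
  shows "in_root t z i \<longleftrightarrow> in_root t z' i"
  using assms(3)
proof (induction i rule: less_induct)
  case (less i)
  consider "i = 0" | "i = 1" | "2 \<le> i" by linarith
  then show ?case
  proof cases
    case 3
    have "par i z < i" using assms(1) 3 by (auto simp: valid_def)
    then have "in_root t z (par i z) \<longleftrightarrow> in_root t z' (par i z)"
      using less.prems by (intro less.IH) auto
    with less.prems[of i] 3 show ?thesis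
      by (simp add: in_root_rec[OF assms(1)] in_root_rec[OF assms(2)] par_def cut_def)
  qed auto
qed

lemma in_root_antimono: "s \<le> t \<Longrightarrow> in_root t z i \<Longrightarrow> in_root s z i"
proof -
  assume "s \<le> t"
  then have "edges t z \<union> (edges t z)\<inverse> \<subseteq> edges s z \<union> (edges s z)\<inverse>"
    by (auto simp: remaining_edges_def)
  from rtrancl_mono[OF this] show "in_root t z i \<Longrightarrow> in_root s z i"
    by (auto simp: in_root_iff_path)
qed

text \<open>
  A vertex is joined to the root by a finite path, and the finitely many clocks on this path all
  exceed \<open>t\<close> strictly.
\<close>

lemma in_root_right_open:
  assumes "in_root t z i"
  obtains s where "t < s" "in_root s z i"
proof -
  have "(1, i) \<in> (edges t z \<union> (edges t z)\<inverse>)\<^sup>*"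
    using assms by (simp add: in_root_iff_path)
  then have "\<exists>s>t. (1, i) \<in> (edges s z \<union> (edges s z)\<inverse>)\<^sup>*"
  proof (induction rule: rtrancl_induct)
    case base show ?case by (auto intro: exI[of _ "t + 1"])
  next
    case (step a b)
    then obtain s where s: "s > t" "(1, a) \<in> (edges s z \<union> (edges s z)\<inverse>)\<^sup>*" by auto
    obtain c where c: "t < c" "(a, b) \<in> edges r z \<union> (edges r z)\<inverse>" if "r < c" for r
    proof (cases "(a, b) \<in> edges t z")
      case True
      then show ?thesis by (intro that[of "cut a z"]) (auto simp: remaining_edges_def)
    next
      case False
      with step show ?thesis by (intro that[of "cut b z"]) (auto simp: remaining_edges_def)
    qed
    have tc: "t < c" using c(1)[of "c - 1"] by simp
    define r where "r = min s ((t + c) / 2)"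
    have r: "r \<le> s" "r < c" "t < r" using tc s by (auto simp: r_def min_def)
    have "edges s z \<union> (edges s z)\<inverse> \<subseteq> edges r z \<union> (edges r z)\<inverse>"
      using r by (auto simp: remaining_edges_def)
    from rtrancl_mono[OF this] s have "(1, a) \<in> (edges r z \<union> (edges r z)\<inverse>)\<^sup>*" by auto
    moreover have "(a, b) \<in> edges r z \<union> (edges r z)\<inverse>" using c r by auto
    ultimately have "(1, b) \<in> (edges r z \<union> (edges r z)\<inverse>)\<^sup>*" by (rule rtrancl_into_rtrancl)
    with r show ?case by auto
  qed
  then show ?thesis using assms that by (auto simp: in_root_iff_path)
qed

lemma root_count_0 [simp]: "root_count 0 t z = 0"
  using not_in_root_0 by (auto simp: root_count_def)

lemma root_count_Suc: "root_count (Suc n) t z = root_count n t z + (if in_root t z (Suc n) then 1 else 0)"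
proof -
  have "{j. j \<le> Suc n \<and> in_root t z j} =
        (if in_root t z (Suc n) then insert (Suc n) {j. j \<le> n \<and> in_root t z j} else {j. j \<le> n \<and> in_root t z j})"
    by (auto simp: le_Suc_eq)
  then show ?thesis by (auto simp: root_count_def)
qed

lemma root_count_1 [simp]: "root_count (Suc 0) t z = 1"
  by (simp add: root_count_Suc)

lemma root_count_eq_sum: "root_count n t z = (\<Sum>i\<le>n. if in_root t z i then 1 else 0)"
  by (induction n) (auto simp: root_count_Suc)

lemma root_count_mono: "m \<le> n \<Longrightarrow> root_count m t z \<le> root_count n t z"
  unfolding root_count_def by (intro card_mono) auto

lemma root_count_le: "root_count n t z \<le> n"
  by (induction n) (auto simp: root_count_Suc)

lemma root_count_pos: "1 \<le> n \<Longrightarrow> 1 \<le> root_count n t z"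
  using root_count_mono[of 1 n t z] by simp

lemma root_count_antimono: "s \<le> t \<Longrightarrow> root_count n t z \<le> root_count n s z"
  unfolding root_count_def by (intro card_mono) (auto intro: in_root_antimono)

lemma root_count_cong:
  assumes "valid z" "valid z'" "\<And>j. 2 \<le> j \<Longrightarrow> j \<le> n \<Longrightarrow> z j = z' j"
  shows "root_count n t z = root_count n t z'"
proof -
  have "{j. j \<le> n \<and> in_root t z j} = {j. j \<le> n \<and> in_root t z' j}"
    using assms(3) by (intro Collect_cong conj_cong refl in_root_cong[OF assms(1,2)]) auto
  then show ?thesis by (simp add: root_count_def)
qed

lemma root_count_right_const:
  obtains s where "t < s" "\<And>r. t \<le> r \<Longrightarrow> r \<le> s \<Longrightarrow> root_count n r z = root_count n t z"
proof -
  have "\<exists>s>t. \<forall>i\<le>n. in_root t z i \<longrightarrow> in_root s z i"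
  proof (induction n)
    case 0 show ?case by (auto intro: exI[of _ "t + 1"])
  next
    case (Suc n)
    then obtain s where s: "s > t" "\<forall>i\<le>n. in_root t z i \<longrightarrow> in_root s z i" by auto
    obtain s' where s': "s' > t" "in_root t z (Suc n) \<longrightarrow> in_root s' z (Suc n)"
      using in_root_right_open[of t z "Suc n"] gt_ex[of t] by blast
    then show ?case using s
      using in_root_antimono[of "min s s'" s z] in_root_antimono[of "min s s'" s' z]
      by (intro exI[of _ "min s s'"]) (auto simp: le_Suc_eq)
  qed
  then obtain s where s: "s > t" "\<forall>i\<le>n. in_root t z i \<longrightarrow> in_root s z i" by auto
  have "root_count n r z = root_count n t z" if "t \<le> r" "r \<le> s" for r
  proof (rule antisym)
    show "root_count n r z \<le> root_count n t z" using that by (intro root_count_antimono)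
    show "root_count n t z \<le> root_count n r z"
      unfolding root_count_def using s that
      by (intro card_mono) (auto intro: in_root_antimono)
  qed
  with s show ?thesis using that by blast
qed

section \<open>Canonical space\<close>

definition exp_law :: "real measure" where
  "exp_law = density lborel (exponential_density 1)"

definition mark :: "nat \<Rightarrow> (nat \<times> real) measure" where
  "mark i = measure_pmf (pmf_of_set {1..<i}) \<Otimes>\<^sub>M exp_law"

definition rrt :: "(nat \<Rightarrow> nat \<times> real) measure" where
  "rrt = (\<Pi>\<^sub>M i\<in>{2..}. mark i)"

lemma sets_exp_law [simp, measurable_cong]: "sets exp_law = sets borel"
  by (simp add: exp_law_def)

lemma space_exp_law [simp]: "space exp_law = UNIV"
  by (simp add: exp_law_def)

lemma prob_space_exp_law: "prob_space exp_law"
  unfolding exp_law_def by (rule prob_space_exponential_density) simp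

interpretation exp_law: prob_space exp_law
  by (rule prob_space_exp_law)

lemma emeasure_exp_law_greater: "0 \<le> t \<Longrightarrow> emeasure exp_law {t<..} = ennreal (exp (- t))"
proof -
  assume t: "0 \<le> t"
  have D: "distributed exp_law lborel (\<lambda>x. x) (exponential_density 1)"
    by (auto simp: distributed_def distr_id2 exp_law_def)
  have "exp_law.prob {x \<in> space exp_law. t < x} = exp (- t * 1)"
    using exp_law.exponential_distributedD_gt[OF D t] by simp
  then show ?thesis by (simp add: exp_law.emeasure_eq_measure greaterThan_def)
qed

lemma AE_exp_law_pos: "AE x in exp_law. 0 < x"
proof -
  have "exp_law.prob {0<..} = 1"
    using emeasure_exp_law_greater[of 0] by (simp add: exp_law.emeasure_eq_measure)
  then show ?thesis using exp_law.prob_eq_1[of "{0<..}"] by simp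
qed

lemma prob_space_mark: "prob_space (mark i)"
proof -
  interpret p: pair_prob_space "measure_pmf (pmf_of_set {1..<i})" exp_law
    by unfold_locales
  show ?thesis unfolding mark_def by (rule p.prob_space_axioms)
qed

lemma sets_mark [measurable_cong]: "sets (mark i) = sets (count_space UNIV \<Otimes>\<^sub>M borel)"
  unfolding mark_def by (intro sets_pair_measure_cong) auto

lemma space_mark [simp]: "space (mark i) = UNIV"
  by (simp add: mark_def space_pair_measure)

interpretation mark: prob_space "mark i" for i
  by (rule prob_space_mark)

interpretation rrt: prob_space rrt
  unfolding rrt_def by (rule prob_space_PiM) (rule prob_space_mark)

lemma measurable_fst_mark [measurable]: "fst \<in> mark i \<rightarrow>\<^sub>M count_space UNIV"
  and measurable_snd_mark [measurable]: "snd \<in> mark i \<rightarrow>\<^sub>M borel"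
  by (simp_all add: measurable_cong_sets[OF sets_mark refl])

lemma measurable_component_rrt: "(\<lambda>z. z i) \<in> rrt \<rightarrow>\<^sub>M count_space UNIV \<Otimes>\<^sub>M borel"
proof (cases "2 \<le> i")
  case True
  then have "(\<lambda>z. z i) \<in> rrt \<rightarrow>\<^sub>M mark i"
    unfolding rrt_def by (intro measurable_component_singleton) auto
  then show ?thesis by (simp cong: measurable_cong_sets add: measurable_cong_sets[OF refl sets_mark])
next
  case False
  have "(\<lambda>z. z i) \<in> rrt \<rightarrow>\<^sub>M count_space UNIV \<Otimes>\<^sub>M borel \<longleftrightarrow> (\<lambda>z. undefined :: nat \<times> real) \<in> rrt \<rightarrow>\<^sub>M count_space UNIV \<Otimes>\<^sub>M borel"
    using False by (intro measurable_cong) (auto simp: rrt_def space_PiM PiE_def extensional_def)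
  then show ?thesis by (simp add: space_pair_measure)
qed

lemma measurable_par [measurable]: "par i \<in> rrt \<rightarrow>\<^sub>M count_space UNIV"
  and measurable_cut [measurable]: "cut i \<in> borel_measurable rrt"
  unfolding par_def cut_def using measurable_component_rrt[of i]
  by (auto intro: measurable_compose[OF _ measurable_fst] measurable_compose[OF _ measurable_snd])

lemma nn_integral_mark:
  assumes "2 \<le> i" "f \<in> borel_measurable (mark i)"
  shows "(\<integral>\<^sup>+ y. f y \<partial>mark i) = (\<Sum>v\<in>{1..<i}. \<integral>\<^sup>+ e. f (v, e) \<partial>exp_law) / of_nat (i - 1)"
proof -
  interpret p: pair_sigma_finite "measure_pmf (pmf_of_set {1..<i})" exp_law ..
  have "(\<integral>\<^sup>+ y. f y \<partial>mark i) = (\<integral>\<^sup>+ v. \<integral>\<^sup>+ e. f (v, e) \<partial>exp_law \<partial>measure_pmf (pmf_of_set {1..<i}))"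
    using assms(2) unfolding mark_def by (intro exp_law.nn_integral_fst[symmetric])
  also have "\<dots> = (\<Sum>v\<in>{1..<i}. \<integral>\<^sup>+ e. f (v, e) \<partial>exp_law) / of_nat (i - 1)"
    using assms(1) by (subst nn_integral_pmf_of_set) auto
  finally show ?thesis .
qed

lemma AE_mark_valid: "2 \<le> i \<Longrightarrow> AE y in mark i. fst y \<in> {1..<i} \<and> 0 < snd y"
proof -
  assume i: "2 \<le> i"
  interpret p: pair_prob_space "measure_pmf (pmf_of_set {1..<i})" exp_law ..
  have m: "Measurable.pred (mark i) (\<lambda>y. fst y \<in> {1..<i})" "Measurable.pred (mark i) (\<lambda>y. 0 < snd y)"
    by (rule measurable_compose[OF measurable_fst_mark], simp)
       (rule measurable_compose[OF measurable_snd_mark], simp)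
  note m = m[unfolded pred_def mark_def]
  have "AE y in mark i. fst y \<in> {1..<i}"
    unfolding mark_def
  proof (rule p.AE_pair_measure[OF m(1)])
    show "AE x in measure_pmf (pmf_of_set {1..<i}). AE y in exp_law. fst (x, y) \<in> {1..<i}"
      using i by (auto simp: AE_measure_pmf_iff set_pmf_of_set)
  qed
  moreover have "AE y in mark i. 0 < snd y"
    unfolding mark_def
  proof (rule p.AE_pair_measure[OF m(2)])
    show "AE x in measure_pmf (pmf_of_set {1..<i}). AE y in exp_law. 0 < snd (x, y)"
      using AE_exp_law_pos by simp
  qed
  ultimately show ?thesis by eventually_elim auto
qed

lemma AE_valid: "AE z in rrt. valid z \<and> (\<forall>i\<ge>2. 0 < cut i z)"
proof -
  have "AE z in rrt. \<forall>i. 2 \<le> i \<longrightarrow> fst (z i) \<in> {1..<i} \<and> 0 < snd (z i)"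
    unfolding AE_all_countable
  proof
    fix i :: nat
    show "AE z in rrt. 2 \<le> i \<longrightarrow> fst (z i) \<in> {1..<i} \<and> 0 < snd (z i)"
    proof (cases "2 \<le> i")
      case True
      have "AE z in (\<Pi>\<^sub>M i\<in>{2..}. mark i). fst (z i) \<in> {1..<i} \<and> 0 < snd (z i)"
        by (rule AE_PiM_component[OF prob_space_mark]) (use True AE_mark_valid[OF True] in auto)
      then show ?thesis unfolding rrt_def by eventually_elim simp
    qed simp
  qed
  then show ?thesis by eventually_elim (auto simp: valid_def par_def cut_def)
qed

lemma measurable_fun_upd_tree [measurable]:
  assumes "2 \<le> n"
  shows "(\<lambda>(y, z). z(n := y)) \<in> mark n \<Otimes>\<^sub>M rrt \<rightarrow>\<^sub>M rrt"
proof -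
  have "insert n {2..} = {2..}" using assms by auto
  then show ?thesis unfolding rrt_def
    by (metis (no_types, lifting) measurable_add_dim measurable_cong_simp measurable_pair_swap_iff split_beta split_def
        case_prod_conv prod.collapse measurable_add_dim[of n "{2..}" mark, THEN measurable_pair_swap])
qed

lemma distr_fun_upd_tree:
  assumes "2 \<le> n"
  shows "distr (mark n \<Otimes>\<^sub>M rrt) rrt (\<lambda>(y, z). z(n := y)) = rrt"
proof -
  have "insert n {2..} = {2..}" using assms by auto
  with distr_pair_PiM_eq_PiM[of "{2..}" mark n] prob_space_mark show ?thesis
    by (simp add: rrt_def)
qed

text \<open>
  The mark of one vertex may be drawn last, which turns statements about the tree on \<open>n\<close> vertices
  into statements about the tree with one more vertex.
\<close>

lemma nn_integral_resample:
  assumes "2 \<le> n" "f \<in> borel_measurable rrt"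
  shows "(\<integral>\<^sup>+ z. f z \<partial>rrt) = (\<integral>\<^sup>+ z. \<integral>\<^sup>+ y. f (z(n := y)) \<partial>mark n \<partial>rrt)"
proof -
  interpret p: pair_sigma_finite "mark n" rrt ..
  have "(\<integral>\<^sup>+ z. f z \<partial>rrt) = (\<integral>\<^sup>+ yz. f ((\<lambda>(y, z). z(n := y)) yz) \<partial>(mark n \<Otimes>\<^sub>M rrt))"
    using assms by (subst distr_fun_upd_tree[OF assms(1), symmetric]) (rule nn_integral_distr, measurable)
  also have "\<dots> = (\<integral>\<^sup>+ z. \<integral>\<^sup>+ y. f (z(n := y)) \<partial>mark n \<partial>rrt)"
    using measurable_compose[OF measurable_fun_upd_tree assms(2)] assms(1)
    by (subst p.nn_integral_snd[symmetric]) (auto simp: case_prod_beta)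
  finally show ?thesis .
qed

section \<open>Measurability\<close>

lemma pred_path [measurable]:
  "Measurable.pred rrt (\<lambda>z. (a, b) \<in> (edges t z \<union> (edges t z)\<inverse>) ^^ n)"
proof (induction n arbitrary: b)
  case 0 show ?case by simp
next
  case (Suc n)
  have e: "Measurable.pred rrt (\<lambda>z. (a, b) \<in> edges t z)" for a b
  proof (cases "2 \<le> a")
    case True
    then have "(\<lambda>z. (a, b) \<in> edges t z) = (\<lambda>z. par a z = b \<and> t < cut a z)"
      by (auto simp: remaining_edges_def)
    with True show ?thesis by simp
  next
    case False then show ?thesis by (simp add: remaining_edges_def)
  qed
  have "(\<lambda>z. (a, b) \<in> (edges t z \<union> (edges t z)\<inverse>) ^^ Suc n) =
     (\<lambda>z. \<exists>c. (a, c) \<in> (edges t z \<union> (edges t z)\<inverse>) ^^ n \<and> ((c, b) \<in> edges t z \<or> (b, c) \<in> edges t z))"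
    by (auto simp: relcomp_unfold)
  then show ?case using e Suc.IH by simp
qed

lemma pred_in_root [measurable]: "Measurable.pred rrt (\<lambda>z. in_root t z i)"
  unfolding in_root_iff_path rtrancl_power by measurable

lemma measurable_root_count [measurable]: "root_count n t \<in> rrt \<rightarrow>\<^sub>M count_space UNIV"
proof -
  have "root_count n t = (\<lambda>z. \<Sum>i\<le>n. if in_root t z i then 1 else 0)"
    by (rule ext) (rule root_count_eq_sum)
  then show ?thesis by simp
qed

section \<open>One step of the recursion\<close>

lemma valid_fun_upd: "valid z \<Longrightarrow> fst y \<in> {1..<n} \<Longrightarrow> valid (z(n := y))"
  by (auto simp: valid_def par_def)

lemma in_root_fun_upd_less:
  assumes "valid z" "fst y \<in> {1..<n}" "j < n"
  shows "in_root t (z(n := y)) j \<longleftrightarrow> in_root t z j"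
  using assms by (intro in_root_cong valid_fun_upd) auto

lemma root_count_fun_upd_less:
  assumes "valid z" "fst y \<in> {1..<n}" "j < n"
  shows "root_count j t (z(n := y)) = root_count j t z"
  using assms by (intro root_count_cong valid_fun_upd) auto

lemma in_root_fun_upd:
  assumes "valid z" "2 \<le> n" "fst y \<in> {1..<n}"
  shows "in_root t (z(n := y)) n \<longleftrightarrow> t < snd y \<and> in_root t z (fst y)"
  using assms in_root_fun_upd_less[OF assms(1,3), of "fst y" t]
  by (subst in_root_rec) (auto intro: valid_fun_upd simp: par_def cut_def)

lemma measurable_attach [measurable]: "Measurable.pred (mark i) (\<lambda>y. t < snd y \<and> in_root t z (fst y))"
proof -
  have "Measurable.pred (mark i) (\<lambda>y. in_root t z (fst y))"
    by (rule measurable_compose[OF measurable_fst_mark]) simp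
  moreover have "Measurable.pred (mark i) (\<lambda>y. t < snd y)"
    by (rule measurable_compose[OF measurable_snd_mark]) simp
  ultimately show ?thesis by simp
qed

lemma root_count_eq_card: "root_count n t z = card {v \<in> {1..<Suc n}. in_root t z v}"
proof -
  have "j \<noteq> 0" if "in_root t z j" for j using that not_in_root_0 by (cases j) auto
  then have "{j. j \<le> n \<and> in_root t z j} = {v \<in> {1..<Suc n}. in_root t z v}"
    by (force simp: less_Suc_eq_le Suc_le_eq)
  then show ?thesis by (simp add: root_count_def)
qed

lemma prob_attach:
  assumes "1 \<le> n" "0 \<le> t"
  shows "mark.prob (Suc n) {y. t < snd y \<and> in_root t z (fst y)} = exp (- t) * root_count n t z / n"
proof -
  let ?A = "{y. t < snd y \<and> in_root t z (fst y)}"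
  have A: "?A \<in> sets (mark (Suc n))"
    using measurable_attach[of t z "Suc n"] by (simp add: pred_def)
  have "emeasure (mark (Suc n)) ?A = (\<integral>\<^sup>+ y. indicator ?A y \<partial>mark (Suc n))"
    using A by simp
  also have "\<dots> = (\<Sum>v\<in>{1..<Suc n}. \<integral>\<^sup>+ e. indicator ?A (v, e) \<partial>exp_law) / of_nat n"
    using A assms by (subst nn_integral_mark) auto
  also have "(\<Sum>v\<in>{1..<Suc n}. \<integral>\<^sup>+ e. indicator ?A (v, e) \<partial>exp_law)
      = (\<Sum>v\<in>{1..<Suc n}. if in_root t z v then ennreal (exp (- t)) else 0)"
  proof (intro sum.cong refl)
    fix v
    have "(\<integral>\<^sup>+ e. indicator ?A (v, e) \<partial>exp_law) =
          (\<integral>\<^sup>+ e. indicator (if in_root t z v then {t<..} else {}) e \<partial>exp_law)"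
      by (intro nn_integral_cong) (auto simp: indicator_def)
    also have "\<dots> = (if in_root t z v then ennreal (exp (- t)) else 0)"
      using assms by (simp add: emeasure_exp_law_greater)
    finally show "(\<integral>\<^sup>+ e. indicator ?A (v, e) \<partial>exp_law) = (if in_root t z v then ennreal (exp (- t)) else 0)" .
  qed
  also have "\<dots> = (\<Sum>v\<in>{v \<in> {1..<Suc n}. in_root t z v}. ennreal (exp (- t)))"
    by (subst sum.inter_filter) auto
  also have "\<dots> = ennreal (root_count n t z * exp (- t))"
    by (simp add: root_count_eq_card ennreal_mult' ennreal_of_nat_eq_real_of_nat)
  also have "ennreal (root_count n t z * exp (- t)) / of_nat n = ennreal (exp (- t) * root_count n t z / n)"
    using assms by (simp add: ennreal_of_nat_eq_real_of_nat divide_ennreal mult.commute)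
  finally show ?thesis
    by (simp add: mark.emeasure_eq_measure)
qed

lemma measurable_fun_upd_section:
  assumes "2 \<le> n" "z \<in> space rrt"
  shows "(\<lambda>y. z(n := y)) \<in> mark n \<rightarrow>\<^sub>M rrt"
  using measurable_compose[OF measurable_Pair2'[OF assms(2)] measurable_fun_upd_tree[OF assms(1)]] by simp

lemma borel_measurable_integral_resample:
  fixes f :: "_ \<Rightarrow> real"
  assumes n: "2 \<le> n" and f: "f \<in> borel_measurable rrt"
  shows "(\<lambda>z. \<integral> y. f (z(n := y)) \<partial>mark n) \<in> borel_measurable rrt"
proof -
  have "(\<lambda>yz. f ((\<lambda>(y, z). z(n := y)) yz)) \<in> borel_measurable (mark n \<Otimes>\<^sub>M rrt)"
    using measurable_compose[OF measurable_fun_upd_tree f] n by simp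
  then have "(\<lambda>(z, y). f (z(n := y))) \<in> borel_measurable (rrt \<Otimes>\<^sub>M mark n)"
    by (subst measurable_pair_swap_iff) (simp add: case_prod_beta)
  then show ?thesis by (rule mark.borel_measurable_lebesgue_integral)
qed

lemma integral_resample:
  fixes f :: "_ \<Rightarrow> real"
  assumes n: "2 \<le> n" and f [measurable]: "f \<in> borel_measurable rrt" and B: "\<And>z. \<bar>f z\<bar> \<le> B"
  shows "(\<integral> z. f z \<partial>rrt) = (\<integral> z. (\<integral> y. f (z(n := y)) \<partial>mark n) \<partial>rrt)"
proof -
  interpret p: pair_prob_space "mark n" rrt ..
  have m: "(\<lambda>yz. f ((\<lambda>(y, z). z(n := y)) yz)) \<in> borel_measurable (mark n \<Otimes>\<^sub>M rrt)"
    using measurable_compose[OF measurable_fun_upd_tree f] n by simp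
  have "(\<integral> z. f z \<partial>rrt) = (\<integral> yz. f ((\<lambda>(y, z). z(n := y)) yz) \<partial>(mark n \<Otimes>\<^sub>M rrt))"
    using n by (subst distr_fun_upd_tree[OF n, symmetric]) (rule integral_distr, measurable)
  also have "\<dots> = (\<integral> z. (\<integral> y. f (z(n := y)) \<partial>mark n) \<partial>rrt)"
  proof -
    have "integrable (mark n \<Otimes>\<^sub>M rrt) (\<lambda>(y, z). f (z(n := y)))"
      using m B by (intro p.P.integrable_const_bound[of _ B]) (auto simp: case_prod_beta)
    from p.integral_snd[OF this] show ?thesis by (simp add: case_prod_unfold)
  qed
  finally show ?thesis .
qed

lemma finite_values_bound:
  fixes g :: "nat \<Rightarrow> nat \<Rightarrow> nat \<Rightarrow> real"
  obtains B where "\<And>i j k. i \<le> m \<Longrightarrow> j \<le> m \<Longrightarrow> k \<le> m \<Longrightarrow> \<bar>g i j k\<bar> \<le> B"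
proof
  fix i j k assume "i \<le> m" "j \<le> m" "k \<le> m"
  then show "\<bar>g i j k\<bar> \<le> (\<Sum>i\<le>m. \<Sum>j\<le>m. \<Sum>k\<le>m. \<bar>g i j k\<bar>)"
    by (intro order.trans[OF _ member_le_sum[of i]] order.trans[OF _ member_le_sum[of j]]
        order.trans[OF _ member_le_sum[of k]]) (auto intro!: sum_nonneg)
qed

lemma integrable_root_counts:
  fixes g :: "nat \<Rightarrow> nat \<Rightarrow> nat \<Rightarrow> real"
  shows "integrable rrt (\<lambda>z. g (root_count a r z) (root_count b s z) (root_count c t z))"
proof -
  obtain B where B: "\<And>i j k. i \<le> max a (max b c) \<Longrightarrow> j \<le> max a (max b c) \<Longrightarrow> k \<le> max a (max b c) \<Longrightarrow> \<bar>g i j k\<bar> \<le> B"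
    using finite_values_bound[of "max a (max b c)" g] by blast
  have "\<bar>g (root_count a r z) (root_count b s z) (root_count c t z)\<bar> \<le> B" for z
    using root_count_le[of a r z] root_count_le[of b s z] root_count_le[of c t z]
    by (intro B) auto
  then show ?thesis
    by (intro rrt.integrable_const_bound[of _ B]) auto
qed

text \<open>
  Given the marks of the first \<open>n\<close> vertices, vertex \<open>n + 1\<close> belongs to the root block with
  probability \<open>exp (- t) * root_count n t z / n\<close>: its edge must survive and its parent, uniform on
  \<open>{1..n}\<close>, must lie in the block.  The earlier count at \<open>m\<close> is carried along for second moments of
  increments.
\<close>

lemma expectation_step:
  fixes g :: "nat \<Rightarrow> nat \<Rightarrow> nat \<Rightarrow> real"
  assumes "1 \<le> n" "m \<le> n" "0 \<le> t"
  shows "(\<integral> z. g (root_count m t z) (root_count n t z) (root_count (Suc n) t z) \<partial>rrt) =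
    (\<integral> z. g (root_count m t z) (root_count n t z) (Suc (root_count n t z)) * (exp (- t) * root_count n t z / n)
         + g (root_count m t z) (root_count n t z) (root_count n t z) * (1 - exp (- t) * root_count n t z / n) \<partial>rrt)"
proof -
  obtain B where B: "\<And>i j k. i \<le> Suc n \<Longrightarrow> j \<le> Suc n \<Longrightarrow> k \<le> Suc n \<Longrightarrow> \<bar>g i j k\<bar> \<le> B"
    using finite_values_bound[of "Suc n" g] by blast
  have B': "\<bar>g (root_count m t z) (root_count n t z) (root_count (Suc n) t z)\<bar> \<le> B" for z
    using root_count_le[of m t z] root_count_le[of n t z] root_count_le[of "Suc n" t z] assms
    by (intro B) auto
  have "(\<integral> z. g (root_count m t z) (root_count n t z) (root_count (Suc n) t z) \<partial>rrt) =
    (\<integral> z. (\<integral> y. g (root_count m t (z(Suc n := y))) (root_count n t (z(Suc n := y)))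
        (root_count (Suc n) t (z(Suc n := y))) \<partial>mark (Suc n)) \<partial>rrt)"
    using assms B' by (intro integral_resample[where B=B]) auto
  also have "\<dots> = (\<integral> z. g (root_count m t z) (root_count n t z) (Suc (root_count n t z)) * (exp (- t) * root_count n t z / n)
         + g (root_count m t z) (root_count n t z) (root_count n t z) * (1 - exp (- t) * root_count n t z / n) \<partial>rrt)"
  proof (intro Bochner_Integration.integral_cong_AE)
    show "AE z in rrt. (\<integral> y. g (root_count m t (z(Suc n := y))) (root_count n t (z(Suc n := y)))
        (root_count (Suc n) t (z(Suc n := y))) \<partial>mark (Suc n)) =
        g (root_count m t z) (root_count n t z) (Suc (root_count n t z)) * (exp (- t) * root_count n t z / n)
         + g (root_count m t z) (root_count n t z) (root_count n t z) * (1 - exp (- t) * root_count n t z / n)"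
      using AE_valid AE_space
    proof eventually_elim
      case (elim z)
      then have z: "valid z" by simp
      have Suc_n: "2 \<le> Suc n" using assms by simp
      let ?A = "{y. t < snd y \<and> in_root t z (fst y)}"
      let ?a = "g (root_count m t z) (root_count n t z) (Suc (root_count n t z))"
      let ?b = "g (root_count m t z) (root_count n t z) (root_count n t z)"
      have A: "?A \<in> sets (mark (Suc n))"
        using measurable_attach[of t z "Suc n"] by (simp add: pred_def)
      have "(\<integral> y. g (root_count m t (z(Suc n := y))) (root_count n t (z(Suc n := y)))
        (root_count (Suc n) t (z(Suc n := y))) \<partial>mark (Suc n)) =
        (\<integral> y. ?b + (?a - ?b) * indicator ?A y \<partial>mark (Suc n))"
      proof (intro Bochner_Integration.integral_cong_AE)
        show "AE y in mark (Suc n). g (root_count m t (z(Suc n := y))) (root_count n t (z(Suc n := y)))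
          (root_count (Suc n) t (z(Suc n := y))) = ?b + (?a - ?b) * indicator ?A y"
          using AE_mark_valid[OF Suc_n]
        proof eventually_elim
          case (elim y)
          then have y: "fst y \<in> {1..<Suc n}" using assms by auto
          show ?case
            using root_count_fun_upd_less[OF z y, of m t] root_count_fun_upd_less[OF z y, of n t]
              in_root_fun_upd[OF z _ y, of t] assms
            by (auto simp: root_count_Suc indicator_def simp del: fun_upd_apply)
        qed
        show "(\<lambda>y. g (root_count m t (z(Suc n := y))) (root_count n t (z(Suc n := y)))
          (root_count (Suc n) t (z(Suc n := y)))) \<in> borel_measurable (mark (Suc n))"
        proof -
          have "(\<lambda>y. z(Suc n := y)) \<in> mark (Suc n) \<rightarrow>\<^sub>M rrt"
            using elim assms(1) by (intro measurable_fun_upd_section) auto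
          then show ?thesis by measurable
        qed
      qed (use A in auto)
      also have "\<dots> = ?b + (?a - ?b) * mark.prob (Suc n) ?A"
        using A by (subst Bochner_Integration.integral_add)
          (auto simp: mark.prob_space[unfolded space_mark] less_top[symmetric] intro!: integrable_mult_right integrable_real_indicator)
      also have "\<dots> = ?a * (exp (- t) * root_count n t z / n) + ?b * (1 - exp (- t) * root_count n t z / n)"
        unfolding prob_attach[OF assms(1,3)] by (simp add: algebra_simps)
      finally show ?case .
    qed
    show "(\<lambda>z. \<integral> y. g (root_count m t (z(Suc n := y))) (root_count n t (z(Suc n := y)))
        (root_count (Suc n) t (z(Suc n := y))) \<partial>mark (Suc n)) \<in> borel_measurable rrt"
      using assms(1) by (intro borel_measurable_integral_resample) auto
    show "(\<lambda>z. g (root_count m t z) (root_count n t z) (Suc (root_count n t z)) * (exp (- t) * root_count n t z / n)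
         + g (root_count m t z) (root_count n t z) (root_count n t z) * (1 - exp (- t) * root_count n t z / n)) \<in> borel_measurable rrt"
      by measurable
  qed
  finally show ?thesis .
qed

section \<open>The harmonic functions\<close>

text \<open>
  The value is \<open>Gamma (k + q) / (Gamma k * Gamma (q + 1))\<close>.  These functions are eigenfunctions of
  the chain \<open>n \<mapsto> root_count n t\<close>, because adding \<open>1\<close> to \<open>k\<close> multiplies them by \<open>1 + q / k\<close>.
\<close>

definition rising :: "real \<Rightarrow> nat \<Rightarrow> real" where
  "rising q k = (\<Prod>j\<in>{1..<k}. 1 + q / real j)"

lemma rising_1 [simp]: "rising q (Suc 0) = 1"
  by (simp add: rising_def)

lemma rising_Suc: "1 \<le> k \<Longrightarrow> rising q (Suc k) = rising q k * (1 + q / k)"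
  by (simp add: rising_def atLeastLessThanSuc)

lemma rising_pos: "-1 < q \<Longrightarrow> 0 < rising q k"
  unfolding rising_def
proof (intro prod_pos ballI)
  fix j assume "-1 < q" "j \<in> {1..<k}"
  then have "- real j \<le> -1" "0 < real j" by auto
  with \<open>-1 < q\<close> show "0 < 1 + q / real j" by (simp add: field_simps)
qed

text \<open>
  Each step multiplies the mean by \<open>1 + exp (- t) * q / n\<close>, which is the factor from
  \<open>rising (exp (- t) * q) n\<close> to \<open>rising (exp (- t) * q) (Suc n)\<close>.
\<close>

lemma expectation_rising:
  assumes "1 \<le> n" "0 \<le> t"
  shows "(\<integral> z. rising q (root_count n t z) \<partial>rrt) = rising (exp (- t) * q) n"
  using assms(1)
proof (induction n rule: dec_induct)
  case base show ?case by (simp add: rrt.prob_space)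
next
  case (step n)
  have "(\<integral> z. rising q (root_count (Suc n) t z) \<partial>rrt) =
    (\<integral> z. rising q (Suc (root_count n t z)) * (exp (- t) * root_count n t z / n)
         + rising q (root_count n t z) * (1 - exp (- t) * root_count n t z / n) \<partial>rrt)"
    using expectation_step[of n n t "\<lambda>_ _ k. rising q k"] step.hyps assms(2) by simp
  also have "\<dots> = (\<integral> z. rising q (root_count n t z) * (1 + exp (- t) * q / n) \<partial>rrt)"
  proof (intro Bochner_Integration.integral_cong refl)
    fix z
    have "1 \<le> root_count n t z" using step.hyps by (intro root_count_pos)
    then show "rising q (Suc (root_count n t z)) * (exp (- t) * root_count n t z / n)
         + rising q (root_count n t z) * (1 - exp (- t) * root_count n t z / n)
         = rising q (root_count n t z) * (1 + exp (- t) * q / n)"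
      using step.hyps by (simp add: rising_Suc field_simps)
  qed
  also have "\<dots> = rising (exp (- t) * q) (Suc n)"
    using step by (simp add: rising_Suc)
  finally show ?case .
qed

section \<open>Asymptotics of the harmonic functions\<close>

text \<open>
  The logarithmic error of the approximation \<open>rising q k \<approx> k powr q\<close>.  It converges uniformly
  in \<open>q\<close> on compact sets, which is what lets the parameter \<open>q = exp t\<close> vary with time.
\<close>

definition rising_err :: "nat \<Rightarrow> real \<Rightarrow> real" where
  "rising_err k q = ln (rising q k) - q * ln k"

lemma abs_ln_1_plus_minus_bound:
  fixes x :: real
  assumes "- 1 / 2 \<le> x"
  shows "\<bar>ln (1 + x) - x\<bar> \<le> 2 * x\<^sup>2"
proof -
  have le: "ln (1 + x) \<le> x" using assms by (intro ln_add_one_self_le_self2) auto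
  have "x - 2 * x\<^sup>2 \<le> ln (1 + x)"
  proof -
    consider "x < 0" | "0 \<le> x" "x \<le> 1" | "1 < x" by linarith
    then show ?thesis
    proof cases
      case 1
      then show ?thesis using ln_one_minus_pos_lower_bound[of "- x"] assms by simp
    next
      case 2
      then have "x - x\<^sup>2 \<le> ln (1 + x)" by (intro ln_one_plus_pos_lower_bound)
      then show ?thesis using zero_le_power2[of x] by linarith
    next
      case 3
      then have "0 \<le> ln (1 + x)" by simp
      moreover have "x * 1 \<le> x * x" using 3 by (intro mult_left_mono) auto
      then have "x \<le> 2 * x\<^sup>2" using 3 by (simp add: power2_eq_square)
      ultimately show ?thesis by linarith
    qed
  qed
  with le show ?thesis by (auto simp: abs_le_iff)
qed

lemma rising_err_bound_step:
  assumes "1 \<le> k" "-1/2 \<le> q" "q \<le> Q" "1 \<le> Q"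
  shows "\<bar>rising_err (Suc k) q - rising_err k q\<bar> \<le> 4 * Q\<^sup>2 / (real k)\<^sup>2"
proof -
  have k: "0 < real k" "1 \<le> real k" using assms by auto
  have "- 1 / 2 \<le> q / k"
  proof (cases "0 \<le> q")
    case False
    then have "q * real k \<le> q * 1" using k by (intro mult_left_mono_neg) auto
    then have "q / k \<ge> q" using k False by (simp add: field_simps mult_le_cancel_left2)
    then show ?thesis using assms by linarith
  qed (use k in \<open>auto intro: order.trans[of _ 0]\<close>)
  from abs_ln_1_plus_minus_bound[OF this] have 1: "\<bar>ln (1 + q / k) - q / k\<bar> \<le> 2 * (q / k)\<^sup>2" .
  have 2: "\<bar>ln (1 + 1 / k) - 1 / k\<bar> \<le> 2 * (1 / k)\<^sup>2"
    using k by (intro abs_ln_1_plus_minus_bound) (auto intro: order.trans[of _ 0])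
  have pos: "0 < 1 + q / k" using \<open>- 1 / 2 \<le> q / k\<close> by linarith
  have "real (Suc k) = k * (1 + 1 / k)" using k by (simp add: distrib_left)
  then have "ln (real (Suc k)) = ln (k * (1 + 1 / k))" by (rule arg_cong)
  also have "\<dots> = ln k + ln (1 + 1 / k)" using k by (intro ln_mult_pos) (auto simp: add_pos_pos)
  finally have lnS: "ln (real (Suc k)) = ln k + ln (1 + 1 / k)" .
  have "rising_err (Suc k) q - rising_err k q = ln (1 + q / k) - q * ln (1 + 1 / k)"
    using ln_mult_pos[OF rising_pos[of q k] pos] assms
    by (simp add: rising_err_def rising_Suc lnS algebra_simps del: of_nat_Suc)
  also have "\<dots> = (ln (1 + q / k) - q / k) - q * (ln (1 + 1 / k) - 1 / k)"
    by (simp add: algebra_simps)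
  also have "\<bar>\<dots>\<bar> \<le> \<bar>ln (1 + q / k) - q / k\<bar> + \<bar>q * (ln (1 + 1 / k) - 1 / k)\<bar>"
    by (rule abs_triangle_ineq4)
  also have "\<dots> \<le> 2 * (q / k)\<^sup>2 + \<bar>q\<bar> * (2 * (1 / k)\<^sup>2)"
    unfolding abs_mult[of q] by (intro add_mono 1 mult_left_mono 2) auto
  also have "\<dots> = (2 * q\<^sup>2 + 2 * \<bar>q\<bar>) / (real k)\<^sup>2"
    by (simp add: power_divide add_divide_distrib)
  also have "\<dots> \<le> 4 * Q\<^sup>2 / (real k)\<^sup>2"
  proof (intro divide_right_mono)
    have q: "\<bar>q\<bar> \<le> Q" using assms by auto
    then have "q\<^sup>2 \<le> Q\<^sup>2" by (metis abs_ge_zero power2_abs power_mono)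
    moreover have "Q * 1 \<le> Q * Q" using assms by (intro mult_left_mono) auto
    then have "\<bar>q\<bar> \<le> Q\<^sup>2" using q by (simp add: power2_eq_square)
    ultimately show "2 * q\<^sup>2 + 2 * \<bar>q\<bar> \<le> 4 * Q\<^sup>2" by linarith
  qed simp
  finally show ?thesis .
qed

lemma rising_err_uniform:
  assumes "1 \<le> Q"
  obtains l B where "uniform_limit {-1/2..Q} rising_err l sequentially"
    and "\<And>k q. 1 \<le> k \<Longrightarrow> q \<in> {-1/2..Q} \<Longrightarrow> \<bar>rising_err k q\<bar> \<le> B"
    and "\<And>q. q \<in> {-1/2..Q} \<Longrightarrow> \<bar>l q\<bar> \<le> B"
proof -
  define d where "d = (\<lambda>k q. rising_err (Suc (Suc k)) q - rising_err (Suc k) q)"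
  define b where "b = (\<lambda>k. 4 * Q\<^sup>2 / (real (Suc k))\<^sup>2)"
  have d: "norm (d k q) \<le> b k" if "q \<in> {-1/2..Q}" for k q
    using rising_err_bound_step[of "Suc k" q Q] that assms by (auto simp: d_def b_def)
  have sb: "summable b"
  proof -
    have "summable (\<lambda>k. 1 / (real (Suc k))\<^sup>2)"
      using inverse_squares_sums sums_iff by (auto simp: summable_def add_ac)
    from summable_mult[OF this, of "4 * Q\<^sup>2"] show ?thesis by (simp add: b_def)
  qed
  have sum: "(\<Sum>k<n. d k q) = rising_err (Suc n) q" for n q
    by (induction n) (auto simp: d_def rising_err_def)
  have "uniform_limit {-1/2..Q} (\<lambda>n q. \<Sum>k<n. d k q) (\<lambda>q. suminf (\<lambda>k. d k q)) sequentially"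
    by (rule Weierstrass_m_test[OF d sb])
  then have u: "uniform_limit {-1/2..Q} (\<lambda>n. rising_err (Suc n)) (\<lambda>q. suminf (\<lambda>k. d k q)) sequentially"
    by (simp add: sum)
  have "uniform_limit {-1/2..Q} rising_err (\<lambda>q. suminf (\<lambda>k. d k q)) sequentially"
    using u unfolding uniform_limit_iff
    by (subst (asm) eventually_sequentially_Suc[of "\<lambda>n. \<forall>x\<in>{-1/2..Q}. dist (rising_err n x) (\<Sum>k. d k x) < _"])
  moreover have err: "\<bar>rising_err k q\<bar> \<le> suminf b" if "1 \<le> k" "q \<in> {-1/2..Q}" for k q
  proof -
    obtain n where n: "k = Suc n" using \<open>1 \<le> k\<close> by (cases k) auto
    have "\<bar>rising_err k q\<bar> \<le> (\<Sum>j<n. norm (d j q))"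
      unfolding n sum[symmetric] using norm_sum[of "\<lambda>j. d j q" "{..<n}"] by simp
    also have "\<dots> \<le> (\<Sum>j<n. b j)" using d that by (intro sum_mono) auto
    also have "\<dots> \<le> suminf b" using sb by (intro sum_le_suminf) (auto simp: b_def)
    finally show ?thesis .
  qed
  moreover have "\<bar>suminf (\<lambda>k. d k q)\<bar> \<le> suminf b" if "q \<in> {-1/2..Q}" for q
  proof (rule tendsto_upperbound)
    show "(\<lambda>n. \<bar>rising_err (Suc n) q\<bar>) \<longlonglongrightarrow> \<bar>suminf (\<lambda>k. d k q)\<bar>"
      using tendsto_uniform_limitI[OF u that] by (rule tendsto_rabs)
    show "\<forall>\<^sub>F n in sequentially. \<bar>rising_err (Suc n) q\<bar> \<le> suminf b"
      using err that by auto
  qed simp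
  ultimately show ?thesis using that by blast
qed

lemma rising_eq_powr: "-1 < q \<Longrightarrow> 1 \<le> k \<Longrightarrow> rising q k = exp (rising_err k q) * real k powr q"
  using rising_pos[of q k] by (simp add: rising_err_def powr_def flip: exp_add)

lemma rising_eq_pochhammer: "rising q (Suc k) = pochhammer (q + 1) k / fact k"
proof (induction k)
  case (Suc k)
  have "rising q (Suc (Suc k)) = pochhammer (q + 1) k / fact k * ((q + 1 + k) / Suc k)"
    by (subst rising_Suc) (auto simp: Suc field_simps)
  then show ?case by (simp add: pochhammer_Suc)
qed simp

lemma rising_err_limit:
  assumes "-1 < q"
  shows "(\<lambda>k. exp (rising_err k q)) \<longlonglongrightarrow> 1 / Gamma (q + 1)"
proof -
  have "(\<lambda>k. Gamma_series' (q + 1) (Suc k)) \<longlonglongrightarrow> Gamma (q + 1)"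
    using Gamma_series'_LIMSEQ[of "q + 1"] assms by (intro LIMSEQ_Suc)
  moreover have "(\<lambda>k. (q + 1 + real k) / real (Suc k)) \<longlonglongrightarrow> 1" by real_asymp
  ultimately have "(\<lambda>k. Gamma_series' (q + 1) (Suc k) * ((q + 1 + real k) / real (Suc k))) \<longlonglongrightarrow> Gamma (q + 1) * 1"
    by (rule tendsto_mult)
  then have "(\<lambda>k. inverse (Gamma_series' (q + 1) (Suc k) * ((q + 1 + real k) / real (Suc k)))) \<longlonglongrightarrow> inverse (Gamma (q + 1) * 1)"
    using assms by (intro tendsto_inverse) (auto simp: Gamma_real_pos less_imp_neq[symmetric])
  moreover have "inverse (Gamma_series' (q + 1) (Suc k) * ((q + 1 + real k) / real (Suc k))) = exp (rising_err (Suc k) q)" for k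
  proof -
    have p: "0 < pochhammer (q + 1) k" using assms by (intro pochhammer_pos) auto
    have k: "0 < q + 1 + real k" using assms by linarith
    define w where "w = real (Suc k) powr q"
    have w: "0 < w" by (simp add: w_def del: of_nat_Suc)
    have e: "exp ((q + 1) * ln (real (Suc k))) = w * real (Suc k)"
      by (simp add: powr_def distrib_right exp_add w_def del: of_nat_Suc)
    have "Gamma_series' (q + 1) (Suc k) * ((q + 1 + real k) / real (Suc k)) =
      fact k * (w * real (Suc k)) / (pochhammer (q + 1) k * (q + 1 + real k)) * ((q + 1 + real k) / real (Suc k))"
      unfolding Gamma_series'_def e pochhammer_Suc by (simp add: e del: of_nat_Suc)
    also have "\<dots> = fact k * w / pochhammer (q + 1) k"
      using p k by (simp add: divide_simps del: of_nat_Suc)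
    finally have "inverse (Gamma_series' (q + 1) (Suc k) * ((q + 1 + real k) / real (Suc k))) =
      pochhammer (q + 1) k / fact k / w" by simp
    also have "\<dots> = exp (rising_err (Suc k) q)"
      using rising_eq_powr[OF assms, of "Suc k"] w by (simp add: rising_eq_pochhammer w_def del: of_nat_Suc)
    finally show ?thesis .
  qed
  ultimately have "(\<lambda>k. exp (rising_err (Suc k) q)) \<longlonglongrightarrow> 1 / Gamma (q + 1)"
    by (simp add: inverse_eq_divide)
  then show ?thesis by (rule LIMSEQ_imp_Suc)
qed

lemma rising_bounds:
  obtains c C where "0 < c" "0 < C"
    "\<And>k q. 1 \<le> k \<Longrightarrow> -1/2 \<le> q \<Longrightarrow> q \<le> Q \<Longrightarrow> c * real k powr q \<le> rising q k"
    "\<And>k q. 1 \<le> k \<Longrightarrow> -1/2 \<le> q \<Longrightarrow> q \<le> Q \<Longrightarrow> rising q k \<le> C * real k powr q"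
proof -
  obtain l B where B: "\<And>k q. 1 \<le> k \<Longrightarrow> q \<in> {-1/2..max 1 Q} \<Longrightarrow> \<bar>rising_err k q\<bar> \<le> B"
    using rising_err_uniform[of "max 1 Q"] by (metis max.cobounded1)
  show ?thesis
  proof (rule that[of "exp (- B)" "exp B"])
    fix k :: nat and q :: real assume k: "1 \<le> k" and q: "-1/2 \<le> q" "q \<le> Q"
    have "q \<in> {-1/2..max 1 Q}" using q by auto
    from B[OF k this] have "- B \<le> rising_err k q" "rising_err k q \<le> B" by auto
    then show "exp (- B) * real k powr q \<le> rising q k" "rising q k \<le> exp B * real k powr q"
      using q k by (auto simp: rising_eq_powr intro!: mult_right_mono)
  qed auto
qed

lemma expectation_powr_bound:
  assumes "-1/2 \<le> q" "0 \<le> t"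
  obtains C where "0 < C" "\<And>n. 1 \<le> n \<Longrightarrow> (\<integral> z. real (root_count n t z) powr q \<partial>rrt) \<le> C * real n powr (exp (- t) * q)"
proof -
  define Q where "Q = max q (exp (- t) * q)"
  obtain c C where C: "0 < c" "0 < C"
    "\<And>k q. 1 \<le> k \<Longrightarrow> -1/2 \<le> q \<Longrightarrow> q \<le> Q \<Longrightarrow> c * real k powr q \<le> rising q k"
    "\<And>k q. 1 \<le> k \<Longrightarrow> -1/2 \<le> q \<Longrightarrow> q \<le> Q \<Longrightarrow> rising q k \<le> C * real k powr q"
    using rising_bounds[of Q] by metis
  have q': "-1/2 \<le> exp (- t) * q"
  proof (cases "0 \<le> q")
    case False
    have "exp (- t) * q \<ge> 1 * q" using False assms by (intro mult_right_mono_neg) auto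
    then show ?thesis using assms by simp
  qed (auto intro: order.trans[of _ 0])
  show ?thesis
  proof (rule that[of "C / c"])
    fix n :: nat assume n: "1 \<le> n"
    have "(\<integral> z. real (root_count n t z) powr q \<partial>rrt) \<le> (\<integral> z. rising q (root_count n t z) / c \<partial>rrt)"
    proof (intro integral_mono)
      fix z
      from C(3)[OF root_count_pos[OF n], of q] assms C(1)
      show "real (root_count n t z) powr q \<le> rising q (root_count n t z) / c"
        by (simp add: Q_def field_simps)
    qed (rule integrable_root_counts[of "\<lambda>i j k. real k powr q" n t n t n t]
        integrable_root_counts[of "\<lambda>i j k. rising q k / c" n t n t n t])+
    also have "\<dots> = rising (exp (- t) * q) n / c"
      using expectation_rising[OF n assms(2)] by simp
    also have "\<dots> \<le> C * real n powr (exp (- t) * q) / c"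
      using C(1) C(4)[OF n q'] by (intro divide_right_mono) (auto simp: Q_def)
    finally show "(\<integral> z. real (root_count n t z) powr q \<partial>rrt) \<le> C / c * real n powr (exp (- t) * q)"
      by simp
  qed (use C in auto)
qed

text \<open>
  The mean of \<open>root_count n t powr (-1/2)\<close> tends to zero, while the counts increase in \<open>n\<close>.
\<close>

lemma AE_root_count_unbounded:
  assumes "0 \<le> t"
  shows "AE z in rrt. filterlim (\<lambda>n. root_count n t z) at_top sequentially"
proof -
  obtain C where C: "0 < C" "\<And>n. 1 \<le> n \<Longrightarrow>
      (\<integral> z. real (root_count n t z) powr (-1/2) \<partial>rrt) \<le> C * real n powr (exp (- t) * (-1/2))"
    using expectation_powr_bound[of "-1/2" t] assms by auto
  have "AE z in rrt. \<exists>n. K < root_count n t z" for K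
  proof -
    let ?B = "{z \<in> space rrt. \<forall>n. root_count n t z \<le> K}"
    have B [measurable]: "?B \<in> sets rrt" by measurable
    have K: "rrt.prob ?B * (real (Suc K) powr (-1/2)) \<le> C * real n powr (exp (- t) * (-1/2))" if n: "1 \<le> n" for n
    proof -
      have "rrt.prob ?B * (real (Suc K) powr (-1/2)) = (\<integral> z. indicator ?B z * real (Suc K) powr (-1/2) \<partial>rrt)"
        by simp
      also have "\<dots> \<le> (\<integral> z. real (root_count n t z) powr (-1/2) \<partial>rrt)"
      proof (intro integral_mono)
        fix z
        have "real (Suc K) powr (-1/2) \<le> real (root_count n t z) powr (-1/2)" if "z \<in> ?B"
        proof (rule powr_mono2')
          show "0 < real (root_count n t z)" using root_count_pos[OF n, of t z] by simp
          show "real (root_count n t z) \<le> real (Suc K)"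
            using that by (auto intro!: le_SucI simp del: of_nat_Suc)
        qed simp
        then show "indicator ?B z * real (Suc K) powr (-1/2) \<le> real (root_count n t z) powr (-1/2)"
          by (auto simp: indicator_def)
      qed (use integrable_root_counts[of "\<lambda>i j k. real k powr (-1/2)" n t n t n t]
          integrable_real_indicator[OF B] in \<open>auto simp: less_top[symmetric]\<close>)
      also have "\<dots> \<le> C * real n powr (exp (- t) * (-1/2))" by (rule C(2)[OF n])
      finally show ?thesis .
    qed
    have "(\<lambda>n. C * real n powr (exp (- t) * (-1/2))) \<longlonglongrightarrow> C * 0"
      by (intro tendsto_mult tendsto_const tendsto_neg_powr filterlim_real_sequentially) auto
    then have "rrt.prob ?B * (real (Suc K) powr (-1/2)) \<le> 0"
      using K by (intro LIMSEQ_le_const[where X="\<lambda>n. C * real n powr (exp (- t) * (-1/2))"]) (auto intro!: exI[of _ 1])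
    then have "rrt.prob ?B = 0"
      using measure_nonneg[of rrt ?B] by (simp add: mult_le_0_iff)
    then have "AE z in rrt. z \<notin> ?B" using B by (subst rrt.prob_eq_0[symmetric]) auto
    then show ?thesis
      using AE_space by eventually_elim (auto simp: not_le)
  qed
  then have "AE z in rrt. \<forall>K. \<exists>n. K < root_count n t z" by (simp add: AE_all_countable)
  then show ?thesis
  proof eventually_elim
    case (elim z)
    show ?case unfolding filterlim_at_top eventually_sequentially
    proof
      fix K
      from elim obtain n where "K < root_count n t z" by blast
      then show "\<exists>N. \<forall>n\<ge>N. K \<le> root_count n t z"
        by (meson less_imp_le order.trans root_count_mono)
    qed
  qed
qed

section \<open>The shifted tree\<close>

definition nth_root :: "real \<Rightarrow> (nat \<Rightarrow> nat \<times> real) \<Rightarrow> nat \<Rightarrow> nat" where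
  "nth_root t z k = (LEAST i. root_count i t z = k)"

text \<open>
  The vertex of rank \<open>k\<close> in the root block at time \<open>t\<close> becomes vertex \<open>k\<close>; its parent is replaced by
  the rank of the parent and its clock by the remaining lifetime.
\<close>

definition shift :: "real \<Rightarrow> (nat \<Rightarrow> nat \<times> real) \<Rightarrow> nat \<Rightarrow> nat \<times> real" where
  "shift t z = (\<lambda>k\<in>{2..}. (root_count (par (nth_root t z k) z) t z, cut (nth_root t z k) z - t))"

lemma nth_root_root_count:
  assumes "in_root t z i"
  shows "nth_root t z (root_count i t z) = i"
  unfolding nth_root_def
proof (rule Least_equality)
  fix j assume j: "root_count j t z = root_count i t z"
  show "i \<le> j"
  proof (rule ccontr)
    assume "\<not> i \<le> j"
    moreover from this obtain i' where i': "i = Suc i'" by (cases i) auto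
    ultimately have "root_count j t z \<le> root_count i' t z" by (intro root_count_mono) auto
    moreover have "root_count i t z = Suc (root_count i' t z)"
      using assms by (simp add: i' root_count_Suc)
    ultimately show False using j by simp
  qed
qed simp

lemma nth_root_exists:
  assumes "1 \<le> k" "k \<le> root_count n t z"
  obtains i where "i \<le> n" "in_root t z i" "root_count i t z = k" "nth_root t z k = i"
proof -
  have "\<exists>i\<le>n. in_root t z i \<and> root_count i t z = k"
    using assms
  proof (induction n)
    case (Suc n)
    show ?case
    proof (cases "k \<le> root_count n t z")
      case True
      with Suc show ?thesis by (meson le_SucI)
    next
      case False
      with Suc.prems have "in_root t z (Suc n)" "root_count (Suc n) t z = k"
        by (auto simp: root_count_Suc split: if_splits)
      then show ?thesis by blast
    qed
  qed auto
  then show ?thesis using that nth_root_root_count by blast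
qed

lemma shift_apply:
  assumes "in_root t z i" "2 \<le> root_count i t z"
  shows "shift t z (root_count i t z) = (root_count (par i z) t z, cut i z - t)"
  using assms by (simp add: shift_def nth_root_root_count)

lemma two_le_of_root_count: "2 \<le> root_count i t z \<Longrightarrow> 2 \<le> i"
  using root_count_le[of i t z] by linarith

lemma root_count_par_less:
  assumes "valid z" "in_root t z i" "2 \<le> i"
  shows "root_count (par i z) t z \<in> {1..<root_count i t z}"
proof -
  obtain j where j: "i = Suc j" using assms by (cases i) auto
  have p: "par i z \<in> {1..<i}" using assms by (auto simp: valid_def)
  then have "root_count (par i z) t z \<le> root_count j t z" using j by (intro root_count_mono) auto
  with assms p root_count_pos[of "par i z" t z] show ?thesis by (auto simp: j root_count_Suc)
qed

lemma valid_shift: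
  assumes "valid z" "filterlim (\<lambda>n. root_count n t z) at_top sequentially"
  shows "valid (shift t z)"
  unfolding valid_def
proof (intro allI impI)
  fix k :: nat assume k: "2 \<le> k"
  from assms(2) obtain n where "k \<le> root_count n t z"
    by (auto simp: filterlim_at_top eventually_sequentially)
  then obtain i where i: "in_root t z i" "root_count i t z = k"
    using nth_root_exists[of k n t z] k by auto
  have "2 \<le> i" using k i two_le_of_root_count by blast
  then show "par k (shift t z) \<in> {1..<k}"
    using shift_apply[of t z i] i k root_count_par_less[OF assms(1) i(1)] by (simp add: par_def)
qed

lemma in_root_shift:
  assumes "valid z" "filterlim (\<lambda>n. root_count n s z) at_top sequentially" "0 \<le> r"
    and "in_root s z i"
  shows "in_root r (shift s z) (root_count i s z) \<longleftrightarrow> in_root (s + r) z i"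
  using assms(4)
proof (induction i rule: less_induct)
  case (less i)
  consider "i = 0" | "i = 1" | "2 \<le> i" by linarith
  then show ?case
  proof cases
    case 1 then show ?thesis using less by simp
  next
    case 2 then show ?thesis by simp
  next
    case 3
    have p: "par i z < i" "in_root s z (par i z)" using assms(1) 3 less.prems in_root_rec[OF assms(1) 3]
      by (auto simp: valid_def)
    have k: "2 \<le> root_count i s z" using root_count_par_less[OF assms(1) less.prems 3] by auto
    have "in_root r (shift s z) (root_count i s z) \<longleftrightarrow>
        r < cut i z - s \<and> in_root r (shift s z) (root_count (par i z) s z)"
      using shift_apply[OF less.prems k]
      by (subst in_root_rec[OF valid_shift[OF assms(1,2)] k]) (simp add: par_def cut_def)
    also have "\<dots> \<longleftrightarrow> in_root (s + r) z i"
      using less.IH[OF p] by (subst in_root_rec[OF assms(1) 3]) auto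
    finally show ?thesis .
  qed
qed

text \<open>
  The identity behind the multiplicative structure of the limit: counting in two stages.
\<close>

lemma root_count_shift:
  assumes "valid z" "filterlim (\<lambda>n. root_count n s z) at_top sequentially" "0 \<le> r"
  shows "root_count (root_count n s z) r (shift s z) = root_count n (s + r) z"
proof (induction n)
  case (Suc n)
  show ?case
  proof (cases "in_root s z (Suc n)")
    case True
    with in_root_shift[OF assms True] show ?thesis
      by (simp add: root_count_Suc Suc.IH)
  next
    case False
    then have "\<not> in_root (s + r) z (Suc n)"
      using in_root_antimono[of s "s + r" z "Suc n"] assms by auto
    with False show ?thesis by (simp add: root_count_Suc Suc.IH)
  qed
qed simp

lemma measurable_shift_component:
  "(\<lambda>z. (root_count (par (nth_root t z k) z) t z, cut (nth_root t z k) z - t)) \<in> rrt \<rightarrow>\<^sub>M count_space UNIV \<Otimes>\<^sub>M borel"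
proof -
  have [measurable]: "(\<lambda>z. nth_root t z k) \<in> rrt \<rightarrow>\<^sub>M count_space UNIV"
    unfolding nth_root_def by measurable
  have [measurable]: "(\<lambda>z. root_count (par i z) t z) \<in> rrt \<rightarrow>\<^sub>M count_space UNIV" for i
    by (rule measurable_compose_countable[where g="par i"]) measurable
  show ?thesis
    by (rule measurable_compose_countable[where g="\<lambda>z. nth_root t z k"]) measurable
qed

lemma measurable_shift [measurable]: "shift t \<in> rrt \<rightarrow>\<^sub>M rrt"
  unfolding shift_def rrt_def
proof (rule measurable_restrict)
  fix k
  show "(\<lambda>z. (root_count (par (nth_root t z k) z) t z, cut (nth_root t z k) z - t)) \<in> Pi\<^sub>M {2..} mark \<rightarrow>\<^sub>M mark k"
    using measurable_shift_component[of t k] unfolding rrt_def measurable_cong_sets[OF refl sets_mark] .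
qed

section \<open>The law of the shifted tree\<close>

lemma sum_root_count_reindex:
  fixes h :: "nat \<Rightarrow> ennreal"
  shows "(\<Sum>v\<in>{v \<in> {1..<Suc n}. in_root t z v}. h (root_count v t z)) = (\<Sum>w\<in>{1..<Suc (root_count n t z)}. h w)"
proof (induction n)
  case (Suc n)
  let ?A = "{v \<in> {1..<Suc n}. in_root t z v}"
  show ?case
  proof (cases "in_root t z (Suc n)")
    case True
    then have "{v \<in> {1..<Suc (Suc n)}. in_root t z v} = insert (Suc n) ?A" by auto
    then have "(\<Sum>v\<in>{v \<in> {1..<Suc (Suc n)}. in_root t z v}. h (root_count v t z)) =
        h (root_count (Suc n) t z) + (\<Sum>v\<in>?A. h (root_count v t z))"
      by simp
    also have "\<dots> = h (Suc (root_count n t z)) + (\<Sum>w\<in>{1..<Suc (root_count n t z)}. h w)"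
      using True by (simp only: Suc.IH root_count_Suc) simp
    also have "\<dots> = (\<Sum>w\<in>{1..<Suc (root_count (Suc n) t z)}. h w)"
      using True by (simp add: root_count_Suc add.commute)
    finally show ?thesis .
  next
    case False
    then have "{v \<in> {1..<Suc (Suc n)}. in_root t z v} = ?A" by (auto simp: less_Suc_eq)
    with False show ?thesis by (simp only: Suc.IH root_count_Suc) simp
  qed
qed simp

lemma nn_integral_exp_law_memoryless:
  assumes [measurable]: "g \<in> borel_measurable borel" and "0 \<le> t"
  shows "(\<integral>\<^sup>+ e. indicator {t<..} e * g (e - t) \<partial>exp_law) = ennreal (exp (- t)) * (\<integral>\<^sup>+ e. g e \<partial>exp_law)"
proof -
  have "(\<integral>\<^sup>+ e. indicator {t<..} e * g (e - t) \<partial>exp_law) =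
    (\<integral>\<^sup>+ e. ennreal (exponential_density 1 e) * (indicator {t<..} e * g (e - t)) \<partial>lborel)"
    unfolding exp_law_def by (subst nn_integral_density) auto
  also have "\<dots> = (\<integral>\<^sup>+ e. ennreal (exponential_density 1 (t + 1 * e)) * (indicator {t<..} (t + 1 * e) * g (t + 1 * e - t)) \<partial>lborel)"
    by (subst nn_integral_real_affine[where c=1 and t=t]) auto
  also have "\<dots> = (\<integral>\<^sup>+ e. ennreal (exp (- t)) * (ennreal (exponential_density 1 e) * g e) \<partial>lborel)"
  proof (intro nn_integral_cong_AE)
    have "AE e in lborel. e \<noteq> (0::real)" by (rule AE_lborel_singleton)
    then show "AE e in lborel. ennreal (exponential_density 1 (t + 1 * e)) * (indicator {t<..} (t + 1 * e) * g (t + 1 * e - t)) =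
        ennreal (exp (- t)) * (ennreal (exponential_density 1 e) * g e)"
    proof eventually_elim
      case (elim e)
      show ?case
      proof (cases "0 < e")
        case True
        then have "exponential_density 1 (t + 1 * e) = exp (- t) * exponential_density 1 e"
          using assms by (simp add: exponential_density_def exp_diff exp_minus field_simps exp_add)
        with True show ?thesis by (simp add: ennreal_mult' mult_ac)
      qed (use elim in \<open>auto simp: exponential_density_def\<close>)
    qed
  qed
  also have "\<dots> = ennreal (exp (- t)) * (\<integral>\<^sup>+ e. g e \<partial>exp_law)"
    unfolding exp_law_def by (subst nn_integral_density) (auto simp: nn_integral_cmult)
  finally show ?thesis .
qed

text \<open>
  Conditioned to join the root block, vertex \<open>n + 1\<close> has a parent of uniform rank in the block, and
  its residual clock is again exponential.  So the mark it acquires in the shifted tree has the law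
  prescribed for its rank.
\<close>

lemma nn_integral_attach:
  assumes n: "1 \<le> n" and t: "0 \<le> t" and B: "B \<in> sets (mark (Suc (root_count n t z)))"
  shows "(\<integral>\<^sup>+ y. indicator {y. t < snd y \<and> in_root t z (fst y)} y *
            indicator B (root_count (fst y) t z, snd y - t) \<partial>mark (Suc n)) =
         emeasure (mark (Suc n)) {y. t < snd y \<and> in_root t z (fst y)} * emeasure (mark (Suc (root_count n t z))) B"
proof -
  let ?m = "root_count n t z"
  let ?A = "{y. t < snd y \<and> in_root t z (fst y)}"
  have m: "1 \<le> ?m" using n by (rule root_count_pos)
  have B': "B \<in> sets (count_space UNIV \<Otimes>\<^sub>M borel)" using B sets_mark by blast
  define h where "h = (\<lambda>w. \<integral>\<^sup>+ e. indicator B (w, e) \<partial>exp_law)"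
  have [measurable]: "(\<lambda>e. indicator B (w, e) :: ennreal) \<in> borel_measurable borel" for w
    using B' by measurable
  have A [measurable]: "?A \<in> sets (mark (Suc n))"
    using measurable_attach[of t z "Suc n"] by (simp add: pred_def)
  have [measurable]: "(\<lambda>y. (root_count (fst y) t z, snd y - t)) \<in> mark (Suc n) \<rightarrow>\<^sub>M count_space UNIV \<Otimes>\<^sub>M borel"
    by (intro measurable_Pair measurable_compose[OF measurable_fst_mark] measurable_compose[OF measurable_snd_mark]) auto
  have "(\<integral>\<^sup>+ y. indicator ?A y * indicator B (root_count (fst y) t z, snd y - t) \<partial>mark (Suc n)) =
    (\<Sum>v\<in>{1..<Suc n}. \<integral>\<^sup>+ e. indicator ?A (v, e) * indicator B (root_count v t z, e - t) \<partial>exp_law) / of_nat n"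
    using n B' by (subst nn_integral_mark) auto
  also have "(\<Sum>v\<in>{1..<Suc n}. \<integral>\<^sup>+ e. indicator ?A (v, e) * indicator B (root_count v t z, e - t) \<partial>exp_law) =
    (\<Sum>v\<in>{1..<Suc n}. if in_root t z v then ennreal (exp (- t)) * h (root_count v t z) else 0)"
  proof (intro sum.cong refl)
    fix v
    have "(\<integral>\<^sup>+ e. indicator ?A (v, e) * indicator B (root_count v t z, e - t) \<partial>exp_law) =
          (if in_root t z v then (\<integral>\<^sup>+ e. indicator {t<..} e * indicator B (root_count v t z, e - t) \<partial>exp_law) else 0)"
      by (auto intro!: nn_integral_cong simp: indicator_def)
    also have "\<dots> = (if in_root t z v then ennreal (exp (- t)) * h (root_count v t z) else 0)"
      using nn_integral_exp_law_memoryless[of "\<lambda>e. indicator B (root_count v t z, e)" t] t by (simp add: h_def)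
    finally show "(\<integral>\<^sup>+ e. indicator ?A (v, e) * indicator B (root_count v t z, e - t) \<partial>exp_law) =
          (if in_root t z v then ennreal (exp (- t)) * h (root_count v t z) else 0)" .
  qed
  also have "\<dots> = (\<Sum>v\<in>{v \<in> {1..<Suc n}. in_root t z v}. ennreal (exp (- t)) * h (root_count v t z))"
    by (rule sum.inter_filter[symmetric]) simp
  also have "\<dots> = ennreal (exp (- t)) * (\<Sum>w\<in>{1..<Suc ?m}. h w)"
    by (simp only: sum_distrib_left[symmetric] sum_root_count_reindex)
  also have "(\<Sum>w\<in>{1..<Suc ?m}. h w) = of_nat ?m * emeasure (mark (Suc ?m)) B"
  proof -
    have "emeasure (mark (Suc ?m)) B = (\<integral>\<^sup>+ y. indicator B y \<partial>mark (Suc ?m))" using B by simp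
    also have "\<dots> = (\<Sum>w\<in>{1..<Suc ?m}. h w) / of_nat ?m"
      using B m by (subst nn_integral_mark) (auto simp: h_def)
    finally have "of_nat ?m * emeasure (mark (Suc ?m)) B = (\<Sum>w\<in>{1..<Suc ?m}. h w) * of_nat ?m / of_nat ?m"
      by (simp only: ennreal_times_divide mult.commute)
    also have "\<dots> = (\<Sum>w\<in>{1..<Suc ?m}. h w)"
      using m by (intro mult_divide_eq_ennreal) auto
    finally show ?thesis ..
  qed
  also have "ennreal (exp (- t)) * (of_nat ?m * emeasure (mark (Suc ?m)) B) / of_nat n =
     emeasure (mark (Suc n)) ?A * emeasure (mark (Suc ?m)) B"
  proof -
    have "emeasure (mark (Suc n)) ?A = ennreal (exp (- t) * ?m / n)"
      using prob_attach[OF n t, of z] by (simp add: mark.emeasure_eq_measure)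
    also have "\<dots> = ennreal (exp (- t)) * of_nat ?m / of_nat n"
      using n by (simp add: ennreal_of_nat_eq_real_of_nat divide_ennreal flip: ennreal_mult')
    finally show ?thesis by (simp only: divide_ennreal_def mult_ac)
  qed
  finally show ?thesis .
qed

text \<open>
  The indicator that the first \<open>K\<close> marks of the shifted tree lie in \<open>B\<close>, in which every vertex that
  has not yet appeared among the first \<open>n\<close> vertices is replaced by its prescribed probability.  The
  point is that its mean does not depend on \<open>n\<close>, even jointly with the past of the root block.
\<close>

definition weight :: "real \<Rightarrow> (nat \<Rightarrow> (nat \<times> real) set) \<Rightarrow> nat \<Rightarrow> nat \<Rightarrow> (nat \<Rightarrow> nat \<times> real) \<Rightarrow> ennreal" where
  "weight t B K n z = (\<Prod>k\<in>{2..K}. if k \<le> root_count n t z then indicator (B k) (shift t z k) else emeasure (mark k) (B k))"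

lemma shift_fun_upd:
  assumes z: "valid z" and y: "fst y \<in> {1..<Suc n}" and k: "2 \<le> k" "k \<le> root_count n t z"
  shows "shift t (z(Suc n := y)) k = shift t z k"
proof -
  obtain i where i: "i \<le> n" "in_root t z i" "root_count i t z = k"
    using nth_root_exists[of k n t z] k by auto
  have "2 \<le> i" using k i two_le_of_root_count by blast
  then have "par i z < i" using z by (auto simp: valid_def)
  let ?z = "z(Suc n := y)"
  have c: "root_count j t ?z = root_count j t z" if "j \<le> n" for j
    using that by (intro root_count_fun_upd_less[OF z y]) auto
  have i': "in_root t ?z i" using in_root_fun_upd_less[OF z y, of i t] i by simp
  have p: "par i ?z = par i z" "cut i ?z = cut i z" using i by (auto simp: par_def cut_def)
  have "shift t ?z (root_count i t ?z) = (root_count (par i ?z) t ?z, cut i ?z - t)"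
    using i k c[of i] by (intro shift_apply[OF i']) auto
  then show ?thesis
    using shift_apply[OF i(2)] i k c[of i] c[of "par i z"] \<open>par i z < i\<close> by (simp only: p)
qed

lemma shift_fun_upd_new:
  assumes z: "valid z" and n: "1 \<le> n" and y: "fst y \<in> {1..<Suc n}" and "t < snd y" "in_root t z (fst y)"
  shows "shift t (z(Suc n := y)) (Suc (root_count n t z)) = (root_count (fst y) t z, snd y - t)"
proof -
  let ?z = "z(Suc n := y)"
  have new: "in_root t ?z (Suc n)" using in_root_fun_upd[OF z _ y, of t] assms by simp
  have c: "root_count j t ?z = root_count j t z" if "j \<le> n" for j
    using that by (intro root_count_fun_upd_less[OF z y]) auto
  have "root_count (Suc n) t ?z = Suc (root_count n t z)" using new c[of n] by (simp add: root_count_Suc)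
  with shift_apply[OF new] root_count_pos[OF n, of t z] c[of "fst y"] y
  show ?thesis by (simp add: par_def cut_def)
qed

text \<open>
  Either vertex \<open>n + 1\<close> stays outside the block and the weight is unchanged, or it supplies the
  next mark, whose indicator averages to the factor that it replaces.  The set \<open>A\<close> contains all
  marks that join the block, so restricting to \<open>A\<close> only changes the total mass.
\<close>

lemma nn_integral_weight_step:
  assumes z: "valid z" "z \<in> space rrt" and n: "1 \<le> n" and t: "0 \<le> t"
    and B: "\<And>k. B k \<in> sets (mark k)"
    and A [measurable]: "A \<in> sets (mark (Suc n))" and sub: "{y. t < snd y \<and> in_root t z (fst y)} \<subseteq> A"
  shows "(\<integral>\<^sup>+ y. indicator A y * weight t B K (Suc n) (z(Suc n := y)) \<partial>mark (Suc n)) =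
         emeasure (mark (Suc n)) A * weight t B K n z"
proof -
  let ?m = "root_count n t z"
  let ?T = "{y. t < snd y \<and> in_root t z (fst y)}"
  have T [measurable]: "?T \<in> sets (mark (Suc n))"
    using measurable_attach[of t z "Suc n"] by (simp add: pred_def)
  define f where "f = (\<lambda>k. if k \<le> ?m then indicator (B k) (shift t z k) else emeasure (mark k) (B k))"
  define w where "w = (\<Prod>k\<in>{2..K} - {Suc ?m}. f k)"
  define b where "b = (\<lambda>y. if Suc ?m \<in> {2..K} then indicator (B (Suc ?m)) (root_count (fst y) t z, snd y - t) else 1 :: ennreal)"
  define c where "c = (if Suc ?m \<in> {2..K} then emeasure (mark (Suc ?m)) (B (Suc ?m)) else 1)"
  have m: "1 \<le> ?m" using n by (rule root_count_pos)
  have Suc_n: "2 \<le> Suc n" using n by simp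
  have w0: "weight t B K n z = w * c"
  proof (cases "Suc ?m \<in> {2..K}")
    case True
    then have "(\<Prod>k\<in>{2..K}. f k) = f (Suc ?m) * w"
      unfolding w_def by (intro prod.remove) auto
    with True show ?thesis by (simp add: weight_def c_def f_def mult.commute)
  next
    case False
    then have "c = 1" "{2..K} - {Suc ?m} = {2..K}" unfolding c_def by auto
    then show ?thesis by (simp add: weight_def f_def w_def)
  qed
  have step: "weight t B K (Suc n) (z(Suc n := y)) = (if y \<in> ?T then w * b y else w * c)"
    if y: "fst y \<in> {1..<Suc n}" for y
  proof -
    let ?z = "z(Suc n := y)"
    have cn: "root_count n t ?z = ?m" by (rule root_count_fun_upd_less[OF z(1) y]) simp
    have iff: "in_root t ?z (Suc n) \<longleftrightarrow> y \<in> ?T" using in_root_fun_upd[OF z(1) Suc_n y] by simp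
    show ?thesis
    proof (cases "y \<in> ?T")
      case False
      then have "root_count (Suc n) t ?z = ?m" using iff cn by (simp add: root_count_Suc)
      then have "weight t B K (Suc n) ?z = weight t B K n z"
        unfolding weight_def using shift_fun_upd[OF z(1) y] by (intro prod.cong) auto
      then show ?thesis using False by (simp only: w0 if_False)
    next
      case True
      then have c': "root_count (Suc n) t ?z = Suc ?m" using iff cn by (simp add: root_count_Suc)
      have new: "shift t ?z (Suc ?m) = (root_count (fst y) t z, snd y - t)"
        using True by (intro shift_fun_upd_new[OF z(1) n y]) auto
      define g where "g = (\<lambda>k. if k \<le> Suc ?m then indicator (B k) (shift t ?z k) else emeasure (mark k) (B k))"
      have "weight t B K (Suc n) ?z = (\<Prod>k\<in>{2..K}. g k)" by (simp add: weight_def c' g_def)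
      also have "\<dots> = (\<Prod>k\<in>{2..K} - {Suc ?m}. g k) * b y"
      proof (cases "Suc ?m \<in> {2..K}")
        case True
        then have "(\<Prod>k\<in>{2..K}. g k) = g (Suc ?m) * (\<Prod>k\<in>{2..K} - {Suc ?m}. g k)"
          by (intro prod.remove) auto
        with True show ?thesis by (simp add: g_def b_def new mult.commute)
      next
        case False
        then have "b y = 1" "{2..K} - {Suc ?m} = {2..K}" unfolding b_def by auto
        then show ?thesis by simp
      qed
      also have "(\<Prod>k\<in>{2..K} - {Suc ?m}. g k) = w"
        unfolding w_def using shift_fun_upd[OF z(1) y] by (intro prod.cong) (auto simp: g_def f_def)
      finally show ?thesis using True by (simp only: if_True)
    qed
  qed
  have [measurable]: "(\<lambda>y. (root_count (fst y) t z, snd y - t)) \<in> mark (Suc n) \<rightarrow>\<^sub>M count_space UNIV \<Otimes>\<^sub>M borel"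
    by (intro measurable_Pair measurable_compose[OF measurable_fst_mark] measurable_compose[OF measurable_snd_mark]) auto
  have B': "B k \<in> sets (count_space UNIV \<Otimes>\<^sub>M borel)" for k using B sets_mark by blast
  have b [measurable]: "b \<in> borel_measurable (mark (Suc n))"
    unfolding b_def using B' by measurable
  have bT: "(\<integral>\<^sup>+ y. indicator ?T y * b y \<partial>mark (Suc n)) = emeasure (mark (Suc n)) ?T * c"
    using nn_integral_attach[OF n t, of "B (Suc ?m)" z] B by (auto simp: b_def c_def)
  have "(\<integral>\<^sup>+ y. indicator A y * weight t B K (Suc n) (z(Suc n := y)) \<partial>mark (Suc n)) =
    (\<integral>\<^sup>+ y. w * (indicator ?T y * b y) + w * c * indicator (A - ?T) y \<partial>mark (Suc n))"
  proof (rule nn_integral_cong_AE)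
    show "AE y in mark (Suc n). indicator A y * weight t B K (Suc n) (z(Suc n := y)) =
        w * (indicator ?T y * b y) + w * c * indicator (A - ?T) y"
      using AE_mark_valid[OF Suc_n]
    proof eventually_elim
      case (elim y)
      then have y: "fst y \<in> {1..<Suc n}" by simp
      show ?case unfolding step[OF y] using sub by (auto simp: indicator_def)
    qed
  qed
  also have "\<dots> = w * (emeasure (mark (Suc n)) ?T * c) + w * c * emeasure (mark (Suc n)) (A - ?T)"
    by (simp add: nn_integral_add nn_integral_cmult bT)
  also have "\<dots> = w * c * (emeasure (mark (Suc n)) ?T + emeasure (mark (Suc n)) (A - ?T))"
    by (simp add: distrib_left mult_ac)
  also have "emeasure (mark (Suc n)) ?T + emeasure (mark (Suc n)) (A - ?T) = emeasure (mark (Suc n)) A"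
  proof -
    have "?T \<union> (A - ?T) = A" using sub by auto
    then show ?thesis using plus_emeasure[OF T, of "A - ?T"] A by auto
  qed
  finally show ?thesis unfolding w0 by (simp only: mult_ac)
qed

text \<open>
  The history of the root block up to \<open>t\<close> is generated by these sets with \<open>J \<subseteq> {1..} \<times> {0..t}\<close>; they
  form an intersection-stable family.
\<close>

definition event :: "(nat \<times> real) set \<Rightarrow> (nat \<Rightarrow> nat \<times> real) set" where
  "event J = {z \<in> space rrt. \<forall>(i, r)\<in>J. in_root r z i}"

lemma sets_event [measurable]: "finite J \<Longrightarrow> event J \<in> sets rrt"
  unfolding event_def by (simp add: case_prod_beta)

lemma measurable_weight [measurable]:
  assumes "\<And>k. B k \<in> sets (mark k)"
  shows "weight t B K n \<in> borel_measurable rrt"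
proof -
  have B': "B k \<in> sets (count_space UNIV \<Otimes>\<^sub>M borel)" for k using assms sets_mark by blast
  have [measurable]: "(\<lambda>z. shift t z k) \<in> rrt \<rightarrow>\<^sub>M count_space UNIV \<Otimes>\<^sub>M borel" for k
    by (rule measurable_compose[OF measurable_shift measurable_component_rrt])
  show ?thesis unfolding weight_def[abs_def] using B' by measurable
qed

text \<open>
  When vertex \<open>n + 1\<close> is integrated out, the constraints that \<open>J\<close> puts on it turn into the same
  constraints on its parent \<open>v\<close> and a lower bound for its clock.  Since they only concern times up
  to \<open>t\<close>, they leave the conditional law of its residual clock unchanged.
\<close>

lemma nn_integral_weight_event_Suc:
  assumes n: "1 \<le> n" and t: "0 \<le> t" and B: "\<And>k. B k \<in> sets (mark k)"
    and J: "finite J" "J \<subseteq> {1..Suc n} \<times> {0..t}"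
  defines "R \<equiv> {r. (Suc n, r) \<in> J}" and "J' \<equiv> {p \<in> J. fst p \<le> n}"
  shows "(\<integral>\<^sup>+ z. weight t B K (Suc n) z * indicator (event J) z \<partial>rrt) =
    (emeasure exp_law {e. \<forall>r\<in>R. r < e} / of_nat n) *
    (\<Sum>v\<in>{1..<Suc n}. \<integral>\<^sup>+ z. weight t B K n z * indicator (event (J' \<union> {v} \<times> R)) z \<partial>rrt)"
proof -
  have Suc_n: "2 \<le> Suc n" using n by simp
  have finR: "finite R"
  proof -
    have "R \<subseteq> snd ` J" by (force simp: R_def)
    then show ?thesis using J(1) finite_subset by blast
  qed
  have finJ': "finite J'" using J by (simp add: J'_def)
  have Rt: "r \<le> t" "0 \<le> r" if "r \<in> R" for r using that J by (auto simp: R_def)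
  note [measurable] = measurable_weight[OF B]
  let ?a = "emeasure exp_law {e. \<forall>r\<in>R. r < e}"
  define A where "A = (\<lambda>z. {y. \<forall>r\<in>R. r < snd y \<and> in_root r z (fst y)})"
  have A: "A z \<in> sets (mark (Suc n))" for z
  proof -
    have "Measurable.pred (mark (Suc n)) (\<lambda>y. \<forall>r\<in>R. r < snd y \<and> in_root r z (fst y))"
      using finR by measurable
    then show ?thesis by (simp add: pred_def A_def)
  qed
  have emA: "emeasure (mark (Suc n)) (A z) = (\<Sum>v\<in>{1..<Suc n}. indicator {v. \<forall>r\<in>R. in_root r z v} v * ?a) / of_nat n" for z
  proof -
    have "emeasure (mark (Suc n)) (A z) = (\<integral>\<^sup>+ y. indicator (A z) y \<partial>mark (Suc n))"
      using A by simp
    also have "\<dots> = (\<Sum>v\<in>{1..<Suc n}. \<integral>\<^sup>+ e. indicator (A z) (v, e) \<partial>exp_law) / of_nat n"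
      using A n by (subst nn_integral_mark) auto
    also have "(\<Sum>v\<in>{1..<Suc n}. \<integral>\<^sup>+ e. indicator (A z) (v, e) \<partial>exp_law) =
       (\<Sum>v\<in>{1..<Suc n}. indicator {v. \<forall>r\<in>R. in_root r z v} v * ?a)"
    proof (intro sum.cong refl)
      fix v
      have [measurable]: "{e. \<forall>r\<in>R. r < e} \<in> sets borel"
        using finR by measurable
      have "(\<integral>\<^sup>+ e. indicator (A z) (v, e) \<partial>exp_law) =
            (\<integral>\<^sup>+ e. indicator {v. \<forall>r\<in>R. in_root r z v} v * indicator {e. \<forall>r\<in>R. r < e} e \<partial>exp_law)"
        by (intro nn_integral_cong) (auto simp: A_def indicator_def)
      also have "\<dots> = indicator {v. \<forall>r\<in>R. in_root r z v} v * ?a"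
        by (subst nn_integral_cmult) auto
      finally show "(\<integral>\<^sup>+ e. indicator (A z) (v, e) \<partial>exp_law) = indicator {v. \<forall>r\<in>R. in_root r z v} v * ?a" .
    qed
    finally show ?thesis .
  qed
  have "(\<integral>\<^sup>+ z. weight t B K (Suc n) z * indicator (event J) z \<partial>rrt) =
    (\<integral>\<^sup>+ z. \<integral>\<^sup>+ y. weight t B K (Suc n) (z(Suc n := y)) * indicator (event J) (z(Suc n := y)) \<partial>mark (Suc n) \<partial>rrt)"
    using J by (intro nn_integral_resample[OF Suc_n]) measurable
  also have "\<dots> = (\<integral>\<^sup>+ z. indicator (event J') z * (emeasure (mark (Suc n)) (A z) * weight t B K n z) \<partial>rrt)"
  proof (rule nn_integral_cong_AE)
    show "AE z in rrt. (\<integral>\<^sup>+ y. weight t B K (Suc n) (z(Suc n := y)) * indicator (event J) (z(Suc n := y)) \<partial>mark (Suc n)) =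
      indicator (event J') z * (emeasure (mark (Suc n)) (A z) * weight t B K n z)"
      using AE_valid AE_space
    proof eventually_elim
      case (elim z)
      then have z: "valid z" "z \<in> space rrt" by auto
      note sec = measurable_fun_upd_section[OF Suc_n z(2)]
      have "(\<integral>\<^sup>+ y. weight t B K (Suc n) (z(Suc n := y)) * indicator (event J) (z(Suc n := y)) \<partial>mark (Suc n)) =
        (\<integral>\<^sup>+ y. indicator (event J') z * (indicator (A z) y * weight t B K (Suc n) (z(Suc n := y))) \<partial>mark (Suc n))"
      proof (rule nn_integral_cong_AE)
        show "AE y in mark (Suc n). weight t B K (Suc n) (z(Suc n := y)) * indicator (event J) (z(Suc n := y)) =
          indicator (event J') z * (indicator (A z) y * weight t B K (Suc n) (z(Suc n := y)))"
          using AE_mark_valid[OF Suc_n] AE_space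
        proof eventually_elim
          case (elim y)
          then have y: "fst y \<in> {1..<Suc n}" by simp
          have sp: "z(Suc n := y) \<in> space rrt"
            using measurable_space[OF sec] elim by simp
          have "(\<forall>(i, r)\<in>J. in_root r (z(Suc n := y)) i) \<longleftrightarrow> (\<forall>(i, r)\<in>J'. in_root r z i) \<and> y \<in> A z"
          proof -
            have "in_root r (z(Suc n := y)) i \<longleftrightarrow> in_root r z i" if "(i, r) \<in> J'" for i r
              using that by (intro in_root_fun_upd_less[OF z(1) y]) (auto simp: J'_def)
            then have 1: "(\<forall>(i, r)\<in>J'. in_root r (z(Suc n := y)) i) \<longleftrightarrow> (\<forall>(i, r)\<in>J'. in_root r z i)"
              by blast
            have "in_root r (z(Suc n := y)) (Suc n) \<longleftrightarrow> r < snd y \<and> in_root r z (fst y)" for r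
              by (rule in_root_fun_upd[OF z(1) Suc_n y])
            then have 2: "(\<forall>(i, r)\<in>{Suc n} \<times> R. in_root r (z(Suc n := y)) i) \<longleftrightarrow> y \<in> A z"
              unfolding A_def by blast
            have "\<forall>(i, r)\<in>J. i \<le> n \<or> i = Suc n"
              using J(2) by (auto simp: le_Suc_eq)
            then have "J = J' \<union> {Suc n} \<times> R"
              unfolding J'_def R_def by auto
            then show ?thesis using 1 2 by (simp only: ball_Un)
          qed
          then have "indicator (event J) (z(Suc n := y)) = (indicator (event J') z * indicator (A z) y :: ennreal)"
            using sp z(2) by (simp add: event_def indicator_def)
          then show ?case by (simp add: mult_ac)
        qed
      qed
      also have "\<dots> = indicator (event J') z * (\<integral>\<^sup>+ y. indicator (A z) y * weight t B K (Suc n) (z(Suc n := y)) \<partial>mark (Suc n))"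
        by (intro nn_integral_cmult borel_measurable_times_ennreal borel_measurable_indicator A
            measurable_compose[OF sec measurable_weight[OF B]])
      also have "(\<integral>\<^sup>+ y. indicator (A z) y * weight t B K (Suc n) (z(Suc n := y)) \<partial>mark (Suc n)) =
         emeasure (mark (Suc n)) (A z) * weight t B K n z"
      proof (rule nn_integral_weight_step[OF z n t B A])
        have "r < snd y \<and> in_root r z (fst y)" if "t < snd y" "in_root t z (fst y)" "r \<in> R" for r y
          using Rt(1)[OF that(3)] that in_root_antimono[OF Rt(1)[OF that(3)] that(2)] by simp
        then show "{y. t < snd y \<and> in_root t z (fst y)} \<subseteq> A z" unfolding A_def by blast
      qed
      finally show ?case .
    qed
  qed
  also have "\<dots> = (\<integral>\<^sup>+ z. (\<Sum>v\<in>{1..<Suc n}. (?a / of_nat n) * (weight t B K n z * indicator (event (J' \<union> {v} \<times> R)) z)) \<partial>rrt)"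
  proof (rule nn_integral_cong)
    fix z assume z: "z \<in> space rrt"
    have e: "indicator (event (J' \<union> {v} \<times> R)) z = (indicator (event J') z * indicator {v. \<forall>r\<in>R. in_root r z v} v :: ennreal)" for v
      using z by (auto simp: event_def indicator_def)
    show "indicator (event J') z * (emeasure (mark (Suc n)) (A z) * weight t B K n z) =
      (\<Sum>v\<in>{1..<Suc n}. (?a / of_nat n) * (weight t B K n z * indicator (event (J' \<union> {v} \<times> R)) z))"
      unfolding emA e
      by (simp only: sum_distrib_left sum_distrib_right divide_ennreal_def mult_ac)
  qed
  also have "\<dots> = (\<Sum>v\<in>{1..<Suc n}. (?a / of_nat n) * (\<integral>\<^sup>+ z. weight t B K n z * indicator (event (J' \<union> {v} \<times> R)) z \<partial>rrt))"
  proof -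
    have m: "(\<lambda>z. weight t B K n z * indicator (event (J' \<union> {v} \<times> R)) z) \<in> borel_measurable rrt" for v
      using finJ' finR
      by (intro borel_measurable_times_ennreal measurable_weight[OF B] borel_measurable_indicator sets_event finite_UnI finite_cartesian_product) simp_all
    show ?thesis
      by (subst nn_integral_sum, rule borel_measurable_times_ennreal[OF borel_measurable_const m])
         (intro sum.cong refl nn_integral_cmult m)
  qed
  finally show ?thesis by (simp only: sum_distrib_left)
qed

lemma nn_integral_weight_event:
  assumes t: "0 \<le> t" and B: "\<And>k. B k \<in> sets (mark k)"
    and n: "1 \<le> n" and J: "finite J" "J \<subseteq> {1..n} \<times> {0..t}"
  shows "(\<integral>\<^sup>+ z. weight t B K n z * indicator (event J) z \<partial>rrt) =
    (\<Prod>k\<in>{2..K}. emeasure (mark k) (B k)) * emeasure rrt (event J)"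
  using n J
proof (induction n arbitrary: J rule: dec_induct)
  case base
  have "in_root r z i" if "(i, r) \<in> J" for i r z
  proof -
    have "i = 1" using base(2) that by auto
    then show ?thesis by simp
  qed
  then have e: "event J = space rrt" unfolding event_def by blast
  have w: "weight t B K 1 z = (\<Prod>k\<in>{2..K}. emeasure (mark k) (B k))" for z
    unfolding weight_def by (intro prod.cong refl) simp
  show ?case
    unfolding e w by (subst nn_integral_cmult) (auto simp: rrt.emeasure_space_1)
next
  case (step n)
  define R where "R = {r. (Suc n, r) \<in> J}"
  define J' where "J' = {p \<in> J. fst p \<le> n}"
  let ?c = "\<Prod>k\<in>{2..K}. emeasure (mark k) (B k)"
  let ?a = "emeasure exp_law {e. \<forall>r\<in>R. r < e} / of_nat n"
  have "finite R"
  proof -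
    have "R \<subseteq> snd ` J" by (force simp: R_def)
    then show ?thesis using step.prems(1) by (meson finite_imageI finite_subset)
  qed
  moreover have "finite J'" using step.prems(1) unfolding J'_def by (rule finite_subset[rotated]) auto
  ultimately have JR1: "finite (J' \<union> {v} \<times> R)" for v by simp
  have JR2: "J' \<union> {v} \<times> R \<subseteq> {1..n} \<times> {0..t}" if "v \<in> {1..<Suc n}" for v
  proof -
    have "r \<in> {0..t}" if "r \<in> R" for r using step.prems(2) that unfolding R_def by blast
    moreover have "J' \<subseteq> {1..n} \<times> {0..t}" using step.prems(2) unfolding J'_def by fastforce
    ultimately show ?thesis using that by auto
  qed
  have w1: "weight t (\<lambda>_. UNIV) K n z = 1" for n z
    using mark.emeasure_space_1 by (auto simp: weight_def intro!: prod.neutral)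
  have U: "UNIV \<in> sets (mark k)" for k using sets.top[of "mark k"] by simp
  have "emeasure rrt (event J) = (\<integral>\<^sup>+ z. weight t (\<lambda>_. UNIV) K (Suc n) z * indicator (event J) z \<partial>rrt)"
    using step.prems by (simp add: w1)
  also have "\<dots> = ?a * (\<Sum>v\<in>{1..<Suc n}. emeasure rrt (event (J' \<union> {v} \<times> R)))"
    unfolding nn_integral_weight_event_Suc[OF step.hyps(1) t U step.prems] J'_def[symmetric] R_def[symmetric]
    by (intro arg_cong2[where f="\<lambda>a b. a * b"] sum.cong refl) (simp add: w1 sets_event[OF JR1])
  finally have P: "emeasure rrt (event J) = ?a * (\<Sum>v\<in>{1..<Suc n}. emeasure rrt (event (J' \<union> {v} \<times> R)))" .
  have "(\<integral>\<^sup>+ z. weight t B K (Suc n) z * indicator (event J) z \<partial>rrt) =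
     ?a * (\<Sum>v\<in>{1..<Suc n}. ?c * emeasure rrt (event (J' \<union> {v} \<times> R)))"
    unfolding nn_integral_weight_event_Suc[OF step.hyps(1) t B step.prems] J'_def[symmetric] R_def[symmetric]
    by (intro arg_cong2[where f="\<lambda>a b. a * b"] sum.cong refl step.IH JR1 JR2)
  also have "\<dots> = ?c * emeasure rrt (event J)"
    unfolding P sum_distrib_left[symmetric] by (simp only: mult.left_commute)
  finally show ?case .
qed

text \<open>
  Letting \<open>n\<close> tend to infinity in the preceding identity: the root block is infinite, so eventually
  every rank up to \<open>K\<close> has appeared and the weight is the indicator.
\<close>

lemma emeasure_event_shift:
  assumes t: "0 \<le> t" and B: "\<And>k. B k \<in> sets (mark k)"
    and J: "finite J" "J \<subseteq> {1..} \<times> {0..t}"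
  shows "emeasure rrt (event J \<inter> {z \<in> space rrt. \<forall>k\<in>{2..K}. shift t z k \<in> B k}) =
    (\<Prod>k\<in>{2..K}. emeasure (mark k) (B k)) * emeasure rrt (event J)"
proof -
  let ?S = "{z \<in> space rrt. \<forall>k\<in>{2..K}. shift t z k \<in> B k}"
  have B': "B k \<in> sets (count_space UNIV \<Otimes>\<^sub>M borel)" for k using B sets_mark by blast
  have [measurable]: "(\<lambda>z. shift t z k) \<in> rrt \<rightarrow>\<^sub>M count_space UNIV \<Otimes>\<^sub>M borel" for k
    by (rule measurable_compose[OF measurable_shift measurable_component_rrt])
  have S [measurable]: "?S \<in> sets rrt" using B' by measurable
  note [measurable] = measurable_weight[OF B]
  obtain N where N: "1 \<le> N" "J \<subseteq> {1..N} \<times> {0..t}"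
  proof -
    have "finite (fst ` J)" using J by simp
    then obtain N where "\<forall>i\<in>fst ` J. i \<le> N" using finite_nat_set_iff_bounded_le by blast
    then have "J \<subseteq> {1..max 1 N} \<times> {0..t}" using J(2) by fastforce
    then show ?thesis by (intro that[of "max 1 N"]) auto
  qed
  have "(\<lambda>n. \<integral>\<^sup>+ z. weight t B K (n + N) z * indicator (event J) z \<partial>rrt) \<longlonglongrightarrow>
    (\<integral>\<^sup>+ z. indicator (event J \<inter> ?S) z \<partial>rrt)"
  proof (rule nn_integral_dominated_convergence[where w="\<lambda>_. 1"])
    have "weight t B K n z \<le> 1" for n z
      unfolding weight_def by (intro prod_le_1) (auto simp: indicator_def mark.emeasure_le_1)
    then show "AE z in rrt. weight t B K (n + N) z * indicator (event J) z \<le> 1" for n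
      by (auto simp: indicator_def)
    show "AE z in rrt. (\<lambda>n. weight t B K (n + N) z * indicator (event J) z) \<longlonglongrightarrow> indicator (event J \<inter> ?S) z"
      using AE_root_count_unbounded[OF t] AE_space
    proof eventually_elim
      case (elim z)
      then have "eventually (\<lambda>n. K \<le> root_count n t z) sequentially" by (simp add: filterlim_at_top)
      then have "eventually (\<lambda>n. K \<le> root_count (n + N) t z) sequentially"
        by (rule eventually_compose_filterlim) (rule filterlim_add_const_nat_at_top)
      then have "eventually (\<lambda>n. weight t B K (n + N) z * indicator (event J) z = indicator (event J \<inter> ?S) z) sequentially"
      proof eventually_elim
        case (elim n)
        then have "weight t B K (n + N) z = (\<Prod>k\<in>{2..K}. indicator (B k) (shift t z k))"
          unfolding weight_def by (intro prod.cong) auto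
        also have "\<dots> = indicator ?S z"
          using \<open>z \<in> space rrt\<close> by (auto simp: indicator_def intro!: prod_zero prod.neutral)
        finally show ?case by (simp add: indicator_inter_arith mult.commute)
      qed
      then show ?case by (rule tendsto_eventually)
    qed
  qed (use J in \<open>auto simp: rrt.emeasure_space_1\<close>)
  moreover have "(\<integral>\<^sup>+ z. weight t B K (n + N) z * indicator (event J) z \<partial>rrt) =
    (\<Prod>k\<in>{2..K}. emeasure (mark k) (B k)) * emeasure rrt (event J)" for n
  proof (rule nn_integral_weight_event[OF t B _ J(1)])
    show "J \<subseteq> {1..n + N} \<times> {0..t}" using N(2) by fastforce
  qed (use N(1) in simp)
  ultimately have "(\<integral>\<^sup>+ z. indicator (event J \<inter> ?S) z \<partial>rrt) =
    (\<Prod>k\<in>{2..K}. emeasure (mark k) (B k)) * emeasure rrt (event J)"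
    by (simp add: LIMSEQ_const_iff)
  then show ?thesis using J S by simp
qed

definition root_alg :: "real \<Rightarrow> (nat \<Rightarrow> nat \<times> real) measure" where
  "root_alg t = sigma (space rrt) {event J | J. finite J \<and> J \<subseteq> {1..} \<times> {0..t}}"

lemma space_root_alg [simp]: "space (root_alg t) = space rrt"
  unfolding root_alg_def by (rule space_measure_of) (auto simp: event_def)

lemma sets_root_alg: "sets (root_alg t) = sigma_sets (space rrt) {event J | J. finite J \<and> J \<subseteq> {1..} \<times> {0..t}}"
  unfolding root_alg_def by (rule sets_measure_of) (auto simp: event_def)

lemma root_alg_subset: "sets (root_alg t) \<subseteq> sets rrt"
  unfolding sets_root_alg by (intro sets.sigma_sets_subset) (auto intro: sets_event)

lemma pred_in_root_root_alg:
  assumes "0 \<le> r" "r \<le> t"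
  shows "Measurable.pred (root_alg t) (\<lambda>z. in_root r z i)"
proof (cases "i = 0")
  case False
  then have "event {(i, r)} \<in> sets (root_alg t)"
  proof -
    have "finite {(i, r)} \<and> {(i, r)} \<subseteq> {1..} \<times> {0..t}" using assms False by auto
    then show ?thesis unfolding sets_root_alg by (intro sigma_sets.Basic) blast
  qed
  then show ?thesis by (simp add: pred_def event_def)
qed simp

lemma measurable_root_count_root_alg:
  assumes "0 \<le> r" "r \<le> t"
  shows "root_count n r \<in> root_alg t \<rightarrow>\<^sub>M count_space UNIV"
proof -
  have [measurable]: "Measurable.pred (root_alg t) (\<lambda>z. in_root r z i)" for i
    by (rule pred_in_root_root_alg[OF assms])
  have "root_count n r = (\<lambda>z. \<Sum>i\<le>n. if in_root r z i then 1 else 0)"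
    by (rule ext) (rule root_count_eq_sum)
  then show ?thesis by simp
qed

lemma subalgebra_root_alg: "subalgebra rrt (root_alg t)"
  unfolding subalgebra_def by (simp add: root_alg_subset)

lemma measurable_root_alg_imp: "f \<in> root_alg t \<rightarrow>\<^sub>M N \<Longrightarrow> f \<in> rrt \<rightarrow>\<^sub>M N"
  by (rule measurable_from_subalg[OF subalgebra_root_alg])

lemma measurable_ident_root_alg: "(\<lambda>z. z) \<in> rrt \<rightarrow>\<^sub>M root_alg t"
  by (rule measurable_root_alg_imp[of _ t]) simp

lemma vimage_shift_prod_emb:
  assumes "J \<subseteq> {2..}"
  shows "shift t -` prod_emb {2..} mark J (Pi\<^sub>E J F) \<inter> space rrt = {z \<in> space rrt. \<forall>k\<in>J. shift t z k \<in> F k}"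
proof (intro set_eqI)
  fix z
  have "shift t z \<in> (\<Pi>\<^sub>E i\<in>{2..}. space (mark i))" if "z \<in> space rrt"
    using measurable_space[OF measurable_shift that] unfolding rrt_def space_PiM .
  then show "z \<in> shift t -` prod_emb {2..} mark J (Pi\<^sub>E J F) \<inter> space rrt \<longleftrightarrow>
      z \<in> {z \<in> space rrt. \<forall>k\<in>J. shift t z k \<in> F k}"
    by (auto simp: prod_emb_def restrict_PiE_iff)
qed

lemma distr_shift:
  assumes t: "0 \<le> t"
  shows "distr rrt rrt (shift t) = rrt"
proof -
  interpret P: product_prob_space mark "{2..}" ..
  have "distr rrt rrt (shift t) = PiM {2..} mark"
  proof (rule P.PiM_eq)
    show "sets (distr rrt rrt (shift t)) = sets (Pi\<^sub>M {2..} mark)" by (simp add: rrt_def)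
    fix J F assume J: "finite J" "J \<subseteq> {2..}" and F: "\<And>j. j \<in> J \<Longrightarrow> F j \<in> sets (mark j)"
    obtain K where K: "J \<subseteq> {2..K}"
    proof -
      obtain K where "\<forall>i\<in>J. i \<le> K" using J finite_nat_set_iff_bounded_le by blast
      with J show ?thesis by (intro that[of K]) auto
    qed
    define B where "B = (\<lambda>k. if k \<in> J then F k else UNIV)"
    have U: "UNIV \<in> sets (mark k)" for k using sets.top[of "mark k"] by simp
    have B: "B k \<in> sets (mark k)" for k using F U by (simp add: B_def)
    have "emeasure (distr rrt rrt (shift t)) (prod_emb {2..} mark J (Pi\<^sub>E J F)) =
       emeasure rrt (shift t -` prod_emb {2..} mark J (Pi\<^sub>E J F) \<inter> space rrt)"
    proof (rule emeasure_distr[OF measurable_shift])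
      show "prod_emb {2..} mark J (Pi\<^sub>E J F) \<in> sets rrt"
        unfolding rrt_def using J F by (intro sets_PiM_I) auto
    qed
    also have "shift t -` prod_emb {2..} mark J (Pi\<^sub>E J F) \<inter> space rrt =
       event {} \<inter> {z \<in> space rrt. \<forall>k\<in>{2..K}. shift t z k \<in> B k}"
      unfolding vimage_shift_prod_emb[OF J(2)] using K by (auto simp: event_def B_def)
    also have "emeasure rrt \<dots> = (\<Prod>k\<in>{2..K}. emeasure (mark k) (B k)) * emeasure rrt (event {})"
      by (rule emeasure_event_shift[OF t B]) auto
    also have "emeasure rrt (event {}) = 1" by (simp add: event_def rrt.emeasure_space_1)
    also have "(\<Prod>k\<in>{2..K}. emeasure (mark k) (B k)) = (\<Prod>k\<in>J. emeasure (mark k) (F k))"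
      using K mark.emeasure_space_1
      by (intro prod.mono_neutral_cong_right) (auto simp: B_def)
    finally show "emeasure (distr rrt rrt (shift t)) (prod_emb {2..} mark J (Pi\<^sub>E J F)) = (\<Prod>k\<in>J. emeasure (mark k) (F k))"
      by simp
  qed
  then show ?thesis by (simp add: rrt_def)
qed

definition shift_box :: "real \<Rightarrow> nat \<Rightarrow> (nat \<Rightarrow> (nat \<times> real) set) \<Rightarrow> (nat \<Rightarrow> nat \<times> real) set" where
  "shift_box t K B = {z \<in> space rrt. \<forall>k\<in>{2..K}. shift t z k \<in> B k}"

lemma sets_shift_box:
  assumes "\<And>k. B k \<in> sets (mark k)"
  shows "shift_box t K B \<in> sets rrt"
proof -
  have "prod_emb {2..} mark {2..K} (Pi\<^sub>E {2..K} B) \<in> sets rrt"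
    unfolding rrt_def using assms by (intro sets_PiM_I) auto
  from measurable_sets[OF measurable_shift this] show ?thesis
    unfolding shift_box_def by (subst (asm) vimage_shift_prod_emb) auto
qed

lemma shift_box_Int:
  "shift_box t K1 B1 \<inter> shift_box t K2 B2 =
   shift_box t (max K1 K2) (\<lambda>k. (if k \<le> K1 then B1 k else UNIV) \<inter> (if k \<le> K2 then B2 k else UNIV))"
  (is "_ = shift_box t _ ?B")
proof -
  have "(\<forall>k\<in>{2..max K1 K2}. f k \<in> ?B k) \<longleftrightarrow> (\<forall>k\<in>{2..K1}. f k \<in> B1 k) \<and> (\<forall>k\<in>{2..K2}. f k \<in> B2 k)" for f
    unfolding Ball_def atLeastAtMost_iff le_max_iff_disj by auto
  then show ?thesis unfolding shift_box_def by blast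
qed

lemma UNIV_in_sets_mark: "UNIV \<in> sets (mark k)"
  using sets.top[of "mark k"] by simp

lemma event_Int: "event J1 \<inter> event J2 = event (J1 \<union> J2)"
  unfolding event_def by blast

lemma indep_event_shift_box:
  assumes t: "0 \<le> t"
  shows "rrt.indep_set {event J | J. finite J \<and> J \<subseteq> {1..} \<times> {0..t}} {shift_box t K B | K B. \<forall>k. B k \<in> sets (mark k)}"
proof (rule rrt.indep_setI)
  show "{event J | J. finite J \<and> J \<subseteq> {1..} \<times> {0..t}} \<subseteq> rrt.events"
    using sets_event by blast
  show "{shift_box t K B | K B. \<forall>k. B k \<in> sets (mark k)} \<subseteq> rrt.events"
    using sets_shift_box by blast
  fix a b
  assume "a \<in> {event J | J. finite J \<and> J \<subseteq> {1..} \<times> {0..t}}" "b \<in> {shift_box t K B | K B. \<forall>k. B k \<in> sets (mark k)}"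
  then obtain J K B where J: "finite J" "J \<subseteq> {1..} \<times> {0..t}" "a = event J"
    and B: "\<And>k. B k \<in> sets (mark k)" "b = shift_box t K B" by blast
  have ab: "emeasure rrt (a \<inter> b) = (\<Prod>k\<in>{2..K}. emeasure (mark k) (B k)) * emeasure rrt a"
    unfolding J(3) B(2) shift_box_def by (rule emeasure_event_shift[OF t B(1) J(1,2)])
  have e: "event {} = space rrt" by (simp add: event_def)
  have "b \<subseteq> space rrt" by (auto simp: B(2) shift_box_def)
  have "emeasure rrt (event {} \<inter> b) = (\<Prod>k\<in>{2..K}. emeasure (mark k) (B k)) * emeasure rrt (event {})"
    unfolding B(2) shift_box_def by (rule emeasure_event_shift[OF t B(1)]) auto
  then have b: "emeasure rrt b = (\<Prod>k\<in>{2..K}. emeasure (mark k) (B k))"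
    using \<open>b \<subseteq> space rrt\<close> by (simp add: e rrt.emeasure_space_1 Int_absorb1)
  have "ennreal (rrt.prob (a \<inter> b)) = ennreal (rrt.prob a * rrt.prob b)"
    using ab unfolding b[symmetric] rrt.emeasure_eq_measure by (simp add: mult.commute ennreal_mult'')
  then show "rrt.prob (a \<inter> b) = rrt.prob a * rrt.prob b" by simp
qed

lemma indep_root_alg_shift_box:
  assumes t: "0 \<le> t"
  shows "rrt.indep_set (sets (root_alg t)) (sigma_sets (space rrt) {shift_box t K B | K B. \<forall>k. B k \<in> sets (mark k)})"
  unfolding sets_root_alg
proof (rule rrt.indep_set_sigma_sets[OF indep_event_shift_box[OF t]])
  show "Int_stable {event J | J. finite J \<and> J \<subseteq> {1..} \<times> {0..t}}"
  proof (rule Int_stableI)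
    fix a b assume "a \<in> {event J | J. finite J \<and> J \<subseteq> {1..} \<times> {0..t}}" "b \<in> {event J | J. finite J \<and> J \<subseteq> {1..} \<times> {0..t}}"
    then obtain J1 J2 where J: "finite J1" "finite J2" "J1 \<subseteq> {1..} \<times> {0..t}" "J2 \<subseteq> {1..} \<times> {0..t}" "a = event J1" "b = event J2"
      by blast
    have "finite (J1 \<union> J2) \<and> J1 \<union> J2 \<subseteq> {1..} \<times> {0..t}" using J by simp
    then show "a \<inter> b \<in> {event J | J. finite J \<and> J \<subseteq> {1..} \<times> {0..t}}"
      unfolding J(5,6) event_Int by blast
  qed
  show "Int_stable {shift_box t K B | K B. \<forall>k. B k \<in> sets (mark k)}"
  proof (rule Int_stableI)
    fix a b assume "a \<in> {shift_box t K B | K B. \<forall>k. B k \<in> sets (mark k)}" "b \<in> {shift_box t K B | K B. \<forall>k. B k \<in> sets (mark k)}"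
    then obtain K1 B1 K2 B2 where B: "\<And>k. B1 k \<in> sets (mark k)" "\<And>k. B2 k \<in> sets (mark k)"
      "a = shift_box t K1 B1" "b = shift_box t K2 B2"
      by blast
    have "\<forall>k. (if k \<le> K1 then B1 k else UNIV) \<inter> (if k \<le> K2 then B2 k else UNIV) \<in> sets (mark k)"
      using B UNIV_in_sets_mark by (simp add: sets.Int)
    then show "a \<inter> b \<in> {shift_box t K B | K B. \<forall>k. B k \<in> sets (mark k)}"
      unfolding B(3,4) shift_box_Int by blast
  qed
qed

lemma vimage_shift_in_sigma_shift_box:
  assumes "D \<in> sets rrt"
  shows "shift t -` D \<inter> space rrt \<in> sigma_sets (space rrt) {shift_box t K B | K B. \<forall>k. B k \<in> sets (mark k)}"
    (is "_ \<in> sigma_sets _ ?H")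
proof -
  have "shift t -` C \<inter> space rrt \<in> sigma_sets (space rrt) ?H"
    if "C \<in> sigma_sets (space rrt) {{f \<in> space rrt. f i \<in> A} | i A. i \<in> {2..} \<and> A \<in> sets (mark i)}" for C
    using that
  proof induction
    case (Basic C)
    then obtain i A where i: "2 \<le> i" "A \<in> sets (mark i)" "C = {f \<in> space rrt. f i \<in> A}" by blast
    have "shift t -` C \<inter> space rrt = shift_box t i (\<lambda>k. if k = i then A else UNIV)"
      using i measurable_space[OF measurable_shift] by (auto simp: shift_box_def)
    moreover have "\<forall>k. (if k = i then A else UNIV) \<in> sets (mark k)" using i UNIV_in_sets_mark by simp
    ultimately show ?case by (intro sigma_sets.Basic) blast
  next
    case Empty show ?case by (simp add: sigma_sets.Empty)
  next
    case (Compl C)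
    have "shift t -` (space rrt - C) \<inter> space rrt = space rrt - (shift t -` C \<inter> space rrt)"
      using measurable_space[OF measurable_shift[of t]] by auto
    with Compl.IH show ?case by (simp add: sigma_sets.Compl)
  next
    case (Union C)
    have e: "shift t -` (\<Union>i. C i) \<inter> space rrt = (\<Union>i. shift t -` C i \<inter> space rrt)" by auto
    show ?case unfolding e by (rule sigma_sets.Union) (rule Union.IH)
  qed
  moreover have "sets rrt = sigma_sets (space rrt) {{f \<in> space rrt. f i \<in> A} | i A. i \<in> {2..} \<and> A \<in> sets (mark i)}"
    unfolding rrt_def sets_PiM_single space_PiM by simp
  ultimately show ?thesis using assms by blast
qed

text \<open>
  The branching Markov property: the renumbered root block at time \<open>t\<close> is a fresh copy of the tree,
  independent of the history up to \<open>t\<close>.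
\<close>

lemma prob_root_alg_shift:
  assumes t: "0 \<le> t" and E: "E \<in> sets (root_alg t)" and D: "D \<in> sets rrt"
  shows "rrt.prob (E \<inter> (shift t -` D \<inter> space rrt)) = rrt.prob E * rrt.prob D"
proof -
  have "rrt.prob (E \<inter> (shift t -` D \<inter> space rrt)) = rrt.prob E * rrt.prob (shift t -` D \<inter> space rrt)"
    by (rule rrt.indep_setD[OF indep_root_alg_shift_box[OF t] E vimage_shift_in_sigma_shift_box[OF D]])
  also have "rrt.prob (shift t -` D \<inter> space rrt) = rrt.prob D"
    using measure_distr[OF measurable_shift D, of t] by (simp add: distr_shift[OF t])
  finally show ?thesis .
qed

text \<open>
  The same independence as an identity of joint laws, which allows integration of functions of
  both the past and the shifted tree.
\<close>

lemma distr_root_alg_shift: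
  assumes t: "0 \<le> t"
  shows "distr rrt (root_alg t \<Otimes>\<^sub>M rrt) (\<lambda>z. (z, shift t z)) = distr rrt (root_alg t) (\<lambda>z. z) \<Otimes>\<^sub>M rrt"
proof (rule pair_measure_eqI[symmetric])
  note measurable_ident_root_alg [measurable]
  show "sigma_finite_measure (distr rrt (root_alg t) (\<lambda>z. z))"
  proof -
    interpret p: prob_space "distr rrt (root_alg t) (\<lambda>z. z)" by (rule rrt.prob_space_distr) simp
    show ?thesis ..
  qed
  show "sigma_finite_measure rrt" ..
  fix A D assume A: "A \<in> sets (distr rrt (root_alg t) (\<lambda>z. z))" and D: "D \<in> sets rrt"
  then have A': "A \<in> sets (root_alg t)" by simp
  then have "A \<in> sets rrt" using root_alg_subset by blast
  then have "A \<subseteq> space rrt" by (rule sets.sets_into_space)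
  have "emeasure (distr rrt (root_alg t \<Otimes>\<^sub>M rrt) (\<lambda>z. (z, shift t z))) (A \<times> D) =
     emeasure rrt (A \<inter> (shift t -` D \<inter> space rrt))"
    using A' D \<open>A \<subseteq> space rrt\<close> by (subst emeasure_distr) (auto intro!: arg_cong[where f="emeasure rrt"])
  also have "\<dots> = emeasure rrt A * emeasure rrt D"
    using prob_root_alg_shift[OF t A' D] by (simp add: rrt.emeasure_eq_measure ennreal_mult')
  also have "emeasure rrt A = emeasure (distr rrt (root_alg t) (\<lambda>z. z)) A"
    using A' \<open>A \<subseteq> space rrt\<close> by (subst emeasure_distr) (auto simp: Int_absorb2)
  finally show "emeasure (distr rrt (root_alg t) (\<lambda>z. z)) A * emeasure rrt D =
     emeasure (distr rrt (root_alg t \<Otimes>\<^sub>M rrt) (\<lambda>z. (z, shift t z))) (A \<times> D)" by simp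
qed simp

section \<open>Consequences of the Markov property\<close>

lemma integral_shift:
  fixes F :: "_ \<Rightarrow> real"
  assumes t: "0 \<le> t" and F: "F \<in> borel_measurable (root_alg t \<Otimes>\<^sub>M rrt)" and B: "\<And>x. \<bar>F x\<bar> \<le> B"
  shows "(\<integral> z. F (z, shift t z) \<partial>rrt) = (\<integral> z. (\<integral> z'. F (z, z') \<partial>rrt) \<partial>rrt)"
proof -
  note measurable_ident_root_alg [measurable]
  interpret R: prob_space "distr rrt (root_alg t) (\<lambda>z. z)"
    by (rule rrt.prob_space_distr) measurable
  interpret P: pair_prob_space "distr rrt (root_alg t) (\<lambda>z. z)" rrt ..
  have F': "F \<in> borel_measurable (distr rrt (root_alg t) (\<lambda>z. z) \<Otimes>\<^sub>M rrt)"
    using F by (simp cong: measurable_cong_sets sets_pair_measure_cong)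
  have "(\<integral> z. F (z, shift t z) \<partial>rrt) = (\<integral> x. F x \<partial>distr rrt (root_alg t \<Otimes>\<^sub>M rrt) (\<lambda>z. (z, shift t z)))"
    using F by (subst integral_distr) auto
  also have "\<dots> = (\<integral> x. F x \<partial>(distr rrt (root_alg t) (\<lambda>z. z) \<Otimes>\<^sub>M rrt))"
    by (simp only: distr_root_alg_shift[OF t])
  also have "\<dots> = (\<integral> z. (\<integral> z'. F (z, z') \<partial>rrt) \<partial>distr rrt (root_alg t) (\<lambda>z. z))"
    using B by (intro P.integral_fst'[symmetric] P.P.integrable_const_bound[of _ B] F') auto
  also have "\<dots> = (\<integral> z. (\<integral> z'. F (z, z') \<partial>rrt) \<partial>rrt)"
    by (intro integral_distr measurable_ident_root_alg rrt.borel_measurable_lebesgue_integral) (use F in simp)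
  finally show ?thesis .
qed

lemma nn_integral_shift:
  assumes t: "0 \<le> t" and F: "F \<in> borel_measurable (root_alg t \<Otimes>\<^sub>M rrt)"
  shows "(\<integral>\<^sup>+ z. F (z, shift t z) \<partial>rrt) = (\<integral>\<^sup>+ z. (\<integral>\<^sup>+ z'. F (z, z') \<partial>rrt) \<partial>rrt)"
proof -
  note measurable_ident_root_alg [measurable]
  have F': "F \<in> borel_measurable (distr rrt (root_alg t) (\<lambda>z. z) \<Otimes>\<^sub>M rrt)"
    using F by (simp cong: measurable_cong_sets sets_pair_measure_cong)
  have "(\<integral>\<^sup>+ z. F (z, shift t z) \<partial>rrt) = (\<integral>\<^sup>+ x. F x \<partial>distr rrt (root_alg t \<Otimes>\<^sub>M rrt) (\<lambda>z. (z, shift t z)))"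
    using F by (subst nn_integral_distr) auto
  also have "\<dots> = (\<integral>\<^sup>+ x. F x \<partial>(distr rrt (root_alg t) (\<lambda>z. z) \<Otimes>\<^sub>M rrt))"
    by (simp only: distr_root_alg_shift[OF t])
  also have "\<dots> = (\<integral>\<^sup>+ z. (\<integral>\<^sup>+ z'. F (z, z') \<partial>rrt) \<partial>distr rrt (root_alg t) (\<lambda>z. z))"
    by (intro rrt.nn_integral_fst[symmetric] F')
  also have "\<dots> = (\<integral>\<^sup>+ z. (\<integral>\<^sup>+ z'. F (z, z') \<partial>rrt) \<partial>rrt)"
    using F by (intro nn_integral_distr measurable_ident_root_alg rrt.borel_measurable_nn_integral) simp
  finally show ?thesis .
qed

lemma AE_shift_distr:
  assumes "0 \<le> t" "AE z in rrt. P z"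
  shows "AE z in rrt. P (shift t z)"
  by (rule AE_distrD[OF measurable_shift]) (simp only: distr_shift[OF assms(1)] assms(2))

lemma AE_root_count_shift:
  assumes "0 \<le> t"
  shows "AE z in rrt. \<forall>n r. 0 \<le> r \<longrightarrow> root_count n (t + r) z = root_count (root_count n t z) r (shift t z)"
  using AE_valid AE_root_count_unbounded[OF assms]
  by eventually_elim (auto simp: root_count_shift)

lemma measurable_root_count_pair:
  assumes "0 \<le> t"
  shows "(\<lambda>x. root_count (root_count n t (fst x)) r (snd x)) \<in> root_alg t \<Otimes>\<^sub>M rrt \<rightarrow>\<^sub>M count_space UNIV"
proof (rule measurable_compose_countable[where g="\<lambda>x. root_count n t (fst x)"])
  show "(\<lambda>x. root_count n t (fst x)) \<in> root_alg t \<Otimes>\<^sub>M rrt \<rightarrow>\<^sub>M count_space UNIV"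
    by (rule measurable_compose[OF measurable_fst measurable_root_count_root_alg[OF assms order.refl]])
qed (rule measurable_compose[OF measurable_snd measurable_root_count])

text \<open>
  Conditionally on the past at \<open>t\<close>, the count at \<open>T\<close> is the count at \<open>T - t\<close> in an independent
  tree with \<open>root_count n t\<close> vertices.  Its mean is given by \<open>expectation_rising\<close>, and the factor
  \<open>exp (- (T - t))\<close> turns the parameter \<open>p * exp T\<close> into \<open>p * exp t\<close>.
\<close>

lemma rising_martingale:
  assumes t: "0 \<le> t" "t \<le> T" and n: "1 \<le> n" and E: "E \<in> sets (root_alg t)"
  shows "(\<integral> z. rising (p * exp T) (root_count n T z) * indicator E z \<partial>rrt) =
         (\<integral> z. rising (p * exp t) (root_count n t z) * indicator E z \<partial>rrt)"
proof -
  define r where "r = T - t"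
  have r: "0 \<le> r" "T = t + r" using t by (auto simp: r_def)
  obtain B where B: "\<And>i. i \<le> n \<Longrightarrow> \<bar>rising (p * exp T) i\<bar> \<le> B"
    using finite_values_bound[of n "\<lambda>i j k. rising (p * exp T) i"] by (metis order.refl)
  define F where "F = (\<lambda>x. rising (p * exp T) (root_count (root_count n t (fst x)) r (snd x)) * indicator E (fst x))"
  note [measurable] = measurable_root_count_pair[OF t(1)]
  have [measurable]: "F \<in> borel_measurable (root_alg t \<Otimes>\<^sub>M rrt)"
    unfolding F_def using E by measurable
  have "0 \<le> B" using B[of 0] by (meson abs_ge_zero le0 order.trans)
  then have FB: "\<bar>F x\<bar> \<le> B" for x
    using B[of "root_count (root_count n t (fst x)) r (snd x)"]
      order.trans[OF root_count_le root_count_le, of "root_count n t (fst x)" r "snd x"]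
    by (auto simp: F_def indicator_def order.trans[OF root_count_le root_count_le])
  have E': "E \<in> sets rrt" using E root_alg_subset by blast
  have "(\<integral> z. rising (p * exp T) (root_count n T z) * indicator E z \<partial>rrt) = (\<integral> z. F (z, shift t z) \<partial>rrt)"
  proof (rule Bochner_Integration.integral_cong_AE)
    show "AE z in rrt. rising (p * exp T) (root_count n T z) * indicator E z = F (z, shift t z)"
      using AE_root_count_shift[OF t(1)] by eventually_elim (use r in \<open>auto simp: F_def\<close>)
    show "(\<lambda>z. F (z, shift t z)) \<in> borel_measurable rrt"
      by (rule measurable_compose[OF _ \<open>F \<in> _\<close>]) (use measurable_ident_root_alg in measurable)
  qed (use E' in measurable)
  also have "\<dots> = (\<integral> z. (\<integral> z'. F (z, z') \<partial>rrt) \<partial>rrt)"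
    by (rule integral_shift[OF t(1) _ FB]) measurable
  also have "\<dots> = (\<integral> z. rising (p * exp t) (root_count n t z) * indicator E z \<partial>rrt)"
  proof (rule Bochner_Integration.integral_cong[OF refl])
    fix z
    have e: "exp (- r) * (p * exp T) = p * exp t" by (simp add: r exp_add exp_minus field_simps)
    have "(\<integral> z'. rising (p * exp T) (root_count (root_count n t z) r z') \<partial>rrt) = rising (p * exp t) (root_count n t z)"
      using expectation_rising[OF root_count_pos[OF n] r(1), of "p * exp T" t z] unfolding e .
    then show "(\<integral> z'. F (z, z') \<partial>rrt) = rising (p * exp t) (root_count n t z) * indicator E z"
      by (simp add: F_def)
  qed
  finally show ?thesis .
qed

text \<open>
  Doob's maximal inequality: on the event that the first exceedance among the finitely many times
  occurs at \<open>t\<close>, the mean of \<open>\<bar>Z T\<bar>\<close> is at least that of \<open>\<bar>Z t\<bar>\<close>.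
\<close>

lemma maximal_inequality_finite:
  fixes Z :: "real \<Rightarrow> _ \<Rightarrow> real"
  assumes S: "finite S" and Z: "\<And>s t. s \<in> S \<Longrightarrow> s \<le> t \<Longrightarrow> Z s \<in> borel_measurable (root_alg t)"
    and int: "\<And>t. t \<in> S \<Longrightarrow> integrable rrt (Z t)" "integrable rrt (Z T)"
    and mart: "\<And>t E. t \<in> S \<Longrightarrow> E \<in> sets (root_alg t) \<Longrightarrow>
        (\<integral> z. Z T z * indicator E z \<partial>rrt) = (\<integral> z. Z t z * indicator E z \<partial>rrt)"
    and l: "0 < l"
  shows "l * rrt.prob {z \<in> space rrt. \<exists>t\<in>S. l < \<bar>Z t z\<bar>} \<le> (\<integral> z. \<bar>Z T z\<bar> \<partial>rrt)"
proof -
  define B where "B = (\<lambda>t. {z \<in> space rrt. l < \<bar>Z t z\<bar> \<and> (\<forall>s\<in>{s \<in> S. s < t}. \<bar>Z s z\<bar> \<le> l)})"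
  have BS: "B t \<in> sets (root_alg t)" if "t \<in> S" for t
  proof -
    have [measurable]: "Z s \<in> borel_measurable (root_alg t)" if "s \<in> {s \<in> S. s < t}" for s using Z that by auto
    have [measurable]: "Z t \<in> borel_measurable (root_alg t)" using Z that by auto
    have "finite {s \<in> S. s < t}" using S by auto
    then have "{z \<in> space (root_alg t). l < \<bar>Z t z\<bar> \<and> (\<forall>s\<in>{s \<in> S. s < t}. \<bar>Z s z\<bar> \<le> l)} \<in> sets (root_alg t)"
      by measurable
    then show ?thesis by (simp add: B_def)
  qed
  then have BM: "B t \<in> sets rrt" if "t \<in> S" for t using root_alg_subset that by blast
  have disj: "disjoint_family_on B S"
    unfolding disjoint_family_on_def
  proof (intro ballI impI)
    fix s t assume "s \<in> S" "t \<in> S" "s \<noteq> t"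
    then show "B s \<inter> B t = {}" by (cases "s < t") (force simp: B_def)+
  qed
  have un: "{z \<in> space rrt. \<exists>t\<in>S. l < \<bar>Z t z\<bar>} = (\<Union>t\<in>S. B t)"
  proof safe
    fix z t assume z: "z \<in> space rrt" and t: "t \<in> S" "l < \<bar>Z t z\<bar>"
    define A where "A = {t \<in> S. l < \<bar>Z t z\<bar>}"
    have A: "finite A" "A \<noteq> {}" using S t by (auto simp: A_def)
    have "Min A \<in> A" using A by (rule Min_in)
    moreover have "\<bar>Z s z\<bar> \<le> l" if "s \<in> S" "s < Min A" for s
      using Min_le[OF A(1), of s] that by (force simp: A_def)
    ultimately have "z \<in> B (Min A)" using z by (auto simp: B_def A_def)
    then show "z \<in> (\<Union>t\<in>S. B t)" using \<open>Min A \<in> A\<close> by (auto simp: A_def)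
  qed (auto simp: B_def)
  have each: "l * rrt.prob (B t) \<le> (\<integral> z. \<bar>Z T z\<bar> * indicator (B t) z \<partial>rrt)" if t: "t \<in> S" for t
  proof -
    have Zt: "Z t \<in> borel_measurable (root_alg t)" using Z t by auto
    define P where "P = {z \<in> space (root_alg t). z \<in> B t \<and> 0 \<le> Z t z}"
    define N where "N = {z \<in> space (root_alg t). z \<in> B t \<and> Z t z < 0}"
    have PN: "P \<in> sets (root_alg t)" "N \<in> sets (root_alg t)"
      unfolding P_def N_def using Zt BS[OF t] by measurable
    have PNM: "P \<in> sets rrt" "N \<in> sets rrt" using PN root_alg_subset by blast+
    have ind: "indicator (B t) z = (indicator P z + indicator N z :: real)" if "z \<in> space rrt" for z
      using that by (auto simp: P_def N_def indicator_def)
    have i: "integrable rrt (\<lambda>z. Z t z * indicator P z)" "integrable rrt (\<lambda>z. Z t z * indicator N z)"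
       "integrable rrt (\<lambda>z. Z T z * indicator P z)" "integrable rrt (\<lambda>z. Z T z * indicator N z)"
      using int t PNM by (auto intro!: integrable_real_mult_indicator)
    have "l * rrt.prob (B t) = (\<integral> z. l * indicator (B t) z \<partial>rrt)" using BM[OF t] by simp
    also have "\<dots> \<le> (\<integral> z. Z t z * indicator P z - Z t z * indicator N z \<partial>rrt)"
    proof (intro integral_mono)
      fix z assume "z \<in> space rrt"
      then show "l * indicator (B t) z \<le> Z t z * indicator P z - Z t z * indicator N z"
        by (auto simp: indicator_def P_def N_def B_def)
    qed (use i BM[OF t] in \<open>auto simp: less_top[symmetric] intro!: integrable_mult_right integrable_real_indicator\<close>)
    also have "\<dots> = (\<integral> z. Z T z * indicator P z - Z T z * indicator N z \<partial>rrt)"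
      using i by (simp add: mart[OF t PN(1)] mart[OF t PN(2)])
    also have "\<dots> \<le> (\<integral> z. \<bar>Z T z\<bar> * indicator (B t) z \<partial>rrt)"
    proof (intro integral_mono)
      fix z assume "z \<in> space rrt"
      then show "Z T z * indicator P z - Z T z * indicator N z \<le> \<bar>Z T z\<bar> * indicator (B t) z"
        by (auto simp: indicator_def P_def N_def)
    qed (use i int BM[OF t] in \<open>auto intro!: integrable_real_mult_indicator\<close>)
    finally show ?thesis .
  qed
  have "l * rrt.prob {z \<in> space rrt. \<exists>t\<in>S. l < \<bar>Z t z\<bar>} = l * (\<Sum>t\<in>S. rrt.prob (B t))"
    unfolding un using S BM disj by (subst rrt.finite_measure_finite_Union) auto
  also have "\<dots> \<le> (\<Sum>t\<in>S. \<integral> z. \<bar>Z T z\<bar> * indicator (B t) z \<partial>rrt)"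
    unfolding sum_distrib_left by (intro sum_mono each)
  also have "\<dots> = (\<integral> z. (\<Sum>t\<in>S. \<bar>Z T z\<bar> * indicator (B t) z) \<partial>rrt)"
    using int BM by (intro Bochner_Integration.integral_sum[symmetric]) (auto intro!: integrable_real_mult_indicator)
  also have "\<dots> \<le> (\<integral> z. \<bar>Z T z\<bar> \<partial>rrt)"
  proof (intro integral_mono)
    fix z
    have "(\<Sum>t\<in>S. indicator (B t) z) = (indicator (\<Union>t\<in>S. B t) z :: real)"
      using disj S by (intro indicator_UN_disjoint[symmetric])
    then have "(\<Sum>t\<in>S. \<bar>Z T z\<bar> * indicator (B t) z) = \<bar>Z T z\<bar> * indicator (\<Union>t\<in>S. B t) z"
      by (simp flip: sum_distrib_left)
    also have "\<dots> \<le> \<bar>Z T z\<bar>" by (auto simp: indicator_def)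
    finally show "(\<Sum>t\<in>S. \<bar>Z T z\<bar> * indicator (B t) z) \<le> \<bar>Z T z\<bar>" .
  qed (use int BM in \<open>auto intro!: integrable_real_mult_indicator\<close>)
  finally show ?thesis .
qed

lemma maximal_inequality:
  fixes Z :: "real \<Rightarrow> _ \<Rightarrow> real"
  assumes S: "countable S" and Z: "\<And>s t. s \<in> S \<Longrightarrow> s \<le> t \<Longrightarrow> Z s \<in> borel_measurable (root_alg t)"
    and int: "\<And>t. t \<in> S \<Longrightarrow> integrable rrt (Z t)" "integrable rrt (Z T)"
    and mart: "\<And>t E. t \<in> S \<Longrightarrow> E \<in> sets (root_alg t) \<Longrightarrow>
        (\<integral> z. Z T z * indicator E z \<partial>rrt) = (\<integral> z. Z t z * indicator E z \<partial>rrt)"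
    and l: "0 < l"
  shows "{z \<in> space rrt. \<exists>t\<in>S. l < \<bar>Z t z\<bar>} \<in> sets rrt"
    and "l * rrt.prob {z \<in> space rrt. \<exists>t\<in>S. l < \<bar>Z t z\<bar>} \<le> (\<integral> z. \<bar>Z T z\<bar> \<partial>rrt)"
proof -
  have Zm [measurable]: "Z s \<in> borel_measurable rrt" if "s \<in> S" for s
    using int(1)[OF that] by (rule borel_measurable_integrable)
  show "{z \<in> space rrt. \<exists>t\<in>S. l < \<bar>Z t z\<bar>} \<in> sets rrt"
    using S by measurable
  show "l * rrt.prob {z \<in> space rrt. \<exists>t\<in>S. l < \<bar>Z t z\<bar>} \<le> (\<integral> z. \<bar>Z T z\<bar> \<partial>rrt)"
  proof (cases "S = {}")
    case False
    define A where "A = (\<lambda>k. {z \<in> space rrt. \<exists>t\<in>from_nat_into S ` {..<k::nat}. l < \<bar>Z t z\<bar>})"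
    have sub: "from_nat_into S ` {..<k} \<subseteq> S" for k using from_nat_into[OF False] by auto
    have Am: "A k \<in> sets rrt" for k
    proof -
      have [measurable]: "Z (from_nat_into S i) \<in> borel_measurable rrt" for i
        by (rule Zm) (rule from_nat_into[OF False])
      have "A k = {z \<in> space rrt. \<exists>i<k. l < \<bar>Z (from_nat_into S i) z\<bar>}"
        by (auto simp: A_def)
      also have "\<dots> \<in> sets rrt" by measurable
      finally show ?thesis .
    qed
    have "(\<lambda>k. rrt.prob (A k)) \<longlonglongrightarrow> rrt.prob (\<Union>k. A k)"
      using Am by (intro rrt.finite_Lim_measure_incseq) (auto simp: incseq_def A_def)
    moreover have "(\<Union>k. A k) = {z \<in> space rrt. \<exists>t\<in>S. l < \<bar>Z t z\<bar>}"
    proof -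
      have "(\<exists>k. t \<in> from_nat_into S ` {..<k}) \<longleftrightarrow> t \<in> S" for t
      proof
        assume "t \<in> S"
        then obtain i where "from_nat_into S i = t" using from_nat_into_surj[OF S] by blast
        then show "\<exists>k. t \<in> from_nat_into S ` {..<k}" by (intro exI[of _ "Suc i"]) auto
      qed (use sub in auto)
      then show ?thesis unfolding A_def by blast
    qed
    ultimately have "(\<lambda>k. l * rrt.prob (A k)) \<longlonglongrightarrow> l * rrt.prob {z \<in> space rrt. \<exists>t\<in>S. l < \<bar>Z t z\<bar>}"
      by (intro tendsto_mult tendsto_const) simp
    then show ?thesis
    proof (rule LIMSEQ_le_const2)
      have "l * rrt.prob (A k) \<le> (\<integral> z. \<bar>Z T z\<bar> \<partial>rrt)" for k
        unfolding A_def using sub[of k] Z int mart l by (intro maximal_inequality_finite) auto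
      then show "\<exists>N. \<forall>k\<ge>N. l * rrt.prob (A k) \<le> (\<integral> z. \<bar>Z T z\<bar> \<partial>rrt)" by blast
    qed
  qed simp
qed

section \<open>Quadratic variation in the number of vertices\<close>

text \<open>
  The conditional variance of one step of the martingale \<open>rising q (root_count n t) / n\<close> with
  \<open>q = exp t\<close>.
\<close>

lemma second_moment_step:
  fixes q t c :: real and n k :: nat
  assumes n: "1 \<le> n" and k: "1 \<le> k" and q: "q * exp (- t) = 1"
  shows "(rising q (Suc k) / Suc n - c)\<^sup>2 * (exp (- t) * k / n)
       + (rising q k / Suc n - c)\<^sup>2 * (1 - exp (- t) * k / n)
       = (rising q k / n - c)\<^sup>2 + (rising q k)\<^sup>2 * (q / (k * n) - 1 / (real n)\<^sup>2) / (real (Suc n))\<^sup>2"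
proof -
  define G where "G = rising q k"
  define p where "p = exp (- t)"
  have p: "q * p = 1" using q by (simp add: p_def)
  have kn: "0 < real k" "0 < real n" using n k by auto
  have S: "real (Suc n) = real n + 1" by simp
  have a: "rising q (Suc k) = G * (1 + q / k)" using k by (simp add: rising_Suc G_def)
  have e1: "(1 + q / k) * (p * k / n) + (1 - p * k / n) = (real n + 1) / n"
  proof -
    have "(1 + q / k) * (p * k / n) + (1 - p * k / n) = 1 + (q * p) / n"
      using kn by (simp add: field_simps)
    then show ?thesis using kn unfolding p by (simp add: add_divide_distrib)
  qed
  have e2: "(1 + q / k)\<^sup>2 * (p * k / n) + (1 - p * k / n) = 1 + 2 / n + q / (k * n)"
  proof -
    have "(1 + q / k)\<^sup>2 * (p * k / n) + (1 - p * k / n) = 1 + 2 * (q * p) / n + q * (q * p) / (k * n)"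
      using kn by (simp add: field_simps power2_eq_square)
    then show ?thesis by (simp add: p)
  qed
  have "(G * (1 + q / k) / (real n + 1) - c)\<^sup>2 * (p * k / n) + (G / (real n + 1) - c)\<^sup>2 * (1 - p * k / n)
     = (G / (real n + 1))\<^sup>2 * ((1 + q / k)\<^sup>2 * (p * k / n) + (1 - p * k / n))
       - 2 * c * (G / (real n + 1)) * ((1 + q / k) * (p * k / n) + (1 - p * k / n)) + c\<^sup>2"
  proof -
    have "(x * A - c)\<^sup>2 * w + (x - c)\<^sup>2 * (1 - w) = x\<^sup>2 * (A\<^sup>2 * w + (1 - w)) - 2 * c * x * (A * w + (1 - w)) + c\<^sup>2"
      for x A w :: real by (simp add: power2_eq_square algebra_simps)
    from this[of "G / (real n + 1)" "1 + q / k" "p * k / n"] show ?thesis by (simp only: times_divide_eq_left)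
  qed
  also have "\<dots> = (G / (real n + 1))\<^sup>2 * (1 + 2 / n + q / (k * n)) - 2 * c * (G / n) + c\<^sup>2"
  proof -
    have "2 * c * (G / N) * (N / n) = 2 * c * (G / n)" if "0 < N" for N
      using kn that by (simp add: field_simps)
    from this[of "real n + 1"] have "2 * c * (G / (real n + 1)) * ((real n + 1) / n) = 2 * c * (G / n)"
      by simp
    then show ?thesis unfolding e1 e2 by simp
  qed
  also have "(G / (real n + 1))\<^sup>2 * (1 + 2 / n + q / (k * n)) = (G / n)\<^sup>2 + G\<^sup>2 * (q / (k * n) - 1 / (real n)\<^sup>2) / (real n + 1)\<^sup>2"
  proof -
    have "1 + 2 / n + q / (k * n) = (real n + 1)\<^sup>2 / (real n)\<^sup>2 + (q / (k * n) - 1 / (real n)\<^sup>2)"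
      using kn by (simp add: field_simps power2_eq_square)
    then have "(G / (real n + 1))\<^sup>2 * (1 + 2 / n + q / (k * n)) =
      (G / (real n + 1))\<^sup>2 * ((real n + 1)\<^sup>2 / (real n)\<^sup>2) + (G / (real n + 1))\<^sup>2 * (q / (k * n) - 1 / (real n)\<^sup>2)"
      by (simp only: distrib_left)
    moreover have "(G / (real n + 1))\<^sup>2 * ((real n + 1)\<^sup>2 / (real n)\<^sup>2) = (G / n)\<^sup>2"
      using kn by (simp add: power_divide)
    ultimately show ?thesis by (simp add: power_divide)
  qed
  finally show ?thesis unfolding a S G_def[symmetric] p_def[symmetric]
    by (simp add: power2_diff power_divide algebra_simps)
qed

lemma increment_step:
  fixes T :: real
  assumes T: "0 \<le> T" and m: "1 \<le> m" "m \<le> n"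
  defines "q \<equiv> exp T"
  shows "(\<integral> z. (rising q (root_count (Suc n) T z) / Suc n - rising q (root_count m T z) / m)\<^sup>2 \<partial>rrt) =
    (\<integral> z. (rising q (root_count n T z) / n - rising q (root_count m T z) / m)\<^sup>2 \<partial>rrt) +
    (\<integral> z. (rising q (root_count n T z))\<^sup>2 * (q / (root_count n T z * n) - 1 / (real n)\<^sup>2) / (real (Suc n))\<^sup>2 \<partial>rrt)"
proof -
  have n: "1 \<le> n" using m by simp
  have q: "q * exp (- T) = 1" by (simp add: q_def exp_minus)
  note * = expectation_step[OF n m(2) T, of "\<lambda>i _ k. (rising q k / Suc n - rising q i / m)\<^sup>2"]
  show ?thesis unfolding *
    second_moment_step[OF n root_count_pos[OF n] q]
    by (intro Bochner_Integration.integral_add)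
       (rule integrable_root_counts[where a=m and b=n and c=n and r=T and s=T and t=T and g="\<lambda>i j k. (rising q k / n - rising q i / m)\<^sup>2"]
        integrable_root_counts[where a=m and b=n and c=n and r=T and s=T and t=T and
          g="\<lambda>i j k. (rising q k)\<^sup>2 * (q / (k * n) - 1 / (real n)\<^sup>2) / (real (Suc n))\<^sup>2"])+
qed

text \<open>
  The conditional variance of a single step has mean of order at most
  \<open>n powr (- 1 - exp (- T))\<close>, because the mean of \<open>root_count n T powr (2 * q - 1)\<close> is of order \<open>n powr (2 - exp (- T))\<close>.
\<close>

lemma increment_bound:
  fixes T :: real
  assumes T: "0 \<le> T"
  defines "q \<equiv> exp T"
  obtains C where "0 < C" "\<And>m n. 1 \<le> m \<Longrightarrow> m \<le> n \<Longrightarrow>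
    (\<integral> z. (rising q (root_count n T z) / n - rising q (root_count m T z) / m)\<^sup>2 \<partial>rrt)
      \<le> real (n - m) * (C * real m powr (- 1 - exp (- T)))"
proof -
  have q: "1 \<le> q" "exp (- T) * q = 1" using T by (simp_all add: q_def exp_minus)
  obtain c C where "0 < c" "\<And>k p. 1 \<le> k \<Longrightarrow> -1/2 \<le> p \<Longrightarrow> p \<le> q \<Longrightarrow> c * real k powr p \<le> rising p k"
    and C: "0 < C" "\<And>k p. 1 \<le> k \<Longrightarrow> -1/2 \<le> p \<Longrightarrow> p \<le> q \<Longrightarrow> rising p k \<le> C * real k powr p"
    using rising_bounds[of q] by metis
  obtain C2 where C2: "0 < C2" "\<And>n. 1 \<le> n \<Longrightarrow>
     (\<integral> z. real (root_count n T z) powr (2 * q - 1) \<partial>rrt) \<le> C2 * real n powr (exp (- T) * (2 * q - 1))"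
    using expectation_powr_bound[of "2 * q - 1" T] T q by auto
  define D where "D = C\<^sup>2 * q * C2"
  have D: "0 < D" using C C2 q by (auto simp: D_def)
  have var: "(\<integral> z. (rising q (root_count n T z))\<^sup>2 * (q / (root_count n T z * n) - 1 / (real n)\<^sup>2) / (real (Suc n))\<^sup>2 \<partial>rrt)
     \<le> D * real n powr (- 1 - exp (- T))" if n: "1 \<le> n" for n
  proof -
    have "(\<integral> z. (rising q (root_count n T z))\<^sup>2 * (q / (root_count n T z * n) - 1 / (real n)\<^sup>2) / (real (Suc n))\<^sup>2 \<partial>rrt)
      \<le> (\<integral> z. real (root_count n T z) powr (2 * q - 1) * (C\<^sup>2 * q / real n ^ 3) \<partial>rrt)"
    proof (intro integral_mono)
      fix z
      define k where "k = root_count n T z"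
      have k: "1 \<le> k" using root_count_pos[OF n] by (simp add: k_def)
      have kn: "0 < real k" "0 < real n" using k n by auto
      have "rising q k \<le> C * real k powr q" using C(2)[OF k, of q] q by auto
      moreover have "0 < rising q k" using q by (intro rising_pos) auto
      ultimately have "(rising q k)\<^sup>2 \<le> (C * real k powr q)\<^sup>2" by (intro power_mono) auto
      also have "\<dots> = C\<^sup>2 * real k powr (2 * q)"
        using kn by (simp add: power_mult_distrib power2_eq_square flip: powr_add)
      finally have 1: "(rising q k)\<^sup>2 \<le> C\<^sup>2 * real k powr (2 * q)" .
      have "(rising q k)\<^sup>2 * (q / (k * n) - 1 / (real n)\<^sup>2) / (real (Suc n))\<^sup>2 \<le> (rising q k)\<^sup>2 * (q / (k * n)) / (real n)\<^sup>2"
      proof -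
        have "(rising q k)\<^sup>2 * (q / (k * n) - 1 / (real n)\<^sup>2) / (real (Suc n))\<^sup>2 \<le> (rising q k)\<^sup>2 * (q / (k * n)) / (real (Suc n))\<^sup>2"
          by (intro divide_right_mono mult_left_mono) auto
        also have "\<dots> \<le> (rising q k)\<^sup>2 * (q / (k * n)) / (real n)\<^sup>2"
          using kn q by (intro divide_left_mono power_mono mult_nonneg_nonneg divide_nonneg_nonneg) auto
        finally show ?thesis .
      qed
      also have "\<dots> \<le> C\<^sup>2 * real k powr (2 * q) * (q / (k * n)) / (real n)\<^sup>2"
        using 1 kn q by (intro divide_right_mono mult_right_mono) auto
      also have "\<dots> = real k powr (2 * q - 1) * (C\<^sup>2 * q / real n ^ 3)"
        using kn by (simp add: powr_diff power3_eq_cube power2_eq_square field_simps)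
      finally show "(rising q (root_count n T z))\<^sup>2 * (q / (root_count n T z * n) - 1 / (real n)\<^sup>2) / (real (Suc n))\<^sup>2
         \<le> real (root_count n T z) powr (2 * q - 1) * (C\<^sup>2 * q / real n ^ 3)" by (simp add: k_def)
    qed (rule integrable_root_counts[where a=n and b=n and c=n and r=T and s=T and t=T and
          g="\<lambda>i j k. (rising q k)\<^sup>2 * (q / (k * n) - 1 / (real n)\<^sup>2) / (real (Suc n))\<^sup>2"]
        integrable_root_counts[where a=n and b=n and c=n and r=T and s=T and t=T and
          g="\<lambda>i j k. real k powr (2 * q - 1) * (C\<^sup>2 * q / real n ^ 3)"])+
    also have "\<dots> = (\<integral> z. real (root_count n T z) powr (2 * q - 1) \<partial>rrt) * (C\<^sup>2 * q / real n ^ 3)"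
      by simp
    also have "\<dots> \<le> C2 * real n powr (exp (- T) * (2 * q - 1)) * (C\<^sup>2 * q / real n ^ 3)"
      using C2(2)[OF n] q by (intro mult_right_mono) auto
    also have "exp (- T) * (2 * q - 1) = 2 - exp (- T)" using q by (simp add: algebra_simps)
    also have "C2 * real n powr (2 - exp (- T)) * (C\<^sup>2 * q / real n ^ 3) = D * (real n powr (2 - exp (- T)) / real n powr 3)"
      using n by (simp add: D_def powr_numeral)
    also have "\<dots> = D * real n powr (- 1 - exp (- T))"
    proof -
      have "real n powr (2 - exp (- T)) / real n powr 3 = real n powr (2 - exp (- T) - 3)"
        by (simp only: powr_diff)
      also have "2 - exp (- T) - 3 = - 1 - exp (- T)" by simp
      finally show ?thesis by (simp only:)
    qed
    finally show ?thesis .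
  qed
  show ?thesis
  proof (rule that[OF D])
    fix m n :: nat assume m: "1 \<le> m" "m \<le> n"
    show "(\<integral> z. (rising q (root_count n T z) / n - rising q (root_count m T z) / m)\<^sup>2 \<partial>rrt)
      \<le> real (n - m) * (D * real m powr (- 1 - exp (- T)))"
      using m(2)
    proof (induction n rule: dec_induct)
      case (step n)
      have "(\<integral> z. (rising q (root_count (Suc n) T z) / Suc n - rising q (root_count m T z) / m)\<^sup>2 \<partial>rrt)
        \<le> real (n - m) * (D * real m powr (- 1 - exp (- T))) + D * real n powr (- 1 - exp (- T))"
        unfolding q_def increment_step[OF T m(1) step.hyps(1)]
        using step.IH var[of n] m step.hyps unfolding q_def by (intro add_mono) auto
      also have "D * real n powr (- 1 - exp (- T)) \<le> D * real m powr (- 1 - exp (- T))"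
        using D m step.hyps by (intro mult_left_mono powr_mono2') (auto intro: order.trans[OF _ exp_ge_zero])
      also have "real (n - m) * (D * real m powr (- 1 - exp (- T))) + D * real m powr (- 1 - exp (- T)) =
         real (Suc n - m) * (D * real m powr (- 1 - exp (- T)))"
        using step.hyps by (simp add: Suc_diff_le distrib_right)
      finally show ?case by simp
    qed simp
  qed
qed

section \<open>Uniform convergence along a polynomial subsequence\<close>

definition scaled_rising :: "nat \<Rightarrow> real \<Rightarrow> (nat \<Rightarrow> nat \<times> real) \<Rightarrow> real" where
  "scaled_rising n t z = rising (exp t) (root_count n t z) / n"

text \<open>
  A countable set of times suffices by right-continuity and keeps suprema over time measurable.
\<close>

definition rational_times :: "nat \<Rightarrow> real set" where
  "rational_times T = \<rat> \<inter> {0..real T}"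

lemma countable_rational_times: "countable (rational_times T)"
  unfolding rational_times_def using countable_rat by auto

lemma integrable_root_count:
  fixes g :: "nat \<Rightarrow> real"
  shows "integrable rrt (\<lambda>z. g (root_count n t z))"
  using integrable_root_counts[where g="\<lambda>i j k. g k" and a=n and b=n and c=n and r=t and s=t and t=t] .

lemma borel_measurable_root_count_root_alg:
  fixes g :: "nat \<Rightarrow> real"
  assumes "0 \<le> s" "s \<le> t"
  shows "(\<lambda>z. g (root_count n s z)) \<in> borel_measurable (root_alg t)"
  by (rule measurable_compose[OF measurable_root_count_root_alg[OF assms]]) simp

lemma scaled_rising_maximal:
  assumes "1 \<le> m" "1 \<le> n" "0 < l"
  shows "{z \<in> space rrt. \<exists>t\<in>rational_times T. l < \<bar>scaled_rising m t z - scaled_rising n t z\<bar>} \<in> sets rrt"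
    and "l * rrt.prob {z \<in> space rrt. \<exists>t\<in>rational_times T. l < \<bar>scaled_rising m t z - scaled_rising n t z\<bar>}
         \<le> (\<integral> z. \<bar>scaled_rising m T z - scaled_rising n T z\<bar> \<partial>rrt)"
proof -
  let ?Z = "\<lambda>t z. scaled_rising m t z - scaled_rising n t z"
  have m: "?Z s \<in> borel_measurable (root_alg t)" if "s \<in> rational_times T" "s \<le> t" for s t
    unfolding scaled_rising_def using that
    by (intro borel_measurable_diff borel_measurable_divide borel_measurable_const
        borel_measurable_root_count_root_alg[where g="rising (exp s)"]) (auto simp: rational_times_def)
  have i: "integrable rrt (?Z t)" for t
    unfolding scaled_rising_def
    by (intro Bochner_Integration.integrable_diff integrable_divide integrable_root_count[where g="rising (exp t)"])
  have mart: "(\<integral> z. ?Z T z * indicator E z \<partial>rrt) = (\<integral> z. ?Z t z * indicator E z \<partial>rrt)"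
    if t: "t \<in> rational_times T" and E: "E \<in> sets (root_alg t)" for t E
  proof -
    have E': "E \<in> sets rrt" using E root_alg_subset by blast
    have t': "0 \<le> t" "t \<le> real T" using t by (auto simp: rational_times_def)
    have one: "(\<integral> z. scaled_rising k T z * indicator E z \<partial>rrt) = (\<integral> z. scaled_rising k t z * indicator E z \<partial>rrt)"
      if "1 \<le> k" for k
      using rising_martingale[OF t' that E, of 1] by (simp add: scaled_rising_def)
    have i: "integrable rrt (\<lambda>z. scaled_rising k t z * indicator E z)" for k t
      unfolding scaled_rising_def using E'
      by (intro integrable_real_mult_indicator integrable_divide integrable_root_count[where g="rising (exp t)"])
    have split: "(\<integral> z. ?Z t z * indicator E z \<partial>rrt) = (\<integral> z. scaled_rising m t z * indicator E z \<partial>rrt) - (\<integral> z. scaled_rising n t z * indicator E z \<partial>rrt)" for t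
      unfolding left_diff_distrib by (rule Bochner_Integration.integral_diff[OF i i])
    show ?thesis unfolding split one[OF assms(1)] one[OF assms(2)] ..
  qed
  from maximal_inequality[where Z="?Z" and S="rational_times T" and T="real T", OF countable_rational_times m i i mart assms(3)]
  show "{z \<in> space rrt. \<exists>t\<in>rational_times T. l < \<bar>scaled_rising m t z - scaled_rising n t z\<bar>} \<in> sets rrt"
    and "l * rrt.prob {z \<in> space rrt. \<exists>t\<in>rational_times T. l < \<bar>scaled_rising m t z - scaled_rising n t z\<bar>}
         \<le> (\<integral> z. \<bar>scaled_rising m T z - scaled_rising n T z\<bar> \<partial>rrt)"
    by blast+
qed

lemma expectation_abs_le_sqrt:
  fixes f :: "_ \<Rightarrow> real"
  assumes "integrable rrt f" "integrable rrt (\<lambda>z. (f z)\<^sup>2)"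
  shows "(\<integral> z. \<bar>f z\<bar> \<partial>rrt) \<le> sqrt (\<integral> z. (f z)\<^sup>2 \<partial>rrt)"
proof (rule real_le_rsqrt)
  have "0 \<le> rrt.variance (\<lambda>z. \<bar>f z\<bar>)" by (rule rrt.variance_positive)
  also have "\<dots> = (\<integral> z. \<bar>f z\<bar>\<^sup>2 \<partial>rrt) - (\<integral> z. \<bar>f z\<bar> \<partial>rrt)\<^sup>2"
    using assms by (intro rrt.variance_eq) auto
  finally show "(\<integral> z. \<bar>f z\<bar> \<partial>rrt)\<^sup>2 \<le> (\<integral> z. (f z)\<^sup>2 \<partial>rrt)" by simp
qed

text \<open>
  Along \<open>k ^ a\<close> the variance of an increment decays like \<open>k powr (- a * exp (- T))\<close>, which is summable
  at any desired rate once \<open>a\<close> is large.  The maximal inequality makes the bound uniform in time.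
\<close>

lemma subsequence_increments:
  fixes T :: nat
  obtains a where "1 \<le> a" "AE z in rrt. eventually (\<lambda>k. \<forall>t\<in>rational_times T.
    \<bar>scaled_rising (Suc k ^ a) t z - scaled_rising (Suc (Suc k) ^ a) t z\<bar> \<le> 1 / (real (Suc k))\<^sup>2) sequentially"
proof -
  define b where "b = exp (- real T)"
  have b: "0 < b" by (simp add: b_def)
  \<comment> \<open>The variance is of order \<open>k powr (- a * b)\<close>; with \<open>8 \<le> a * b\<close> its square root divided by the
    threshold \<open>1 / k\<^sup>2\<close> is still summable.\<close>
  define a where "a = Suc (nat \<lceil>8 / b\<rceil>)"
  have a: "1 \<le> a" "8 \<le> a * b"
  proof -
    have "8 / b \<le> real (nat \<lceil>8 / b\<rceil>)" by (rule real_nat_ceiling_ge)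
    then have "8 / b \<le> real a" unfolding a_def by linarith
    then show "8 \<le> a * b" using b by (simp add: field_simps)
  qed (simp add: a_def)
  obtain C where C: "0 < C" "\<And>m n. 1 \<le> m \<Longrightarrow> m \<le> n \<Longrightarrow>
    (\<integral> z. (rising (exp T) (root_count n T z) / n - rising (exp T) (root_count m T z) / m)\<^sup>2 \<partial>rrt)
      \<le> real (n - m) * (C * real m powr (- 1 - b))"
    using increment_bound[of "real T"] by (auto simp: b_def)
  define A where "A = (\<lambda>k. {z \<in> space rrt. \<exists>t\<in>rational_times T. 1 / (real (Suc k))\<^sup>2 <
     \<bar>scaled_rising (Suc k ^ a) t z - scaled_rising (Suc (Suc k) ^ a) t z\<bar>})"
  have A: "A k \<in> sets rrt" "rrt.prob (A k) \<le> sqrt (2 ^ a * C) * (1 / (real (Suc k))\<^sup>2)" for k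
  proof -
    define m where "m = Suc k ^ a"
    define n where "n = Suc (Suc k) ^ a"
    define x where "x = real (Suc k)"
    have x: "1 \<le> x" by (simp add: x_def)
    have mn: "1 \<le> m" "1 \<le> n" "m \<le> n" by (simp_all add: m_def n_def power_mono)
    have l: "0 < 1 / (real (Suc k))\<^sup>2" by simp
    note M = scaled_rising_maximal[OF mn(1,2) l, of T]
    show "A k \<in> sets rrt" unfolding A_def using M(1) by (simp add: m_def n_def)
    have m': "real m = x powr a" using x by (simp add: m_def x_def powr_realpow)
    have "real n \<le> 2 ^ a * x powr a"
    proof -
      have "real n = (real (Suc (Suc k))) ^ a" by (simp add: n_def)
      also have "\<dots> \<le> (2 * x) ^ a" by (intro power_mono) (auto simp: x_def)
      also have "\<dots> = 2 ^ a * x powr a" using x by (simp add: power_mult_distrib powr_realpow)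
      finally show ?thesis .
    qed
    then have nm: "real (n - m) \<le> 2 ^ a * x powr a" using mn by (simp add: of_nat_diff)
    have "(\<integral> z. (scaled_rising m T z - scaled_rising n T z)\<^sup>2 \<partial>rrt) \<le> real (n - m) * (C * real m powr (- 1 - b))"
      using C(2)[OF mn(1,3)] by (simp add: scaled_rising_def power2_commute)
    also have "\<dots> \<le> (2 ^ a * x powr a) * (C * real m powr (- 1 - b))"
      using nm C by (intro mult_right_mono) auto
    also have "\<dots> = 2 ^ a * C * x powr (- (a * b))"
    proof -
      have "x powr a * real m powr (- 1 - b) = x powr (a + a * (- 1 - b))"
        unfolding m' powr_powr powr_add ..
      also have "a + a * (- 1 - b) = - (a * b)" by (simp add: algebra_simps)
      finally have e: "x powr a * real m powr (- 1 - b) = x powr (- (a * b))" .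
      show ?thesis unfolding e[symmetric] by (simp only: mult_ac)
    qed
    also have "\<dots> \<le> 2 ^ a * C * x powr (- 8)"
      using a x C by (intro mult_left_mono powr_mono) auto
    finally have "sqrt (\<integral> z. (scaled_rising m T z - scaled_rising n T z)\<^sup>2 \<partial>rrt) \<le> sqrt (2 ^ a * C * x powr (- 8))"
      by simp
    also have "\<dots> = sqrt (2 ^ a * C) * (1 / x ^ 4)"
    proof -
      have "(x ^ 4)\<^sup>2 = x ^ 8" by (simp flip: power_mult)
      then have "x powr (- 8) = (1 / x ^ 4)\<^sup>2"
        using x by (simp add: powr_minus_divide powr_numeral power_divide)
      then show ?thesis using x by (simp add: real_sqrt_mult)
    qed
    finally have sq: "sqrt (\<integral> z. (scaled_rising m T z - scaled_rising n T z)\<^sup>2 \<partial>rrt) \<le> sqrt (2 ^ a * C) * (1 / x ^ 4)" .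
    have "1 / x\<^sup>2 * rrt.prob (A k) \<le> (\<integral> z. \<bar>scaled_rising m T z - scaled_rising n T z\<bar> \<partial>rrt)"
      using M(2) unfolding A_def m_def n_def x_def .
    also have "\<dots> \<le> sqrt (\<integral> z. (scaled_rising m T z - scaled_rising n T z)\<^sup>2 \<partial>rrt)"
      unfolding scaled_rising_def
      by (rule expectation_abs_le_sqrt)
         (rule integrable_root_counts[where g="\<lambda>i j k. rising (exp T) i / m - rising (exp T) k / n" and a=m and b=m and c=n and r=T and s=T and t=T]
           integrable_root_counts[where g="\<lambda>i j k. (rising (exp T) i / m - rising (exp T) k / n)\<^sup>2" and a=m and b=m and c=n and r=T and s=T and t=T])+
    also note sq
    finally have "x\<^sup>2 * (1 / x\<^sup>2 * rrt.prob (A k)) \<le> x\<^sup>2 * (sqrt (2 ^ a * C) * (1 / x ^ 4))"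
      by (intro mult_left_mono) auto
    moreover have "x ^ 4 = x\<^sup>2 * x\<^sup>2" by (simp flip: power_add)
    moreover have "w * (s * (1 / (w * w))) = s * (1 / w)" if "w \<noteq> 0" for w s :: real
      using that by simp
    from this[of "x\<^sup>2"] have "x\<^sup>2 * (sqrt (2 ^ a * C) * (1 / (x\<^sup>2 * x\<^sup>2))) = sqrt (2 ^ a * C) * (1 / x\<^sup>2)"
      using x by simp
    moreover have "x\<^sup>2 * (1 / x\<^sup>2 * rrt.prob (A k)) = rrt.prob (A k)" using x by simp
    ultimately show "rrt.prob (A k) \<le> sqrt (2 ^ a * C) * (1 / (real (Suc k))\<^sup>2)"
      unfolding x_def by (simp only:)
  qed
  have "AE z in rrt. eventually (\<lambda>k. z \<in> space rrt - A k) sequentially"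
  proof (rule borel_cantelli_AE1)
    have "summable (\<lambda>k. 1 / (real (Suc k))\<^sup>2)"
      using inverse_squares_sums sums_iff by (auto simp: summable_def add_ac)
    then have "summable (\<lambda>k. sqrt (2 ^ a * C) * (1 / (real (Suc k))\<^sup>2))" by (rule summable_mult)
    then show "summable (\<lambda>k. rrt.prob (A k))"
      by (rule summable_comparison_test'[of _ 0]) (use A in auto)
  qed (use A in \<open>auto simp: rrt.emeasure_finite less_top[symmetric]\<close>)
  then have "AE z in rrt. eventually (\<lambda>k. \<forall>t\<in>rational_times T.
    \<bar>scaled_rising (Suc k ^ a) t z - scaled_rising (Suc (Suc k) ^ a) t z\<bar> \<le> 1 / (real (Suc k))\<^sup>2) sequentially"
    by eventually_elim (auto elim!: eventually_mono simp: A_def not_less)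
  then show ?thesis by (rule that[OF a(1)])
qed

section \<open>Uniform lower bound\<close>

text \<open>
  With this \<open>p\<close> the parameters \<open>p * exp t\<close> stay in \<open>[-1/2, 0)\<close> for \<open>t \<le> T\<close>.  A bound from above for a
  negative power of the counts is a bound from below for the counts, uniformly in time.
\<close>

lemma rising_maximal:
  fixes T :: nat
  defines "p \<equiv> - exp (- real T) / 2"
  obtains C where "0 < C"
    "\<And>n l. 1 \<le> n \<Longrightarrow> 0 < l \<Longrightarrow>
       {z \<in> space rrt. \<exists>t\<in>rational_times T. l < \<bar>rising (p * exp t) (root_count n t z) * real n powr (- p)\<bar>} \<in> sets rrt"
    "\<And>n l. 1 \<le> n \<Longrightarrow> 0 < l \<Longrightarrow>
       l * rrt.prob {z \<in> space rrt. \<exists>t\<in>rational_times T. l < \<bar>rising (p * exp t) (root_count n t z) * real n powr (- p)\<bar>} \<le> C"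
proof -
  obtain C where C: "0 < C" "\<And>k q. 1 \<le> k \<Longrightarrow> -1/2 \<le> q \<Longrightarrow> q \<le> 0 \<Longrightarrow> rising q k \<le> C * real k powr q"
    using rising_bounds[of 0] by metis
  have p: "-1/2 \<le> p" "p \<le> 0" "p * exp (real T) = -1/2"
    by (simp_all add: p_def flip: exp_add)
  have M: "{z \<in> space rrt. \<exists>t\<in>rational_times T. l < \<bar>rising (p * exp t) (root_count n t z) * real n powr (- p)\<bar>} \<in> sets rrt \<and>
     l * rrt.prob {z \<in> space rrt. \<exists>t\<in>rational_times T. l < \<bar>rising (p * exp t) (root_count n t z) * real n powr (- p)\<bar>} \<le> C"
    if n: "1 \<le> n" and l: "0 < l" for n l
  proof -
    let ?Z = "\<lambda>t z. rising (p * exp t) (root_count n t z) * real n powr (- p)"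
    have m: "?Z s \<in> borel_measurable (root_alg t)" if "s \<in> rational_times T" "s \<le> t" for s t
      using that
      by (intro borel_measurable_times borel_measurable_const
          borel_measurable_root_count_root_alg[where g="rising (p * exp s)"]) (auto simp: rational_times_def)
    have i: "integrable rrt (?Z t)" for t
      by (intro integrable_mult_left integrable_root_count[where g="rising (p * exp t)"])
    have mart: "(\<integral> z. ?Z T z * indicator E z \<partial>rrt) = (\<integral> z. ?Z t z * indicator E z \<partial>rrt)"
      if t: "t \<in> rational_times T" and E: "E \<in> sets (root_alg t)" for t E
    proof -
      have t': "0 \<le> t" "t \<le> real T" using t by (auto simp: rational_times_def)
      have eq: "?Z s z * indicator E z = (rising (p * exp s) (root_count n s z) * indicator E z) * real n powr (- p)" for s z
        by (simp only: mult_ac)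
      show ?thesis unfolding eq using rising_martingale[OF t' n E, of p] by simp
    qed
    have pos: "0 \<le> ?Z T z" for z
      using rising_pos[of "p * exp (real T)" "root_count n T z"] by (simp add: p(3) less_imp_le)
    have "(\<integral> z. \<bar>?Z T z\<bar> \<partial>rrt) = (\<integral> z. ?Z T z \<partial>rrt)" using pos by (simp only: abs_of_nonneg)
    also have "\<dots> = rising (exp (- T) * (p * exp T)) n * real n powr (- p)"
      using expectation_rising[OF n, of "real T" "p * exp T"] by simp
    also have "exp (- T) * (p * exp T) = p" by (simp add: exp_minus)
    also have "rising p n * real n powr (- p) \<le> C * real n powr p * real n powr (- p)"
      using C(2)[OF n p(1,2)] by (intro mult_right_mono) auto
    also have "\<dots> = C" using n by (simp add: mult.assoc flip: powr_add)
    finally have le: "(\<integral> z. \<bar>?Z T z\<bar> \<partial>rrt) \<le> C" .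
    note M = maximal_inequality[where Z="?Z" and S="rational_times T" and T="real T", OF countable_rational_times m i i mart l]
    show ?thesis by (intro conjI M(1) order.trans[OF M(2) le])
  qed
  show ?thesis by (rule that[OF C(1) M[THEN conjunct1] M[THEN conjunct2]])
qed

text \<open>
  The maximal inequality bounds the probability of a large supremum uniformly in \<open>n\<close>.  This does not
  give boundedness along the whole sequence, but infinitely many bounded terms are enough to
  bound the limit away from zero.
\<close>

lemma AE_frequently_bounded:
  fixes T :: nat and \<nu> :: "nat \<Rightarrow> nat"
  assumes nu: "\<And>k. 1 \<le> \<nu> k"
  defines "p \<equiv> - exp (- real T) / 2"
  shows "AE z in rrt. \<exists>l>0. frequently (\<lambda>k. \<forall>t\<in>rational_times T. rising (p * exp t) (root_count (\<nu> k) t z) * real (\<nu> k) powr (- p) \<le> l) sequentially"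
proof -
  obtain C where C: "0 < C"
    "\<And>n l. 1 \<le> n \<Longrightarrow> 0 < l \<Longrightarrow>
       {z \<in> space rrt. \<exists>t\<in>rational_times T. l < \<bar>rising (p * exp t) (root_count n t z) * real n powr (- p)\<bar>} \<in> sets rrt"
    "\<And>n l. 1 \<le> n \<Longrightarrow> 0 < l \<Longrightarrow>
       l * rrt.prob {z \<in> space rrt. \<exists>t\<in>rational_times T. l < \<bar>rising (p * exp t) (root_count n t z) * real n powr (- p)\<bar>} \<le> C"
    by (rule rising_maximal[of T, folded p_def]) (rule that)
  define A where "A = (\<lambda>l k. {z \<in> space rrt. \<exists>t\<in>rational_times T. real (Suc l) < \<bar>rising (p * exp t) (root_count (\<nu> k) t z) * real (\<nu> k) powr (- p)\<bar>})"
  have A [measurable]: "A l k \<in> sets rrt" for l k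
    unfolding A_def by (rule C(2)[OF nu]) simp
  have pA: "rrt.prob (A l k) \<le> C / real (Suc l)" for l k
  proof -
    have "real (Suc l) * rrt.prob (A l k) \<le> C" unfolding A_def by (rule C(3)[OF nu]) simp
    then show ?thesis by (simp add: field_simps)
  qed
  define F where "F = (\<lambda>l. \<Union>K. \<Inter>k\<in>{K..}. A l k)"
  have F: "F l \<in> sets rrt" for l unfolding F_def by measurable
  have pF: "rrt.prob (F l) \<le> C / real (Suc l)" for l
  proof -
    have "(\<lambda>K. rrt.prob (\<Inter>k\<in>{K..}. A l k)) \<longlonglongrightarrow> rrt.prob (F l)"
      unfolding F_def by (rule rrt.finite_Lim_measure_incseq) (auto simp: incseq_def)
    then show ?thesis
    proof (rule LIMSEQ_le_const2)
      have "rrt.prob (\<Inter>k\<in>{K..}. A l k) \<le> C / real (Suc l)" for K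
        by (rule order.trans[OF rrt.finite_measure_mono pA[of l K]]) auto
      then show "\<exists>N. \<forall>K\<ge>N. rrt.prob (\<Inter>k\<in>{K..}. A l k) \<le> C / real (Suc l)" by blast
    qed
  qed
  have "rrt.prob (\<Inter>l. F l) \<le> 0"
  proof (rule LIMSEQ_le_const)
    show "(\<lambda>l. C / real (Suc l)) \<longlonglongrightarrow> 0" by real_asymp
    have "rrt.prob (\<Inter>l. F l) \<le> C / real (Suc l)" for l
      by (rule order.trans[OF rrt.finite_measure_mono pF[of l]]) (use F in auto)
    then show "\<exists>N. \<forall>l\<ge>N. rrt.prob (\<Inter>l. F l) \<le> C / real (Suc l)" by blast
  qed
  then have "rrt.prob (\<Inter>l. F l) = 0" using measure_nonneg[of rrt "\<Inter>l. F l"] by linarith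
  moreover have "(\<Inter>l. F l) \<in> sets rrt" using F by auto
  ultimately have "AE z in rrt. z \<notin> (\<Inter>l. F l)" by (simp add: rrt.prob_eq_0)
  then show ?thesis
    using AE_space
  proof eventually_elim
    case (elim z)
    then obtain l where "z \<notin> F l" by blast
    then have "\<exists>k\<ge>K. z \<notin> A l k" for K unfolding F_def by blast
    then have "\<exists>k\<ge>K. \<forall>t\<in>rational_times T. rising (p * exp t) (root_count (\<nu> k) t z) * real (\<nu> k) powr (- p) \<le> real (Suc l)" for K
      using elim(2) unfolding A_def by (fastforce simp: not_less)
    then have "frequently (\<lambda>k. \<forall>t\<in>rational_times T. rising (p * exp t) (root_count (\<nu> k) t z) * real (\<nu> k) powr (- p) \<le> real (Suc l)) sequentially"
      unfolding frequently_sequentially by blast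
    then show ?case by (intro exI[of _ "real (Suc l)"]) auto
  qed
qed

section \<open>Locally uniform convergence\<close>

definition log_count :: "nat \<Rightarrow> real \<Rightarrow> (nat \<Rightarrow> nat \<times> real) \<Rightarrow> real" where
  "log_count n t z = ln (root_count n t z) - exp (- t) * ln n"

lemma log_count_right_continuous: "((\<lambda>s. log_count n s z) \<longlongrightarrow> log_count n t z) (at_right t)"
proof -
  obtain s where s: "t < s" "\<And>r. t \<le> r \<Longrightarrow> r \<le> s \<Longrightarrow> root_count n r z = root_count n t z"
    using root_count_right_const[of t n z] by blast
  have "((\<lambda>r. ln (root_count n t z) - exp (- r) * ln n) \<longlongrightarrow> log_count n t z) (at_right t)"
    unfolding log_count_def by (intro tendsto_intros)
  moreover have "eventually (\<lambda>r. ln (root_count n t z) - exp (- r) * ln n = log_count n r z) (at_right t)"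
    using eventually_at_right_real[OF s(1)]
  proof eventually_elim
    case (elim r)
    then have "root_count n r z = root_count n t z" by (intro s(2)) auto
    then show ?case by (simp add: log_count_def)
  qed
  ultimately show ?thesis by (rule Lim_transform_eventually)
qed

lemma uniform_limit_ln:
  fixes f :: "nat \<Rightarrow> 'a \<Rightarrow> real"
  assumes u: "uniform_limit S f g sequentially" and d: "0 < d" "\<And>x. x \<in> S \<Longrightarrow> d \<le> g x"
  shows "uniform_limit S (\<lambda>n x. ln (f n x)) (\<lambda>x. ln (g x)) sequentially"
proof (rule uniform_limitI)
  fix e :: real assume e: "0 < e"
  define e' where "e' = min (d / 2) (e * d / 2)"
  have e': "0 < e'" using d e by (simp add: e'_def)
  from uniform_limitD[OF u e'] show "\<forall>\<^sub>F n in sequentially. \<forall>x\<in>S. dist (ln (f n x)) (ln (g x)) < e"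
  proof eventually_elim
    case (elim n)
    show ?case
    proof
      fix x assume x: "x \<in> S"
      have 1: "\<bar>f n x - g x\<bar> < e'" using elim x by (simp add: dist_real_def)
      have g: "d / 2 < g x" "0 < g x" using d(2)[OF x] d(1) by auto
      have "e' \<le> d / 2" by (simp add: e'_def)
      then have f: "d / 2 < f n x" "0 < f n x" using 1 d(2)[OF x] d(1) by linarith+
      have "ln (f n x) - ln (g x) \<le> (f n x - g x) / g x" using f g by (intro ln_diff_le) auto
      also have "\<dots> \<le> \<bar>f n x - g x\<bar> / (d / 2)"
        using g d by (intro frac_le) auto
      finally have a: "ln (f n x) - ln (g x) \<le> \<bar>f n x - g x\<bar> / (d / 2)" .
      have "ln (g x) - ln (f n x) \<le> (g x - f n x) / f n x" using f g by (intro ln_diff_le) auto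
      also have "\<dots> \<le> \<bar>f n x - g x\<bar> / (d / 2)"
        using f d by (intro frac_le) auto
      finally have b: "ln (g x) - ln (f n x) \<le> \<bar>f n x - g x\<bar> / (d / 2)" .
      have "\<bar>f n x - g x\<bar> / (d / 2) < e' / (d / 2)" using 1 d by (intro divide_strict_right_mono) auto
      also have "\<dots> \<le> (e * d / 2) / (d / 2)" using d by (intro divide_right_mono) (auto simp: e'_def)
      also have "\<dots> = e" using d by simp
      finally show "dist (ln (f n x)) (ln (g x)) < e" using a b by (simp add: dist_real_def abs_le_iff abs_less_iff)
    qed
  qed
qed

lemma one_le_exp_nat: "1 \<le> exp (real T)"
  by simp

lemma exp_in_range:
  fixes t T :: real
  assumes "t \<le> T"
  shows "exp t \<in> {-1/2..exp T}"
proof -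
  have "0 \<le> exp t" by simp
  then have "-1/2 \<le> exp t" by linarith
  with assms show ?thesis by simp
qed

lemma uniform_limit_rising_err:
  fixes \<nu> :: "nat \<Rightarrow> nat" and T :: nat
  assumes nu: "filterlim \<nu> at_top sequentially"
    and unb: "filterlim (\<lambda>n. root_count n T z) at_top sequentially" and S: "S \<subseteq> {0..real T}"
  obtains l where "uniform_limit S (\<lambda>k t. rising_err (root_count (\<nu> k) t z) (exp t)) l sequentially"
proof -
  obtain l where l: "uniform_limit {-1/2..exp (real T)} rising_err l sequentially"
    using rising_err_uniform[OF one_le_exp_nat[of T]] by metis
  show ?thesis
  proof (rule that[of "\<lambda>t. l (exp t)"], rule uniform_limitI)
    fix e :: real assume "0 < e"
    from uniform_limitD[OF l this] obtain N where N: "\<And>n q. N \<le> n \<Longrightarrow> q \<in> {-1/2..exp (real T)} \<Longrightarrow> dist (rising_err n q) (l q) < e"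
      unfolding eventually_sequentially by blast
    have "eventually (\<lambda>k. N \<le> root_count (\<nu> k) T z) sequentially"
      using filterlim_compose[OF unb nu] by (simp add: filterlim_at_top)
    then show "\<forall>\<^sub>F k in sequentially. \<forall>t\<in>S. dist (rising_err (root_count (\<nu> k) t z) (exp t)) (l (exp t)) < e"
    proof eventually_elim
      case (elim k)
      show ?case
      proof
        fix t assume "t \<in> S"
        then have t: "0 \<le> t" "t \<le> real T" using S by auto
        have "N \<le> root_count (\<nu> k) t z" using elim root_count_antimono[OF t(2)] by (rule order.trans)
        moreover have "exp t \<in> {-1/2..exp (real T)}" using t by (intro exp_in_range)
        ultimately show "dist (rising_err (root_count (\<nu> k) t z) (exp t)) (l (exp t)) < e" by (rule N)
      qed
    qed
  qed
qed

lemma rising_eq_exp_log_count: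
  assumes "1 \<le> n" "-1 < c * exp t"
  shows "rising (c * exp t) (root_count n t z) * real n powr (- c) =
    exp (rising_err (root_count n t z) (c * exp t) + c * (exp t * log_count n t z))"
proof -
  have k: "1 \<le> root_count n t z" using assms by (intro root_count_pos)
  have "c * (exp t * log_count n t z) = (c * exp t) * ln (root_count n t z) - c * (exp t * exp (- t)) * ln n"
    by (simp add: log_count_def algebra_simps)
  then have e: "(c * exp t) * ln (root_count n t z) - c * ln n = c * (exp t * log_count n t z)"
    by (simp add: exp_minus)
  have "rising (c * exp t) (root_count n t z) * real n powr (- c) =
      exp (rising_err (root_count n t z) (c * exp t)) * exp ((c * exp t) * ln (root_count n t z)) * exp (- c * ln n)"
    unfolding rising_eq_powr[OF assms(2) k] using assms k by (simp add: powr_def)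
  also have "\<dots> = exp (rising_err (root_count n t z) (c * exp t) + ((c * exp t) * ln (root_count n t z) - c * ln n))"
    by (simp flip: exp_add)
  finally show ?thesis unfolding e .
qed

lemma scaled_rising_eq_exp_log_count:
  assumes "1 \<le> n"
  shows "scaled_rising n t z = exp (rising_err (root_count n t z) (exp t) + exp t * log_count n t z)"
proof -
  have "-1 < exp t" by (rule less_le_trans[of _ 0]) auto
  with rising_eq_exp_log_count[OF assms, of 1 t z] assms show ?thesis
    by (simp add: scaled_rising_def powr_minus_divide)
qed

text \<open>
  The increments are summable, so \<open>scaled_rising\<close> converges uniformly; the lower bound carries over
  from infinitely many indices to the limit, so logarithms may be taken; the error terms
  \<open>rising_err\<close> converge uniformly as well.
\<close>

lemma uniform_limit_log_count_subsequence:
  fixes T :: nat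
  assumes a: "1 \<le> a" and S: "S \<subseteq> {0..real T}"
    and inc: "eventually (\<lambda>k. \<forall>t\<in>S.
      \<bar>scaled_rising (Suc k ^ a) t z - scaled_rising (Suc (Suc k) ^ a) t z\<bar> \<le> 1 / (real (Suc k))\<^sup>2) sequentially"
    and low: "0 < l" "frequently (\<lambda>k. \<forall>t\<in>S. rising (p * exp t) (root_count (Suc k ^ a) t z) * real (Suc k ^ a) powr (- p) \<le> l) sequentially"
    and p: "p = - exp (- real T) / 2"
    and unb: "filterlim (\<lambda>n. root_count n T z) at_top sequentially"
  obtains y where "uniform_limit S (\<lambda>k t. log_count (Suc k ^ a) t z) y sequentially"
proof -
  define \<nu> where "\<nu> = (\<lambda>k::nat. Suc k ^ a)"
  have nu1: "1 \<le> \<nu> k" for k by (simp add: \<nu>_def)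
  have nu_top: "filterlim \<nu> at_top sequentially"
    unfolding filterlim_at_top
  proof
    fix Z
    show "eventually (\<lambda>k. Z \<le> \<nu> k) sequentially"
      using eventually_ge_at_top[of Z]
    proof eventually_elim
      case (elim k)
      have "Suc k ^ 1 \<le> Suc k ^ a" using a by (intro power_increasing) auto
      with elim show ?case by (simp add: \<nu>_def)
    qed
  qed
  define H where "H = (\<lambda>k t. scaled_rising (\<nu> k) t z)"
  have H_eq: "H k t = exp (rising_err (root_count (\<nu> k) t z) (exp t) + exp t * log_count (\<nu> k) t z)" for k t
    unfolding H_def by (rule scaled_rising_eq_exp_log_count[OF nu1])
  have "uniform_limit S (\<lambda>n t. \<Sum>k<n. H (Suc k) t - H k t) (\<lambda>t. \<Sum>k. H (Suc k) t - H k t) sequentially"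
  proof (rule Weierstrass_m_test_ev)
    show "\<forall>\<^sub>F k in sequentially. \<forall>t\<in>S. norm (H (Suc k) t - H k t) \<le> 1 / (real (Suc k))\<^sup>2"
      using inc by (simp add: H_def \<nu>_def abs_minus_commute)
    show "summable (\<lambda>k. 1 / (real (Suc k))\<^sup>2)"
      using inverse_squares_sums sums_iff by (auto simp: summable_def add_ac)
  qed
  moreover have "uniform_limit S (\<lambda>n t. H 0 t) (H 0) sequentially" by (rule uniform_limit_const)
  ultimately have "uniform_limit S (\<lambda>n t. H 0 t + (\<Sum>k<n. H (Suc k) t - H k t)) (\<lambda>t. H 0 t + (\<Sum>k. H (Suc k) t - H k t)) sequentially"
    by (intro uniform_limit_add)
  moreover have "(\<lambda>n t. H 0 t + (\<Sum>k<n. H (Suc k) t - H k t)) = H"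
  proof (intro ext)
    fix n t show "H 0 t + (\<Sum>k<n. H (Suc k) t - H k t) = H n t"
      using sum_lessThan_telescope[of "\<lambda>k. H k t" n] by simp
  qed
  ultimately obtain Hl where Hl: "uniform_limit S H Hl sequentially" by metis
  obtain B where B: "\<And>k q. 1 \<le> k \<Longrightarrow> q \<in> {-1/2..exp (real T)} \<Longrightarrow> \<bar>rising_err k q\<bar> \<le> B"
    using rising_err_uniform[OF one_le_exp_nat[of T]] by metis
  have p0: "p < 0" by (simp add: p)
  define c where "c = (\<bar>ln l\<bar> + B) / (- p)"
  define d where "d = exp (- B - c)"
  have freq: "frequently (\<lambda>k. \<forall>t\<in>S. d \<le> H k t) sequentially"
    using low(2)
  proof (rule frequently_elim1)
    fix k assume k: "\<forall>t\<in>S. rising (p * exp t) (root_count (Suc k ^ a) t z) * real (Suc k ^ a) powr (- p) \<le> l"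
    show "\<forall>t\<in>S. d \<le> H k t"
    proof
      fix t assume tS: "t \<in> S"
      then have t: "0 \<le> t" "t \<le> real T" using S by auto
      let ?N = "root_count (\<nu> k) t z"
      have N: "1 \<le> ?N" by (rule root_count_pos[OF nu1])
      have "exp (t - real T) \<le> 1" using t by simp
      then have pt: "- 1 / 2 \<le> p * exp t" "p * exp t \<le> 0" unfolding p
        by (simp_all add: exp_diff exp_minus field_simps)
      have "p * exp t \<le> exp (real T)" using pt(2) exp_ge_zero[of "real T"] by linarith
      then have r1: "p * exp t \<in> {-1/2..exp (real T)}" using pt by simp
      have r2: "exp t \<in> {-1/2..exp (real T)}" using t by (intro exp_in_range)
      have gt: "-1 < p * exp t" using pt by linarith
      have "rising (p * exp t) ?N * real (\<nu> k) powr (- p) \<le> l"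
        using k tS unfolding \<nu>_def by blast
      then have "exp (rising_err ?N (p * exp t) + p * (exp t * log_count (\<nu> k) t z)) \<le> l"
        unfolding rising_eq_exp_log_count[OF nu1 gt] .
      then have "rising_err ?N (p * exp t) + p * (exp t * log_count (\<nu> k) t z) \<le> ln l"
        using low(1) by (simp add: ln_ge_iff)
      then have "p * (exp t * log_count (\<nu> k) t z) \<le> \<bar>ln l\<bar> + B"
        using B[OF N r1] by linarith
      then have "exp t * log_count (\<nu> k) t z \<ge> - c"
        using p0 by (simp add: c_def field_simps)
      then have "- B - c \<le> rising_err ?N (exp t) + exp t * log_count (\<nu> k) t z"
        using B[OF N r2] by linarith
      then show "d \<le> H k t" unfolding d_def H_eq by simp
    qed
  qed
  have Hd: "d \<le> Hl t" if t: "t \<in> S" for t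
  proof (rule ccontr)
    assume "\<not> d \<le> Hl t"
    then have "eventually (\<lambda>k. H k t < d) sequentially"
      using tendsto_uniform_limitI[OF Hl t] by (intro order_tendstoD(2)) auto
    from frequently_ex[OF frequently_eventually_frequently[OF freq this]] t show False by fastforce
  qed
  have lnH: "uniform_limit S (\<lambda>k t. ln (H k t)) (\<lambda>t. ln (Hl t)) sequentially"
    by (rule uniform_limit_ln[OF Hl]) (auto simp: d_def intro: Hd[unfolded d_def])
  obtain e where e: "uniform_limit S (\<lambda>k t. rising_err (root_count (\<nu> k) t z) (exp t)) e sequentially"
    using uniform_limit_rising_err[OF nu_top unb S] by blast
  have "uniform_limit S (\<lambda>k t. ln (H k t) - rising_err (root_count (\<nu> k) t z) (exp t)) (\<lambda>t. ln (Hl t) - e t) sequentially"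
    by (intro uniform_limit_minus lnH e)
  then have u: "uniform_limit S (\<lambda>k t. exp t * log_count (\<nu> k) t z) (\<lambda>t. ln (Hl t) - e t) sequentially"
    by (simp add: H_eq)
  have "uniform_limit S (\<lambda>k t. log_count (\<nu> k) t z) (\<lambda>t. exp (- t) * (ln (Hl t) - e t)) sequentially"
  proof (rule uniform_limitI)
    fix r :: real assume "0 < r"
    from uniform_limitD[OF u this]
    show "\<forall>\<^sub>F k in sequentially. \<forall>t\<in>S. dist (log_count (\<nu> k) t z) (exp (- t) * (ln (Hl t) - e t)) < r"
    proof eventually_elim
      case (elim k)
      show ?case
      proof
        fix t assume tS: "t \<in> S"
        then have t: "0 \<le> t" using S by auto
        have "log_count (\<nu> k) t z - exp (- t) * (ln (Hl t) - e t) = exp (- t) * (exp t * log_count (\<nu> k) t z - (ln (Hl t) - e t))"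
          by (simp add: exp_minus field_simps)
        then have "\<bar>log_count (\<nu> k) t z - exp (- t) * (ln (Hl t) - e t)\<bar> = exp (- t) * \<bar>exp t * log_count (\<nu> k) t z - (ln (Hl t) - e t)\<bar>"
          by (simp add: abs_mult)
        also have "\<dots> \<le> 1 * \<bar>exp t * log_count (\<nu> k) t z - (ln (Hl t) - e t)\<bar>"
          using t by (intro mult_right_mono) auto
        also have "\<dots> < r" using elim tS by (simp add: dist_real_def)
        finally show "dist (log_count (\<nu> k) t z) (exp (- t) * (ln (Hl t) - e t)) < r" by (simp add: dist_real_def)
      qed
    qed
  qed
  then show ?thesis unfolding \<nu>_def by (rule that)
qed

lemma exists_power_sandwich:
  fixes n K a :: nat
  assumes a: "1 \<le> a" and n: "Suc K ^ a \<le> n"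
  obtains k where "K \<le> k" "Suc k ^ a \<le> n" "n < Suc (Suc k) ^ a"
proof -
  have big: "k < Suc k ^ a" for k
  proof -
    have "Suc k ^ 1 \<le> Suc k ^ a" using a by (intro power_increasing) auto
    then show ?thesis by simp
  qed
  define k where "k = (GREATEST k. Suc k ^ a \<le> n)"
  have bd: "\<And>y. Suc y ^ a \<le> n \<Longrightarrow> y \<le> n" using big by (meson less_imp_le less_le_trans)
  have "Suc k ^ a \<le> n" unfolding k_def by (rule GreatestI_nat[where P="\<lambda>k. Suc k ^ a \<le> n", OF n bd])
  moreover have "K \<le> k" unfolding k_def by (rule Greatest_le_nat[where P="\<lambda>k. Suc k ^ a \<le> n", OF n bd])
  moreover have "n < Suc (Suc k) ^ a"
  proof (rule ccontr)
    assume "\<not> n < Suc (Suc k) ^ a"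
    then have "Suc k \<le> k" unfolding k_def
      by (intro Greatest_le_nat[where P="\<lambda>k. Suc k ^ a \<le> n", OF _ bd]) auto
    then show False by simp
  qed
  ultimately show ?thesis using that by blast
qed

text \<open>
  Between \<open>k ^ a\<close> and \<open>(k + 1) ^ a\<close> the counts are monotone in \<open>n\<close>, while \<open>exp (- t) * ln n\<close> changes by
  at most \<open>a * ln ((k + 1) / k)\<close>.
\<close>

lemma uniform_limit_log_count:
  assumes a: "1 \<le> a" and S: "S \<subseteq> {0..}"
    and y: "uniform_limit S (\<lambda>k t. log_count (Suc k ^ a) t z) y sequentially"
  shows "uniform_limit S (\<lambda>n t. log_count n t z) y sequentially"
proof (rule uniform_limitI)
  fix e :: real assume e: "0 < e"
  define g where "g = (\<lambda>k. real a * (ln (real (Suc (Suc k))) - ln (real (Suc k))))"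
  have "g \<longlonglongrightarrow> 0" unfolding g_def by real_asymp
  then have "eventually (\<lambda>k. g k < e / 2) sequentially" using e by (intro order_tendstoD(2)) auto
  moreover have "eventually (\<lambda>k. \<forall>t\<in>S. dist (log_count (Suc k ^ a) t z) (y t) < e / 2) sequentially"
    using uniform_limitD[OF y, of "e / 2"] e by simp
  ultimately have "eventually (\<lambda>k. g k < e / 2 \<and> (\<forall>t\<in>S. dist (log_count (Suc k ^ a) t z) (y t) < e / 2)) sequentially"
    by eventually_elim auto
  then obtain K where K: "\<And>k. K \<le> k \<Longrightarrow> g k < e / 2" "\<And>k t. K \<le> k \<Longrightarrow> t \<in> S \<Longrightarrow> dist (log_count (Suc k ^ a) t z) (y t) < e / 2"
    unfolding eventually_sequentially by blast
  show "\<forall>\<^sub>F n in sequentially. \<forall>t\<in>S. dist (log_count n t z) (y t) < e"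
    using eventually_ge_at_top[of "Suc K ^ a"]
  proof eventually_elim
    case (elim n)
    obtain k where k: "K \<le> k" "Suc k ^ a \<le> n" "n < Suc (Suc k) ^ a"
      using exists_power_sandwich[OF a elim] by blast
    have lnp: "ln (real (Suc j ^ a)) = real a * ln (real (Suc j))" for j
      using ln_realpow[of "real (Suc j)" a] by (simp only: of_nat_power)
    define A where "A = Suc k ^ a"
    define B where "B = Suc (Suc k) ^ a"
    have AB: "1 \<le> A" "A \<le> n" "n \<le> B" using k by (simp_all add: A_def B_def)
    then have n1: "1 \<le> n" by simp
    have "ln (real A) \<le> ln (real n)" "ln (real n) \<le> ln (real B)" using AB by simp_all
    moreover have "ln (real B) - ln (real A) = g k"
      unfolding g_def A_def B_def lnp by (simp only: right_diff_distrib)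
    ultimately have ln: "ln (real A) \<le> ln (real n)" "ln (real n) \<le> ln (real B)" "ln (real B) - ln (real A) = g k" .
    show ?case
    proof
      fix t assume tS: "t \<in> S"
      then have t: "0 \<le> t" using S by auto
      have g0: "0 \<le> g k" using ln by linarith
      have c: "ln (real (root_count (A) t z)) \<le> ln (real (root_count n t z))"
        "ln (real (root_count n t z)) \<le> ln (real (root_count (B) t z))"
        using root_count_mono[OF AB(2), of t z] root_count_mono[OF AB(3), of t z]
          root_count_pos[OF AB(1), of t z] root_count_pos[OF n1, of t z] by simp_all
      have eg: "exp (- t) * g k \<le> g k" using t g0 by (simp add: mult_left_le_one_le)
      have l1: "exp (- t) * ln (real n) \<le> exp (- t) * ln (real (A)) + exp (- t) * g k"
        using ln mult_left_mono[of "ln (real n)" "ln (real (A)) + g k" "exp (- t)"] by (simp add: distrib_left)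
      have l2: "exp (- t) * ln (real (B)) \<le> exp (- t) * ln (real n) + exp (- t) * g k"
        using ln mult_left_mono[of "ln (real (B))" "ln (real n) + g k" "exp (- t)"] by (simp add: distrib_left)
      have "log_count (A) t z - g k \<le> log_count n t z"
        unfolding log_count_def using c(1) l1 eg by linarith
      moreover have "log_count n t z \<le> log_count (B) t z + g k"
        unfolding log_count_def using c(2) l2 eg by linarith
      moreover have "\<bar>log_count (A) t z - y t\<bar> < e / 2" "\<bar>log_count (B) t z - y t\<bar> < e / 2"
        using K(2)[OF k(1) tS] K(2)[of "Suc k" t] k(1) tS unfolding A_def B_def dist_real_def by simp_all
      ultimately show "dist (log_count n t z) (y t) < e"
        using K(1)[OF k(1)] unfolding dist_real_def by linarith
    qed
  qed
qed

text \<open>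
  All the functions \<open>log_count n\<close> are right-continuous in time, so a uniform Cauchy bound on rational
  times persists at every time that rational times approach from the right; this costs one unit at
  the end of the interval.
\<close>

lemma uniformly_convergent_log_count_extend:
  assumes "uniformly_convergent_on (rational_times (Suc T)) (\<lambda>n t. log_count n t z)"
  shows "uniformly_convergent_on {0..real T} (\<lambda>n t. log_count n t z)"
  unfolding uniformly_convergent_eq_Cauchy
proof (rule uniformly_Cauchy_onI)
  fix e :: real assume e: "0 < e"
  then obtain M where M: "\<And>t m n. t \<in> rational_times (Suc T) \<Longrightarrow> M \<le> m \<Longrightarrow> M \<le> n \<Longrightarrow> dist (log_count m t z) (log_count n t z) < e / 2"
    using assms unfolding uniformly_convergent_eq_Cauchy uniformly_Cauchy_on_def
    by (metis half_gt_zero)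
  show "\<exists>M. \<forall>t\<in>{0..real T}. \<forall>m\<ge>M. \<forall>n\<ge>M. dist (log_count m t z) (log_count n t z) < e"
  proof (intro exI[of _ M] ballI allI impI)
    fix t m n assume t: "t \<in> {0..real T}" and mn: "M \<le> m" "M \<le> n"
    have "((\<lambda>s. dist (log_count m s z) (log_count n s z)) \<longlongrightarrow> dist (log_count m t z) (log_count n t z)) (at_right t)"
      by (intro tendsto_dist log_count_right_continuous)
    show "dist (log_count m t z) (log_count n t z) < e"
    proof (rule ccontr)
      assume "\<not> dist (log_count m t z) (log_count n t z) < e"
      then have "e / 2 < dist (log_count m t z) (log_count n t z)" using e by simp
      with \<open>(_ \<longlongrightarrow> _) (at_right t)\<close> have "eventually (\<lambda>s. e / 2 < dist (log_count m s z) (log_count n s z)) (at_right t)"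
        by (rule order_tendstoD(1))
      then obtain b where b: "t < b" "\<And>s. t < s \<Longrightarrow> s < b \<Longrightarrow> e / 2 < dist (log_count m s z) (log_count n s z)"
        unfolding eventually_at_right_field by blast
      obtain r where r: "r \<in> \<rat>" "t < r" "r < min b (t + 1)"
        using Rats_dense_in_real[of t "min b (t + 1)"] b(1) by auto
      then have "r \<in> rational_times (Suc T)" using t by (auto simp: rational_times_def)
      from M[OF this mn] b(2)[of r] r show False by auto
    qed
  qed
qed

theorem AE_uniformly_convergent_log_count:
  "AE z in rrt. \<forall>T::nat. uniformly_convergent_on {0..real T} (\<lambda>n t. log_count n t z)"
  unfolding AE_all_countable
proof
  fix T :: nat
  obtain a where a: "1 \<le> a" "AE z in rrt. eventually (\<lambda>k. \<forall>t\<in>rational_times (Suc T).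
    \<bar>scaled_rising (Suc k ^ a) t z - scaled_rising (Suc (Suc k) ^ a) t z\<bar> \<le> 1 / (real (Suc k))\<^sup>2) sequentially"
    using subsequence_increments[of "Suc T"] by blast
  have "AE z in rrt. \<exists>l>0. frequently (\<lambda>k. \<forall>t\<in>rational_times (Suc T).
      rising (- exp (- real (Suc T)) / 2 * exp t) (root_count (Suc k ^ a) t z) * real (Suc k ^ a) powr (- (- exp (- real (Suc T)) / 2)) \<le> l) sequentially"
    by (rule AE_frequently_bounded[where \<nu>="\<lambda>k. Suc k ^ a"]) simp
  moreover have "AE z in rrt. filterlim (\<lambda>n. root_count n (real (Suc T)) z) at_top sequentially"
    by (rule AE_root_count_unbounded) simp
  ultimately show "AE z in rrt. uniformly_convergent_on {0..real T} (\<lambda>n t. log_count n t z)"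
    using a(2)
  proof eventually_elim
    case (elim z)
    then obtain l where l: "0 < l" "frequently (\<lambda>k. \<forall>t\<in>rational_times (Suc T).
      rising (- exp (- real (Suc T)) / 2 * exp t) (root_count (Suc k ^ a) t z) * real (Suc k ^ a) powr (- (- exp (- real (Suc T)) / 2)) \<le> l) sequentially"
      by blast
    have S: "rational_times (Suc T) \<subseteq> {0..real (Suc T)}" "rational_times (Suc T) \<subseteq> {0..}" by (auto simp: rational_times_def)
    obtain y where "uniform_limit (rational_times (Suc T)) (\<lambda>k t. log_count (Suc k ^ a) t z) y sequentially"
      using uniform_limit_log_count_subsequence[OF a(1) S(1) elim(3) l refl elim(2)] by blast
    from uniform_limit_log_count[OF a(1) S(2) this] have "uniformly_convergent_on (rational_times (Suc T)) (\<lambda>n t. log_count n t z)"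
      unfolding uniformly_convergent_on_def by blast
    then show ?case by (rule uniformly_convergent_log_count_extend)
  qed
qed

section \<open>The limit process\<close>

abbreviation mass :: "real \<Rightarrow> (nat \<Rightarrow> nat \<times> real) \<Rightarrow> real" where
  "mass t z \<equiv> X\<^sub>1 par cut t z"

abbreviation log_mass :: "real \<Rightarrow> (nat \<Rightarrow> nat \<times> real) \<Rightarrow> real" where
  "log_mass t z \<equiv> Y par cut t z"

text \<open>
  The event of full probability on which all pathwise statements hold.
\<close>

definition good :: "(nat \<Rightarrow> nat \<times> real) \<Rightarrow> bool" where
  "good z \<longleftrightarrow> z \<in> space rrt \<and> valid z \<and> (\<forall>i\<ge>2. 0 < cut i z) \<and> (\<forall>T::nat. uniformly_convergent_on {0..real T} (\<lambda>n t. log_count n t z))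
     \<and> (\<forall>T::nat. filterlim (\<lambda>n. root_count n (real T) z) at_top sequentially)"

lemma AE_good: "AE z in rrt. good z"
proof -
  have "AE z in rrt. \<forall>T::nat. filterlim (\<lambda>n. root_count n (real T) z) at_top sequentially"
    unfolding AE_all_countable using AE_root_count_unbounded by simp
  with AE_valid AE_uniformly_convergent_log_count AE_space show ?thesis
    by eventually_elim (simp add: good_def)
qed

lemma good_unbounded:
  assumes "good z"
  shows "filterlim (\<lambda>n. root_count n t z) at_top sequentially"
proof -
  obtain T :: nat where "t \<le> real T" using real_arch_simple by blast
  then have le: "\<forall>n. root_count n (real T) z \<le> root_count n t z" by (intro allI root_count_antimono)
  have "filterlim (\<lambda>n. root_count n (real T) z) at_top sequentially" using assms by (simp add: good_def)
  from filterlim_at_top_mono[OF this always_eventually[OF le]] show ?thesis .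
qed

lemma scaled_count_eq: "scaled_count par cut t z n = real n powr (- exp (- t)) * real (root_count n t z)"
  by (simp add: scaled_count_def root_count_def in_root_def)

lemma scaled_count_eq_exp:
  assumes "1 \<le> n"
  shows "scaled_count par cut t z n = exp (log_count n t z)"
proof -
  have "log_count n t z = - exp (- t) * ln (real n) + ln (real (root_count n t z))"
    by (simp add: log_count_def)
  then have "exp (log_count n t z) = exp (- exp (- t) * ln (real n)) * exp (ln (real (root_count n t z)))"
    by (simp only: exp_add)
  then show ?thesis
    using assms root_count_pos[OF assms, of t z] by (simp add: scaled_count_eq powr_def)
qed

lemma good_convergent:
  assumes "good z" "0 \<le> t"
  shows "(\<lambda>n. log_count n t z) \<longlonglongrightarrow> log_mass t z" and "scaled_count par cut t z \<longlonglongrightarrow> mass t z" and "0 < mass t z"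
proof -
  obtain T :: nat where T: "t \<le> real T" using real_arch_simple by blast
  have "uniformly_convergent_on {0..real T} (\<lambda>n t. log_count n t z)" using assms by (simp add: good_def)
  then obtain y where "uniform_limit {0..real T} (\<lambda>n t. log_count n t z) y sequentially"
    by (auto simp: uniformly_convergent_on_def)
  from tendsto_uniform_limitI[OF this, of t] have y: "(\<lambda>n. log_count n t z) \<longlonglongrightarrow> y t" using T assms by simp
  have "eventually (\<lambda>n. exp (log_count n t z) = scaled_count par cut t z n) sequentially"
    using eventually_ge_at_top[of 1] by eventually_elim (simp add: scaled_count_eq_exp)
  with tendsto_exp[OF y] have s: "scaled_count par cut t z \<longlonglongrightarrow> exp (y t)"
    by (rule Lim_transform_eventually)
  then have m: "mass t z = exp (y t)" unfolding X\<^sub>1_def by (rule limI)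
  with s show "scaled_count par cut t z \<longlonglongrightarrow> mass t z" "0 < mass t z" by simp_all
  show "(\<lambda>n. log_count n t z) \<longlonglongrightarrow> log_mass t z" using y by (simp add: Y_def m)
qed

lemma good_mass_eq: "good z \<Longrightarrow> 0 \<le> t \<Longrightarrow> mass t z = exp (log_mass t z)"
  using good_convergent(3) by (simp add: Y_def)

lemma good_uniform_limit:
  assumes "good z"
  shows "uniform_limit {0..real T} (\<lambda>n t. log_count n t z) (\<lambda>t. log_mass t z) sequentially"
proof -
  obtain y where y: "uniform_limit {0..real T} (\<lambda>n t. log_count n t z) y sequentially"
  proof -
    have "uniformly_convergent_on {0..real T} (\<lambda>n t. log_count n t z)" using assms by (simp add: good_def)
    then show ?thesis using that by (auto simp: uniformly_convergent_on_def)
  qed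
  moreover have "y t = log_mass t z" if "t \<in> {0..real T}" for t
    using tendsto_uniform_limitI[OF y that] good_convergent(1)[OF assms, of t] that
    by (auto intro: LIMSEQ_unique)
  ultimately show ?thesis by (metis (no_types, lifting) uniform_limit_cong')
qed

subsection \<open>Path regularity\<close>

lemma root_count_left_const:
  assumes "s0 < t"
  obtains s m where "s < t" "s0 \<le> s" "root_count n t z \<le> m" "\<And>r. s \<le> r \<Longrightarrow> r < t \<Longrightarrow> root_count n r z = m"
proof -
  define A where "A = (\<lambda>s. root_count n s z) ` {s0..<t}"
  have "A \<noteq> {}" using assms by (auto simp: A_def)
  then have "(LEAST x. x \<in> A) \<in> A" by (metis LeastI equals0I)
  then obtain s where s: "s0 \<le> s" "s < t" "root_count n s z = (LEAST x. x \<in> A)" by (auto simp: A_def)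
  show ?thesis
  proof (rule that[OF s(2,1), of "root_count n s z"])
    show "root_count n t z \<le> root_count n s z" using s by (intro root_count_antimono) auto
    fix r assume r: "s \<le> r" "r < t"
    have "root_count n r z \<in> A" using r s by (auto simp: A_def)
    then have "root_count n s z \<le> root_count n r z" unfolding s(3) by (rule Least_le)
    moreover have "root_count n r z \<le> root_count n s z" using r by (intro root_count_antimono)
    ultimately show "root_count n r z = root_count n s z" by simp
  qed
qed

lemma log_count_left_limit:
  assumes "0 < t" "1 \<le> n"
  obtains g where "((\<lambda>s. log_count n s z) \<longlongrightarrow> g) (at_left t)" "log_count n t z \<le> g"
proof -
  obtain s m where s: "s < t" "root_count n t z \<le> m" "\<And>r. s \<le> r \<Longrightarrow> r < t \<Longrightarrow> root_count n r z = m"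
    using root_count_left_const[of 0 t n z] assms by metis
  have "((\<lambda>r. ln (real m) - exp (- r) * ln n) \<longlongrightarrow> ln (real m) - exp (- t) * ln n) (at_left t)"
    by (intro tendsto_intros)
  moreover have "eventually (\<lambda>r. ln (real m) - exp (- r) * ln n = log_count n r z) (at_left t)"
    using eventually_at_left_real[OF s(1)]
  proof eventually_elim
    case (elim r)
    then have "root_count n r z = m" by (intro s(3)) auto
    then show ?case by (simp add: log_count_def)
  qed
  ultimately have "((\<lambda>s. log_count n s z) \<longlongrightarrow> ln (real m) - exp (- t) * ln n) (at_left t)"
    by (rule Lim_transform_eventually)
  moreover have "log_count n t z \<le> ln (real m) - exp (- t) * ln n"
    using s(2) root_count_pos[OF assms(2), of t z] by (simp add: log_count_def)
  ultimately show ?thesis by (rule that)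
qed

lemma good_right_continuous:
  assumes "good z" "0 \<le> t"
  shows "((\<lambda>s. log_mass s z) \<longlongrightarrow> log_mass t z) (at_right t)"
proof -
  obtain T :: nat where T: "t + 1 \<le> real T" using real_arch_simple by blast
  show ?thesis
  proof (rule swap_uniform_limit'[OF _ good_convergent(1)[OF assms] good_uniform_limit[OF assms(1), of T]])
    show "\<forall>\<^sub>F n in sequentially. ((\<lambda>s. log_count n s z) \<longlongrightarrow> log_count n t z) (at_right t)"
      using log_count_right_continuous by simp
    have "\<forall>\<^sub>F x in at_right t. x \<in> {t<..<t + 1}" by (rule eventually_at_right_real) simp
    then show "\<forall>\<^sub>F x in at_right t. x \<in> {0..real T}"
      by eventually_elim (use T assms in auto)
  qed simp
qed

text \<open>
  At a jump time the counts can only decrease; a uniform limit of functions with left limits has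
  left limits, namely the limits of those.
\<close>

lemma good_left_limit:
  assumes "good z" "0 < t"
  obtains l where "((\<lambda>s. log_mass s z) \<longlongrightarrow> l) (at_left t)" "log_mass t z \<le> l"
proof -
  obtain T :: nat where T: "t \<le> real T" using real_arch_simple by blast
  have "\<forall>n. \<exists>g. ((\<lambda>s. log_count (Suc n) s z) \<longlongrightarrow> g) (at_left t) \<and> log_count (Suc n) t z \<le> g"
    using log_count_left_limit[OF assms(2)] by (metis le_add1 plus_1_eq_Suc)
  then obtain g where g: "\<And>n. ((\<lambda>s. log_count (Suc n) s z) \<longlongrightarrow> g n) (at_left t)" "\<And>n. log_count (Suc n) t z \<le> g n"
    by metis
  have ev: "\<forall>\<^sub>F x in at_left t. x \<in> {0..real T}"
    using eventually_at_left_real[OF assms(2)] by eventually_elim (use T in auto)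
  have u: "uniform_limit {0..real T} (\<lambda>n t. log_count (Suc n) t z) (\<lambda>t. log_mass t z) sequentially"
    using filterlim_compose[OF good_uniform_limit[OF assms(1), of T] filterlim_Suc] .
  have "Cauchy g"
  proof (rule metric_CauchyI)
    fix e :: real assume e: "0 < e"
    have e4: "0 < e / 4" using e by simp
    from uniform_limitD[OF u e4] obtain N where N: "\<And>n x. N \<le> n \<Longrightarrow> x \<in> {0..real T} \<Longrightarrow> dist (log_count (Suc n) x z) (log_mass x z) < e / 4"
      unfolding eventually_sequentially by blast
    show "\<exists>M. \<forall>m\<ge>M. \<forall>n\<ge>M. dist (g m) (g n) < e"
    proof (intro exI[of _ N] allI impI)
      fix m n assume mn: "N \<le> m" "N \<le> n"
      have "dist (g m) (g n) \<le> e / 2"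
      proof (rule tendsto_upperbound)
        show "((\<lambda>s. dist (log_count (Suc m) s z) (log_count (Suc n) s z)) \<longlongrightarrow> dist (g m) (g n)) (at_left t)"
          by (intro tendsto_dist g)
        show "\<forall>\<^sub>F s in at_left t. dist (log_count (Suc m) s z) (log_count (Suc n) s z) \<le> e / 2"
          using ev
        proof eventually_elim
          case (elim s)
          from N[OF mn(1) elim] N[OF mn(2) elim] show ?case unfolding dist_real_def by linarith
        qed
      qed simp
      then show "dist (g m) (g n) < e" using e by simp
    qed
  qed
  then obtain l where l: "g \<longlonglongrightarrow> l" using convergent_eq_Cauchy by blast
  have "((\<lambda>s. log_mass s z) \<longlongrightarrow> l) (at_left t)"
    by (rule swap_uniform_limit'[OF _ l u ev]) (use g in auto)
  moreover have "log_mass t z \<le> l"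
    by (rule LIMSEQ_le[OF LIMSEQ_Suc[OF good_convergent(1)[OF assms(1)]] l]) (use g assms in auto)
  ultimately show ?thesis by (rule that)
qed

lemma abs_log_count_le:
  assumes "1 \<le> n" "0 \<le> t"
  shows "\<bar>log_count n t z\<bar> \<le> ln n"
proof -
  have N: "1 \<le> root_count n t z" "root_count n t z \<le> n" using root_count_pos[OF assms(1)] root_count_le by auto
  then have 1: "0 \<le> ln (real (root_count n t z))" "ln (real (root_count n t z)) \<le> ln (real n)" by auto
  have n: "0 \<le> ln (real n)" using assms by simp
  have "exp (- t) * ln (real n) \<le> 1 * ln (real n)" using assms n by (intro mult_right_mono) auto
  moreover have "0 \<le> exp (- t) * ln (real n)" using n by simp
  ultimately show ?thesis using 1 unfolding log_count_def abs_le_iff by linarith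
qed

lemma good_bounded:
  assumes "good z"
  obtains B where "\<And>t. 0 \<le> t \<Longrightarrow> t \<le> real T \<Longrightarrow> \<bar>log_mass t z\<bar> \<le> B"
proof -
  from uniform_limitD[OF good_uniform_limit[OF assms, of T] zero_less_one]
  obtain N where "\<And>n x. N \<le> n \<Longrightarrow> x \<in> {0..real T} \<Longrightarrow> dist (log_count n x z) (log_mass x z) < 1"
    unfolding eventually_sequentially by blast
  from this[of "Suc N"] have N: "\<And>x. x \<in> {0..real T} \<Longrightarrow> \<bar>log_count (Suc N) x z - log_mass x z\<bar> < 1"
    by (simp add: dist_real_def)
  show ?thesis
  proof (rule that[of "ln (real (Suc N)) + 1"])
    fix t assume t: "0 \<le> t" "t \<le> real T"
    show "\<bar>log_mass t z\<bar> \<le> ln (real (Suc N)) + 1"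
      using N[of t] abs_log_count_le[of "Suc N" t z] t by (simp del: of_nat_Suc)
  qed
qed

subsection \<open>Progressive measurability\<close>

text \<open>
  At a fixed time, membership in the root block is measurable with respect to the history; joint
  measurability in time and tree, as needed for the time integral in \<open>levy\<close>, is obtained by
  approximating the time from the right by rational times in \<open>{0..s}\<close>.  For \<open>r\<close> in \<open>{0..s}\<close> this is
  membership at time \<open>r\<close>.
\<close>

definition in_root_before :: "real \<Rightarrow> real \<Rightarrow> (nat \<Rightarrow> nat \<times> real) \<Rightarrow> nat \<Rightarrow> bool" where
  "in_root_before s r z j \<longleftrightarrow> in_root s z j \<or> (\<exists>q\<in>\<rat> \<inter> {0..s}. r < q \<and> in_root q z j)"

lemma in_root_before_eq:
  assumes "0 \<le> r" "r \<le> s"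
  shows "in_root_before s r z j \<longleftrightarrow> in_root r z j"
proof
  assume "in_root_before s r z j"
  then show "in_root r z j" unfolding in_root_before_def
    using in_root_antimono[OF assms(2)] in_root_antimono[of r _ z j] by (meson less_imp_le)
next
  assume j: "in_root r z j"
  show "in_root_before s r z j"
  proof (cases "r = s")
    case True
    with j show ?thesis by (simp add: in_root_before_def)
  next
    case False
    obtain b where b: "r < b" "in_root b z j" using in_root_right_open[OF j] by blast
    obtain q where q: "q \<in> \<rat>" "r < q" "q < min b s" using Rats_dense_in_real[of r "min b s"] b False assms by auto
    then have "in_root q z j" using b by (intro in_root_antimono[of q b]) auto
    with q assms show ?thesis unfolding in_root_before_def by (intro disjI2 bexI[of _ q]) auto
  qed
qed

definition mass_before :: "real \<Rightarrow> real \<times> (nat \<Rightarrow> nat \<times> real) \<Rightarrow> real" where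
  "mass_before s x = lim (\<lambda>n. real n powr (- exp (- fst x)) * (\<Sum>j\<le>n. if in_root_before s (fst x) (snd x) j then 1 else 0))"

lemma mass_before_eq:
  assumes "0 \<le> r" "r \<le> s"
  shows "mass_before s (r, z) = mass r z"
proof -
  have "(\<lambda>n. real n powr (- exp (- r)) * (\<Sum>j\<le>n. if in_root_before s r z j then 1 else 0)) = scaled_count par cut r z"
    by (rule ext) (simp add: scaled_count_eq root_count_eq_sum in_root_before_eq[OF assms] if_distrib cong: if_cong)
  then show ?thesis by (simp add: mass_before_def X\<^sub>1_def)
qed

lemma pred_in_root_before:
  assumes "0 \<le> s"
  shows "Measurable.pred (borel \<Otimes>\<^sub>M root_alg s) (\<lambda>x. in_root_before s (fst x) (snd x) j)"
proof -
  have "countable (\<rat> \<inter> {0..s})" using countable_rat by auto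
  moreover have "Measurable.pred (borel \<Otimes>\<^sub>M root_alg s) (\<lambda>x. in_root q (snd x) j)" if "0 \<le> q" "q \<le> s" for q
    by (rule measurable_compose[OF measurable_snd pred_in_root_root_alg[OF that]])
  moreover have "Measurable.pred (borel \<Otimes>\<^sub>M root_alg s) (\<lambda>x. fst x < q)" for q :: real
    by measurable
  ultimately show ?thesis unfolding in_root_before_def using assms
    by (intro pred_intros_logic pred_intros_countable_bounded) auto
qed

lemma borel_measurable_mass_before:
  assumes "0 \<le> s"
  shows "mass_before s \<in> borel_measurable (borel \<Otimes>\<^sub>M root_alg s)"
  unfolding mass_before_def
proof (rule borel_measurable_lim_metric)
  fix n
  note [measurable] = pred_in_root_before[OF assms]
  show "(\<lambda>x. real n powr (- exp (- fst x)) * (\<Sum>j\<le>n. if in_root_before s (fst x) (snd x) j then 1 else 0)) \<in> borel_measurable (borel \<Otimes>\<^sub>M root_alg s)"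
    by measurable
qed

lemma borel_measurable_mass_root_alg:
  assumes "0 \<le> r" "r \<le> s"
  shows "mass r \<in> borel_measurable (root_alg s)"
proof -
  have "(\<lambda>z. mass_before s (r, z)) \<in> borel_measurable (root_alg s)"
    by (rule measurable_compose[OF _ borel_measurable_mass_before]) (use assms in auto)
  then show ?thesis unfolding mass_before_eq[OF assms] .
qed

lemma borel_measurable_log_mass_root_alg:
  assumes "0 \<le> r" "r \<le> s"
  shows "log_mass r \<in> borel_measurable (root_alg s)"
  unfolding Y_def[abs_def] using borel_measurable_mass_root_alg[OF assms] by measurable

lemma borel_measurable_mass [measurable]: "0 \<le> r \<Longrightarrow> mass r \<in> borel_measurable rrt"
  using borel_measurable_mass_root_alg[of r r] measurable_root_alg_imp by blast

lemma borel_measurable_log_mass [measurable]: "0 \<le> r \<Longrightarrow> log_mass r \<in> borel_measurable rrt"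
  using borel_measurable_log_mass_root_alg[of r r] measurable_root_alg_imp by blast

abbreviation levy :: "real \<Rightarrow> (nat \<Rightarrow> nat \<times> real) \<Rightarrow> real" where
  "levy t z \<equiv> L par cut t z"

lemma levy_eq:
  assumes "0 \<le> t" "t \<le> s"
  shows "levy t z = ln (mass_before s (t, z)) + (\<integral> r. indicator {0..t} r * ln (mass_before s (r, z)) \<partial>lborel)"
proof -
  have "(\<integral> r. indicator {0..t} r * ln (mass_before s (r, z)) \<partial>lborel) = (LBINT r:{0..t}. log_mass r z)"
    unfolding set_lebesgue_integral_def
    using assms by (intro Bochner_Integration.integral_cong) (auto simp: indicator_def Y_def mass_before_eq)
  then show ?thesis by (simp add: L_def Y_def mass_before_eq[OF assms])
qed

lemma borel_measurable_levy_root_alg: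
  assumes "0 \<le> t" "t \<le> s"
  shows "levy t \<in> borel_measurable (root_alg s)"
proof -
  have s: "0 \<le> s" using assms by simp
  have [measurable]: "(\<lambda>z. mass_before s (t, z)) \<in> borel_measurable (root_alg s)"
    by (rule measurable_compose[OF _ borel_measurable_mass_before[OF s]]) simp
  have snd: "snd \<in> root_alg s \<Otimes>\<^sub>M lborel \<rightarrow>\<^sub>M borel"
    using measurable_snd[of "root_alg s" lborel] unfolding measurable_cong_sets[OF refl sets_lborel] .
  have "(\<lambda>x. mass_before s (snd x, fst x)) \<in> borel_measurable (root_alg s \<Otimes>\<^sub>M lborel)"
    by (rule measurable_compose[OF measurable_Pair[OF snd measurable_fst] borel_measurable_mass_before[OF s]])
  moreover have "(\<lambda>x. indicator {0..t} (snd x) :: real) \<in> borel_measurable (root_alg s \<Otimes>\<^sub>M lborel)"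
    by (rule measurable_compose[OF snd]) simp
  ultimately have m: "(\<lambda>x. indicator {0..t} (snd x) * ln (mass_before s (snd x, fst x))) \<in> borel_measurable (root_alg s \<Otimes>\<^sub>M lborel)"
    by (intro borel_measurable_times borel_measurable_ln)
  have "(\<lambda>z. ln (mass_before s (t, z)) + (\<integral> r. indicator {0..t} r * ln (mass_before s (r, z)) \<partial>lborel)) \<in> borel_measurable (root_alg s)"
    using m by (intro borel_measurable_add borel_measurable_ln lborel.borel_measurable_lebesgue_integral)
      (auto simp: case_prod_beta)
  then show ?thesis unfolding levy_eq[OF assms, symmetric] .
qed

lemma borel_measurable_levy [measurable]: "0 \<le> r \<Longrightarrow> levy r \<in> borel_measurable rrt"
  using borel_measurable_levy_root_alg[of r r] measurable_root_alg_imp by blast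

lemma good_set_integrable:
  assumes "good z" "0 \<le> a"
  shows "set_integrable lborel {a..b} (\<lambda>r. log_mass r z)"
proof -
  obtain T :: nat where T: "max a b \<le> real T" using real_arch_simple by blast
  obtain B where B: "\<And>t. 0 \<le> t \<Longrightarrow> t \<le> real T \<Longrightarrow> \<bar>log_mass t z\<bar> \<le> B"
    using good_bounded[OF assms(1), of T] by blast
  have m: "(\<lambda>r. indicator {a..b} r * ln (mass_before (real T) (r, z))) \<in> borel_measurable borel"
  proof -
    have "(\<lambda>r. mass_before (real T) (r, z)) \<in> borel_measurable borel"
      by (rule measurable_compose[OF _ borel_measurable_mass_before]) (use assms(1) in \<open>auto simp: good_def\<close>)
    then show ?thesis by measurable
  qed
  have eq: "indicator {a..b} r * ln (mass_before (real T) (r, z)) = indicator {a..b} r *\<^sub>R log_mass r z" for r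
    using T assms by (auto simp: indicator_def mass_before_eq Y_def)
  show ?thesis unfolding set_integrable_def
  proof (rule Bochner_Integration.integrable_bound[where f="\<lambda>r. indicator {a..b} r * \<bar>B\<bar>"])
    show "integrable lborel (\<lambda>r. indicator {a..b} r * \<bar>B\<bar>)"
      by (intro integrable_mult_left integrable_real_indicator) (auto simp: emeasure_lborel_Icc_eq)
    show "(\<lambda>r. indicator {a..b} r *\<^sub>R log_mass r z) \<in> borel_measurable lborel"
      using m unfolding eq by simp
    show "AE r in lborel. norm (indicator {a..b} r *\<^sub>R log_mass r z) \<le> norm (indicator {a..b} r * \<bar>B\<bar>)"
    proof (rule AE_I2)
      fix r
      show "norm (indicator {a..b} r *\<^sub>R log_mass r z) \<le> norm (indicator {a..b} r * \<bar>B\<bar>)"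
        using B[of r] T assms by (auto simp: indicator_def intro: order.trans[OF _ abs_ge_self])
    qed
  qed
qed

subsection \<open>The shift acts on the limit process\<close>

definition good_at :: "real \<Rightarrow> (nat \<Rightarrow> nat \<times> real) \<Rightarrow> bool" where
  "good_at s z \<longleftrightarrow> good z \<and> good (shift s z)"

lemma AE_good_at: "0 \<le> s \<Longrightarrow> AE z in rrt. good_at s z"
  unfolding good_at_def using AE_good AE_shift_distr[OF _ AE_good] by simp

lemma log_mass_shift:
  assumes z: "good_at s z" and s: "0 \<le> s" and r: "0 \<le> r"
  shows "log_mass (s + r) z = exp (- r) * log_mass s z + log_mass r (shift s z)"
proof -
  have g: "good z" "good (shift s z)" using z by (auto simp: good_at_def)
  have v: "valid z" using g by (simp add: good_def)
  note unb = good_unbounded[OF g(1), of s]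
  have "(\<lambda>n. exp (- r) * log_count n s z + log_count (root_count n s z) r (shift s z)) \<longlonglongrightarrow>
     exp (- r) * log_mass s z + log_mass r (shift s z)"
    by (intro tendsto_intros good_convergent(1)[OF g(1) s]
        filterlim_compose[OF good_convergent(1)[OF g(2) r] unb])
  moreover have "exp (- r) * log_count n s z + log_count (root_count n s z) r (shift s z) = log_count n (s + r) z" for n
    using root_count_shift[OF v unb r, of n]
    by (simp add: log_count_def algebra_simps flip: exp_add mult.assoc)
  ultimately have "(\<lambda>n. log_count n (s + r) z) \<longlonglongrightarrow> exp (- r) * log_mass s z + log_mass r (shift s z)" by simp
  with good_convergent(1)[OF g(1), of "s + r"] s r show ?thesis by (auto intro: LIMSEQ_unique)
qed

text \<open>
  Pass to the limit in the two-stage count: the shifted tree has \<open>root_count n s\<close> vertices, which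
  is asymptotic to \<open>mass s z * n powr exp (- s)\<close>.
\<close>

lemma mass_shift:
  assumes z: "good_at s z" and s: "0 \<le> s" and r: "0 \<le> r"
  shows "mass (s + r) z = mass s z powr exp (- r) * mass r (shift s z)"
proof -
  have g: "good z" "good (shift s z)" using z by (auto simp: good_at_def)
  show ?thesis using log_mass_shift[OF assms] s r good_convergent(3)[OF g(1) s]
    by (simp add: good_mass_eq[OF g(1)] good_mass_eq[OF g(2)] exp_add powr_def)
qed

lemma set_integral_exp_minus:
  fixes r :: real
  assumes "0 \<le> r"
  shows "(LBINT v:{0..r}. exp (- v)) = 1 - exp (- r)" and "set_integrable lborel {0..r} (\<lambda>v. exp (- v))"
proof -
  have "has_bochner_integral lborel (\<lambda>x. exp (- x) * indicator {0..r} x) (- exp (- r) - - exp (- 0))"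
    by (rule has_bochner_integral_FTC_Icc_real[where F="\<lambda>x. - exp (- x)" and f="\<lambda>x. exp (- x)" and a=0 and b=r, OF assms])
       (auto intro!: derivative_eq_intros)
  then have "has_bochner_integral lborel (\<lambda>x. indicator {0..r} x *\<^sub>R exp (- x)) (1 - exp (- r))"
    by (simp add: mult.commute)
  then show "(LBINT v:{0..r}. exp (- v)) = 1 - exp (- r)" "set_integrable lborel {0..r} (\<lambda>v. exp (- v))"
    unfolding set_lebesgue_integral_def set_integrable_def
    by (auto dest: has_bochner_integral_integral_eq has_bochner_integral_integrable simp: has_bochner_integral_iff)
qed

text \<open>
  Integrating \<open>Y (s + v) = exp (- v) * Y s + Y' v\<close> over \<open>v \<in> {0..r}\<close> contributes
  \<open>(1 - exp (- r)) * Y s\<close>, which cancels the loss \<open>exp (- r) * Y s - Y s\<close> of the first summand.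
\<close>

lemma levy_shift:
  assumes z: "good_at s z" and s: "0 \<le> s" and r: "0 \<le> r"
  shows "levy (s + r) z - levy s z = levy r (shift s z)"
proof -
  have g: "good z" "good (shift s z)" using z by (auto simp: good_at_def)
  have i: "set_integrable lborel {s..s + r} (\<lambda>v. log_mass v z)" using s by (intro good_set_integrable[OF g(1)])
  have i2: "set_integrable lborel {s<..s + r} (\<lambda>v. log_mass v z)"
    by (rule set_integrable_subset[OF i]) auto
  have "{0..s + r} = {0..s} \<union> {s<..s + r}" using s r by auto
  then have "(LBINT v:{0..s + r}. log_mass v z) = (LBINT v:{0..s}. log_mass v z) + (LBINT v:{s<..s + r}. log_mass v z)"
    using good_set_integrable[OF g(1), of 0 s] i2
    by (simp only:) (rule set_integral_Un, auto)
  also have "(LBINT v:{s<..s + r}. log_mass v z) = (LBINT v:{s..s + r}. log_mass v z)"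
  proof -
    have "AE v in lborel. v \<noteq> s" by (rule AE_lborel_singleton)
    then have "AE v in lborel. v \<in> {s<..s + r} \<longleftrightarrow> v \<in> {s..s + r}" by eventually_elim auto
    then show ?thesis unfolding set_lebesgue_integral_def
      using borel_measurable_integrable[OF i[unfolded set_integrable_def]]
        borel_measurable_integrable[OF i2[unfolded set_integrable_def]]
      by (intro Bochner_Integration.integral_cong_AE) (auto simp: indicator_def elim!: eventually_mono)
  qed
  also have "(LBINT v:{s..s + r}. log_mass v z) = (LBINT v:{0..r}. log_mass (s + v) z)"
    unfolding set_lebesgue_integral_def
    by (subst lborel_integral_real_affine[where c=1 and t=s]) (auto intro!: Bochner_Integration.integral_cong simp: indicator_def)
  also have "\<dots> = (LBINT v:{0..r}. exp (- v) * log_mass s z + log_mass v (shift s z))"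
    unfolding set_lebesgue_integral_def using log_mass_shift[OF z s]
    by (intro Bochner_Integration.integral_cong) (auto simp: indicator_def)
  also have "\<dots> = (LBINT v:{0..r}. exp (- v) * log_mass s z) + (LBINT v:{0..r}. log_mass v (shift s z))"
    using set_integral_exp_minus(2)[OF r] good_set_integrable[OF g(2), of 0 r]
    by (intro set_integral_add set_integrable_mult_left) auto
  also have "(LBINT v:{0..r}. exp (- v) * log_mass s z) = (1 - exp (- r)) * log_mass s z"
    using set_integral_exp_minus(1)[OF r] by simp
  finally have "(LBINT v:{0..s + r}. log_mass v z) = (LBINT v:{0..s}. log_mass v z)
     + ((1 - exp (- r)) * log_mass s z + (LBINT v:{0..r}. log_mass v (shift s z)))" .
  then show ?thesis using log_mass_shift[OF assms] by (simp add: L_def algebra_simps)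
qed

lemma good_levy_0: "good z \<Longrightarrow> mass 0 z = 1 \<and> levy 0 z = 0"
proof -
  assume z: "good z"
  then have v: "valid z" "\<forall>i\<ge>2. 0 < cut i z" by (auto simp: good_def)
  have a: "in_root 0 z i" if "1 \<le> i" for i
    using that
  proof (induction i rule: less_induct)
    case (less i)
    show ?case
    proof (cases "i = 1")
      case False
      then have i: "2 \<le> i" using less.prems by simp
      then have "par i z \<in> {1..<i}" using v by (auto simp: valid_def)
      with less.IH v i show ?thesis by (subst in_root_rec[OF v(1) i]) auto
    qed simp
  qed
  have c: "root_count n 0 z = n" for n
    by (induction n) (auto simp: root_count_Suc a)
  have "eventually (\<lambda>n. scaled_count par cut 0 z n = 1) sequentially"
    using eventually_ge_at_top[of 1] by eventually_elim (simp add: scaled_count_eq c powr_minus)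
  then have "scaled_count par cut 0 z \<longlonglongrightarrow> 1" by (rule tendsto_eventually)
  then have m: "mass 0 z = 1" unfolding X\<^sub>1_def by (rule limI)
  moreover have "(LBINT s:{0..0}. log_mass s z) = 0"
  proof -
    have "AE v in lborel. v \<noteq> (0::real)" by (rule AE_lborel_singleton)
    then have "AE v in lborel. indicator {0..0} v *\<^sub>R log_mass v z = 0" by eventually_elim (auto simp: indicator_def)
    then show ?thesis unfolding set_lebesgue_integral_def by (rule integral_eq_zero_AE)
  qed
  ultimately show ?thesis by (simp add: L_def Y_def)
qed

lemma good_cadlag_levy:
  assumes z: "good z"
  shows "cadlag (\<lambda>t. levy t z)"
    and "\<And>t l. 0 < t \<Longrightarrow> ((\<lambda>s. levy s z) \<longlongrightarrow> l) (at_left t) \<Longrightarrow> levy t z \<le> l"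
proof -
  define I where "I = (\<lambda>t. LBINT s:{0..t}. log_mass s z)"
  have I_diff: "\<exists>B. \<forall>s t. 0 \<le> s \<longrightarrow> s \<le> t \<longrightarrow> t \<le> real T \<longrightarrow> \<bar>I t - I s\<bar> \<le> B * (t - s)" for T
  proof -
    obtain B where B: "\<And>t. 0 \<le> t \<Longrightarrow> t \<le> real T \<Longrightarrow> \<bar>log_mass t z\<bar> \<le> B"
      using good_bounded[OF z, of T] by blast
    have "\<bar>I t - I s\<bar> \<le> B * (t - s)" if st: "0 \<le> s" "s \<le> t" "t \<le> real T" for s t
    proof -
      have i: "set_integrable lborel {0..t} (\<lambda>v. log_mass v z)" by (intro good_set_integrable[OF z]) simp
      have i1: "set_integrable lborel {0..s} (\<lambda>v. log_mass v z)" "set_integrable lborel {s<..t} (\<lambda>v. log_mass v z)"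
        using st by (auto intro!: set_integrable_subset[OF i])
      have "{0..t} = {0..s} \<union> {s<..t}" using st by auto
      then have "I t = I s + (LBINT v:{s<..t}. log_mass v z)"
        unfolding I_def using i1 by (simp only:) (rule set_integral_Un, auto)
      moreover have "\<bar>LBINT v:{s<..t}. log_mass v z\<bar> \<le> (LBINT v:{s<..t}. B)"
      proof -
        have "emeasure lborel {s<..t} < \<infinity>" using st by simp
        then have "integrable lborel (\<lambda>v. indicator {s<..t} v *\<^sub>R B)"
          by (intro integrable_scaleR_left integrable_real_indicator) auto
        then show ?thesis
          using i1(2) B st unfolding set_lebesgue_integral_def set_integrable_def
          by (intro integral_abs_bound_integral) (auto simp: indicator_def)
      qed
      moreover have "(LBINT v:{s<..t}. B) = B * (t - s)"
        using st by (simp add: set_lebesgue_integral_def mult.commute)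
      ultimately show ?thesis by simp
    qed
    then show ?thesis by blast
  qed
  have I_cont: "(I \<longlongrightarrow> I t) (at t within {0..})" if t: "0 \<le> t" for t
  proof -
    obtain T :: nat where T: "t + 1 \<le> real T" using real_arch_simple by blast
    obtain B where B: "\<And>s u. 0 \<le> s \<Longrightarrow> s \<le> u \<Longrightarrow> u \<le> real T \<Longrightarrow> \<bar>I u - I s\<bar> \<le> B * (u - s)" using I_diff[of T] by blast
    show ?thesis
    proof (rule Lim_null[THEN iffD2], rule Lim_null_comparison)
      show "((\<lambda>s. \<bar>B\<bar> * \<bar>s - t\<bar>) \<longlongrightarrow> 0) (at t within {0..})"
        by (rule tendsto_eq_intros refl | simp)+
      have "\<forall>\<^sub>F s in at t within {0..}. s < t + 1"
        by (rule order_tendstoD(2)[OF tendsto_ident_at]) simp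
      moreover have "\<forall>\<^sub>F s in at t within {0..}. s \<in> {0..}" by (simp add: eventually_at_filter)
      ultimately show "\<forall>\<^sub>F s in at t within {0..}. norm (I s - I t) \<le> \<bar>B\<bar> * \<bar>s - t\<bar>"
      proof eventually_elim
        case (elim s)
        have m: "B * x \<le> \<bar>B\<bar> * x" if "0 \<le> x" for x :: real using that by (intro mult_right_mono) auto
        show ?case
        proof (cases "s \<le> t")
          case True
          with B[of s t] elim T m[of "t - s"] show ?thesis by (simp add: abs_minus_commute[of _ t] abs_minus_commute[of "I s"])
        next
          case False
          have "\<bar>I s - I t\<bar> \<le> B * (s - t)" using B[of t s] False elim T t by simp
          also have "\<dots> \<le> \<bar>B\<bar> * (s - t)" using False by (intro m) simp
          finally show ?thesis using False by simp
        qed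
      qed
    qed
  qed
  have I_right: "(I \<longlongrightarrow> I t) (at_right t)" if "0 \<le> t" for t
    using that by (intro tendsto_within_subset[OF I_cont[OF that]]) auto
  have I_left: "(I \<longlongrightarrow> I t) (at_left t)" if "0 < t" for t
  proof -
    have "(I \<longlongrightarrow> I t) (at t within {0..<t})" using that by (intro tendsto_within_subset[OF I_cont]) auto
    moreover have "at t within {0..<t} = at_left t"
      using that by (intro at_within_nhd[of _ "{0<..}"]) auto
    ultimately show ?thesis by simp
  qed
  have levy: "levy t z = log_mass t z + I t" for t by (simp add: L_def I_def)
  have left: "\<exists>l. ((\<lambda>s. levy s z) \<longlongrightarrow> l) (at_left t) \<and> levy t z \<le> l" if t: "0 < t" for t
  proof -
    obtain l where l: "((\<lambda>s. log_mass s z) \<longlongrightarrow> l) (at_left t)" "log_mass t z \<le> l"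
      using good_left_limit[OF z t] by blast
    have "((\<lambda>s. levy s z) \<longlongrightarrow> l + I t) (at_left t)"
      unfolding levy by (intro tendsto_add l I_left t)
    moreover have "levy t z \<le> l + I t" using l by (simp add: levy)
    ultimately show ?thesis by blast
  qed
  show "cadlag (\<lambda>t. levy t z)"
    unfolding cadlag_def
  proof (intro conjI allI impI)
    fix t :: real assume t: "0 \<le> t"
    show "((\<lambda>t. levy t z) \<longlongrightarrow> levy t z) (at_right t)"
      unfolding levy by (intro tendsto_add good_right_continuous[OF z t] I_right t)
  next
    fix t :: real assume "0 < t"
    with left show "\<exists>l. ((\<lambda>t. levy t z) \<longlongrightarrow> l) (at_left t)" by blast
  qed
  fix t l assume t: "0 < t" and l: "((\<lambda>s. levy s z) \<longlongrightarrow> l) (at_left t)"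
  from left[OF t] obtain l' where "((\<lambda>s. levy s z) \<longlongrightarrow> l') (at_left t)" "levy t z \<le> l'" by blast
  with tendsto_unique[OF _ l] show "levy t z \<le> l" by auto
qed

section \<open>Moments\<close>

text \<open>
  Integrability of the limit is Fatou's lemma.  Truncation at a level \<open>K\<close> changes each mean by at most
  \<open>C / K\<close>, and the truncated means converge by dominated convergence.
\<close>

lemma (in prob_space) tendsto_expectation_of_bounded_second_moment:
  fixes f :: "nat \<Rightarrow> 'a \<Rightarrow> real"
  assumes [measurable]: "\<And>n. f n \<in> borel_measurable M" "g \<in> borel_measurable M"
    and pos: "\<And>n x. 0 \<le> f n x"
    and lim: "AE x in M. (\<lambda>n. f n x) \<longlonglongrightarrow> g x"
    and sq: "\<And>n. integrable M (\<lambda>x. (f n x)\<^sup>2)" and C: "\<And>n. expectation (\<lambda>x. (f n x)\<^sup>2) \<le> C"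
  shows "integrable M g" and "(\<lambda>n. expectation (f n)) \<longlonglongrightarrow> expectation g"
proof -
  have le: "y \<le> 1 + y\<^sup>2" for y :: real
    using zero_le_power2[of "y - 1/2"] by (simp add: power2_diff power2_eq_square field_simps)
  have int: "integrable M (f n)" for n
    by (rule Bochner_Integration.integrable_bound[where f="\<lambda>x. 1 + (f n x)\<^sup>2"])
       (use sq[of n] le pos in \<open>auto intro!: AE_I2 add_nonneg_nonneg\<close>)
  have C0: "0 \<le> C" using C[of 0] by (rule order.trans[rotated]) simp
  have gpos: "AE x in M. 0 \<le> g x"
    using lim by eventually_elim (use pos in \<open>auto intro: LIMSEQ_le_const\<close>)
  show g: "integrable M g"
  proof (rule integrableI_nonneg)
    have "(\<integral>\<^sup>+ x. ennreal (g x) \<partial>M) = (\<integral>\<^sup>+ x. liminf (\<lambda>n. ennreal (f n x)) \<partial>M)"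
    proof (rule nn_integral_cong_AE)
      show "AE x in M. ennreal (g x) = liminf (\<lambda>n. ennreal (f n x))"
        using lim
      proof eventually_elim
        case (elim x)
        have "liminf (\<lambda>n. ennreal (f n x)) = ennreal (g x)"
          by (rule lim_imp_Liminf) (use elim in \<open>auto intro: tendsto_ennrealI\<close>)
        then show ?case ..
      qed
    qed
    also have "\<dots> \<le> liminf (\<lambda>n. \<integral>\<^sup>+ x. ennreal (f n x) \<partial>M)" by (rule nn_integral_liminf) simp
    also have "\<dots> \<le> liminf (\<lambda>n. ennreal (1 + C))"
    proof (rule Liminf_mono, rule always_eventually, rule allI)
      fix n
      have "(\<integral>\<^sup>+ x. ennreal (f n x) \<partial>M) = ennreal (expectation (f n))"
        using int pos by (intro nn_integral_eq_integral) auto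
      also have "expectation (f n) \<le> expectation (\<lambda>x. 1 + (f n x)\<^sup>2)"
        using int sq le by (intro integral_mono) auto
      also have "\<dots> = 1 + expectation (\<lambda>x. (f n x)\<^sup>2)"
        using sq by (simp add: prob_space)
      also have "\<dots> \<le> 1 + C" using C by simp
      finally show "(\<integral>\<^sup>+ x. ennreal (f n x) \<partial>M) \<le> ennreal (1 + C)" by (simp add: ennreal_leI)
    qed
    also have "\<dots> < \<infinity>" by (simp add: Liminf_const)
    finally show "(\<integral>\<^sup>+ x. ennreal (g x) \<partial>M) < \<infinity>" .
  qed (use gpos in auto)
  have trunc: "(\<lambda>n. expectation (\<lambda>x. min (f n x) K)) \<longlonglongrightarrow> expectation (\<lambda>x. min (g x) K)" if K: "0 < K" for K
  proof (rule integral_dominated_convergence[where w="\<lambda>_. K"])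
    show "AE x in M. (\<lambda>n. min (f n x) K) \<longlonglongrightarrow> min (g x) K"
      using lim by eventually_elim (intro tendsto_min tendsto_const)
    show "AE x in M. norm (min (f n x) K) \<le> K" for n
      using pos K by (intro AE_I2) (auto simp: min_def)
  qed simp_all
  have tail: "\<bar>expectation (f n) - expectation (\<lambda>x. min (f n x) K)\<bar> \<le> C / K" if K: "0 < K" for n K
  proof -
    have i: "integrable M (\<lambda>x. min (f n x) K)"
      using int[of n] K pos by (intro Bochner_Integration.integrable_bound[OF int[of n]] AE_I2) (auto simp: min_def)
    have "f n x - min (f n x) K \<le> (f n x)\<^sup>2 / K" for x
    proof (cases "f n x \<le> K")
      case False
      then have "f n x * K \<le> f n x * f n x" using pos by (intro mult_left_mono) auto
      then have "f n x \<le> (f n x)\<^sup>2 / K" using K by (simp add: field_simps power2_eq_square)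
      with False K show ?thesis by simp
    qed (use K in simp)
    then have "expectation (\<lambda>x. f n x - min (f n x) K) \<le> expectation (\<lambda>x. (f n x)\<^sup>2 / K)"
      using int i sq by (intro integral_mono) auto
    also have "\<dots> \<le> C / K" using C[of n] K by (simp add: divide_right_mono)
    finally have "expectation (f n) - expectation (\<lambda>x. min (f n x) K) \<le> C / K"
      using int i by simp
    moreover have "expectation (\<lambda>x. min (f n x) K) \<le> expectation (f n)"
      using int i by (intro integral_mono) auto
    ultimately show ?thesis by simp
  qed
  have tail_g: "(\<lambda>k. expectation (\<lambda>x. min (g x) (real (Suc k)))) \<longlonglongrightarrow> expectation g"
  proof (rule integral_dominated_convergence[where w="\<lambda>x. \<bar>g x\<bar>"])
    show "AE x in M. (\<lambda>k. min (g x) (real (Suc k))) \<longlonglongrightarrow> g x"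
    proof (rule AE_I2, rule tendsto_eventually)
      fix x
      obtain N :: nat where "g x \<le> real N" using real_arch_simple by blast
      then show "\<forall>\<^sub>F k in sequentially. min (g x) (real (Suc k)) = g x"
        by (intro eventually_sequentiallyI[of N]) auto
    qed
    show "AE x in M. norm (min (g x) (real (Suc k))) \<le> \<bar>g x\<bar>" for k
      by (intro AE_I2) (auto simp: min_def)
  qed (use g in simp_all)
  show "(\<lambda>n. expectation (f n)) \<longlonglongrightarrow> expectation g"
  proof (rule LIMSEQ_I)
    fix e :: real assume e: "0 < e"
    have "(\<lambda>k. C / real (Suc k)) \<longlonglongrightarrow> 0" by real_asymp
    then have "\<forall>\<^sub>F k in sequentially. C / real (Suc k) < e / 3" using e by (intro order_tendstoD(2)) auto
    moreover have "\<forall>\<^sub>F k in sequentially. dist (expectation (\<lambda>x. min (g x) (real (Suc k)))) (expectation g) < e / 3"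
      using tail_g e by (intro tendstoD) auto
    ultimately have "\<forall>\<^sub>F k in sequentially. C / real (Suc k) < e / 3 \<and> dist (expectation (\<lambda>x. min (g x) (real (Suc k)))) (expectation g) < e / 3"
      by eventually_elim auto
    then obtain k where k: "C / real (Suc k) < e / 3" "dist (expectation (\<lambda>x. min (g x) (real (Suc k)))) (expectation g) < e / 3"
      unfolding eventually_sequentially by blast
    have "\<forall>\<^sub>F n in sequentially. dist (expectation (\<lambda>x. min (f n x) (real (Suc k)))) (expectation (\<lambda>x. min (g x) (real (Suc k)))) < e / 3"
      using trunc[of "real (Suc k)"] e by (intro tendstoD) auto
    then obtain N where N: "\<And>n. N \<le> n \<Longrightarrow> dist (expectation (\<lambda>x. min (f n x) (real (Suc k)))) (expectation (\<lambda>x. min (g x) (real (Suc k)))) < e / 3"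
      unfolding eventually_sequentially by blast
    show "\<exists>N. \<forall>n\<ge>N. norm (expectation (f n) - expectation g) < e"
    proof (intro exI[of _ N] allI impI)
      fix n assume "N \<le> n"
      from N[OF this] k tail[of "real (Suc k)" n] show "norm (expectation (f n) - expectation g) < e"
        unfolding dist_real_def real_norm_def by linarith
    qed
  qed
qed

lemma Gamma_shift_pos: "-1 < q \<Longrightarrow> 0 < Gamma (q + 1 :: real)"
  by (rule Gamma_real_pos) simp

text \<open>
  The means of \<open>rising q (root_count n t) / n powr (exp (- t) * q)\<close> converge, and the variables are
  bounded in \<open>L\<^sup>2\<close> because their squares are comparable to the same expression for \<open>2 * q\<close>.  The bound
  \<open>-1/4\<close> keeps \<open>2 * q\<close> in the range where the comparison with powers is uniform.
\<close>

theorem moments_mass: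
  assumes t: "0 \<le> t" and q: "-1/4 \<le> q"
  shows "integrable rrt (\<lambda>z. mass t z powr q)"
    and "(\<integral> z. mass t z powr q \<partial>rrt) = Gamma (q + 1) / Gamma (exp (- t) * q + 1)"
proof -
  define a where "a = exp (- t)"
  have a: "0 < a" "a \<le> 1" using t by (auto simp: a_def)
  have aq: "-1/4 \<le> a * q"
  proof (cases "0 \<le> q")
    case True
    then have "0 \<le> a * q" using a by simp
    then show ?thesis by linarith
  next
    case False
    then have "1 * q \<le> a * q" using a by (intro mult_right_mono_neg) auto
    then show ?thesis using q by simp
  qed
  define f where "f = (\<lambda>n z. rising q (root_count (Suc n) t z) * real (Suc n) powr (- (a * q)))"
  have f_nonneg: "0 \<le> f n z" for n z
    unfolding f_def using rising_pos[of q] q by (intro mult_nonneg_nonneg) (auto intro: less_imp_le)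
  have f_meas: "f n \<in> borel_measurable rrt" for n
    unfolding f_def by measurable
  have f_eq: "f n z = exp (rising_err (root_count (Suc n) t z) q) * exp (q * log_count (Suc n) t z)" for n z
  proof -
    have N: "1 \<le> root_count (Suc n) t z" by (rule root_count_pos) simp
    have "f n z = exp (rising_err (root_count (Suc n) t z) q) * (exp (q * ln (root_count (Suc n) t z)) * exp (- (a * q) * ln (real (Suc n))))"
      unfolding f_def using N q by (subst rising_eq_powr) (simp_all add: powr_def del: of_nat_Suc)
    also have "exp (q * ln (root_count (Suc n) t z)) * exp (- (a * q) * ln (real (Suc n))) = exp (q * log_count (Suc n) t z)"
      unfolding log_count_def a_def by (simp add: right_diff_distrib mult_ac flip: exp_add del: of_nat_Suc)
    finally show ?thesis .
  qed
  have lim: "AE z in rrt. (\<lambda>n. f n z) \<longlonglongrightarrow> 1 / Gamma (q + 1) * mass t z powr q"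
    using AE_good
  proof eventually_elim
    case (elim z)
    have "(\<lambda>n. exp (rising_err (root_count (Suc n) t z) q)) \<longlonglongrightarrow> 1 / Gamma (q + 1)"
      using q by (intro filterlim_compose[OF rising_err_limit] filterlim_compose[OF good_unbounded[OF elim] filterlim_Suc]) auto
    moreover have "(\<lambda>n. exp (q * log_count (Suc n) t z)) \<longlonglongrightarrow> exp (q * log_mass t z)"
      by (intro tendsto_intros LIMSEQ_Suc good_convergent(1)[OF elim t])
    ultimately have "(\<lambda>n. f n z) \<longlonglongrightarrow> 1 / Gamma (q + 1) * exp (q * log_mass t z)"
      unfolding f_eq by (rule tendsto_mult)
    then show ?case using good_convergent(3)[OF elim t] by (simp add: powr_def Y_def)
  qed
  obtain C1 where C1: "0 < C1" "\<And>k. 1 \<le> k \<Longrightarrow> rising q k \<le> C1 * real k powr q"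
  proof -
    have "-1/2 \<le> q" using q by simp
    then show ?thesis using rising_bounds[of q] that by (metis order.refl)
  qed
  obtain C2 where C2: "0 < C2" "\<And>n. 1 \<le> n \<Longrightarrow> (\<integral> z. real (root_count n t z) powr (2 * q) \<partial>rrt) \<le> C2 * real n powr (exp (- t) * (2 * q))"
    using expectation_powr_bound[of "2 * q" t] q t by auto
  have sq_int: "integrable rrt (\<lambda>z. (f n z)\<^sup>2)" for n
    unfolding f_def by (rule integrable_root_count[where g="\<lambda>k. (rising q k * real (Suc n) powr (- (a * q)))\<^sup>2"])
  have sq: "(\<integral> z. (f n z)\<^sup>2 \<partial>rrt) \<le> C1\<^sup>2 * C2" for n
  proof -
    have "(\<integral> z. (f n z)\<^sup>2 \<partial>rrt) \<le> (\<integral> z. real (root_count (Suc n) t z) powr (2 * q) * (C1\<^sup>2 * real (Suc n) powr (- (a * (2 * q)))) \<partial>rrt)"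
    proof (rule integral_mono[OF sq_int])
      show "integrable rrt (\<lambda>z. real (root_count (Suc n) t z) powr (2 * q) * (C1\<^sup>2 * real (Suc n) powr (- (a * (2 * q)))))"
        by (intro integrable_mult_left integrable_root_count[where g="\<lambda>k. real k powr (2 * q)"])
      fix z
      have N: "1 \<le> root_count (Suc n) t z" by (rule root_count_pos) simp
      have "0 \<le> rising q (root_count (Suc n) t z)" using rising_pos[of q] q by (auto intro: less_imp_le)
      then have "f n z \<le> C1 * real (root_count (Suc n) t z) powr q * real (Suc n) powr (- (a * q))"
        unfolding f_def using C1(2)[OF N] by (intro mult_right_mono) auto
      then have "(f n z)\<^sup>2 \<le> (C1 * real (root_count (Suc n) t z) powr q * real (Suc n) powr (- (a * q)))\<^sup>2"
        using f_nonneg by (intro power_mono)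
      also have "\<dots> = C1\<^sup>2 * (real (root_count (Suc n) t z) powr q * real (root_count (Suc n) t z) powr q) * (real (Suc n) powr (- (a * q)) * real (Suc n) powr (- (a * q)))"
        by (simp only: power2_eq_square mult_ac)
      also have "\<dots> = real (root_count (Suc n) t z) powr (2 * q) * (C1\<^sup>2 * real (Suc n) powr (- (a * (2 * q))))"
      proof -
        have d: "x powr y * x powr y = x powr (2 * y)" for x y :: real by (simp flip: powr_add)
        have "2 * - (a * q) = - (a * (2 * q))" by simp
        then show ?thesis unfolding d by (simp only: mult_ac)
      qed
      finally show "(f n z)\<^sup>2 \<le> real (root_count (Suc n) t z) powr (2 * q) * (C1\<^sup>2 * real (Suc n) powr (- (a * (2 * q))))" .
    qed
    also have "\<dots> = (\<integral> z. real (root_count (Suc n) t z) powr (2 * q) \<partial>rrt) * (C1\<^sup>2 * real (Suc n) powr (- (a * (2 * q))))"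
      by simp
    also have "\<dots> \<le> C2 * real (Suc n) powr (a * (2 * q)) * (C1\<^sup>2 * real (Suc n) powr (- (a * (2 * q))))"
      unfolding a_def by (intro mult_right_mono C2(2)) auto
    also have "\<dots> = C1\<^sup>2 * C2 * (real (Suc n) powr (a * (2 * q)) * real (Suc n) powr (- (a * (2 * q))))"
      by (simp only: mult_ac)
    also have "real (Suc n) powr (a * (2 * q)) * real (Suc n) powr (- (a * (2 * q))) = 1"
      by (simp flip: powr_add del: of_nat_Suc)
    finally show ?thesis by simp
  qed
  have g_meas: "(\<lambda>z. 1 / Gamma (q + 1) * mass t z powr q) \<in> borel_measurable rrt"
    using t by measurable
  note UI = rrt.tendsto_expectation_of_bounded_second_moment[OF f_meas g_meas f_nonneg lim sq_int sq]
  have G: "0 < Gamma (q + 1)" using q by (intro Gamma_shift_pos) simp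
  from integrable_mult_right[OF UI(1), of "Gamma (q + 1)"] G
  show "integrable rrt (\<lambda>z. mass t z powr q)" by simp
  have Ef: "(\<integral> z. f n z \<partial>rrt) = exp (rising_err (Suc n) (a * q))" for n
  proof -
    have "(\<integral> z. f n z \<partial>rrt) = rising (a * q) (Suc n) * real (Suc n) powr (- (a * q))"
      using expectation_rising[of "Suc n" t q] t unfolding f_def a_def by simp
    also have "\<dots> = exp (rising_err (Suc n) (a * q)) * (real (Suc n) powr (a * q) * real (Suc n) powr (- (a * q)))"
      using aq by (subst rising_eq_powr) (simp_all add: mult.assoc)
    also have "real (Suc n) powr (a * q) * real (Suc n) powr (- (a * q)) = 1"
      by (simp flip: powr_add del: of_nat_Suc)
    finally show ?thesis by simp
  qed
  have "(\<lambda>n. \<integral> z. f n z \<partial>rrt) \<longlonglongrightarrow> 1 / Gamma (a * q + 1)"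
    unfolding Ef using aq by (intro LIMSEQ_Suc rising_err_limit) simp
  with UI(2) have "(\<integral> z. 1 / Gamma (q + 1) * mass t z powr q \<partial>rrt) = 1 / Gamma (a * q + 1)"
    by (rule LIMSEQ_unique)
  then show "(\<integral> z. mass t z powr q \<partial>rrt) = Gamma (q + 1) / Gamma (exp (- t) * q + 1)"
    using G by (simp add: a_def field_simps)
qed

section \<open>The cumulants\<close>

definition innovation_sum :: "real \<Rightarrow> nat \<Rightarrow> (nat \<Rightarrow> nat \<times> real) \<Rightarrow> real" where
  "innovation_sum h m z = (\<Sum>j<m. log_mass (real (Suc j) * h) z - exp (- h) * log_mass (real j * h) z)"

lemma borel_measurable_innovation_sum:
  assumes "0 \<le> h"
  shows "innovation_sum h m \<in> borel_measurable (root_alg (real m * h))"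
  unfolding innovation_sum_def[abs_def] using assms
  by (intro borel_measurable_sum borel_measurable_diff borel_measurable_times borel_measurable_const
      borel_measurable_log_mass_root_alg) (auto intro!: mult_right_mono)

lemma nn_integral_exp_log_mass:
  assumes "0 \<le> t" "0 \<le> q"
  shows "(\<integral>\<^sup>+ z. ennreal (exp (q * log_mass t z)) \<partial>rrt) = ennreal (Gamma (q + 1) / Gamma (exp (- t) * q + 1))"
proof -
  have q: "-1/4 \<le> q" using assms by simp
  have "(\<integral>\<^sup>+ z. ennreal (exp (q * log_mass t z)) \<partial>rrt) = (\<integral>\<^sup>+ z. ennreal (mass t z powr q) \<partial>rrt)"
  proof (rule nn_integral_cong_AE)
    show "AE z in rrt. ennreal (exp (q * log_mass t z)) = ennreal (mass t z powr q)"
      using AE_good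
    proof eventually_elim
      case (elim z)
      from good_convergent(3)[OF elim assms(1)] show ?case by (simp add: powr_def Y_def)
    qed
  qed
  also have "\<dots> = ennreal (\<integral> z. mass t z powr q \<partial>rrt)"
    by (rule nn_integral_eq_integral[OF moments_mass(1)[OF assms(1) q]]) simp
  finally show ?thesis by (simp only: moments_mass(2)[OF assms(1) q])
qed

text \<open>
  By the Markov property each new summand is independent of the previous ones and is distributed
  as \<open>log_mass h\<close>.
\<close>

lemma nn_integral_exp_innovation_sum:
  assumes h: "0 \<le> h" and q: "0 \<le> q"
  shows "(\<integral>\<^sup>+ z. ennreal (exp (q * innovation_sum h m z)) \<partial>rrt) = ennreal (Gamma (q + 1) / Gamma (exp (- h) * q + 1)) ^ m"
proof (induction m)
  case 0
  show ?case by (simp add: innovation_sum_def rrt.emeasure_space_1)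
next
  case (Suc m)
  define s where "s = real m * h"
  have s: "0 \<le> s" using h by (simp add: s_def)
  define F where "F = (\<lambda>x. ennreal (exp (q * innovation_sum h m (fst x))) * ennreal (exp (q * log_mass h (snd x))))"
  have m1: "(\<lambda>z. ennreal (exp (q * innovation_sum h m z))) \<in> borel_measurable (root_alg s)"
    using borel_measurable_innovation_sum[OF h, of m] by (simp add: s_def)
  have m2: "(\<lambda>z. ennreal (exp (q * log_mass h z))) \<in> borel_measurable rrt"
    using h by measurable
  have F: "F \<in> borel_measurable (root_alg s \<Otimes>\<^sub>M rrt)"
    unfolding F_def
    by (intro borel_measurable_times_ennreal measurable_compose[OF measurable_fst m1] measurable_compose[OF measurable_snd m2])
  have "(\<integral>\<^sup>+ z. ennreal (exp (q * innovation_sum h (Suc m) z)) \<partial>rrt) = (\<integral>\<^sup>+ z. F (z, shift s z) \<partial>rrt)"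
  proof (rule nn_integral_cong_AE)
    show "AE z in rrt. ennreal (exp (q * innovation_sum h (Suc m) z)) = F (z, shift s z)"
      using AE_good_at[OF s]
    proof eventually_elim
      case (elim z)
      have "real (Suc m) * h = s + h" by (simp add: s_def algebra_simps)
      then have "innovation_sum h (Suc m) z = innovation_sum h m z + log_mass h (shift s z)"
        using log_mass_shift[OF elim s h] by (simp add: innovation_sum_def s_def)
      then show ?case unfolding F_def by (simp add: distrib_left exp_add ennreal_mult)
    qed
  qed
  also have "\<dots> = (\<integral>\<^sup>+ z. (\<integral>\<^sup>+ z'. F (z, z') \<partial>rrt) \<partial>rrt)"
    by (rule nn_integral_shift[OF s F])
  also have "\<dots> = (\<integral>\<^sup>+ z. ennreal (exp (q * innovation_sum h m z)) * ennreal (Gamma (q + 1) / Gamma (exp (- h) * q + 1)) \<partial>rrt)"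
    unfolding F_def using nn_integral_exp_log_mass[OF h q] m2 by (simp add: nn_integral_cmult)
  also have "\<dots> = ennreal (Gamma (q + 1) / Gamma (exp (- h) * q + 1)) ^ m * ennreal (Gamma (q + 1) / Gamma (exp (- h) * q + 1))"
    using measurable_root_alg_imp[OF m1] by (simp add: nn_integral_multc Suc.IH)
  finally show ?case by (simp add: mult.commute)
qed

lemma Gamma_ratio_power_limit:
  assumes q: "0 \<le> q"
  shows "(\<lambda>n. (Gamma (q + 1) / Gamma (exp (- (1 / real (Suc n))) * q + 1)) ^ Suc n) \<longlonglongrightarrow> exp (q * Digamma (q + 1 :: real))"
proof -
  define \<phi> where "\<phi> = (\<lambda>h. - ln_Gamma (exp (- h) * q + 1 :: real))"
  have pos: "0 < exp (- h) * q + 1" for h using q by (intro add_nonneg_pos) auto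
  have "(\<phi> has_real_derivative q * Digamma (q + 1)) (at 0)"
    unfolding \<phi>_def
    by (rule derivative_eq_intros refl pos | simp add: q add_nonneg_pos)+
  then have d: "((\<lambda>h. (\<phi> (0 + h) - \<phi> 0) / h) \<longlongrightarrow> q * Digamma (q + 1)) (at 0)"
    by (simp only: DERIV_def)
  have "filterlim (\<lambda>n. 1 / real (Suc n)) (at 0) sequentially"
    unfolding filterlim_at by (intro conjI) (simp, real_asymp)
  from filterlim_compose[OF d this]
  have "(\<lambda>n. (\<phi> (0 + 1 / real (Suc n)) - \<phi> 0) / (1 / real (Suc n))) \<longlonglongrightarrow> q * Digamma (q + 1)" .
  then have "(\<lambda>n. exp (real (Suc n) * (\<phi> (1 / real (Suc n)) - \<phi> 0))) \<longlonglongrightarrow> exp (q * Digamma (q + 1))"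
    by (intro tendsto_exp) (simp add: mult.commute del: of_nat_Suc)
  moreover have "exp (real (Suc n) * (\<phi> (1 / real (Suc n)) - \<phi> 0)) = (Gamma (q + 1) / Gamma (exp (- (1 / real (Suc n))) * q + 1)) ^ Suc n" for n
  proof -
    have "exp (\<phi> h - \<phi> 0) = Gamma (q + 1) / Gamma (exp (- h) * q + 1)" for h
      using Gamma_real_pos_exp[OF pos[of h]] Gamma_real_pos_exp[OF pos[of 0]]
      by (simp add: \<phi>_def exp_diff exp_minus divide_inverse mult.commute)
    then show ?thesis by (simp only: exp_of_nat_mult)
  qed
  ultimately show ?thesis by simp
qed

text \<open>
  The sum equals \<open>exp (- h) * (Y 1 - Y 0)\<close> plus \<open>1 - exp (- h)\<close> times the sum of \<open>Y\<close> over the right end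
  points of the mesh, that is, asymptotically a Riemann sum of mesh \<open>h\<close>.  The right end points
  approach each time strictly from the right, so right-continuity and boundedness of the paths
  suffice for the convergence.
\<close>

lemma good_innovation_sum_limit:
  assumes z: "good z"
  shows "(\<lambda>n. innovation_sum (1 / real (Suc n)) (Suc n) z) \<longlonglongrightarrow> levy 1 z"
proof -
  define y where "y = (\<lambda>r. log_mass r z)"
  define S where "S = (\<lambda>n r. \<Sum>j<Suc n. indicator {real j / real (Suc n)..<real (Suc j) / real (Suc n)} r * y (real (Suc j) / real (Suc n)))"
  obtain B where B: "\<And>t. 0 \<le> t \<Longrightarrow> t \<le> real 1 \<Longrightarrow> \<bar>y t\<bar> \<le> B"
    using good_bounded[OF z, of 1] unfolding y_def by blast
  have B0: "0 \<le> B" using B[of 0] by simp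
  have S_eq: "S n r = (if r \<in> {0..<1} then y (real (Suc (nat \<lfloor>r * real (Suc n)\<rfloor>)) / real (Suc n)) else 0)" for n r
  proof -
    have N: "0 < real (Suc n)" by simp
    have iff: "r \<in> {real j / real (Suc n)..<real (Suc j) / real (Suc n)} \<longleftrightarrow> 0 \<le> r \<and> j = nat \<lfloor>r * real (Suc n)\<rfloor>" for j
    proof -
      have "r \<in> {real j / real (Suc n)..<real (Suc j) / real (Suc n)} \<longleftrightarrow> real j \<le> r * real (Suc n) \<and> r * real (Suc n) < real j + 1"
        using N by (simp add: pos_divide_le_eq pos_less_divide_eq del: of_nat_Suc) (simp add: add.commute)
      also have "\<dots> \<longleftrightarrow> \<lfloor>r * real (Suc n)\<rfloor> = int j"
        by (simp add: floor_eq_iff del: of_nat_Suc)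
      also have "\<dots> \<longleftrightarrow> 0 \<le> r \<and> j = nat \<lfloor>r * real (Suc n)\<rfloor>"
      proof (cases "0 \<le> r")
        case True
        then have "0 \<le> \<lfloor>r * real (Suc n)\<rfloor>" by simp
        with True show ?thesis by auto
      next
        case False
        then have "r * real (Suc n) < 0" using N by (simp add: mult_neg_pos del: of_nat_Suc)
        then have "\<lfloor>r * real (Suc n)\<rfloor> < 0" by linarith
        then have "\<lfloor>r * real (Suc n)\<rfloor> \<noteq> int j" by linarith
        with False show ?thesis by blast
      qed
      finally show ?thesis .
    qed
    define j0 where "j0 = nat \<lfloor>r * real (Suc n)\<rfloor>"
    have j0: "0 \<le> r \<Longrightarrow> j0 < Suc n \<longleftrightarrow> r < 1"
    proof -
      assume r: "0 \<le> r"
      have "j0 < Suc n \<longleftrightarrow> \<lfloor>r * real (Suc n)\<rfloor> < int (Suc n)" using r by (simp add: j0_def nat_less_iff del: of_nat_Suc)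
      also have "\<dots> \<longleftrightarrow> r * real (Suc n) < real (Suc n)" by (simp add: floor_less_iff del: of_nat_Suc)
      also have "\<dots> \<longleftrightarrow> r < 1" using N by (simp add: mult_less_cancel_right2 del: of_nat_Suc)
      finally show ?thesis .
    qed
    have "S n r = (\<Sum>j<Suc n. if j = j0 then (if 0 \<le> r then y (real (Suc j0) / real (Suc n)) else 0) else 0)"
      unfolding S_def
    proof (intro sum.cong refl)
      fix j
      have "indicator {real j / real (Suc n)..<real (Suc j) / real (Suc n)} r = (if 0 \<le> r \<and> j = j0 then 1 else 0 :: real)"
        unfolding indicator_def iff j0_def by simp
      then show "indicator {real j / real (Suc n)..<real (Suc j) / real (Suc n)} r * y (real (Suc j) / real (Suc n)) =
          (if j = j0 then (if 0 \<le> r then y (real (Suc j0) / real (Suc n)) else 0) else 0)"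
        by (simp del: of_nat_Suc)
    qed
    also have "\<dots> = (if j0 < Suc n then (if 0 \<le> r then y (real (Suc j0) / real (Suc n)) else 0) else 0)"
      by (simp only: sum.delta[OF finite_lessThan] lessThan_iff)
    also have "\<dots> = (if r \<in> {0..<1} then y (real (Suc j0) / real (Suc n)) else 0)"
      using j0 by auto
    finally show ?thesis unfolding j0_def .
  qed
  have lim_S: "(\<lambda>n. S n r) \<longlonglongrightarrow> indicator {0..<1} r * y r" for r
  proof (cases "r \<in> {0..<1}")
    case True
    have "(\<lambda>n. y (real (Suc (nat \<lfloor>r * real (Suc n)\<rfloor>)) / real (Suc n))) \<longlonglongrightarrow> y r"
    proof -
      have right: "(y \<longlongrightarrow> y r) (at_right r)" unfolding y_def using True by (intro good_right_continuous[OF z]) auto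
      have b: "r < real (Suc (nat \<lfloor>r * real (Suc n)\<rfloor>)) / real (Suc n) \<and> real (Suc (nat \<lfloor>r * real (Suc n)\<rfloor>)) / real (Suc n) \<le> r + 1 / real (Suc n)" for n
      proof -
        have e: "real (Suc (nat \<lfloor>r * real (Suc n)\<rfloor>)) = of_int \<lfloor>r * real (Suc n)\<rfloor> + 1"
          using True by (simp add: add.commute del: of_nat_Suc) (simp add: of_nat_nat)
        have "r * real (Suc n) < of_int \<lfloor>r * real (Suc n)\<rfloor> + 1" "of_int \<lfloor>r * real (Suc n)\<rfloor> + 1 \<le> r * real (Suc n) + 1"
          by linarith+
        then show ?thesis unfolding e by (simp add: pos_less_divide_eq pos_divide_le_eq distrib_right del: of_nat_Suc)
      qed
      have "filterlim (\<lambda>n. real (Suc (nat \<lfloor>r * real (Suc n)\<rfloor>)) / real (Suc n)) (at_right r) sequentially"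
        unfolding filterlim_at
      proof (intro conjI)
        show "\<forall>\<^sub>F n in sequentially. real (Suc (nat \<lfloor>r * real (Suc n)\<rfloor>)) / real (Suc n) \<in> {r<..} \<and> real (Suc (nat \<lfloor>r * real (Suc n)\<rfloor>)) / real (Suc n) \<noteq> r"
          using b by (intro always_eventually allI) (metis greaterThan_iff less_irrefl)
        show "(\<lambda>n. real (Suc (nat \<lfloor>r * real (Suc n)\<rfloor>)) / real (Suc n)) \<longlonglongrightarrow> r"
        proof -
          have lo: "\<forall>n. r \<le> real (Suc (nat \<lfloor>r * real (Suc n)\<rfloor>)) / real (Suc n)"
            and hi: "\<forall>n. real (Suc (nat \<lfloor>r * real (Suc n)\<rfloor>)) / real (Suc n) \<le> r + 1 / real (Suc n)"
            using b by (auto intro: less_imp_le simp del: of_nat_Suc)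
          have "(\<lambda>n. r + 1 / real (Suc n)) \<longlonglongrightarrow> r" by real_asymp
          from tendsto_sandwich[OF always_eventually[OF lo] always_eventually[OF hi] tendsto_const this] show ?thesis .
        qed
      qed
      from filterlim_compose[OF right this] show ?thesis .
    qed
    with True show ?thesis by (simp only: S_eq if_True indicator_simps(1) mult_1)
  next
    case False
    then have "S n r = 0" for n unfolding S_eq by (rule if_not_P)
    with False show ?thesis by simp
  qed
  have "(\<lambda>n. \<integral> r. S n r \<partial>lborel) \<longlonglongrightarrow> (\<integral> r. indicator {0..<1} r * y r \<partial>lborel)"
  proof (rule integral_dominated_convergence[where w="\<lambda>r. indicator {0..1} r * B"])
    have "set_integrable lborel {0..<1} y"
      by (rule set_integrable_subset[OF good_set_integrable[OF z order.refl, of 1, folded y_def]]) auto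
    then show "(\<lambda>r. indicator {0..<1} r * y r) \<in> borel_measurable lborel"
      unfolding set_integrable_def by (auto dest: borel_measurable_integrable)
    show "S n \<in> borel_measurable lborel" for n unfolding S_def by measurable
    show "integrable lborel (\<lambda>r. indicator {0..1::real} r * B)"
      by (intro integrable_mult_left integrable_real_indicator) auto
    show "AE r in lborel. (\<lambda>n. S n r) \<longlonglongrightarrow> indicator {0..<1} r * y r" using lim_S by simp
    show "AE r in lborel. norm (S n r) \<le> indicator {0..1} r * B" for n
    proof (rule AE_I2)
      fix r
      show "norm (S n r) \<le> indicator {0..1} r * B"
      proof (cases "r \<in> {0..<1}")
        case True
        have "nat \<lfloor>r * real (Suc n)\<rfloor> < Suc n"
        proof -
          have "r * real (Suc n) < 1 * real (Suc n)" using True by (intro mult_strict_right_mono) auto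
          then have "\<lfloor>r * real (Suc n)\<rfloor> < int (Suc n)" by (simp add: floor_less_iff del: of_nat_Suc)
          then show ?thesis by linarith
        qed
        then have "real (Suc (nat \<lfloor>r * real (Suc n)\<rfloor>)) \<le> real (Suc n)" by (simp only: of_nat_le_iff Suc_leI)
        then have "real (Suc (nat \<lfloor>r * real (Suc n)\<rfloor>)) / real (Suc n) \<le> 1"
          by (simp only: divide_le_eq_1_pos[OF of_nat_0_less_iff[THEN iffD2, OF zero_less_Suc]])
        then have "\<bar>y (real (Suc (nat \<lfloor>r * real (Suc n)\<rfloor>)) / real (Suc n))\<bar> \<le> B" by (intro B) auto
        with True show ?thesis by (simp add: S_eq del: of_nat_Suc)
      qed (auto simp: S_eq indicator_def B0)
    qed
  qed
  moreover have "(\<integral> r. S n r \<partial>lborel) = 1 / real (Suc n) * (\<Sum>j<Suc n. y (real (Suc j) / real (Suc n)))" for n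
  proof -
    have len: "measure lborel {real j / real (Suc n)..<real (Suc j) / real (Suc n)} = 1 / real (Suc n)" for j
      by (subst measure_lborel_Ico) (auto intro!: divide_right_mono simp: diff_divide_distrib[symmetric])
    have fin: "emeasure lborel {real j / real (Suc n)..<real (Suc j) / real (Suc n)} < \<infinity>" for j
      by (subst emeasure_lborel_Ico) (auto intro!: divide_right_mono)
    have "(\<integral> r. S n r \<partial>lborel) = (\<Sum>j<Suc n. \<integral> r. indicator {real j / real (Suc n)..<real (Suc j) / real (Suc n)} r * y (real (Suc j) / real (Suc n)) \<partial>lborel)"
      unfolding S_def using fin by (intro Bochner_Integration.integral_sum integrable_mult_left integrable_real_indicator) auto
    also have "\<dots> = (\<Sum>j<Suc n. 1 / real (Suc n) * y (real (Suc j) / real (Suc n)))"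
    proof (intro sum.cong refl)
      fix j
      have "(\<integral> r. indicator A r * v \<partial>lborel) = measure lborel A * v" for A :: "real set" and v
        by simp
      then show "(\<integral> r. indicator {real j / real (Suc n)..<real (Suc j) / real (Suc n)} r * y (real (Suc j) / real (Suc n)) \<partial>lborel) =
          1 / real (Suc n) * y (real (Suc j) / real (Suc n))"
        by (simp only: len)
    qed
    finally show ?thesis by (simp only: sum_distrib_left)
  qed
  moreover have "(\<integral> r. indicator {0..<1} r * y r \<partial>lborel) = (LBINT r:{0..1}. y r)"
  proof -
    have i: "set_integrable lborel {0..1} y" unfolding y_def by (rule good_set_integrable[OF z]) simp
    have i': "set_integrable lborel {0..<1} y" by (rule set_integrable_subset[OF i]) auto
    have "AE v in lborel. v \<noteq> (1::real)" by (rule AE_lborel_singleton)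
    then have "AE v in lborel. indicator {0..<1} v * y v = indicator {0..1} v *\<^sub>R y v"
      by eventually_elim (auto simp: indicator_def)
    then show ?thesis unfolding set_lebesgue_integral_def
      using i i' unfolding set_integrable_def
      by (intro Bochner_Integration.integral_cong_AE) (auto dest: borel_measurable_integrable)
  qed
  ultimately have R: "(\<lambda>n. 1 / real (Suc n) * (\<Sum>j<Suc n. y (real (Suc j) / real (Suc n)))) \<longlonglongrightarrow> (LBINT r:{0..1}. y r)"
    by simp
  have lim1: "(\<lambda>n. exp (- (1 / real (Suc n)))) \<longlonglongrightarrow> 1" by real_asymp
  have lim2: "(\<lambda>n. real (Suc n) * (1 - exp (- (1 / real (Suc n))))) \<longlonglongrightarrow> 1" by real_asymp
  have "(\<lambda>n. exp (- (1 / real (Suc n))) * (y 1 - y 0) +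
      (real (Suc n) * (1 - exp (- (1 / real (Suc n))))) * (1 / real (Suc n) * (\<Sum>j<Suc n. y (real (Suc j) / real (Suc n)))))
      \<longlonglongrightarrow> 1 * (y 1 - y 0) + 1 * (LBINT r:{0..1}. y r)"
    by (intro tendsto_add tendsto_mult lim1 lim2 R tendsto_const)
  moreover have "exp (- (1 / real (Suc n))) * (y 1 - y 0) +
      (real (Suc n) * (1 - exp (- (1 / real (Suc n))))) * (1 / real (Suc n) * (\<Sum>j<Suc n. y (real (Suc j) / real (Suc n))))
      = innovation_sum (1 / real (Suc n)) (Suc n) z" for n
  proof -
    define h where "h = 1 / real (Suc n)"
    define T where "T = (\<Sum>j<Suc n. y (real (Suc j) * h))"
    have hn: "real (Suc n) * h = 1" by (simp add: h_def del: of_nat_Suc)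
    have "(\<Sum>j<Suc n. y (real (Suc j) * h) - y (real j * h)) = y (real (Suc n) * h) - y (real 0 * h)"
      by (rule sum_lessThan_telescope[of "\<lambda>j. y (real j * h)"])
    then have tel: "(\<Sum>j<Suc n. y (real (Suc j) * h) - y (real j * h)) = y 1 - y 0" by (simp only: hn of_nat_0 mult_zero_left)
    have "innovation_sum h (Suc n) z = (\<Sum>j<Suc n. (1 - exp (- h)) * y (real (Suc j) * h) + exp (- h) * (y (real (Suc j) * h) - y (real j * h)))"
      unfolding innovation_sum_def y_def by (intro sum.cong refl) (simp add: algebra_simps del: of_nat_Suc)
    also have "\<dots> = (1 - exp (- h)) * T + exp (- h) * (y 1 - y 0)"
      unfolding sum.distrib sum_distrib_left[symmetric] tel T_def ..
    finally have i: "innovation_sum h (Suc n) z = (1 - exp (- h)) * T + exp (- h) * (y 1 - y 0)" .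
    have T: "(\<Sum>j<Suc n. y (real (Suc j) / real (Suc n))) = T" unfolding T_def h_def by simp
    have "(real (Suc n) * (1 - exp (- h))) * (h * T) = (real (Suc n) * h) * ((1 - exp (- h)) * T)"
      by (simp only: mult_ac)
    then have "(real (Suc n) * (1 - exp (- h))) * (h * T) = (1 - exp (- h)) * T" by (simp only: hn mult_1)
    then show ?thesis unfolding T h_def[symmetric] i by simp
  qed
  moreover have "1 * (y 1 - y 0) + 1 * (LBINT r:{0..1}. y r) = levy 1 z"
    using good_levy_0[OF z] by (simp add: L_def y_def) (simp add: Y_def)
  ultimately show ?thesis by simp
qed

text \<open>
  Exponential moments converge along the innovation sums because those for \<open>2 * q\<close> are bounded.
\<close>

theorem cumulant_levy:
  assumes q: "0 \<le> q"
  shows "integrable rrt (\<lambda>z. exp (q * levy 1 z))" and "(\<integral> z. exp (q * levy 1 z) \<partial>rrt) = exp (q * Digamma (q + 1))"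
proof -
  define f where "f = (\<lambda>n z. exp (q * innovation_sum (1 / real (Suc n)) (Suc n) z))"
  define c where "c = (\<lambda>q n. (Gamma (q + 1) / Gamma (exp (- (1 / real (Suc n))) * q + 1)) ^ Suc n :: real)"
  have pos: "0 \<le> Gamma (p + 1) / Gamma (exp (- h) * p + 1)" if "0 \<le> p" for p h :: real
  proof -
    have "0 < p + 1" "0 < exp (- h) * p + 1" using that by (auto intro: add_nonneg_pos)
    then show ?thesis by (intro divide_nonneg_nonneg less_imp_le Gamma_real_pos)
  qed
  have e: "(\<integral>\<^sup>+ z. ennreal (exp (p * innovation_sum (1 / real (Suc n)) (Suc n) z)) \<partial>rrt) = ennreal (c p n)" if p: "0 \<le> p" for p n
    unfolding c_def ennreal_power[OF pos[OF p], symmetric]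
    by (rule nn_integral_exp_innovation_sum) (use p in auto)
  have c0: "0 \<le> c p n" if "0 \<le> p" for p n unfolding c_def using pos[OF that] by (intro zero_le_power)
  have im: "innovation_sum (1 / real (Suc n)) (Suc n) \<in> borel_measurable rrt" for n
    by (rule measurable_root_alg_imp[OF borel_measurable_innovation_sum]) simp
  have int: "integrable rrt (\<lambda>z. exp (p * innovation_sum (1 / real (Suc n)) (Suc n) z))"
    and E: "(\<integral> z. exp (p * innovation_sum (1 / real (Suc n)) (Suc n) z) \<partial>rrt) = c p n" if p: "0 \<le> p" for p n
  proof -
    have m: "(\<lambda>z. exp (p * innovation_sum (1 / real (Suc n)) (Suc n) z)) \<in> borel_measurable rrt"
      using im by measurable
    show "integrable rrt (\<lambda>z. exp (p * innovation_sum (1 / real (Suc n)) (Suc n) z))"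
      using m by (rule integrableI_nonneg) (use e[OF p, of n] in auto)
    show "(\<integral> z. exp (p * innovation_sum (1 / real (Suc n)) (Suc n) z) \<partial>rrt) = c p n"
      using m e[OF p, of n] c0[OF p] by (subst integral_eq_nn_integral) auto
  qed
  have c_lim: "(\<lambda>n. c p n) \<longlonglongrightarrow> exp (p * Digamma (p + 1))" if "0 \<le> p" for p
    unfolding c_def by (rule Gamma_ratio_power_limit[OF that])
  have "Bseq (\<lambda>n. c (2 * q) n)" using c_lim[of "2 * q"] q by (intro convergent_imp_Bseq convergentI) auto
  then obtain K where K: "\<And>n. \<bar>c (2 * q) n\<bar> \<le> K" by (auto simp: Bseq_def)
  have sq: "(f n z)\<^sup>2 = exp ((2 * q) * innovation_sum (1 / real (Suc n)) (Suc n) z)" for n z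
    unfolding f_def power2_eq_square by (simp add: mult.assoc flip: exp_add)
  have fm: "f n \<in> borel_measurable rrt" for n unfolding f_def using im by measurable
  have gm: "(\<lambda>z. exp (q * levy 1 z)) \<in> borel_measurable rrt" by measurable
  have f0: "0 \<le> f n z" for n z by (simp add: f_def)
  have lim: "AE z in rrt. (\<lambda>n. f n z) \<longlonglongrightarrow> exp (q * levy 1 z)"
    using AE_good by eventually_elim (unfold f_def, intro tendsto_intros good_innovation_sum_limit)
  have sqi: "integrable rrt (\<lambda>z. (f n z)\<^sup>2)" for n unfolding sq using q by (intro int) simp
  have sqb: "(\<integral> z. (f n z)\<^sup>2 \<partial>rrt) \<le> K" for n
    unfolding sq using K[of n] q by (subst E) auto
  note UI = rrt.tendsto_expectation_of_bounded_second_moment[OF fm gm f0 lim sqi sqb]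
  show "integrable rrt (\<lambda>z. exp (q * levy 1 z))" by (rule UI(1))
  have "(\<lambda>n. \<integral> z. f n z \<partial>rrt) \<longlonglongrightarrow> exp (q * Digamma (q + 1))"
    unfolding f_def E[OF q] by (rule c_lim[OF q])
  with UI(2) show "(\<integral> z. exp (q * levy 1 z) \<partial>rrt) = exp (q * Digamma (q + 1))"
    by (rule LIMSEQ_unique)
qed

section \<open>Integrals depending holomorphically on a parameter\<close>

lemma norm_exp_minus_1_le:
  fixes u :: complex
  shows "norm (exp u - 1) \<le> norm u * exp (norm u)"
proof -
  have "norm (exp u - exp 0) \<le> exp (norm u) * norm (u - 0)"
  proof (rule field_differentiable_bound[where S="cball 0 (norm u)" and f=exp and f'=exp])
    show "(exp has_field_derivative exp z) (at z within cball 0 (norm u))" for z :: complex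
      by (rule DERIV_subset[OF DERIV_exp]) simp
    fix z :: complex assume "z \<in> cball 0 (norm u)"
    then have "Re z \<le> norm u" using complex_Re_le_cmod[of z] by (simp add: dist_norm)
    then show "norm (exp z) \<le> exp (norm u)" by simp
  qed simp_all
  then show ?thesis by (simp add: mult.commute)
qed

text \<open>
  Difference quotients of \<open>exp (w * g x)\<close> at \<open>w\<close> are dominated by the two exponentials with exponents
  slightly to the left and right of \<open>Re w\<close>, so differentiation under the integral is justified.
\<close>

lemma holomorphic_on_exponential_integral:
  fixes h :: "'a \<Rightarrow> complex" and g :: "'a \<Rightarrow> real"
  assumes g [measurable]: "g \<in> borel_measurable M" and h [measurable]: "h \<in> borel_measurable M"
    and int: "\<And>c. a < c \<Longrightarrow> c < b \<Longrightarrow> integrable M (\<lambda>x. exp (c * g x) * norm (h x))"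
  shows "(\<lambda>w. \<integral> x. exp (w * of_real (g x)) * h x \<partial>M) holomorphic_on {w. a < Re w \<and> Re w < b}"
proof (rule holomorphic_onI)
  fix w assume w: "w \<in> {w. a < Re w \<and> Re w < b}"
  define F where "F = (\<lambda>w. \<integral> x. exp (w * of_real (g x)) * h x \<partial>M)"
  define D where "D = (\<integral> x. of_real (g x) * (exp (w * of_real (g x)) * h x) \<partial>M)"
  define \<delta> where "\<delta> = min (Re w - a) (b - Re w) / 4"
  have d: "0 < \<delta>" using w by (simp add: \<delta>_def)
  have rng: "a < Re w + c \<and> Re w + c < b" if "\<bar>c\<bar> \<le> 2 * \<delta>" for c
  proof -
    have "4 * \<delta> \<le> Re w - a" "4 * \<delta> \<le> b - Re w" by (simp_all add: \<delta>_def)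
    then show ?thesis using that d by auto
  qed
  have normI: "norm (exp (v * of_real (g x)) * h x) = exp (Re v * g x) * norm (h x)" for v x
    by (simp add: norm_mult)
  have intI: "integrable M (\<lambda>x. exp (v * of_real (g x)) * h x)" if "a < Re v" "Re v < b" for v
  proof (rule Bochner_Integration.integrable_bound[OF int[OF that]])
    show "AE x in M. norm (exp (v * of_real (g x)) * h x) \<le> norm (exp (Re v * g x) * norm (h x))"
      by (simp add: normI abs_mult)
  qed measurable
  define W where "W = (\<lambda>x. 1 / \<delta> * (exp ((Re w + 2 * \<delta>) * g x) * norm (h x) + exp ((Re w + - (2 * \<delta>)) * g x) * norm (h x)))"
  have intW: "integrable M W" unfolding W_def
    using rng[of "2 * \<delta>"] rng[of "- (2 * \<delta>)"] d
    by (intro integrable_mult_right Bochner_Integration.integrable_add int) auto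
  have bound: "norm ((exp (k * of_real (g x)) - 1) / k * (exp (w * of_real (g x)) * h x)) \<le> W x"
    if k: "k \<noteq> 0" "norm k \<le> \<delta>" for k x
  proof -
    have 1: "norm ((exp (k * of_real (g x)) - 1) / k) \<le> \<bar>g x\<bar> * exp (\<delta> * \<bar>g x\<bar>)"
    proof -
      have "norm (exp (k * of_real (g x)) - 1) \<le> norm (k * of_real (g x)) * exp (norm (k * of_real (g x)))"
        by (rule norm_exp_minus_1_le)
      also have "\<dots> \<le> (norm k * \<bar>g x\<bar>) * exp (\<delta> * \<bar>g x\<bar>)"
        using k by (intro mult_mono) (auto simp: norm_mult intro!: mult_right_mono)
      finally show ?thesis using k by (simp add: norm_divide pos_divide_le_eq mult_ac)
    qed
    have 2: "\<bar>g x\<bar> \<le> 1 / \<delta> * exp (\<delta> * \<bar>g x\<bar>)"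
    proof -
      have "\<delta> * \<bar>g x\<bar> \<le> exp (\<delta> * \<bar>g x\<bar>)"
        using exp_ge_add_one_self[of "\<delta> * \<bar>g x\<bar>"] by linarith
      then show ?thesis using d by (simp add: field_simps)
    qed
    have "norm ((exp (k * of_real (g x)) - 1) / k) \<le> 1 / \<delta> * exp (\<delta> * \<bar>g x\<bar>) * exp (\<delta> * \<bar>g x\<bar>)"
      by (rule order.trans[OF 1 mult_right_mono[OF 2]]) simp
    also have "\<dots> = 1 / \<delta> * exp (2 * \<delta> * \<bar>g x\<bar>)" by (simp flip: exp_add)
    also have "\<dots> \<le> 1 / \<delta> * (exp (2 * \<delta> * g x) + exp (- (2 * \<delta>) * g x))"
      using d by (intro mult_left_mono) (auto simp: abs_real_def)
    finally have 3: "norm ((exp (k * of_real (g x)) - 1) / k) \<le> 1 / \<delta> * (exp (2 * \<delta> * g x) + exp (- (2 * \<delta>) * g x))" .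
    have "norm ((exp (k * of_real (g x)) - 1) / k * (exp (w * of_real (g x)) * h x)) =
        norm ((exp (k * of_real (g x)) - 1) / k) * (exp (Re w * g x) * norm (h x))"
      by (simp only: norm_mult[of "(exp (k * of_real (g x)) - 1) / k"] normI)
    also have "\<dots> \<le> 1 / \<delta> * (exp (2 * \<delta> * g x) + exp (- (2 * \<delta>) * g x)) * (exp (Re w * g x) * norm (h x))"
      using 3 by (intro mult_right_mono) auto
    also have "\<dots> = W x"
      unfolding W_def distrib_right[of _ _ "g x"] exp_add by (simp add: algebra_simps)
    finally show ?thesis .
  qed
  have "(F has_field_derivative D) (at w)"
    unfolding DERIV_def tendsto_at_iff_sequentially
  proof (intro allI impI)
    fix X :: "nat \<Rightarrow> complex" assume X: "\<forall>i. X i \<in> UNIV - {0}" "X \<longlonglongrightarrow> 0"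
    have "\<forall>\<^sub>F n in sequentially. norm (X n) < \<delta>"
      using tendstoD[OF X(2) d] by (simp add: dist_norm)
    then obtain N where N: "\<And>n. N \<le> n \<Longrightarrow> norm (X n) < \<delta>" unfolding eventually_sequentially by blast
    have Xn: "X (n + N) \<noteq> 0" "norm (X (n + N)) \<le> \<delta>" for n using X(1) N[of "n + N"] by auto
    have quot: "(F (w + X (n + N)) - F w) / X (n + N) =
      (\<integral> x. (exp (X (n + N) * of_real (g x)) - 1) / X (n + N) * (exp (w * of_real (g x)) * h x) \<partial>M)" for n
    proof -
      have "\<bar>Re (X (n + N))\<bar> \<le> \<delta>" using abs_Re_le_cmod[of "X (n + N)"] Xn(2)[of n] by linarith
      then have r: "a < Re (w + X (n + N))" "Re (w + X (n + N)) < b" using rng[of "Re (X (n + N))"] d by auto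
      have "F (w + X (n + N)) - F w = (\<integral> x. exp ((w + X (n + N)) * of_real (g x)) * h x - exp (w * of_real (g x)) * h x \<partial>M)"
        unfolding F_def using r w by (intro Bochner_Integration.integral_diff[symmetric] intI) auto
      also have "\<dots> / X (n + N) = (\<integral> x. (exp ((w + X (n + N)) * of_real (g x)) * h x - exp (w * of_real (g x)) * h x) / X (n + N) \<partial>M)"
        by simp
      also have "\<dots> = (\<integral> x. (exp (X (n + N) * of_real (g x)) - 1) / X (n + N) * (exp (w * of_real (g x)) * h x) \<partial>M)"
        by (intro Bochner_Integration.integral_cong refl) (simp add: distrib_right exp_add divide_simps algebra_simps)
      finally show ?thesis .
    qed
    have "(\<lambda>n. \<integral> x. (exp (X (n + N) * of_real (g x)) - 1) / X (n + N) * (exp (w * of_real (g x)) * h x) \<partial>M) \<longlonglongrightarrow> D"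
      unfolding D_def
    proof (rule integral_dominated_convergence[where w=W])
      show "AE x in M. (\<lambda>n. (exp (X (n + N) * of_real (g x)) - 1) / X (n + N) * (exp (w * of_real (g x)) * h x))
          \<longlonglongrightarrow> of_real (g x) * (exp (w * of_real (g x)) * h x)"
      proof (rule AE_I2)
        fix x
        have "((\<lambda>k. exp (k * complex_of_real (g x))) has_field_derivative of_real (g x)) (at 0)"
          by (auto intro!: derivative_eq_intros)
        then have "((\<lambda>k. (exp (k * complex_of_real (g x)) - 1) / k) \<longlongrightarrow> of_real (g x)) (at 0)"
          by (simp add: DERIV_def)
        moreover have "filterlim (\<lambda>n. X (n + N)) (at 0) sequentially"
          unfolding filterlim_at using Xn LIMSEQ_ignore_initial_segment[OF X(2), of N] by simp
        ultimately have "(\<lambda>n. (exp (X (n + N) * of_real (g x)) - 1) / X (n + N)) \<longlonglongrightarrow> of_real (g x)"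
          by (rule filterlim_compose)
        then show "(\<lambda>n. (exp (X (n + N) * of_real (g x)) - 1) / X (n + N) * (exp (w * of_real (g x)) * h x))
          \<longlonglongrightarrow> of_real (g x) * (exp (w * of_real (g x)) * h x)"
          by (intro tendsto_mult tendsto_const)
      qed
      show "AE x in M. norm ((exp (X (n + N) * of_real (g x)) - 1) / X (n + N) * (exp (w * of_real (g x)) * h x)) \<le> W x" for n
        by (intro AE_I2 bound Xn)
      show "(\<lambda>x. of_real (g x) * (exp (w * of_real (g x)) * h x)) \<in> borel_measurable M" by measurable
      show "(\<lambda>x. (exp (X (n + N) * of_real (g x)) - 1) / X (n + N) * (exp (w * of_real (g x)) * h x)) \<in> borel_measurable M" for n
        by measurable
      show "integrable M W" by (rule intW)
    qed
    then have "(\<lambda>n. (F (w + X (n + N)) - F w) / X (n + N)) \<longlonglongrightarrow> D" unfolding quot .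
    then have "(\<lambda>n. (F (w + X n) - F w) / X n) \<longlonglongrightarrow> D" by (rule LIMSEQ_offset)
    then show "((\<lambda>h. (F (w + h) - F w) / h) \<circ> X) \<longlonglongrightarrow> D" by (simp add: o_def)
  qed
  then show "(\<lambda>w. \<integral> x. exp (w * of_real (g x)) * h x \<partial>M) field_differentiable at w within {w. a < Re w \<and> Re w < b}"
    unfolding F_def[symmetric] field_differentiable_def by (auto intro: has_field_derivative_at_within)
qed

lemma open_vertical_strip: "open {w. a < Re w \<and> Re w < b}"
  using open_Int[OF open_halfspace_Re_gt[of a] open_halfspace_Re_lt[of b]] by (simp add: Collect_conj_eq)

lemma connected_vertical_strip: "connected {w. a < Re w \<and> Re w < b}"
  using convex_Int[OF convex_halfspace_Re_gt[of a] convex_halfspace_Re_lt[of b]]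
  by (intro convex_connected) (simp add: Collect_conj_eq)

text \<open>
  The real segment of the strip has a limit point in it, so the identity theorem applies.
\<close>

lemma vertical_strip_unique:
  assumes "f holomorphic_on {w. a < Re w \<and> Re w < b}" "g holomorphic_on {w. a < Re w \<and> Re w < b}"
    and eq: "\<And>c. a < c \<Longrightarrow> c < b \<Longrightarrow> f (of_real c) = g (of_real c)"
    and w: "a < Re w" "Re w < b"
  shows "f w = g w"
proof -
  let ?S = "{w. a < Re w \<and> Re w < b}"
  define m where "m = (a + b) / 2"
  have m: "a < m" "m < b" using w by (auto simp: m_def)
  have "f w - g w = 0"
  proof (rule analytic_continuation[where f="\<lambda>w. f w - g w" and S="?S" and U="complex_of_real ` {a<..<b}" and \<xi>="of_real m"])
    show "(\<lambda>w. f w - g w) holomorphic_on ?S" using assms by (intro holomorphic_on_diff)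
    show "complex_of_real m islimpt complex_of_real ` {a<..<b}"
      unfolding islimpt_approachable
    proof (intro allI impI)
      fix e :: real assume e: "0 < e"
      obtain d where d: "0 < d" "d \<le> e" "d \<le> b - m"
      proof
        show "0 < min e (b - m)" "min e (b - m) \<le> e" "min e (b - m) \<le> b - m" using e m by auto
      qed
      define x where "x = m + d / 2"
      have "x \<in> {a<..<b}" "x \<noteq> m" "\<bar>x - m\<bar> < e"
        using d m by (auto simp: x_def)
      then show "\<exists>x'\<in>complex_of_real ` {a<..<b}. x' \<noteq> of_real m \<and> dist x' (of_real m) < e"
        by (intro bexI[of _ "of_real x"]) (auto simp: dist_of_real dist_real_def)
    qed
  qed (use open_vertical_strip connected_vertical_strip eq w m in auto)
  then show ?thesis by simp
qed

section \<open>A complex gamma integral\<close>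

lemma has_bochner_integral_Gamma_real:
  fixes s \<rho> :: real
  assumes s: "0 < s" and r: "0 < \<rho>"
  shows "has_bochner_integral lborel (\<lambda>x. indicator {0<..} x * (x powr (s - 1) * exp (- (\<rho> * x)))) (Gamma s * \<rho> powr (- s))"
proof -
  define f where "f = (\<lambda>x::real. indicator {0<..} x * (x powr (s - 1) * exp (- x)))"
  have "has_bochner_integral lborel f (Gamma s)"
  proof (rule has_bochner_integral_nn_integral)
    show "0 \<le> Gamma s" using s by (simp add: Gamma_real_pos less_imp_le)
    show "(\<integral>\<^sup>+ x. ennreal (f x) \<partial>lborel) = ennreal (Gamma s)"
      unfolding Gamma_conv_nn_integral_real[OF s]
    proof (rule nn_integral_cong_AE)
      have "AE x in lborel. x \<noteq> (0::real)" by (rule AE_lborel_singleton)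
      then show "AE x in lborel. ennreal (f x) = ennreal (indicator {0..} x * x powr (s - 1) / exp x)"
        by eventually_elim (auto simp: f_def indicator_def exp_minus field_simps)
    qed
  qed (auto simp: f_def)
  then have "has_bochner_integral lborel (\<lambda>x. f (0 + \<rho> * x)) (Gamma s /\<^sub>R \<bar>\<rho>\<bar>)"
    using r by (subst lborel_has_bochner_integral_real_affine_iff[symmetric]) auto
  then have "has_bochner_integral lborel (\<lambda>x. \<rho> powr (1 - s) * f (0 + \<rho> * x)) (\<rho> powr (1 - s) * (Gamma s /\<^sub>R \<bar>\<rho>\<bar>))"
    by (rule has_bochner_integral_mult_right)
  moreover have "\<rho> powr (1 - s) * f (0 + \<rho> * x) = indicator {0<..} x * (x powr (s - 1) * exp (- (\<rho> * x)))" for x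
  proof (cases "0 < x")
    case True
    have "\<rho> powr (1 - s) * \<rho> powr (s - 1) = 1" using r by (simp flip: powr_add)
    then show ?thesis using True r by (simp add: f_def powr_mult zero_less_mult_iff mult.assoc[symmetric])
  next
    case False
    then show ?thesis using r by (simp add: f_def zero_less_mult_iff)
  qed
  moreover have "\<rho> powr (1 - s) * (Gamma s /\<^sub>R \<bar>\<rho>\<bar>) = Gamma s * \<rho> powr (- s)"
    using r by (simp add: powr_diff powr_minus field_simps)
  ultimately show ?thesis by (simp only:)
qed

text \<open>
  Both sides are holomorphic in the rate \<open>\<rho> * cis \<phi>\<close> on a right half-plane and agree for real rates.
\<close>

lemma Gamma_integral_rotated:
  fixes s \<rho> \<phi> :: real
  assumes s: "0 < s" and r: "0 < \<rho>" and phi: "\<bar>\<phi>\<bar> < pi / 2"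
  shows "integrable lborel (\<lambda>x. indicator {0<..} x * (of_real (x powr (s - 1)) * exp (- (of_real \<rho> * cis \<phi> * of_real x))) :: complex)"
    and "(\<integral> x. indicator {0<..} x * (of_real (x powr (s - 1)) * exp (- (of_real \<rho> * cis \<phi> * of_real x))) \<partial>lborel)
       = of_real (Gamma s * \<rho> powr (- s)) * cis (- (s * \<phi>))"
proof -
  define h where "h = (\<lambda>x::real. indicator {0<..} x * complex_of_real (x powr (s - 1)))"
  define H where "H = (\<lambda>w. \<integral> x. exp (w * of_real x) * h x \<partial>lborel)"
  define \<eta> where "\<eta> = of_real \<rho> * cis \<phi>"
  have Re_eta: "Re \<eta> = \<rho> * cos \<phi>" by (simp add: \<eta>_def)
  have cos: "0 < cos \<phi>" using phi by (intro cos_gt_zero_pi) auto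
  have eta: "0 < Re \<eta>" using cos r by (simp add: Re_eta)
  define b where "b = - (Re \<eta> + 1)"
  have hm: "h \<in> borel_measurable lborel" unfolding h_def by measurable
  have nh: "exp (c * x) * norm (h x) = indicator {0<..} x * (x powr (s - 1) * exp (- (- c * x)))" for c x
    by (auto simp: h_def indicator_def)
  have int: "integrable lborel (\<lambda>x. exp (c * x) * norm (h x))" if "c < 0" for c
    unfolding nh using has_bochner_integral_Gamma_real[OF s, of "- c"] that by (auto simp: has_bochner_integral_iff)
  have hol: "H holomorphic_on {w. b < Re w \<and> Re w < 0}"
    unfolding H_def using hm int by (intro holomorphic_on_exponential_integral) auto
  define K where "K = (\<lambda>w. of_real (Gamma s) * exp (- of_real s * Ln (- w)))"
  have nonpos: "- w \<notin> \<real>\<^sub>\<le>\<^sub>0" if "Re w < 0" for w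
    using that by (simp add: complex_nonpos_Reals_iff)
  have holK: "K holomorphic_on {w. b < Re w \<and> Re w < 0}"
    unfolding K_def by (intro holomorphic_intros) (auto simp: complex_nonneg_Reals_iff complex_nonpos_Reals_iff)
  have "H (- \<eta>) = K (- \<eta>)"
  proof (rule vertical_strip_unique[OF hol holK])
    fix c assume c: "b < c" "c < 0"
    have "H (of_real c) = (\<integral> x. of_real (indicator {0<..} x * (x powr (s - 1) * exp (- (- c * x)))) \<partial>lborel)"
      unfolding H_def h_def
      by (intro Bochner_Integration.integral_cong refl) (auto simp: indicator_def exp_of_real mult.commute simp flip: of_real_mult)
    also have "\<dots> = of_real (Gamma s * (- c) powr (- s))"
    proof -
      have "0 < - c" using c by simp
      from has_bochner_integral_integral_eq[OF has_bochner_integral_Gamma_real[OF s this]]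
      show ?thesis by (simp only: integral_complex_of_real)
    qed
    also have "\<dots> = K (of_real c)"
    proof -
      have "Ln (- complex_of_real c) = of_real (ln (- c))"
        using Ln_of_real[of "- c"] c by simp
      then have "K (of_real c) = of_real (Gamma s) * exp (of_real (- s * ln (- c)))"
        unfolding K_def by simp
      also have "\<dots> = of_real (Gamma s * exp (- s * ln (- c)))"
        unfolding exp_of_real by simp
      finally show ?thesis using c by (simp add: powr_def)
    qed
    finally show "H (of_real c) = K (of_real c)" .
  qed (use eta in \<open>auto simp: b_def\<close>)
  moreover have "K (- \<eta>) = of_real (Gamma s * \<rho> powr (- s)) * cis (- (s * \<phi>))"
  proof -
    have "\<eta> = exp (of_real (ln \<rho>) + \<i> * of_real \<phi>)"
      using r by (simp add: \<eta>_def exp_add exp_of_real cis_conv_exp)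
    then have "Ln \<eta> = of_real (ln \<rho>) + \<i> * of_real \<phi>"
      using phi pi_gt_zero by (simp only:) (rule Ln_exp, auto)
    then have "K (- \<eta>) = of_real (Gamma s) * exp (of_real (- s * ln \<rho>) + \<i> * of_real (- (s * \<phi>)))"
      unfolding K_def by (simp add: algebra_simps)
    also have "\<dots> = of_real (Gamma s) * (of_real (exp (- s * ln \<rho>)) * cis (- (s * \<phi>)))"
      unfolding exp_add exp_of_real cis_conv_exp ..
    finally show ?thesis using r by (simp add: powr_def)
  qed
  moreover have int_eq: "exp (- \<eta> * of_real x) * h x = indicator {0<..} x * (of_real (x powr (s - 1)) * exp (- (of_real \<rho> * cis \<phi> * of_real x)))" for x
    unfolding h_def \<eta>_def by (simp add: mult_ac)
  ultimately show "(\<integral> x. indicator {0<..} x * (of_real (x powr (s - 1)) * exp (- (of_real \<rho> * cis \<phi> * of_real x))) \<partial>lborel)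
       = of_real (Gamma s * \<rho> powr (- s)) * cis (- (s * \<phi>))"
    unfolding H_def by simp
  have "integrable lborel (\<lambda>x. exp (- \<eta> * of_real x) * h x)"
  proof (rule Bochner_Integration.integrable_bound[OF int[of "- Re \<eta>"]])
    show "AE x in lborel. norm (exp (- \<eta> * of_real x) * h x) \<le> norm (exp (- Re \<eta> * x) * norm (h x))"
      by (intro AE_I2) (simp add: norm_mult)
  qed (use hm eta in \<open>auto\<close>)
  then show "integrable lborel (\<lambda>x. indicator {0<..} x * (of_real (x powr (s - 1)) * exp (- (of_real \<rho> * cis \<phi> * of_real x))) :: complex)"
    unfolding int_eq .
qed

section \<open>Uniqueness of Mellin transforms\<close>

text \<open>
  The uniqueness theorem for characteristic functions, stated with nonnegative test functions so
  that both sides may be moved across an equation between nonnegative integrals.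
\<close>

lemma measure_eqI_trig:
  assumes M: "real_distribution M1" "real_distribution M2"
    and c: "\<And>t. (\<integral>\<^sup>+ x. ennreal (1 + cos (t * x)) \<partial>M1) = (\<integral>\<^sup>+ x. ennreal (1 + cos (t * x)) \<partial>M2)"
    and s: "\<And>t. (\<integral>\<^sup>+ x. ennreal (1 + sin (t * x)) \<partial>M1) = (\<integral>\<^sup>+ x. ennreal (1 + sin (t * x)) \<partial>M2)"
  shows "M1 = M2"
proof (rule Levy_uniqueness[OF M])
  have re: "Re (char M t) = enn2real (\<integral>\<^sup>+ x. ennreal (1 + cos (t * x)) \<partial>M) - 1"
    and im: "Im (char M t) = enn2real (\<integral>\<^sup>+ x. ennreal (1 + sin (t * x)) \<partial>M) - 1"
    if M: "real_distribution M" for M t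
  proof -
    interpret real_distribution M by (rule M)
    have ic: "integrable M (\<lambda>x. cos (t * x))" "integrable M (\<lambda>x. sin (t * x))"
      by (auto intro!: integrable_const_bound[where B=1] AE_I2)
    have i: "integrable M (\<lambda>x. iexp (t * x))" by (rule integrable_iexp) simp_all
    have "Re (char M t) = (\<integral> x. cos (t * x) \<partial>M)" "Im (char M t) = (\<integral> x. sin (t * x) \<partial>M)"
      unfolding char_def using integral_Re[OF i] integral_Im[OF i] by (simp_all add: Re_exp Im_exp)
    moreover have "(\<integral> x. 1 + cos (t * x) \<partial>M) = enn2real (\<integral>\<^sup>+ x. ennreal (1 + cos (t * x)) \<partial>M)"
      "(\<integral> x. 1 + sin (t * x) \<partial>M) = enn2real (\<integral>\<^sup>+ x. ennreal (1 + sin (t * x)) \<partial>M)"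
    proof -
      have "0 \<le> 1 + cos y" "0 \<le> 1 + sin y" for y :: real
        using cos_ge_minus_one[of y] sin_ge_minus_one[of y] by linarith+
      then show "(\<integral> x. 1 + cos (t * x) \<partial>M) = enn2real (\<integral>\<^sup>+ x. ennreal (1 + cos (t * x)) \<partial>M)"
        "(\<integral> x. 1 + sin (t * x) \<partial>M) = enn2real (\<integral>\<^sup>+ x. ennreal (1 + sin (t * x)) \<partial>M)"
        by (intro integral_eq_nn_integral AE_I2; simp)+
    qed
    ultimately show "Re (char M t) = enn2real (\<integral>\<^sup>+ x. ennreal (1 + cos (t * x)) \<partial>M) - 1"
      "Im (char M t) = enn2real (\<integral>\<^sup>+ x. ennreal (1 + sin (t * x)) \<partial>M) - 1"
      using ic prob_space[unfolded space_eq_univ] by simp_all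
  qed
  show "char M1 = char M2"
    by (rule ext, rule complex_eqI) (simp_all add: re[OF M(1)] re[OF M(2)] im[OF M(1)] im[OF M(2)] c s)
qed

lemma Re_exp_strip: "Re (exp (Complex p \<tau> * of_real y)) = exp (p * y) * cos (\<tau> * y)"
  and Im_exp_strip: "Im (exp (Complex p \<tau> * of_real y)) = exp (p * y) * sin (\<tau> * y)"
  by (simp_all add: Re_exp Im_exp)

text \<open>
  The function \<open>f\<close> is not known to be nonnegative, so it is treated as a signed density.  Its Mellin
  transform and that of \<open>X\<close> are holomorphic on the strip \<open>a < Re w < b\<close> and agree on the real
  segment, hence on the vertical line through \<open>p = (a + b) / 2\<close>.  There they are characteristic
  functions in the variable \<open>ln x\<close> of the laws tilted by \<open>x powr p\<close>, and the uniqueness theorem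
  applies once the negative part of \<open>f\<close> has been moved to the side of \<open>X\<close>.
\<close>

lemma Mellin_unique:
  fixes X :: "'a \<Rightarrow> real" and f :: "real \<Rightarrow> real"
  assumes M: "prob_space M" and X [measurable]: "X \<in> borel_measurable M" and X_pos: "AE \<omega> in M. 0 < X \<omega>"
    and f [measurable]: "f \<in> borel_measurable borel" and ab: "a < b"
    and iX: "\<And>p. a < p \<Longrightarrow> p < b \<Longrightarrow> integrable M (\<lambda>\<omega>. X \<omega> powr p)"
    and i_f: "\<And>p. a < p \<Longrightarrow> p < b \<Longrightarrow> integrable lborel (\<lambda>x. indicator {0<..} x * (f x * x powr p))"
    and eq: "\<And>p. a < p \<Longrightarrow> p < b \<Longrightarrow> (\<integral> \<omega>. X \<omega> powr p \<partial>M) = (\<integral> x. indicator {0<..} x * (f x * x powr p) \<partial>lborel)"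
    and G [measurable]: "G \<in> borel_measurable borel"
  shows "(\<integral>\<^sup>+ \<omega>. G (X \<omega>) \<partial>M) + (\<integral>\<^sup>+ x. ennreal (indicator {0<..} x * max 0 (- f x)) * G x \<partial>lborel)
       = (\<integral>\<^sup>+ x. ennreal (indicator {0<..} x * max 0 (f x)) * G x \<partial>lborel)"
proof -
  interpret prob_space M by (rule M)
  define p where "p = (a + b) / 2"
  have p: "a < p" "p < b" using ab by (auto simp: p_def)
  define S where "S = {w. a < Re w \<and> Re w < b}"
  define HX where "HX = (\<lambda>w::complex. \<integral> \<omega>. exp (w * of_real (ln (X \<omega>))) * 1 \<partial>M)"
  define h where "h = (\<lambda>x. complex_of_real (indicator {0<..} x * f x))"
  define HF where "HF = (\<lambda>w. \<integral> x. exp (w * of_real (ln x)) * h x \<partial>lborel)"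
  have hm [measurable]: "h \<in> borel_measurable lborel" unfolding h_def by measurable
  have X_powr: "AE \<omega> in M. exp (c * ln (X \<omega>)) = X \<omega> powr c" for c
    using X_pos by eventually_elim (simp add: powr_def)
  have iX': "integrable M (\<lambda>\<omega>. exp (c * ln (X \<omega>)))" if "a < c" "c < b" for c
    using iX[OF that] X_powr[of c] by (subst integrable_cong_AE) auto
  have nh: "exp (c * ln x) * norm (h x) = \<bar>indicator {0<..} x * (f x * x powr c)\<bar>" for c x
    by (auto simp: h_def indicator_def powr_def abs_mult)
  have i_h: "integrable lborel (\<lambda>x. exp (c * ln x) * norm (h x))" if "a < c" "c < b" for c
    unfolding nh using i_f[OF that] by (rule integrable_abs)
  have holX: "HX holomorphic_on S"
    unfolding HX_def S_def using iX' by (intro holomorphic_on_exponential_integral) auto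
  have holF: "HF holomorphic_on S"
    unfolding HF_def S_def using i_h by (intro holomorphic_on_exponential_integral) auto
  have strip_eq: "HX w = HF w" if "a < Re w" "Re w < b" for w
  proof (rule vertical_strip_unique[OF holX[unfolded S_def] holF[unfolded S_def] _ that])
    fix c assume c: "a < c" "c < b"
    have "HX (of_real c) = (\<integral> \<omega>. of_real (exp (c * ln (X \<omega>))) \<partial>M)"
      unfolding HX_def by (simp add: exp_of_real flip: of_real_mult)
    also have "\<dots> = of_real (\<integral> \<omega>. exp (c * ln (X \<omega>)) \<partial>M)" by (rule integral_complex_of_real)
    also have "(\<integral> \<omega>. exp (c * ln (X \<omega>)) \<partial>M) = (\<integral> \<omega>. X \<omega> powr c \<partial>M)"
      using X_powr[of c] by (intro Bochner_Integration.integral_cong_AE) auto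
    also have "\<dots> = (\<integral> x. indicator {0<..} x * (f x * x powr c) \<partial>lborel)" by (rule eq[OF c])
    also have "of_real \<dots> = (\<integral> x. complex_of_real (indicator {0<..} x * (f x * x powr c)) \<partial>lborel)"
      by (rule integral_complex_of_real[symmetric])
    also have "\<dots> = HF (of_real c)"
      unfolding HF_def h_def
      by (intro Bochner_Integration.integral_cong refl) (auto simp: indicator_def powr_def exp_of_real mult.commute simp flip: of_real_mult)
    finally show "HX (of_real c) = HF (of_real c)" .
  qed
  define wp where "wp = (\<lambda>x. indicator {0<..} x * max 0 (f x) * exp (p * ln x))"
  define wm where "wm = (\<lambda>x. indicator {0<..} x * max 0 (- f x) * exp (p * ln x))"
  have wpm: "wp x - wm x = indicator {0<..} x * (f x * x powr p)" for x
    by (auto simp: wp_def wm_def indicator_def powr_def max_def)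
  have wnn: "0 \<le> wp x" "0 \<le> wm x" for x by (auto simp: wp_def wm_def)
  have wm_meas [measurable]: "wp \<in> borel_measurable borel" "wm \<in> borel_measurable borel"
    unfolding wp_def wm_def by measurable
  have iw: "integrable lborel wp" "integrable lborel wm"
  proof -
    have "norm (wp x) \<le> norm (indicator {0<..} x * (f x * x powr p))" "norm (wm x) \<le> norm (indicator {0<..} x * (f x * x powr p))" for x
      by (auto simp: wp_def wm_def indicator_def powr_def max_def abs_mult mult_le_0_iff)
    then show "integrable lborel wp" "integrable lborel wm"
      by (auto intro!: Bochner_Integration.integrable_bound[OF i_f[OF p]] AE_I2)
  qed
  \<comment> \<open>the identity for bounded trigonometric test functions\<close>
  have trig: "(\<integral>\<^sup>+ \<omega>. ennreal (exp (p * ln (X \<omega>)) * g (ln (X \<omega>))) \<partial>M) + (\<integral>\<^sup>+ x. ennreal (wm x * g (ln x)) \<partial>lborel)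
      = (\<integral>\<^sup>+ x. ennreal (wp x * g (ln x)) \<partial>lborel)"
    if g [measurable]: "g \<in> borel_measurable borel" and g0: "\<And>y. 0 \<le> g y" "\<And>y. g y \<le> 2"
      and gi: "(\<integral> \<omega>. exp (p * ln (X \<omega>)) * g (ln (X \<omega>)) \<partial>M) = (\<integral> x. (wp x - wm x) * g (ln x) \<partial>lborel)" for g :: "real \<Rightarrow> real"
  proof -
    have i1: "integrable M (\<lambda>\<omega>. exp (p * ln (X \<omega>)) * g (ln (X \<omega>)))"
      using g0 by (intro Bochner_Integration.integrable_bound[OF integrable_mult_right[OF iX'[OF p], of 2]])
        (auto intro!: AE_I2 mult_mono simp: abs_mult mult.commute)
    have i2: "integrable lborel (\<lambda>x. wp x * g (ln x))" "integrable lborel (\<lambda>x. wm x * g (ln x))"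
    proof -
      have b: "norm (u * g y) \<le> norm (2 * u)" for u y
        using mult_left_mono[OF g0(2)[of y], of "\<bar>u\<bar>"] g0(1)[of y] by (simp add: abs_mult mult.commute)
      show "integrable lborel (\<lambda>x. wp x * g (ln x))"
        by (rule Bochner_Integration.integrable_bound[OF integrable_mult_right[OF iw(1), of 2] _ AE_I2[OF b]]) measurable
      show "integrable lborel (\<lambda>x. wm x * g (ln x))"
        by (rule Bochner_Integration.integrable_bound[OF integrable_mult_right[OF iw(2), of 2] _ AE_I2[OF b]]) measurable
    qed
    have "(\<integral> x. (wp x - wm x) * g (ln x) \<partial>lborel) = (\<integral> x. wp x * g (ln x) \<partial>lborel) - (\<integral> x. wm x * g (ln x) \<partial>lborel)"
      unfolding left_diff_distrib by (rule Bochner_Integration.integral_diff[OF i2])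
    with gi have e: "(\<integral> \<omega>. exp (p * ln (X \<omega>)) * g (ln (X \<omega>)) \<partial>M) + (\<integral> x. wm x * g (ln x) \<partial>lborel) = (\<integral> x. wp x * g (ln x) \<partial>lborel)"
      by simp
    have nn: "0 \<le> (\<integral> \<omega>. exp (p * ln (X \<omega>)) * g (ln (X \<omega>)) \<partial>M)" "0 \<le> (\<integral> x. wm x * g (ln x) \<partial>lborel)"
      using g0 wnn by (auto intro!: Bochner_Integration.integral_nonneg)
    show ?thesis
      using g0 wnn i1 i2 nn
      by (simp add: nn_integral_eq_integral e[symmetric] ennreal_plus)
  qed
  have HX_int: "integrable M (\<lambda>\<omega>. exp (Complex p \<tau> * of_real (ln (X \<omega>))) * 1)" for \<tau>
    by (rule Bochner_Integration.integrable_bound[OF iX'[OF p]]) (auto intro!: AE_I2)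
  have HF_int: "integrable lborel (\<lambda>x. exp (Complex p \<tau> * of_real (ln x)) * h x)" for \<tau>
    by (rule Bochner_Integration.integrable_bound[OF i_h[OF p]]) (auto intro!: AE_I2 simp: norm_mult)
  have wh: "exp (Complex p \<tau> * of_real (ln x)) * h x = exp (\<i> * of_real (\<tau> * ln x)) * of_real (wp x - wm x)" for \<tau> x
  proof -
    have "exp (Complex p \<tau> * of_real (ln x)) = exp (of_real (p * ln x)) * exp (\<i> * of_real (\<tau> * ln x))"
      unfolding exp_add[symmetric] by (intro arg_cong[where f=exp]) (simp add: complex_eq_iff)
    moreover have "exp (complex_of_real (p * ln x)) * h x = of_real (wp x - wm x)"
      unfolding wpm h_def exp_of_real by (auto simp: indicator_def powr_def)
    ultimately show ?thesis by (simp add: mult_ac)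
  qed
  have cs: "(\<integral> \<omega>. exp (p * ln (X \<omega>)) * cos (\<tau> * ln (X \<omega>)) \<partial>M) = (\<integral> x. (wp x - wm x) * cos (\<tau> * ln x) \<partial>lborel)"
    "(\<integral> \<omega>. exp (p * ln (X \<omega>)) * sin (\<tau> * ln (X \<omega>)) \<partial>M) = (\<integral> x. (wp x - wm x) * sin (\<tau> * ln x) \<partial>lborel)" for \<tau>
  proof -
    have "HX (Complex p \<tau>) = HF (Complex p \<tau>)" using p by (intro strip_eq) auto
    then have "Re (HX (Complex p \<tau>)) = Re (HF (Complex p \<tau>))" "Im (HX (Complex p \<tau>)) = Im (HF (Complex p \<tau>))" by simp_all
    then show "(\<integral> \<omega>. exp (p * ln (X \<omega>)) * cos (\<tau> * ln (X \<omega>)) \<partial>M) = (\<integral> x. (wp x - wm x) * cos (\<tau> * ln x) \<partial>lborel)"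
      "(\<integral> \<omega>. exp (p * ln (X \<omega>)) * sin (\<tau> * ln (X \<omega>)) \<partial>M) = (\<integral> x. (wp x - wm x) * sin (\<tau> * ln x) \<partial>lborel)"
      unfolding HX_def HF_def integral_Re[OF HX_int, symmetric] integral_Re[OF HF_int, symmetric]
        integral_Im[OF HX_int, symmetric] integral_Im[OF HF_int, symmetric]
      unfolding wh mult_1_right Re_exp_strip Im_exp_strip
      by (simp_all add: Re_exp Im_exp mult.commute)
  qed
  have trig_cos: "(\<integral>\<^sup>+ \<omega>. ennreal (exp (p * ln (X \<omega>)) * (1 + cos (\<tau> * ln (X \<omega>)))) \<partial>M) + (\<integral>\<^sup>+ x. ennreal (wm x * (1 + cos (\<tau> * ln x))) \<partial>lborel)
      = (\<integral>\<^sup>+ x. ennreal (wp x * (1 + cos (\<tau> * ln x))) \<partial>lborel)" (is ?c)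
    and trig_sin: "(\<integral>\<^sup>+ \<omega>. ennreal (exp (p * ln (X \<omega>)) * (1 + sin (\<tau> * ln (X \<omega>)))) \<partial>M) + (\<integral>\<^sup>+ x. ennreal (wm x * (1 + sin (\<tau> * ln x))) \<partial>lborel)
      = (\<integral>\<^sup>+ x. ennreal (wp x * (1 + sin (\<tau> * ln x))) \<partial>lborel)" (is ?s) for \<tau>
  proof -
    have b: "0 \<le> 1 + cos y" "1 + cos y \<le> 2" "0 \<le> 1 + sin y" "1 + sin y \<le> 2" for y :: real
      using cos_ge_minus_one[of y] sin_ge_minus_one[of y] cos_le_one[of y] sin_le_one[of y] by linarith+
    have iXc: "integrable M (\<lambda>\<omega>. exp (p * ln (X \<omega>)) * cos (\<tau> * ln (X \<omega>)))"
      "integrable M (\<lambda>\<omega>. exp (p * ln (X \<omega>)) * sin (\<tau> * ln (X \<omega>)))" for \<tau>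
      using integrable_Re[OF HX_int[of \<tau>]] integrable_Im[OF HX_int[of \<tau>]] by (simp_all only: mult_1_right Re_exp_strip Im_exp_strip)
    have iFc: "integrable lborel (\<lambda>x. (wp x - wm x) * cos (\<tau> * ln x))"
      "integrable lborel (\<lambda>x. (wp x - wm x) * sin (\<tau> * ln x))" for \<tau>
      using integrable_Re[OF HF_int[of \<tau>]] integrable_Im[OF HF_int[of \<tau>]] unfolding wh
      by (simp_all add: Re_exp Im_exp mult.commute)
    have one: "(\<integral> \<omega>. exp (p * ln (X \<omega>)) \<partial>M) = (\<integral> x. (wp x - wm x) \<partial>lborel)" using cs(1)[of 0] by simp
    have ione: "integrable lborel (\<lambda>x. wp x - wm x)" using iw by (rule Bochner_Integration.integrable_diff)
    show ?c
      by (rule trig) (use b one cs(1)[of \<tau>] iX'[OF p] iXc(1)[of \<tau>] iFc(1)[of \<tau>] ione in \<open>simp_all add: distrib_left\<close>)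
    show ?s
      by (rule trig) (use b one cs(2)[of \<tau>] iX'[OF p] iXc(2)[of \<tau>] iFc(2)[of \<tau>] ione in \<open>simp_all add: distrib_left\<close>)
  qed
  have mass: "(\<integral>\<^sup>+ \<omega>. ennreal (exp (p * ln (X \<omega>))) \<partial>M) + (\<integral>\<^sup>+ x. ennreal (wm x) \<partial>lborel) = (\<integral>\<^sup>+ x. ennreal (wp x) \<partial>lborel)"
    using trig[of "\<lambda>_. 1"] cs(1)[of 0] by simp
  define c where "c = (\<integral> x. wp x \<partial>lborel)"
  have c_nn: "(\<integral>\<^sup>+ x. ennreal (wp x) \<partial>lborel) = ennreal c"
    unfolding c_def using wnn by (intro nn_integral_eq_integral iw) auto
  have c: "0 < c"
  proof -
    have "0 < (\<integral> \<omega>. exp (p * ln (X \<omega>)) \<partial>M)"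
    proof (rule ccontr)
      assume "\<not> 0 < (\<integral> \<omega>. exp (p * ln (X \<omega>)) \<partial>M)"
      then have "(\<integral> \<omega>. exp (p * ln (X \<omega>)) \<partial>M) = 0"
        using Bochner_Integration.integral_nonneg[of M "\<lambda>\<omega>. exp (p * ln (X \<omega>))"] by (simp add: not_less antisym)
      then have "AE \<omega> in M. exp (p * ln (X \<omega>)) = 0"
        using integral_nonneg_eq_0_iff_AE[OF iX'[OF p]] by simp
      then show False by simp
    qed
    also have "\<dots> = (\<integral> x. wp x \<partial>lborel) - (\<integral> x. wm x \<partial>lborel)"
      using cs(1)[of 0] iw by simp
    also have "\<dots> \<le> c" unfolding c_def using Bochner_Integration.integral_nonneg[of lborel wm] wnn by simp
    finally show ?thesis .
  qed
  define NA where "NA = distr (density M (\<lambda>\<omega>. ennreal (exp (p * ln (X \<omega>)) / c))) borel (\<lambda>\<omega>. ln (X \<omega>))"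
  define NB where "NB = distr (density lborel (\<lambda>x. ennreal (wm x / c))) borel ln"
  define N2 where "N2 = distr (density lborel (\<lambda>x. ennreal (wp x / c))) borel ln"
  have nnA: "(\<integral>\<^sup>+ y. g y \<partial>NA) = (\<integral>\<^sup>+ \<omega>. ennreal (exp (p * ln (X \<omega>)) / c) * g (ln (X \<omega>)) \<partial>M)"
    if [measurable]: "g \<in> borel_measurable borel" for g
    unfolding NA_def by (simp add: nn_integral_distr nn_integral_density)
  have nnB: "(\<integral>\<^sup>+ y. g y \<partial>NB) = (\<integral>\<^sup>+ x. ennreal (wm x / c) * g (ln x) \<partial>lborel)"
    and nn2: "(\<integral>\<^sup>+ y. g y \<partial>N2) = (\<integral>\<^sup>+ x. ennreal (wp x / c) * g (ln x) \<partial>lborel)"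
    if [measurable]: "g \<in> borel_measurable borel" for g
    unfolding NB_def N2_def by (simp_all add: nn_integral_distr nn_integral_density)
  have div: "ennreal (y / c) * ennreal g = ennreal (1 / c) * ennreal (y * g)" if "0 \<le> y" "0 \<le> g" for y g
    using c that by (simp flip: ennreal_mult)
  have real_g: "(\<integral>\<^sup>+ y. ennreal (g y) \<partial>NA) + (\<integral>\<^sup>+ y. ennreal (g y) \<partial>NB) =
      ennreal (1 / c) * ((\<integral>\<^sup>+ \<omega>. ennreal (exp (p * ln (X \<omega>)) * g (ln (X \<omega>))) \<partial>M) + (\<integral>\<^sup>+ x. ennreal (wm x * g (ln x)) \<partial>lborel))"
    and real_g2: "(\<integral>\<^sup>+ y. ennreal (g y) \<partial>N2) = ennreal (1 / c) * (\<integral>\<^sup>+ x. ennreal (wp x * g (ln x)) \<partial>lborel)"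
    if [measurable]: "g \<in> borel_measurable borel" and g0: "\<And>y. 0 \<le> g y" for g :: "real \<Rightarrow> real"
  proof -
    have A: "(\<integral>\<^sup>+ y. ennreal (g y) \<partial>NA) = ennreal (1 / c) * (\<integral>\<^sup>+ \<omega>. ennreal (exp (p * ln (X \<omega>)) * g (ln (X \<omega>))) \<partial>M)"
    proof -
      have "(\<integral>\<^sup>+ y. ennreal (g y) \<partial>NA) = (\<integral>\<^sup>+ \<omega>. ennreal (1 / c) * ennreal (exp (p * ln (X \<omega>)) * g (ln (X \<omega>))) \<partial>M)"
        by (subst nnA, measurable) (intro nn_integral_cong div g0 exp_ge_zero)
      also have "\<dots> = ennreal (1 / c) * (\<integral>\<^sup>+ \<omega>. ennreal (exp (p * ln (X \<omega>)) * g (ln (X \<omega>))) \<partial>M)"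
        by (rule nn_integral_cmult) measurable
      finally show ?thesis .
    qed
    have B: "(\<integral>\<^sup>+ y. ennreal (g y) \<partial>NB) = ennreal (1 / c) * (\<integral>\<^sup>+ x. ennreal (wm x * g (ln x)) \<partial>lborel)"
    proof -
      have "(\<integral>\<^sup>+ y. ennreal (g y) \<partial>NB) = (\<integral>\<^sup>+ x. ennreal (1 / c) * ennreal (wm x * g (ln x)) \<partial>lborel)"
        by (subst nnB, measurable) (intro nn_integral_cong div g0 wnn)
      also have "\<dots> = ennreal (1 / c) * (\<integral>\<^sup>+ x. ennreal (wm x * g (ln x)) \<partial>lborel)"
        by (rule nn_integral_cmult) measurable
      finally show ?thesis .
    qed
    show "(\<integral>\<^sup>+ y. ennreal (g y) \<partial>NA) + (\<integral>\<^sup>+ y. ennreal (g y) \<partial>NB) =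
      ennreal (1 / c) * ((\<integral>\<^sup>+ \<omega>. ennreal (exp (p * ln (X \<omega>)) * g (ln (X \<omega>))) \<partial>M) + (\<integral>\<^sup>+ x. ennreal (wm x * g (ln x)) \<partial>lborel))"
      unfolding A B by (rule distrib_left[symmetric])
    have "(\<integral>\<^sup>+ y. ennreal (g y) \<partial>N2) = (\<integral>\<^sup>+ x. ennreal (1 / c) * ennreal (wp x * g (ln x)) \<partial>lborel)"
      by (subst nn2, measurable) (intro nn_integral_cong div g0 wnn)
    also have "\<dots> = ennreal (1 / c) * (\<integral>\<^sup>+ x. ennreal (wp x * g (ln x)) \<partial>lborel)"
      by (rule nn_integral_cmult) measurable
    finally show "(\<integral>\<^sup>+ y. ennreal (g y) \<partial>N2) = ennreal (1 / c) * (\<integral>\<^sup>+ x. ennreal (wp x * g (ln x)) \<partial>lborel)" .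
  qed
  have tot: "(\<integral>\<^sup>+ y. 1 \<partial>NA) + (\<integral>\<^sup>+ y. 1 \<partial>NB) = 1" "(\<integral>\<^sup>+ y. 1 \<partial>N2) = 1"
  proof -
    have "ennreal (1 / c) * ennreal c = 1" using c by (simp flip: ennreal_mult)
    then show "(\<integral>\<^sup>+ y. 1 \<partial>NA) + (\<integral>\<^sup>+ y. 1 \<partial>NB) = 1" "(\<integral>\<^sup>+ y. 1 \<partial>N2) = 1"
      using real_g[of "\<lambda>_. 1"] real_g2[of "\<lambda>_. 1"] mass c_nn by simp_all
  qed
  have sub: "NA \<in> space (subprob_algebra borel)" "NB \<in> space (subprob_algebra borel)"
  proof -
    have t: "emeasure NA (space NA) + emeasure NB (space NB) = 1" using tot(1) by simp
    have "emeasure NA (space NA) \<le> emeasure NA (space NA) + emeasure NB (space NB)"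
      by (rule add_increasing2) simp_all
    then have A: "emeasure NA (space NA) \<le> 1" unfolding t .
    have "emeasure NB (space NB) \<le> emeasure NA (space NA) + emeasure NB (space NB)"
      by (rule add_increasing) simp_all
    then have B: "emeasure NB (space NB) \<le> 1" unfolding t .
    have "space NA \<noteq> {}" "space NB \<noteq> {}" by (simp_all add: NA_def NB_def)
    then have "subprob_space NA" "subprob_space NB"
      using subprob_spaceI[OF A] subprob_spaceI[OF B] by simp_all
    then show "NA \<in> space (subprob_algebra borel)" "NB \<in> space (subprob_algebra borel)"
      by (simp_all add: space_subprob_algebra NA_def NB_def)
  qed
  define N1 where "N1 = count_space (UNIV :: bool set) \<bind> (\<lambda>b. if b then NA else NB)"
  have kern: "(\<lambda>b. if b then NA else NB) \<in> measurable (count_space (UNIV :: bool set)) (subprob_algebra borel)"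
    using sub by auto
  have nn1: "(\<integral>\<^sup>+ y. g y \<partial>N1) = (\<integral>\<^sup>+ y. g y \<partial>NA) + (\<integral>\<^sup>+ y. g y \<partial>NB)" if "g \<in> borel_measurable borel" for g
    unfolding N1_def nn_integral_bind[OF that kern] by (simp add: nn_integral_count_space_finite UNIV_bool add.commute)
  have sets1: "sets N1 = sets borel" unfolding N1_def by (rule sets_bind[OF sets_kernel[OF kern]]) auto
  have N12: "N1 = N2"
  proof (rule measure_eqI_trig)
    have "emeasure N1 (space N1) = 1" "emeasure N2 (space N2) = 1"
      using tot nn1[of "\<lambda>_. 1"] by simp_all
    then have "prob_space N1" "prob_space N2" by (auto intro: prob_spaceI)
    then show "real_distribution N1" "real_distribution N2"
      using sets1 sets_eq_imp_space_eq[OF sets1] by (auto simp: real_distribution_def real_distribution_axioms_def N2_def)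
    have b: "0 \<le> 1 + cos y" "0 \<le> 1 + sin y" for y :: real
      using cos_ge_minus_one[of y] sin_ge_minus_one[of y] by linarith+
    fix \<tau>
    show "(\<integral>\<^sup>+ y. ennreal (1 + cos (\<tau> * y)) \<partial>N1) = (\<integral>\<^sup>+ y. ennreal (1 + cos (\<tau> * y)) \<partial>N2)"
      using b by (subst nn1) (simp_all add: real_g real_g2 trig_cos)
    show "(\<integral>\<^sup>+ y. ennreal (1 + sin (\<tau> * y)) \<partial>N1) = (\<integral>\<^sup>+ y. ennreal (1 + sin (\<tau> * y)) \<partial>N2)"
      using b by (subst nn1) (simp_all add: real_g real_g2 trig_sin)
  qed
  define g where "g = (\<lambda>y. ennreal (c * exp (- p * y)) * G (exp y))"
  have g [measurable]: "g \<in> borel_measurable borel" unfolding g_def by measurable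
  have canc: "ennreal (u * exp (p * ln x) / c) * g (ln x) = ennreal u * G x" if "0 < x" "0 \<le> u" for u x
  proof -
    have "ennreal (u * exp (p * ln x) / c) * ennreal (c * exp (- p * ln x)) = ennreal (u * exp (p * ln x) / c * (c * exp (- p * ln x)))"
      using c that by (intro ennreal_mult[symmetric]) auto
    also have "u * exp (p * ln x) / c * (c * exp (- p * ln x)) = u * (exp (p * ln x) * exp (- p * ln x))"
      using c by simp
    also have "exp (p * ln x) * exp (- p * ln x) = 1" by (simp flip: exp_add)
    finally show ?thesis using that by (simp add: g_def mult.assoc[symmetric])
  qed
  have "(\<integral>\<^sup>+ y. g y \<partial>NA) = (\<integral>\<^sup>+ \<omega>. G (X \<omega>) \<partial>M)"
    unfolding nnA[OF g]
  proof (rule nn_integral_cong_AE)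
    show "AE \<omega> in M. ennreal (exp (p * ln (X \<omega>)) / c) * g (ln (X \<omega>)) = G (X \<omega>)"
      using X_pos by eventually_elim (use canc[of _ 1] in simp)
  qed
  moreover have "ennreal (wm x / c) * g (ln x) = ennreal (indicator {0<..} x * max 0 (- f x)) * G x"
    "ennreal (wp x / c) * g (ln x) = ennreal (indicator {0<..} x * max 0 (f x)) * G x" for x
    using canc[of x "max 0 (- f x)"] canc[of x "max 0 (f x)"] by (simp_all add: wm_def wp_def indicator_def)
  ultimately show ?thesis using nn1[OF g] by (simp add: N12 nnB[OF g] nn2[OF g])
qed

section \<open>The Mittag-Leffler density\<close>

context
  fixes \<alpha> \<theta> :: real
  assumes \<alpha>: "0 < \<alpha>" "\<alpha> < 1" and \<theta>: "pi / 2 < \<theta>" "\<theta> < pi" "\<alpha> * \<theta> < pi / 2"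
begin

definition ray_weight :: "real \<Rightarrow> complex" where
  "ray_weight r = indicator {0<..} r * (of_real (r powr (\<alpha> - 1)) * exp (- (of_real 1 * cis (- (pi - \<theta>)) * of_real r)))"

text \<open>
  The Hankel contour of the reciprocal gamma function, folded onto the ray of angle \<open>\<theta>\<close>: the
  negative real axis has been rotated to the direction of \<open>- cis (- (pi - \<theta>))\<close>, in which the exponential
  still decays, while \<open>\<alpha> * \<theta> < pi / 2\<close> makes the factor in \<open>x\<close> decay as well.  The imaginary part of the
  integral over \<open>r\<close> is \<open>pi\<close> times the density at \<open>x\<close>.
\<close>

definition ray_kernel :: "real \<Rightarrow> real \<Rightarrow> complex" where
  "ray_kernel x r = ray_weight r * (cis (\<alpha> * \<theta>) * exp (- (of_real (x * r powr \<alpha>) * cis (\<alpha> * \<theta>))))"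

lemma borel_measurable_ray_weight [measurable]: "ray_weight \<in> borel_measurable borel"
  unfolding ray_weight_def by measurable

lemma norm_ray_weight:
  "norm (ray_weight r) = indicator {0<..} r * (r powr (\<alpha> - 1) * exp (- (cos (pi - \<theta>) * r)))"
  by (auto simp: ray_weight_def norm_mult indicator_def)

lemma cos_ray_pos: "0 < cos (pi - \<theta>)" "0 < cos (\<alpha> * \<theta>)"
proof -
  show "0 < cos (pi - \<theta>)" using \<theta> by (intro cos_gt_zero_pi) auto
  have "0 < \<alpha> * \<theta>" using \<alpha> \<theta> pi_gt_zero by (intro mult_pos_pos) linarith+
  then show "0 < cos (\<alpha> * \<theta>)" using \<theta>(3) by (intro cos_gt_zero_pi) auto
qed

lemma powr_le_linear:
  assumes x: "0 < x" and a: "0 < a"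
  obtains K where "\<And>r. 0 < r \<Longrightarrow> x * r powr \<alpha> \<le> K + a * r"
proof
  \<comment> \<open>For \<open>r \<ge> R\<close> the quotient \<open>x * r powr \<alpha> / r\<close> is at most \<open>a\<close>.\<close>
  define R where "R = (a / x) powr (1 / (\<alpha> - 1))"
  have R: "0 < R" using x a by (simp add: R_def)
  have RR: "R powr (\<alpha> - 1) = a / x" unfolding R_def using \<alpha> x a by (simp add: powr_powr)
  fix r :: real assume r: "0 < r"
  show "x * r powr \<alpha> \<le> x * R powr \<alpha> + a * r"
  proof (cases "r \<le> R")
    case True
    then have "x * r powr \<alpha> \<le> x * R powr \<alpha>" using r \<alpha> x by (intro mult_left_mono powr_mono2) auto
    moreover have "0 \<le> a * r" using a r by simp
    ultimately show ?thesis by linarith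
  next
    case False
    then have "r powr (\<alpha> - 1) \<le> R powr (\<alpha> - 1)" using R \<alpha> by (intro powr_mono2') auto
    then have le: "r powr (\<alpha> - 1) \<le> a / x" unfolding RR .
    have "x * r powr \<alpha> = x * (r powr (\<alpha> - 1) * r)" using r by (simp add: powr_diff)
    also have "\<dots> \<le> x * ((a / x) * r)" using le r x by (intro mult_left_mono mult_right_mono) auto
    also have "\<dots> = a * r" using x by simp
    also have "\<dots> \<le> x * R powr \<alpha> + a * r" using x by simp
    finally show ?thesis .
  qed
qed

lemma integrable_ray_weight_exp:
  assumes x: "0 < x"
  shows "integrable lborel (\<lambda>r. norm (ray_weight r) * exp (x * r powr \<alpha>))"
proof -
  \<comment> \<open>Half of the exponential decay rate absorbs the growth of \<open>exp (x * r powr \<alpha>)\<close>.\<close>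
  define a where "a = cos (pi - \<theta>) / 2"
  have a: "0 < a" using cos_ray_pos by (simp add: a_def)
  obtain K where K: "\<And>r. 0 < r \<Longrightarrow> x * r powr \<alpha> \<le> K + a * r" using powr_le_linear[OF x a] by blast
  have "integrable lborel (\<lambda>r. exp K * (indicator {0<..} r * (r powr (\<alpha> - 1) * exp (- (a * r)))))"
    using has_bochner_integral_Gamma_real[OF \<alpha>(1) a] by (intro integrable_mult_right) (simp add: has_bochner_integral_iff)
  then show ?thesis
  proof (rule Bochner_Integration.integrable_bound)
    have "norm (norm (ray_weight r) * exp (x * r powr \<alpha>)) \<le> norm (exp K * (indicator {0<..} r * (r powr (\<alpha> - 1) * exp (- (a * r)))))" for r
    proof (cases "0 < r")
      case True
      have "exp (- (2 * a * r)) * exp (x * r powr \<alpha>) \<le> exp K * exp (- (a * r))"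
        using K[OF True] by (simp flip: exp_add)
      then have "r powr (\<alpha> - 1) * (exp (- (2 * a * r)) * exp (x * r powr \<alpha>)) \<le> r powr (\<alpha> - 1) * (exp K * exp (- (a * r)))"
        by (intro mult_left_mono) auto
      then show ?thesis using True by (simp add: norm_ray_weight a_def mult_ac)
    qed (simp add: norm_ray_weight)
    then show "AE r in lborel. norm (norm (ray_weight r) * exp (x * r powr \<alpha>)) \<le> norm (exp K * (indicator {0<..} r * (r powr (\<alpha> - 1) * exp (- (a * r)))))"
      by (intro AE_I2)
  qed measurable
qed

text \<open>
  Expand the exponential in \<open>x\<close> and integrate term by term.  The phases \<open>\<theta>\<close> from the powers and
  \<open>pi - \<theta>\<close> from the rotated gamma integrals add up to \<open>pi\<close>, so that the auxiliary angle disappears.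
\<close>

lemma ray_kernel_series:
  assumes x: "0 < x"
  shows "(\<lambda>n. of_real ((- x) ^ n / fact n * Gamma (\<alpha> * real (Suc n))) * cis (pi * (\<alpha> * real (Suc n))))
     sums (\<integral> r. ray_kernel x r \<partial>lborel)"
proof -
  define \<zeta> where "\<zeta> = cis (\<alpha> * \<theta>)"
  define g where "g = (\<lambda>n r. ray_weight r * (\<zeta> * ((- (of_real (x * r powr \<alpha>) * \<zeta>)) ^ n /\<^sub>R fact n)))"
  define s where "s = (\<lambda>n. \<alpha> * real (Suc n))"
  have s: "0 < s n" for n using \<alpha> by (simp add: s_def)
  have phi: "\<bar>- (pi - \<theta>)\<bar> < pi / 2" using \<theta> by auto
  define h where "h = (\<lambda>n r. indicator {0<..} r * (of_real (r powr (s n - 1)) * exp (- (complex_of_real 1 * cis (- (pi - \<theta>)) * of_real r))))"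
  have ih: "integrable lborel (h n)"
    and Ih: "(\<integral> r. h n r \<partial>lborel) = of_real (Gamma (s n)) * cis (s n * (pi - \<theta>))" for n
    unfolding h_def using Gamma_integral_rotated[OF s zero_less_one phi, of n]
    by (simp_all only: powr_one_eq_one mult_1_right mult_minus_right minus_minus)
  define c where "c = (\<lambda>n. of_real ((- x) ^ n / fact n) * \<zeta> ^ Suc n)"
  have gh: "g n r = c n * h n r" for n r
  proof (cases "0 < r")
    case True
    have "r powr (\<alpha> - 1) * (r powr \<alpha>) ^ n = r powr (s n - 1)"
      using True by (simp add: powr_power s_def algebra_simps flip: powr_add)
    then have e: "complex_of_real (r powr (s n - 1)) = of_real (r powr (\<alpha> - 1)) * of_real (r powr \<alpha>) ^ n"
      by (metis of_real_mult of_real_power)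
    have "(- (of_real (x * r powr \<alpha>) * \<zeta>)) ^ n = (of_real (- x) * of_real (r powr \<alpha>) * \<zeta>) ^ n" by simp
    also have "\<dots> = of_real ((- x) ^ n) * of_real (r powr \<alpha>) ^ n * \<zeta> ^ n"
      by (simp only: power_mult_distrib of_real_power)
    finally show ?thesis using True
      unfolding g_def c_def h_def ray_weight_def e by (simp add: scaleR_conv_of_real divide_simps)
  qed (simp add: g_def h_def ray_weight_def)
  have ig: "integrable lborel (g n)" for n unfolding gh[abs_def] by (intro integrable_mult_right ih)
  have Ig: "(\<integral> r. g n r \<partial>lborel) = of_real ((- x) ^ n / fact n * Gamma (s n)) * cis (pi * s n)" for n
  proof -
    have "\<zeta> ^ Suc n * cis (s n * (pi - \<theta>)) = cis (pi * s n)"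
      unfolding \<zeta>_def Complex.DeMoivre cis_mult by (simp add: s_def algebra_simps)
    moreover have "(\<integral> r. g n r \<partial>lborel) = c n * (of_real (Gamma (s n)) * cis (s n * (pi - \<theta>)))"
      unfolding gh[abs_def] by (simp add: Ih)
    ultimately show ?thesis unfolding c_def by (metis (no_types, lifting) mult.assoc mult.left_commute of_real_mult)
  qed
  have ng: "norm (g n r) = norm (ray_weight r) * ((x * r powr \<alpha>) ^ n /\<^sub>R fact n)" for n r
    using x by (simp add: g_def \<zeta>_def norm_mult norm_power norm_divide)
  have nsum: "(\<lambda>n. norm (g n r)) sums (norm (ray_weight r) * exp (x * r powr \<alpha>))" for r
    unfolding ng by (intro sums_mult exp_converges)
  have gsum: "(\<lambda>n. g n r) sums ray_kernel x r" for r
    unfolding g_def ray_kernel_def \<zeta>_def by (intro sums_mult exp_converges)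
  have "(\<lambda>n. \<integral> r. g n r \<partial>lborel) sums (\<integral> r. (\<Sum>n. g n r) \<partial>lborel)"
  proof (rule sums_integral[OF ig])
    show "AE r in lborel. summable (\<lambda>n. norm (g n r))" using nsum by (auto simp: sums_iff)
    show "summable (\<lambda>n. \<integral> r. norm (g n r) \<partial>lborel)"
    proof (rule summableI_nonneg_bounded)
      show "0 \<le> (\<integral> r. norm (g n r) \<partial>lborel)" for n by simp
      fix n
      have "(\<Sum>i<n. \<integral> r. norm (g i r) \<partial>lborel) = (\<integral> r. (\<Sum>i<n. norm (g i r)) \<partial>lborel)"
        by (intro Bochner_Integration.integral_sum[symmetric] integrable_norm ig)
      also have "\<dots> \<le> (\<integral> r. norm (ray_weight r) * exp (x * r powr \<alpha>) \<partial>lborel)"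
      proof (intro integral_mono Bochner_Integration.integrable_sum integrable_norm ig integrable_ray_weight_exp x)
        fix r
        show "(\<Sum>i<n. norm (g i r)) \<le> norm (ray_weight r) * exp (x * r powr \<alpha>)"
          using nsum[of r] sum_le_suminf[of "\<lambda>i. norm (g i r)" "{..<n}"] by (simp add: sums_iff)
      qed
      finally show "(\<Sum>i<n. \<integral> r. norm (g i r) \<partial>lborel) \<le> (\<integral> r. norm (ray_weight r) * exp (x * r powr \<alpha>) \<partial>lborel)" .
    qed
  qed
  then show ?thesis unfolding Ig using gsum by (simp add: sums_iff s_def)
qed

lemma Gamma_mult_sin:
  assumes "0 < s" "s < (1::real)"
  shows "Gamma s * sin (pi * s) / pi = 1 / Gamma (1 - s)"
proof -
  have "complex_of_real (Gamma s * Gamma (1 - s)) = of_real (pi / sin (pi * s))"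
    using Gamma_reflection_complex[of "of_real s"] Gamma_complex_of_real[of "1 - s"]
    by (simp add: Gamma_complex_of_real flip: sin_of_real)
  then have "Gamma s * Gamma (1 - s) = pi / sin (pi * s)" by (simp only: of_real_eq_iff)
  moreover have "0 < sin (pi * s)" using assms by (intro sin_gt_zero) auto
  moreover have "0 < Gamma (1 - s)" using assms by (simp add: Gamma_real_pos)
  ultimately show ?thesis by (simp add: field_simps)
qed

text \<open>
  For \<open>p < 0\<close> the double integral converges absolutely.  Integrating over \<open>x\<close> first gives a gamma
  integral with rate \<open>r powr \<alpha> * cis (\<alpha> * \<theta>)\<close>, and the remaining integral over \<open>r\<close> is again a rotated
  gamma integral; the reflection formula turns the product into the quotient.
\<close>

lemma ray_kernel_Mellin:
  assumes p: "-1 < p" "p < 0"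
  defines "F \<equiv> \<lambda>x. Im (\<integral> r. ray_kernel x r \<partial>lborel) / pi"
  shows "integrable lborel (\<lambda>x. indicator {0<..} x * (F x * x powr p))"
    and "(\<integral> x. indicator {0<..} x * (F x * x powr p) \<partial>lborel) = Gamma (p + 1) / Gamma (\<alpha> * p + 1)"
proof -
  define q where "q = p + 1"
  define s where "s = \<alpha> * (1 - q)"
  have q: "0 < q" "q < 1" "p = q - 1" using p by (auto simp: q_def)
  have s: "0 < s" using \<alpha> q by (simp add: s_def)
  have s1: "s < 1"
  proof -
    have "\<alpha> * (1 - q) < 1 * 1" using \<alpha> q by (intro mult_strict_mono) auto
    then show ?thesis by (simp add: s_def)
  qed
  define c where "c = cos (\<alpha> * \<theta>)"
  have c: "0 < c" using cos_ray_pos by (simp add: c_def)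
  have at: "0 < \<alpha> * \<theta>" using \<alpha> \<theta> pi_gt_zero by (intro mult_pos_pos) linarith+
  have phi: "\<bar>- (pi - \<theta>)\<bar> < pi / 2" "\<bar>\<alpha> * \<theta>\<bar> < pi / 2" using \<theta> at by auto
  define k where "k = (\<lambda>(r, x). ray_kernel x r * (indicator {0<..} x * of_real (x powr p)))"
  have km [measurable]: "k \<in> borel_measurable (lborel \<Otimes>\<^sub>M lborel)"
    unfolding k_def ray_kernel_def by measurable
  have nk: "norm (k (r, x)) = norm (ray_weight r) * (indicator {0<..} x * (x powr (q - 1) * exp (- ((c * r powr \<alpha>) * x))))" for r x
    by (auto simp: k_def ray_kernel_def norm_mult c_def q(3) indicator_def mult_ac)
  have inner: "has_bochner_integral lborel (\<lambda>x. norm (k (r, x))) (norm (ray_weight r) * (Gamma q * (c * r powr \<alpha>) powr (- q)))" for r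
  proof (cases "0 < r")
    case True
    then have "0 < c * r powr \<alpha>" using c by simp
    then show ?thesis unfolding nk by (intro has_bochner_integral_mult_right has_bochner_integral_Gamma_real q)
  qed (simp add: nk norm_ray_weight has_bochner_integral_zero)
  have outer: "norm (ray_weight r) * (Gamma q * (c * r powr \<alpha>) powr (- q)) =
      Gamma q * c powr (- q) * (indicator {0<..} r * (r powr (s - 1) * exp (- (cos (pi - \<theta>) * r))))" for r
  proof (cases "0 < r")
    case True
    have "r powr (\<alpha> - 1) * r powr (- (\<alpha> * q)) = r powr (s - 1)"
      unfolding powr_add[symmetric] by (simp add: s_def algebra_simps)
    moreover have "(c * r powr \<alpha>) powr (- q) = c powr (- q) * r powr (- (\<alpha> * q))"
      using c True by (simp add: powr_mult powr_powr)
    ultimately show ?thesis using True by (simp add: norm_ray_weight algebra_simps)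
  qed (simp add: norm_ray_weight)
  have ik: "integrable (lborel \<Otimes>\<^sub>M lborel) k"
  proof (rule lborel_pair.Fubini_integrable[OF km])
    have "(\<lambda>r. \<integral> x. norm (k (r, x)) \<partial>lborel) =
      (\<lambda>r. Gamma q * c powr (- q) * (indicator {0<..} r * (r powr (s - 1) * exp (- (cos (pi - \<theta>) * r)))))"
      using has_bochner_integral_integral_eq[OF inner] outer by simp
    moreover have "integrable lborel \<dots>"
      using has_bochner_integral_Gamma_real[OF s cos_ray_pos(1)]
      by (intro integrable_mult_right) (simp add: has_bochner_integral_iff)
    ultimately show "integrable lborel (\<lambda>r. \<integral> x. norm (k (r, x)) \<partial>lborel)" by simp
    show "AE r in lborel. integrable lborel (\<lambda>x. k (r, x))"
    proof (rule AE_I2, rule integrable_norm_cancel)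
      show "integrable lborel (\<lambda>x. norm (k (r, x)))" for r using inner[of r] by (simp add: has_bochner_integral_iff)
    qed measurable
  qed
  have eqF: "indicator {0<..} x * (F x * x powr p) = Im (\<integral> r. k (r, x) \<partial>lborel) / pi" for x
    by (auto simp: F_def k_def indicator_def)
  have "integrable lborel (\<lambda>x. \<integral> r. k (r, x) \<partial>lborel)"
    using lborel_pair.integrable_snd[of "\<lambda>r x. k (r, x)"] ik by simp
  then have iI: "integrable lborel (\<lambda>x. Im (\<integral> r. k (r, x) \<partial>lborel))"
    and II: "(\<integral> x. Im (\<integral> r. k (r, x) \<partial>lborel) \<partial>lborel) = Im (\<integral> x. (\<integral> r. k (r, x) \<partial>lborel) \<partial>lborel)"
    by (auto intro: integral_Im)
  show "integrable lborel (\<lambda>x. indicator {0<..} x * (F x * x powr p))"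
    unfolding eqF using iI by simp
  have kin: "(\<integral> x. k (r, x) \<partial>lborel) = of_real (Gamma q) * cis (s * \<theta>) *
      (indicator {0<..} r * (of_real (r powr (s - 1)) * exp (- (of_real 1 * cis (- (pi - \<theta>)) * of_real r))))" for r
  proof (cases "0 < r")
    case True
    then have r: "0 < r powr \<alpha>" by simp
    have "(\<integral> x. k (r, x) \<partial>lborel) = (\<integral> x. (ray_weight r * cis (\<alpha> * \<theta>)) *
        (indicator {0<..} x * (of_real (x powr (q - 1)) * exp (- (of_real (r powr \<alpha>) * cis (\<alpha> * \<theta>) * of_real x)))) \<partial>lborel)"
      by (intro Bochner_Integration.integral_cong refl) (simp add: k_def ray_kernel_def q(3) mult_ac)
    also have "\<dots> = ray_weight r * cis (\<alpha> * \<theta>) * (of_real (Gamma q * (r powr \<alpha>) powr (- q)) * cis (- (q * (\<alpha> * \<theta>))))"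
      using Gamma_integral_rotated(2)[OF q(1) r phi(2)] by simp
    also have "\<dots> = of_real (Gamma q) * (cis (\<alpha> * \<theta>) * cis (- (q * (\<alpha> * \<theta>)))) * (ray_weight r * of_real ((r powr \<alpha>) powr (- q)))"
      by simp
    also have "cis (\<alpha> * \<theta>) * cis (- (q * (\<alpha> * \<theta>))) = cis (s * \<theta>)"
      unfolding cis_mult by (simp add: s_def algebra_simps)
    also have "ray_weight r * of_real ((r powr \<alpha>) powr (- q)) =
      indicator {0<..} r * (of_real (r powr (s - 1)) * exp (- (of_real 1 * cis (- (pi - \<theta>)) * of_real r)))"
    proof -
      have "r powr (\<alpha> - 1) * (r powr \<alpha>) powr (- q) = r powr (s - 1)"
        unfolding powr_powr powr_add[symmetric] by (simp add: s_def algebra_simps)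
      then have "complex_of_real (r powr (s - 1)) = of_real (r powr (\<alpha> - 1)) * of_real ((r powr \<alpha>) powr (- q))"
        by (metis of_real_mult)
      then show ?thesis unfolding ray_weight_def by (simp add: mult_ac)
    qed
    finally show ?thesis .
  qed (simp add: k_def ray_kernel_def ray_weight_def)
  have "(\<integral> x. indicator {0<..} x * (F x * x powr p) \<partial>lborel) = Im (\<integral> x. (\<integral> r. k (r, x) \<partial>lborel) \<partial>lborel) / pi"
    unfolding eqF by (simp add: II)
  also have "(\<integral> x. (\<integral> r. k (r, x) \<partial>lborel) \<partial>lborel) = (\<integral> r. (\<integral> x. k (r, x) \<partial>lborel) \<partial>lborel)"
    using lborel_pair.Fubini_integral[of "\<lambda>r x. k (r, x)"] ik by simp
  also have "\<dots> = of_real (Gamma q) * cis (s * \<theta>) * (of_real (Gamma s) * cis (s * (pi - \<theta>)))"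
    unfolding kin integral_mult_right_zero using Gamma_integral_rotated(2)[OF s zero_less_one phi(1)]
    by (simp only: powr_one_eq_one mult_1_right mult_minus_right minus_minus)
  also have "\<dots> = of_real (Gamma q * Gamma s) * (cis (s * \<theta>) * cis (s * (pi - \<theta>)))" by simp
  also have "cis (s * \<theta>) * cis (s * (pi - \<theta>)) = cis (pi * s)"
    unfolding cis_mult by (simp add: algebra_simps)
  also have "Im (of_real (Gamma q * Gamma s) * cis (pi * s)) / pi = Gamma q * (Gamma s * sin (pi * s) / pi)"
    by simp
  also have "\<dots> = Gamma q * (1 / Gamma (1 - s))" by (simp only: Gamma_mult_sin[OF s s1])
  finally show "(\<integral> x. indicator {0<..} x * (F x * x powr p) \<partial>lborel) = Gamma (p + 1) / Gamma (\<alpha> * p + 1)"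
    by (simp add: q_def s_def algebra_simps)
qed

end

text \<open>
  With \<open>Gamma (k * \<alpha> + 1) = k * \<alpha> * Gamma (k * \<alpha>)\<close>, and because the term at \<open>k = 0\<close> vanishes, the
  defining series of the density becomes a power series in \<open>x\<close> with these coefficients.
\<close>

definition mittag_leffler_coeff :: "real \<Rightarrow> nat \<Rightarrow> real" where
  "mittag_leffler_coeff \<alpha> n =
     (- 1) ^ n / fact n * Gamma (\<alpha> * real (Suc n)) * sin (pi * (\<alpha> * real (Suc n))) / pi"

lemma mittag_leffler_term_Suc:
  "mittag_leffler_term t x (Suc n) = exp (- t) * pi * (mittag_leffler_coeff (exp (- t)) n * x ^ n)"
proof -
  define s where "s = real (Suc n) * exp (- t)"
  have s: "0 < s" by (simp add: s_def)
  have "Gamma (s + 1) = s * Gamma s" using s by (intro Gamma_plus1) (auto simp: nonpos_Ints_def)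
  moreover have "x powi (int (Suc n) - 1) = x ^ n" by simp
  moreover have "(- 1) ^ (Suc n + 1) / fact (Suc n) * (s * Gamma s) = exp (- t) * ((- 1) ^ n / fact n * Gamma s)"
    unfolding s_def by (simp add: divide_simps)
  ultimately show ?thesis
    unfolding mittag_leffler_term_def mittag_leffler_coeff_def
    by (simp add: s_def mult_ac del: of_nat_Suc)
qed

lemma mittag_leffler_term_0: "mittag_leffler_term t x 0 = 0"
  by (simp add: mittag_leffler_term_def)

text \<open>
  Any angle in \<open>(pi / 2, min pi (pi / (2 * \<alpha>)))\<close> would do.
\<close>

lemma rotation_angle_exists:
  assumes "0 < \<alpha>" "\<alpha> < (1::real)"
  obtains \<theta> where "pi / 2 < \<theta>" "\<theta> < pi" "\<alpha> * \<theta> < pi / 2"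
proof
  define \<theta> where "\<theta> = pi / 2 * ((3 - \<alpha>) / 2)"
  have "0 < (1 - \<alpha>) * (2 - \<alpha>)" using assms by (intro mult_pos_pos) auto
  then have "\<alpha> * ((3 - \<alpha>) / 2) < 1" by (simp add: algebra_simps)
  then have "pi / 2 * (\<alpha> * ((3 - \<alpha>) / 2)) < pi / 2 * 1" by (intro mult_strict_left_mono) auto
  then show "\<alpha> * \<theta> < pi / 2" by (simp add: \<theta>_def mult_ac)
  have "pi / 2 * 1 < pi / 2 * ((3 - \<alpha>) / 2)" "pi / 2 * ((3 - \<alpha>) / 2) < pi / 2 * 2"
    using assms by (intro mult_strict_left_mono; simp)+
  then show "pi / 2 < \<theta>" "\<theta> < pi" by (simp_all add: \<theta>_def)
qed

lemma mittag_leffler_coeff_sums: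
  assumes "0 < \<alpha>" "\<alpha> < 1" "pi / 2 < \<theta>" "\<theta> < pi" "\<alpha> * \<theta> < pi / 2" "0 < x"
  shows "(\<lambda>n. mittag_leffler_coeff \<alpha> n * x ^ n) sums (Im (\<integral> r. ray_kernel \<alpha> \<theta> x r \<partial>lborel) / pi)"
proof -
  have "mittag_leffler_coeff \<alpha> n * x ^ n =
      Im (of_real ((- x) ^ n / fact n * Gamma (\<alpha> * real (Suc n))) * cis (pi * (\<alpha> * real (Suc n)))) / pi" for n
  proof -
    have Im: "Im (of_real a * cis b) = a * sin b" for a b by simp
    have "(- x) ^ n = (- 1) ^ n * x ^ n" by (rule power_minus)
    then show ?thesis unfolding Im by (simp add: mittag_leffler_coeff_def del: of_nat_Suc)
  qed
  then show ?thesis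
    using sums_divide[OF sums_Im[OF ray_kernel_series[OF assms]], of pi] by (simp only:)
qed

lemma summable_mittag_leffler_coeff:
  assumes "0 < \<alpha>" "\<alpha> < 1" "0 < x"
  shows "summable (\<lambda>n. mittag_leffler_coeff \<alpha> n * x ^ n)"
  using rotation_angle_exists[OF assms(1,2)] mittag_leffler_coeff_sums[OF assms(1,2) _ _ _ assms(3)]
  by (metis sums_summable)

lemma summable_mittag_leffler_term:
  assumes "0 < t" "0 < x"
  shows "summable (mittag_leffler_term t x)"
proof -
  have "summable (\<lambda>n. mittag_leffler_term t x (Suc n))"
    unfolding mittag_leffler_term_Suc using assms by (intro summable_mult summable_mittag_leffler_coeff) auto
  then show ?thesis by (simp only: summable_Suc_iff)
qed

lemma mittag_leffler_density_eq:
  assumes t: "0 < t" and x: "0 < x"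
  shows "mittag_leffler_density t x = (\<Sum>n. mittag_leffler_coeff (exp (- t)) n * x ^ n)"
proof -
  have "(\<Sum>k. mittag_leffler_term t x k) = (\<Sum>n. mittag_leffler_term t x (Suc n))"
    using suminf_split_head[OF summable_mittag_leffler_term[OF t x]] by (simp add: mittag_leffler_term_0)
  also have "\<dots> = exp (- t) * pi * (\<Sum>n. mittag_leffler_coeff (exp (- t)) n * x ^ n)"
    unfolding mittag_leffler_term_Suc using t x by (intro suminf_mult summable_mittag_leffler_coeff) auto
  finally have "mittag_leffler_density t x = exp t / pi * (exp (- t) * pi * (\<Sum>n. mittag_leffler_coeff (exp (- t)) n * x ^ n))"
    using x by (simp add: mittag_leffler_density_def)
  then show ?thesis by (simp add: exp_minus field_simps)
qed

lemma isCont_mittag_leffler_series: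
  assumes "0 < \<alpha>" "\<alpha> < 1"
  shows "isCont (\<lambda>x. \<Sum>n. mittag_leffler_coeff \<alpha> n * x ^ n) x"
  by (rule isCont_powser[where K="\<bar>x\<bar> + 1"]) (auto intro!: summable_mittag_leffler_coeff assms)

lemma borel_measurable_mittag_leffler_density:
  assumes "0 < t"
  shows "mittag_leffler_density t \<in> borel_measurable borel"
proof -
  have "(\<lambda>x. \<Sum>n. mittag_leffler_coeff (exp (- t)) n * x ^ n) \<in> borel_measurable borel"
    using assms by (intro borel_measurable_continuous_onI continuous_at_imp_continuous_on ballI isCont_mittag_leffler_series) auto
  then have "(\<lambda>x. if 0 < x then \<Sum>n. mittag_leffler_coeff (exp (- t)) n * x ^ n else 0) \<in> borel_measurable borel"
    by measurable
  moreover have "mittag_leffler_density t = (\<lambda>x. if 0 < x then \<Sum>n. mittag_leffler_coeff (exp (- t)) n * x ^ n else 0)"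
    using mittag_leffler_density_eq[OF assms] by (auto simp: mittag_leffler_density_def)
  ultimately show ?thesis by simp
qed

lemma AE_mass_pos: "0 \<le> t \<Longrightarrow> AE z in rrt. 0 < mass t z"
  using AE_good by eventually_elim (auto dest: good_convergent)

lemma nn_integral_mass_density:
  assumes t: "0 < t" and G: "G \<in> borel_measurable borel"
  shows "(\<integral>\<^sup>+ z. G (mass t z) \<partial>rrt) + (\<integral>\<^sup>+ x. ennreal (indicator {0<..} x * max 0 (- mittag_leffler_density t x)) * G x \<partial>lborel)
    = (\<integral>\<^sup>+ x. ennreal (indicator {0<..} x * max 0 (mittag_leffler_density t x)) * G x \<partial>lborel)"
proof -
  obtain \<theta> where \<theta>: "pi / 2 < \<theta>" "\<theta> < pi" "exp (- t) * \<theta> < pi / 2"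
    using rotation_angle_exists[of "exp (- t)"] t by auto
  have eq: "indicator {0<..} x * (mittag_leffler_density t x * x powr p) =
      indicator {0<..} x * (Im (\<integral> r. ray_kernel (exp (- t)) \<theta> x r \<partial>lborel) / pi * x powr p)" for x p
  proof (cases "0 < x")
    case True
    then have "mittag_leffler_density t x = Im (\<integral> r. ray_kernel (exp (- t)) \<theta> x r \<partial>lborel) / pi"
      using mittag_leffler_coeff_sums[OF _ _ \<theta> True] t by (simp add: mittag_leffler_density_eq sums_iff)
    then show ?thesis by simp
  qed simp
  show ?thesis
  proof (rule Mellin_unique[where a="-1/4" and b=0])
    fix p :: real assume p: "-1/4 < p" "p < 0"
    show "integrable rrt (\<lambda>z. mass t z powr p)" using t p by (intro moments_mass) auto
    have p1: "-1 < p" using p by simp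
    have e: "0 < exp (- t)" "exp (- t) < 1" using t by auto
    show "integrable lborel (\<lambda>x. indicator {0<..} x * (mittag_leffler_density t x * x powr p))"
      unfolding eq by (rule ray_kernel_Mellin(1)[OF e \<theta> p1 p(2)])
    show "(\<integral> z. mass t z powr p \<partial>rrt) = (\<integral> x. indicator {0<..} x * (mittag_leffler_density t x * x powr p) \<partial>lborel)"
      unfolding eq ray_kernel_Mellin(2)[OF e \<theta> p1 p(2)] using t p by (intro moments_mass) auto
  qed (use t AE_mass_pos borel_measurable_mittag_leffler_density G in \<open>auto intro: rrt.prob_space_axioms\<close>)
qed

text \<open>
  Test the identity of laws on the set where the density is negative: the negative part has no mass,
  so this set is null, and it is open because the power series is continuous.
\<close>

lemma mittag_leffler_density_nonneg:
  assumes t: "0 < t" and x: "0 < x"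
  shows "0 \<le> mittag_leffler_density t x"
proof (rule ccontr)
  note [measurable] = borel_measurable_mittag_leffler_density[OF t]
  let ?f = "mittag_leffler_density t"
  define S where "S = (\<lambda>x. \<Sum>n. mittag_leffler_coeff (exp (- t)) n * x ^ n)"
  define N where "N = {x. 0 < x \<and> ?f x < 0}"
  have N: "N \<in> sets borel" unfolding N_def by measurable
  have "(\<integral>\<^sup>+ x. ennreal (indicator {0<..} x * max 0 (- ?f x)) * indicator N x \<partial>lborel) \<le>
      (\<integral>\<^sup>+ x. ennreal (indicator {0<..} x * max 0 (?f x)) * indicator N x \<partial>lborel)"
    using nn_integral_mass_density[OF t, of "indicator N"] N
    by (metis (no_types, lifting) add.commute borel_measurable_indicator le_iff_add)
  also have "\<dots> = (\<integral>\<^sup>+ x. 0 \<partial>(lborel :: real measure))"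
    by (intro nn_integral_cong) (auto simp: N_def indicator_def max_def)
  finally have "(\<integral>\<^sup>+ x. ennreal (indicator {0<..} x * max 0 (- ?f x)) * indicator N x \<partial>lborel) = 0" by simp
  then have "AE x in lborel. ennreal (indicator {0<..} x * max 0 (- ?f x)) * indicator N x = 0"
    using N by (subst (asm) nn_integral_0_iff_AE) auto
  then have ae: "AE x in lborel. x \<notin> N"
    by eventually_elim (auto simp: N_def indicator_def split: if_splits)
  assume "\<not> 0 \<le> ?f x"
  then have neg: "S x < 0" using mittag_leffler_density_eq[OF t x] by (simp add: S_def)
  have cS: "isCont S y" for y unfolding S_def using t by (intro isCont_mittag_leffler_series) auto
  have "open ({0<..} \<inter> S -` {..<0})"
    using cS by (intro open_Int open_vimage) (auto intro: continuous_at_imp_continuous_on)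
  moreover have "{0<..} \<inter> S -` {..<0} = N"
    by (auto simp: N_def S_def mittag_leffler_density_eq[OF t])
  ultimately have oN: "open N" by simp
  \<comment> \<open>A nonempty open set is not null.\<close>
  have "N \<in> null_sets lborel" using ae N by (subst AE_iff_null_sets) auto
  then have "negligible N" unfolding negligible_iff_null_sets by (rule null_sets_completionI)
  then have "N = {}" using oN open_not_negligible by blast
  moreover have "x \<in> N" using neg x by (simp add: N_def S_def mittag_leffler_density_eq[OF t])
  ultimately show False by simp
qed

lemma distributed_mass:
  assumes t: "0 < t"
  shows "distributed rrt lborel (mass t) (\<lambda>x. ennreal (mittag_leffler_density t x))"
proof -
  note [measurable] = borel_measurable_mittag_leffler_density[OF t]
  have nn: "indicator {0<..} x * max 0 (- mittag_leffler_density t x) = 0"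
    "indicator {0<..} x * max 0 (mittag_leffler_density t x) = mittag_leffler_density t x" for x :: real
    using mittag_leffler_density_nonneg[OF t, of x] by (auto simp: indicator_def max_def mittag_leffler_density_def)
  have m: "mass t \<in> measurable rrt lborel" using t by simp
  show ?thesis
    unfolding distributed_def
  proof (intro conjI m)
    show "distr rrt lborel (mass t) = density lborel (\<lambda>x. ennreal (mittag_leffler_density t x))"
    proof (rule measure_eqI)
      fix A assume "A \<in> sets (distr rrt lborel (mass t))"
      then have A [measurable]: "A \<in> sets borel" by simp
      have "emeasure (distr rrt lborel (mass t)) A = (\<integral>\<^sup>+ x. indicator A x \<partial>distr rrt lborel (mass t))"
        by simp
      also have "\<dots> = (\<integral>\<^sup>+ z. indicator A (mass t z) \<partial>rrt)"
        using m by (intro nn_integral_distr) auto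
      also have "\<dots> = (\<integral>\<^sup>+ x. ennreal (mittag_leffler_density t x) * indicator A x \<partial>lborel)"
        using nn_integral_mass_density[OF t, of "indicator A"] by (simp add: nn)
      finally show "emeasure (distr rrt lborel (mass t)) A = emeasure (density lborel (\<lambda>x. ennreal (mittag_leffler_density t x))) A"
        by (simp add: emeasure_density)
    qed simp
  qed measurable
qed

section \<open>The Markov semigroup of the root block\<close>

definition mass_kernel :: "real \<Rightarrow> real \<Rightarrow> real measure" where
  "mass_kernel t x = distr rrt borel (\<lambda>z. x powr exp (- t) * mass t z)"

lemma emeasure_mass_kernel:
  assumes "0 \<le> t" "A \<in> sets borel"
  shows "emeasure (mass_kernel t x) A = (\<integral>\<^sup>+ z. indicator A (x powr exp (- t) * mass t z) \<partial>rrt)"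
proof -
  have "emeasure (mass_kernel t x) A = (\<integral>\<^sup>+ y. indicator A y \<partial>mass_kernel t x)"
    using assms by (simp add: mass_kernel_def)
  also have "\<dots> = (\<integral>\<^sup>+ z. indicator A (x powr exp (- t) * mass t z) \<partial>rrt)"
    unfolding mass_kernel_def using assms by (intro nn_integral_distr) auto
  finally show ?thesis .
qed

lemma borel_measurable_mass_kernel:
  assumes t: "0 \<le> t" and A: "A \<in> sets borel"
  shows "(\<lambda>x. emeasure (mass_kernel t x) A) \<in> borel_measurable borel"
    and "(\<lambda>x. measure (mass_kernel t x) A) \<in> borel_measurable borel"
proof -
  note [measurable] = A borel_measurable_mass[OF t]
  have "(\<lambda>(x, z). indicator A (x powr exp (- t) * mass t z) :: ennreal) \<in> borel_measurable (borel \<Otimes>\<^sub>M rrt)"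
    by measurable
  then have "(\<lambda>x. \<integral>\<^sup>+ z. indicator A (x powr exp (- t) * mass t z) \<partial>rrt) \<in> borel_measurable borel"
    by (rule rrt.borel_measurable_nn_integral)
  then show "(\<lambda>x. emeasure (mass_kernel t x) A) \<in> borel_measurable borel"
    by (simp add: emeasure_mass_kernel[OF t A])
  then show "(\<lambda>x. measure (mass_kernel t x) A) \<in> borel_measurable borel"
    unfolding measure_def by measurable
qed

lemma prob_space_mass_kernel: "0 \<le> t \<Longrightarrow> prob_space (mass_kernel t x)"
  unfolding mass_kernel_def by (rule rrt.prob_space_distr) simp

text \<open>
  The value at time \<open>s + t\<close> is obtained from the one at time \<open>s\<close> by \<open>mass_shift\<close>; integrating out the
  independent shifted tree first leaves the kernel for time \<open>t\<close>.
\<close>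

lemma mass_kernel_semigroup:
  assumes s: "0 \<le> s" and t: "0 \<le> t" and x: "0 < x" and A: "A \<in> sets borel"
  shows "emeasure (mass_kernel (s + t) x) A = (\<integral>\<^sup>+ y\<in>{0<..}. emeasure (mass_kernel t y) A \<partial>mass_kernel s x)"
proof -
  note [measurable] = A borel_measurable_mass[OF t] borel_measurable_mass[OF s]
    borel_measurable_mass_root_alg[OF s order.refl] borel_measurable_mass_kernel(1)[OF t A]
  define m where "m = (\<lambda>z. x powr exp (- s) * mass s z)"
  define F where "F = (\<lambda>(z, z'). indicator A (m z powr exp (- t) * mass t z') :: ennreal)"
  have F: "F \<in> borel_measurable (root_alg s \<Otimes>\<^sub>M rrt)" unfolding F_def m_def by measurable
  have st: "0 \<le> s + t" using s t by simp
  have "emeasure (mass_kernel (s + t) x) A = (\<integral>\<^sup>+ z. F (z, shift s z) \<partial>rrt)"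
    unfolding emeasure_mass_kernel[OF st A]
  proof (rule nn_integral_cong_AE)
    show "AE z in rrt. indicator A (x powr exp (- (s + t)) * mass (s + t) z) = F (z, shift s z)"
      using AE_good_at[OF s] AE_mass_pos[OF s]
    proof eventually_elim
      case (elim z)
      have "x powr exp (- (s + t)) * mass (s + t) z = m z powr exp (- t) * mass t (shift s z)"
        unfolding mass_shift[OF elim(1) s t] m_def using elim(2) x
        by (simp add: powr_mult powr_powr exp_add[symmetric] algebra_simps)
      then show ?case by (simp add: F_def)
    qed
  qed
  also have "\<dots> = (\<integral>\<^sup>+ z. \<integral>\<^sup>+ z'. F (z, z') \<partial>rrt \<partial>rrt)" by (rule nn_integral_shift[OF s F])
  also have "\<dots> = (\<integral>\<^sup>+ z. emeasure (mass_kernel t (m z)) A * indicator {0<..} (m z) \<partial>rrt)"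
  proof (rule nn_integral_cong_AE)
    show "AE z in rrt. (\<integral>\<^sup>+ z'. F (z, z') \<partial>rrt) = emeasure (mass_kernel t (m z)) A * indicator {0<..} (m z)"
      using AE_mass_pos[OF s]
    proof eventually_elim
      case (elim z)
      then have "0 < m z" using x by (simp add: m_def)
      then show ?case by (simp add: F_def emeasure_mass_kernel[OF t A])
    qed
  qed
  also have "\<dots> = (\<integral>\<^sup>+ y\<in>{0<..}. emeasure (mass_kernel t y) A \<partial>mass_kernel s x)"
    unfolding mass_kernel_def[of s] m_def by (intro nn_integral_distr[symmetric]) measurable
  finally show ?thesis .
qed

lemma markov_semigroup_mass_kernel: "markov_semigroup {0<..} mass_kernel"
  unfolding markov_semigroup_def
proof (intro conjI allI impI ballI)
  fix t x :: real assume t: "0 \<le> t" and x: "x \<in> {0<..}"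
  show "prob_space (mass_kernel t x)" by (rule prob_space_mass_kernel[OF t])
  show "sets (mass_kernel t x) = sets borel" by (simp add: mass_kernel_def)
  have "AE z in rrt. x powr exp (- t) * mass t z \<in> {0<..}"
    using AE_mass_pos[OF t] by eventually_elim (use x in auto)
  then show "AE y in mass_kernel t x. y \<in> {0<..}"
    unfolding mass_kernel_def using t by (subst AE_distr_iff) auto
next
  fix t :: real and A :: "real set" assume "0 \<le> t" "A \<in> sets borel"
  then show "(\<lambda>x. emeasure (mass_kernel t x) A) \<in> borel_measurable (restrict_space borel {0<..})"
    by (intro measurable_restrict_space1 borel_measurable_mass_kernel)
next
  fix x :: real assume x: "x \<in> {0<..}"
  have "mass_kernel 0 x = distr rrt borel (\<lambda>z. x)"
    unfolding mass_kernel_def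
  proof (rule distr_cong_AE)
    show "AE z in rrt. x powr exp (- 0) * mass 0 z = x"
      using AE_good by eventually_elim (use x good_levy_0 in auto)
  qed auto
  then show "mass_kernel 0 x = return borel x" by (simp add: rrt.distr_const)
qed (use mass_kernel_semigroup in auto)

lemma integral_mass_transition:
  assumes s: "0 \<le> s" and t: "0 \<le> t" and A: "A \<in> sets borel" and B: "B \<in> sets (root_alg s)"
  shows "(\<integral> z. indicator B z * indicator A (mass (s + t) z) \<partial>rrt) =
     (\<integral> z. indicator B z * measure (mass_kernel t (mass s z)) A \<partial>rrt)"
proof -
  note [measurable] = A B borel_measurable_mass[OF t] borel_measurable_mass_root_alg[OF s order.refl]
  have B': "B \<in> sets rrt" using B root_alg_subset by blast
  define F where "F = (\<lambda>(z, z'). indicator B z * indicator A (mass s z powr exp (- t) * mass t z') :: real)"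
  have F: "F \<in> borel_measurable (root_alg s \<Otimes>\<^sub>M rrt)" unfolding F_def by measurable
  have b: "\<bar>F x\<bar> \<le> 1" for x by (auto simp: F_def indicator_def split: prod.split)
  have "(\<integral> z. indicator B z * indicator A (mass (s + t) z) \<partial>rrt) = (\<integral> z. F (z, shift s z) \<partial>rrt)"
  proof (rule integral_cong_AE)
    show "AE z in rrt. indicator B z * indicator A (mass (s + t) z) = F (z, shift s z)"
      using AE_good_at[OF s] by eventually_elim (simp add: F_def mass_shift s t)
    have "(\<lambda>z. (z, shift s z)) \<in> rrt \<rightarrow>\<^sub>M root_alg s \<Otimes>\<^sub>M rrt"
      by (intro measurable_Pair measurable_ident_root_alg measurable_shift)
    then show "(\<lambda>z. F (z, shift s z)) \<in> borel_measurable rrt" by (rule measurable_compose[OF _ F])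
    have st: "0 \<le> s + t" using s t by simp
    show "(\<lambda>z. indicator B z * indicator A (mass (s + t) z) :: real) \<in> borel_measurable rrt"
      by (intro borel_measurable_times borel_measurable_indicator B'
          measurable_compose[OF borel_measurable_mass[OF st] borel_measurable_indicator[OF A]])
  qed
  also have "\<dots> = (\<integral> z. (\<integral> z'. F (z, z') \<partial>rrt) \<partial>rrt)" by (rule integral_shift[OF s F b])
  also have "\<dots> = (\<integral> z. indicator B z * measure (mass_kernel t (mass s z)) A \<partial>rrt)"
  proof -
    have "(\<integral> z'. indicator A (y powr exp (- t) * mass t z') \<partial>rrt) = measure (mass_kernel t y) A" for y
    proof -
      have "(\<integral> z'. indicator A (y powr exp (- t) * mass t z') \<partial>rrt) = (\<integral> v. (indicator A v :: real) \<partial>mass_kernel t y)"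
        unfolding mass_kernel_def using t by (intro integral_distr[symmetric]) auto
      then show ?thesis by (simp add: mass_kernel_def)
    qed
    then show ?thesis by (simp add: F_def)
  qed
  finally show ?thesis .
qed

section \<open>Stationary independent increments\<close>

lemma distr_levy_increment:
  assumes s: "0 \<le> s" and t: "0 \<le> t"
  shows "distr rrt borel (\<lambda>z. levy (s + t) z - levy s z) = distr rrt borel (levy t)"
proof -
  have "distr rrt borel (\<lambda>z. levy (s + t) z - levy s z) = distr rrt borel (\<lambda>z. levy t (shift s z))"
  proof (rule distr_cong_AE)
    show "AE z in rrt. levy (s + t) z - levy s z = levy t (shift s z)"
      using AE_good_at[OF s] by eventually_elim (simp add: levy_shift s t)
    show "(\<lambda>z. levy t (shift s z)) \<in> borel_measurable rrt"
      by (rule measurable_compose[OF measurable_shift borel_measurable_levy[OF t]])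
    show "(\<lambda>z. levy (s + t) z - levy s z) \<in> borel_measurable rrt" using s t by simp
  qed auto
  also have "\<dots> = distr (distr rrt rrt (shift s)) borel (levy t)"
    using t by (subst distr_distr) (auto simp: comp_def)
  finally show ?thesis by (simp add: distr_shift[OF s])
qed

text \<open>
  The last increment is a function of the tree shifted by the last but one time, and the previous
  increments are determined by the history up to that time.
\<close>

lemma prob_levy_increments:
  assumes \<tau>: "0 \<le> \<tau> 0" "\<And>k. k < n \<Longrightarrow> \<tau> k \<le> \<tau> (Suc k)" and D: "\<And>k. k < n \<Longrightarrow> D k \<in> sets borel"
  shows "rrt.prob {z \<in> space rrt. \<forall>k<n. levy (\<tau> (Suc k)) z - levy (\<tau> k) z \<in> D k} =
    (\<Prod>k<n. rrt.prob {z \<in> space rrt. levy (\<tau> (Suc k)) z - levy (\<tau> k) z \<in> D k})"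
  using \<tau>(2) D
proof (induction n)
  case 0
  then show ?case by (simp add: rrt.prob_space)
next
  case (Suc n)
  let ?I = "\<lambda>k z. levy (\<tau> (Suc k)) z - levy (\<tau> k) z"
  have le: "\<tau> i \<le> \<tau> j" if "i \<le> j" "j \<le> Suc n" for i j
    using that
  proof (induction j rule: dec_induct)
    case (step j) then show ?case using Suc.prems(1)[of j] by simp
  qed simp
  have \<tau>_nonneg: "0 \<le> \<tau> j" if "j \<le> Suc n" for j using le[OF le0 that] \<tau>(1) by simp
  define s where "s = \<tau> n"
  define r where "r = \<tau> (Suc n) - s"
  have s: "0 \<le> s" and r: "0 \<le> r" and sr: "\<tau> (Suc n) = s + r"
    using \<tau>_nonneg[of n] Suc.prems(1)[of n] by (auto simp: s_def r_def)
  have meas: "levy (\<tau> k) \<in> borel_measurable (root_alg s)" if "k \<le> n" for k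
    using that \<tau>_nonneg[of k] le[of k n] by (intro borel_measurable_levy_root_alg) (auto simp: s_def)
  define E where "E = {z \<in> space rrt. \<forall>k<n. ?I k z \<in> D k}"
  have E: "E \<in> sets (root_alg s)"
  proof -
    have "?I k \<in> borel_measurable (root_alg s)" if "k < n" for k
      using that by (intro borel_measurable_diff meas) auto
    then have "?I k -` D k \<inter> space (root_alg s) \<in> sets (root_alg s)" if "k < n" for k
      using that Suc.prems(2) by (intro measurable_sets) auto
    then have one: "{z \<in> space (root_alg s). ?I k z \<in> D k} \<in> sets (root_alg s)" if "k < n" for k
      using that by (simp add: vimage_def Int_def conj_commute)
    have "{z \<in> space (root_alg s). \<forall>k\<in>{..<n}. ?I k z \<in> D k} \<in> sets (root_alg s)"
      by (rule sets.sets_Collect_finite_All[OF one]) simp_all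
    then show ?thesis unfolding E_def space_root_alg Ball_def lessThan_iff .
  qed
  have Dn: "D n \<in> sets borel" using Suc.prems by simp
  have lm: "levy r -` D n \<inter> space rrt \<in> sets rrt" by (rule measurable_sets[OF borel_measurable_levy[OF r] Dn])
  have mI: "?I n \<in> borel_measurable rrt"
    using s r unfolding sr s_def[symmetric] by simp
  have Im: "{z \<in> space rrt. ?I n z \<in> D n} \<in> sets rrt"
    using measurable_sets[OF mI Dn] by (simp add: vimage_def Int_def conj_commute)
  have E': "E \<in> sets rrt" using E root_alg_subset by blast
  have "rrt.prob {z \<in> space rrt. \<forall>k<Suc n. ?I k z \<in> D k} = rrt.prob (E \<inter> (shift s -` (levy r -` D n \<inter> space rrt) \<inter> space rrt))"
  proof (rule rrt.finite_measure_eq_AE)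
    show "AE z in rrt. z \<in> {z \<in> space rrt. \<forall>k<Suc n. ?I k z \<in> D k} \<longleftrightarrow>
        z \<in> E \<inter> (shift s -` (levy r -` D n \<inter> space rrt) \<inter> space rrt)"
      using AE_good_at[OF s] AE_space
    proof eventually_elim
      case (elim z)
      have "levy (\<tau> (Suc n)) z - levy (\<tau> n) z = levy r (shift s z)"
        using levy_shift[OF elim(1) s r] by (simp add: sr s_def)
      moreover have "shift s z \<in> space rrt" by (rule measurable_space[OF measurable_shift elim(2)])
      ultimately show ?case using elim(2) by (auto simp: E_def All_less_Suc)
    qed
    have "{z \<in> space rrt. \<forall>k<Suc n. ?I k z \<in> D k} = E \<inter> {z \<in> space rrt. ?I n z \<in> D n}"
      by (auto simp: E_def All_less_Suc)
    then show "{z \<in> space rrt. \<forall>k<Suc n. ?I k z \<in> D k} \<in> sets rrt" using sets.Int[OF E' Im] by (simp only:)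
    show "E \<inter> (shift s -` (levy r -` D n \<inter> space rrt) \<inter> space rrt) \<in> sets rrt"
      by (rule sets.Int[OF E' measurable_sets[OF measurable_shift lm]])
  qed
  also have "\<dots> = rrt.prob E * rrt.prob (levy r -` D n \<inter> space rrt)" by (rule prob_root_alg_shift[OF s E lm])
  also have "rrt.prob (levy r -` D n \<inter> space rrt) = rrt.prob {z \<in> space rrt. ?I n z \<in> D n}"
  proof -
    have "rrt.prob {z \<in> space rrt. ?I n z \<in> D n} = measure (distr rrt borel (?I n)) (D n)"
      using measure_distr[OF mI Dn] by (simp add: vimage_def Int_def conj_commute)
    also have "distr rrt borel (?I n) = distr rrt borel (levy r)"
      using distr_levy_increment[OF s r] by (simp add: sr s_def)
    also have "measure \<dots> (D n) = rrt.prob (levy r -` D n \<inter> space rrt)"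
      by (rule measure_distr[OF borel_measurable_levy[OF r] Dn])
    finally show ?thesis by simp
  qed
  also have "rrt.prob E = (\<Prod>k<n. rrt.prob {z \<in> space rrt. ?I k z \<in> D k})"
    unfolding E_def using Suc.prems by (intro Suc.IH) auto
  finally show ?case by simp
qed

section \<open>Transfer to an arbitrary probability space\<close>

lemma markov_process_cong:
  assumes "\<And>t x. 0 \<le> t \<Longrightarrow> P t x = Q t x" and "markov_process M E X P"
  shows "markov_process M E X Q"
  using assms(2) unfolding markov_process_def markov_semigroup_def
  by (simp add: assms(1)[symmetric]) (intro allI impI ballI, subst assms(1)[symmetric], assumption, blast)

context random_tree_destruction
begin

definition marks :: "'a \<Rightarrow> nat \<Rightarrow> nat \<times> real" where
  "marks \<omega> = (\<lambda>i\<in>{2..}. (u i \<omega>, \<epsilon> i \<omega>))"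

lemma \<epsilon>_measurable: "2 \<le> i \<Longrightarrow> \<epsilon> i \<in> borel_measurable M"
  using \<epsilon>_exponential[of i] distributed_measurable[of M lborel "\<epsilon> i"] by simp

lemma measurable_mark:
  assumes "2 \<le> i"
  shows "(\<lambda>\<omega>. (u i \<omega>, \<epsilon> i \<omega>)) \<in> M \<rightarrow>\<^sub>M mark i"
  unfolding measurable_cong_sets[OF refl sets_mark]
  using assms by (intro measurable_Pair u_measurable \<epsilon>_measurable)

lemma measurable_marks: "marks \<in> M \<rightarrow>\<^sub>M rrt"
  unfolding marks_def[abs_def] rrt_def by (intro measurable_restrict measurable_mark) simp

text \<open>
  Independence of the sequence \<open>u\<close> from the sequence \<open>\<epsilon>\<close>, together with independence inside each,
  factorises the probabilities of rectangles, which generate the joint \<open>\<sigma>\<close>-algebra.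
\<close>

lemma prob_rectangles:
  assumes J: "J \<noteq> {}" "finite J" "J \<subseteq> {2..}" and B: "\<And>j. j \<in> J \<Longrightarrow> B j \<in> sets borel"
  shows "prob (\<Inter>j\<in>J. (\<lambda>\<omega>. (u j \<omega>, \<epsilon> j \<omega>)) -` (A j \<times> B j) \<inter> space M) =
    (\<Prod>j\<in>J. prob (u j -` A j \<inter> space M) * prob (\<epsilon> j -` B j \<inter> space M))"
proof -
  define U where "U = (\<Inter>j\<in>J. u j -` A j \<inter> space M)"
  define V where "V = (\<Inter>j\<in>J. \<epsilon> j -` B j \<inter> space M)"
  have "(\<lambda>\<omega>. \<lambda>i\<in>{2..}. u i \<omega>) -` prod_emb {2..} (\<lambda>_. count_space UNIV) J (Pi\<^sub>E J A) \<inter> space M = U"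
    using J by (auto simp: U_def prod_emb_iff PiE_iff subset_iff)
  moreover have "prod_emb {2..} (\<lambda>_. count_space UNIV) J (Pi\<^sub>E J A) \<in> sets (\<Pi>\<^sub>M i\<in>{2..}. count_space UNIV)"
    using J by (intro sets_PiM_I) auto
  ultimately have U: "U \<in> sets (vimage_algebra (space M) (\<lambda>\<omega>. \<lambda>i\<in>{2..}. u i \<omega>) (\<Pi>\<^sub>M i\<in>{2..}. count_space UNIV))"
    using in_vimage_algebra by metis
  have "(\<lambda>\<omega>. \<lambda>i\<in>{2..}. \<epsilon> i \<omega>) -` prod_emb {2..} (\<lambda>_. borel) J (Pi\<^sub>E J B) \<inter> space M = V"
    using J by (auto simp: V_def prod_emb_iff PiE_iff subset_iff)
  moreover have "prod_emb {2..} (\<lambda>_. borel) J (Pi\<^sub>E J B) \<in> sets (\<Pi>\<^sub>M i\<in>{2..}. borel)"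
    using J B by (intro sets_PiM_I) auto
  ultimately have V: "V \<in> sets (vimage_algebra (space M) (\<lambda>\<omega>. \<lambda>i\<in>{2..}. \<epsilon> i \<omega>) (\<Pi>\<^sub>M i\<in>{2..}. borel))"
    using in_vimage_algebra by metis
  have "(\<Inter>j\<in>J. (\<lambda>\<omega>. (u j \<omega>, \<epsilon> j \<omega>)) -` (A j \<times> B j) \<inter> space M) = U \<inter> V"
    using J(1) by (auto simp: U_def V_def)
  then have "prob (\<Inter>j\<in>J. (\<lambda>\<omega>. (u j \<omega>, \<epsilon> j \<omega>)) -` (A j \<times> B j) \<inter> space M) = prob U * prob V"
    using indep_setD[OF u_\<epsilon>_indep U V] by simp
  also have "prob U = (\<Prod>j\<in>J. prob (u j -` A j \<inter> space M))"
    unfolding U_def by (rule indep_varsD[OF u_indep J]) simp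
  also have "prob V = (\<Prod>j\<in>J. prob (\<epsilon> j -` B j \<inter> space M))"
    unfolding V_def by (rule indep_varsD[OF \<epsilon>_indep J B])
  finally show ?thesis by (simp add: prod.distrib)
qed

lemma distr_mark:
  assumes i: "2 \<le> i"
  shows "distr M (mark i) (\<lambda>\<omega>. (u i \<omega>, \<epsilon> i \<omega>)) = mark i"
  unfolding mark_def
proof (rule pair_measure_eqI[symmetric])
  fix A B assume A: "A \<in> sets (measure_pmf (pmf_of_set {1..<i}))" and "B \<in> sets exp_law"
  then have B: "B \<in> sets borel" by simp
  have AB: "A \<times> B \<in> sets (measure_pmf (pmf_of_set {1..<i}) \<Otimes>\<^sub>M exp_law)"
    using A B by (intro pair_measureI) auto
  have "emeasure (measure_pmf (pmf_of_set {1..<i})) A = prob (u i -` A \<inter> space M)"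
    using u_uniform[OF i] emeasure_distr[OF u_measurable[OF i], of A] by (simp add: emeasure_eq_measure)
  moreover have "emeasure exp_law B = prob (\<epsilon> i -` B \<inter> space M)"
  proof -
    have "emeasure exp_law B = emeasure (distr M lborel (\<epsilon> i)) B"
      using \<epsilon>_exponential[OF i] by (simp add: exp_law_def distributed_def)
    also have "\<dots> = prob (\<epsilon> i -` B \<inter> space M)"
      using B \<epsilon>_measurable[OF i] by (subst emeasure_distr) (auto simp: emeasure_eq_measure)
    finally show ?thesis .
  qed
  moreover have "emeasure (distr M (measure_pmf (pmf_of_set {1..<i}) \<Otimes>\<^sub>M exp_law) (\<lambda>\<omega>. (u i \<omega>, \<epsilon> i \<omega>))) (A \<times> B) =
      prob ((\<lambda>\<omega>. (u i \<omega>, \<epsilon> i \<omega>)) -` (A \<times> B) \<inter> space M)"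
    using emeasure_distr[OF measurable_mark[OF i, unfolded mark_def] AB] by (simp add: emeasure_eq_measure)
  moreover have "prob ((\<lambda>\<omega>. (u i \<omega>, \<epsilon> i \<omega>)) -` (A \<times> B) \<inter> space M) = prob (u i -` A \<inter> space M) * prob (\<epsilon> i -` B \<inter> space M)"
    using prob_rectangles[of "{i}" "\<lambda>_. B" "\<lambda>_. A"] i B by simp
  ultimately show "emeasure (measure_pmf (pmf_of_set {1..<i})) A * emeasure exp_law B =
      emeasure (distr M (measure_pmf (pmf_of_set {1..<i}) \<Otimes>\<^sub>M exp_law) (\<lambda>\<omega>. (u i \<omega>, \<epsilon> i \<omega>))) (A \<times> B)"
    by (simp add: ennreal_mult)
qed (rule measure_pmf.sigma_finite_measure_axioms exp_law.sigma_finite_measure_axioms sets_distr[symmetric])+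

lemma indep_marks:
  assumes J: "J \<noteq> {}" "finite J" "J \<subseteq> {2..}"
  shows "indep_vars (\<lambda>_. count_space UNIV \<Otimes>\<^sub>M borel) (\<lambda>i \<omega>. (u i \<omega>, \<epsilon> i \<omega>)) J"
proof (subst indep_vars_finite[OF J(1,2), where E="\<lambda>_. {A \<times> B | A B. A \<in> sets (count_space (UNIV :: nat set)) \<and> B \<in> sets (borel :: real measure)}"])
  let ?E = "{A \<times> B | A B. A \<in> sets (count_space (UNIV :: nat set)) \<and> B \<in> sets (borel :: real measure)}"
  show "sets (count_space UNIV \<Otimes>\<^sub>M borel) = sigma_sets (space (count_space UNIV \<Otimes>\<^sub>M borel)) ?E"
    by (simp add: sets_pair_measure space_pair_measure)
  show "random_variable (count_space UNIV \<Otimes>\<^sub>M borel) (\<lambda>\<omega>. (u i \<omega>, \<epsilon> i \<omega>))" if "i \<in> J" for i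
    using that J(3) by (intro measurable_Pair u_measurable \<epsilon>_measurable) auto
  show "Int_stable ?E" by (rule Int_stable_pair_measure_generator)
  show "space (count_space UNIV \<Otimes>\<^sub>M borel) \<in> ?E"
    unfolding space_pair_measure by (rule CollectI, rule exI, rule exI, rule conjI, rule refl) (intro conjI sets.top)
  show "?E \<subseteq> Pow (space (count_space UNIV \<Otimes>\<^sub>M borel))" by (simp add: space_pair_measure)
  show "\<forall>C\<in>J \<rightarrow> ?E. prob (\<Inter>j\<in>J. (\<lambda>\<omega>. (u j \<omega>, \<epsilon> j \<omega>)) -` C j \<inter> space M) =
      (\<Prod>j\<in>J. prob ((\<lambda>\<omega>. (u j \<omega>, \<epsilon> j \<omega>)) -` C j \<inter> space M))"
  proof
    fix C assume "C \<in> J \<rightarrow> ?E"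
    then have "\<forall>j\<in>J. \<exists>A B. C j = A \<times> B \<and> B \<in> sets borel" by blast
    then obtain A B where C: "\<And>j. j \<in> J \<Longrightarrow> C j = A j \<times> B j" and B: "\<And>j. j \<in> J \<Longrightarrow> B j \<in> sets borel" by metis
    have one: "prob ((\<lambda>\<omega>. (u j \<omega>, \<epsilon> j \<omega>)) -` (A j \<times> B j) \<inter> space M) = prob (u j -` A j \<inter> space M) * prob (\<epsilon> j -` B j \<inter> space M)"
      if "j \<in> J" for j
      using prob_rectangles[of "{j}" B A] that J(3) B by auto
    have "(\<Inter>j\<in>J. (\<lambda>\<omega>. (u j \<omega>, \<epsilon> j \<omega>)) -` C j \<inter> space M) = (\<Inter>j\<in>J. (\<lambda>\<omega>. (u j \<omega>, \<epsilon> j \<omega>)) -` (A j \<times> B j) \<inter> space M)"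
      by (intro INF_cong refl) (simp add: C)
    moreover have "(\<Prod>j\<in>J. prob ((\<lambda>\<omega>. (u j \<omega>, \<epsilon> j \<omega>)) -` C j \<inter> space M)) =
        (\<Prod>j\<in>J. prob (u j -` A j \<inter> space M) * prob (\<epsilon> j -` B j \<inter> space M))"
      by (intro prod.cong refl) (simp only: C one)
    ultimately show "prob (\<Inter>j\<in>J. (\<lambda>\<omega>. (u j \<omega>, \<epsilon> j \<omega>)) -` C j \<inter> space M) =
        (\<Prod>j\<in>J. prob ((\<lambda>\<omega>. (u j \<omega>, \<epsilon> j \<omega>)) -` C j \<inter> space M))"
      using prob_rectangles[OF J B, where A=A] by (simp only:)
  qed
qed

lemma distr_marks: "distr M rrt marks = rrt"
proof -
  interpret P: product_prob_space mark "{2..}" ..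
  have "distr M rrt marks = PiM {2..} mark"
  proof (rule P.PiM_eq)
    show "sets (distr M rrt marks) = sets (Pi\<^sub>M {2..} mark)" by (simp add: rrt_def)
    fix J F assume J: "finite J" "J \<subseteq> {2..}" and F: "\<And>j. j \<in> J \<Longrightarrow> F j \<in> sets (mark j)"
    have "prod_emb {2..} mark J (Pi\<^sub>E J F) \<in> sets rrt"
      unfolding rrt_def using J F by (intro sets_PiM_I) auto
    then have "emeasure (distr M rrt marks) (prod_emb {2..} mark J (Pi\<^sub>E J F)) =
        emeasure M (marks -` prod_emb {2..} mark J (Pi\<^sub>E J F) \<inter> space M)"
      by (rule emeasure_distr[OF measurable_marks])
    also have "marks -` prod_emb {2..} mark J (Pi\<^sub>E J F) \<inter> space M =
        {\<omega> \<in> space M. \<forall>j\<in>J. (u j \<omega>, \<epsilon> j \<omega>) \<in> F j}"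
      using J by (auto simp: marks_def prod_emb_iff PiE_iff subset_iff)
    also have "emeasure M \<dots> = (\<Prod>j\<in>J. emeasure (mark j) (F j))"
    proof (cases "J = {}")
      case False
      have "prob (\<Inter>j\<in>J. (\<lambda>\<omega>. (u j \<omega>, \<epsilon> j \<omega>)) -` F j \<inter> space M) =
          (\<Prod>j\<in>J. prob ((\<lambda>\<omega>. (u j \<omega>, \<epsilon> j \<omega>)) -` F j \<inter> space M))"
        using F sets_mark by (intro indep_varsD_finite[OF indep_marks[OF False J]] False J(1)) auto
      moreover have "{\<omega> \<in> space M. \<forall>j\<in>J. (u j \<omega>, \<epsilon> j \<omega>) \<in> F j} = (\<Inter>j\<in>J. (\<lambda>\<omega>. (u j \<omega>, \<epsilon> j \<omega>)) -` F j \<inter> space M)"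
        using False by auto
      moreover have "emeasure (mark j) (F j) = prob ((\<lambda>\<omega>. (u j \<omega>, \<epsilon> j \<omega>)) -` F j \<inter> space M)" if "j \<in> J" for j
      proof -
        have "2 \<le> j" using that J(2) by auto
        from emeasure_distr[OF measurable_mark[OF this] F[OF that]] distr_mark[OF this]
        show ?thesis by (simp add: emeasure_eq_measure)
      qed
      ultimately show ?thesis by (simp add: emeasure_eq_measure prod_ennreal)
    qed (simp add: emeasure_space_1)
    finally show "emeasure (distr M rrt marks) (prod_emb {2..} mark J (Pi\<^sub>E J F)) = (\<Prod>j\<in>J. emeasure (mark j) (F j))" .
  qed
  then show ?thesis by (simp add: rrt_def)
qed

lemma AE_marks: "AE z in rrt. P z \<Longrightarrow> AE \<omega> in M. P (marks \<omega>)"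
  using AE_distrD[OF measurable_marks, of P] by (simp only: distr_marks)

lemma prob_marks:
  assumes "{z \<in> space rrt. P z} \<in> sets rrt"
  shows "prob {\<omega> \<in> space M. P (marks \<omega>)} = rrt.prob {z \<in> space rrt. P z}"
proof -
  have "marks -` {z \<in> space rrt. P z} \<inter> space M = {\<omega> \<in> space M. P (marks \<omega>)}"
    using measurable_space[OF measurable_marks] by auto
  then show ?thesis using measure_distr[OF measurable_marks assms] by (simp add: distr_marks)
qed

lemma integral_marks:
  fixes f :: "_ \<Rightarrow> real"
  assumes "f \<in> borel_measurable rrt"
  shows "integrable M (\<lambda>\<omega>. f (marks \<omega>)) \<longleftrightarrow> integrable rrt f"
    and "(\<integral> \<omega>. f (marks \<omega>) \<partial>M) = (\<integral> z. f z \<partial>rrt)"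
  using integrable_distr_eq[OF measurable_marks assms] integral_distr[OF measurable_marks assms]
  by (simp_all add: distr_marks)

lemma distr_marks_comp:
  assumes "f \<in> rrt \<rightarrow>\<^sub>M N"
  shows "distr M N (\<lambda>\<omega>. f (marks \<omega>)) = distr rrt N f"
  using distr_distr[OF assms measurable_marks] by (simp add: distr_marks comp_def)

lemma scaled_count_marks: "scaled_count u \<epsilon> t \<omega> = scaled_count par cut t (marks \<omega>)"
proof -
  have "remaining_edges (\<lambda>i. u i \<omega>) (\<lambda>i. \<epsilon> i \<omega>) t =
      remaining_edges (\<lambda>i. par i (marks \<omega>)) (\<lambda>i. cut i (marks \<omega>)) t"
    by (auto simp: remaining_edges_def par_def cut_def marks_def)
  then have "root_block (\<lambda>i. u i \<omega>) (\<lambda>i. \<epsilon> i \<omega>) t = root_block (\<lambda>i. par i (marks \<omega>)) (\<lambda>i. cut i (marks \<omega>)) t"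
    by (simp add: root_block_eq connected_vertices_def)
  then show ?thesis by (simp add: scaled_count_def fun_eq_iff)
qed

lemma X\<^sub>1_marks: "X\<^sub>1 u \<epsilon> t \<omega> = mass t (marks \<omega>)"
  by (simp add: X\<^sub>1_def scaled_count_marks)

lemma Y_marks: "Y u \<epsilon> t \<omega> = log_mass t (marks \<omega>)"
  by (simp add: Y_def X\<^sub>1_marks)

lemma L_marks: "L u \<epsilon> t \<omega> = levy t (marks \<omega>)"
  by (simp add: L_def Y_marks)

text \<open>
  The natural filtration of \<open>X\<^sub>1\<close> is contained in the history of the root block, to which the branching
  Markov property applies.
\<close>

lemma natural_filtration_marks:
  fixes s :: real
  defines "F \<equiv> natural_filtration M (X\<^sub>1 u \<epsilon>) s"
  assumes "B \<in> sets F"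
  obtains B' where "B' \<in> sets (root_alg s)" "B = marks -` B' \<inter> space M"
proof -
  have sp: "marks \<in> space M \<rightarrow> space (root_alg s)"
    using measurable_space[OF measurable_marks] by simp
  let ?G = "{X\<^sub>1 u \<epsilon> r -` A \<inter> space M | r A. 0 \<le> r \<and> r \<le> s \<and> A \<in> sets borel}"
  have "?G \<subseteq> sets (vimage_algebra (space M) marks (root_alg s))"
  proof
    fix S assume "S \<in> ?G"
    then obtain r A where r: "0 \<le> r" "r \<le> s" "A \<in> sets borel" and S: "S = X\<^sub>1 u \<epsilon> r -` A \<inter> space M" by blast
    have "mass r -` A \<inter> space (root_alg s) \<in> sets (root_alg s)"
      by (rule measurable_sets[OF borel_measurable_mass_root_alg[OF r(1,2)] r(3)])
    from in_vimage_algebra[OF this]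
    have "marks -` (mass r -` A \<inter> space (root_alg s)) \<inter> space M \<in> sets (vimage_algebra (space M) marks (root_alg s))" .
    moreover have "marks -` (mass r -` A \<inter> space (root_alg s)) \<inter> space M = S"
      using sp by (auto simp: S X\<^sub>1_marks)
    ultimately show "S \<in> sets (vimage_algebra (space M) marks (root_alg s))" by simp
  qed
  then have "sigma_sets (space M) ?G \<subseteq> sets (vimage_algebra (space M) marks (root_alg s))"
    using sets.sigma_sets_subset[of ?G "vimage_algebra (space M) marks (root_alg s)"] by simp
  moreover have "sets F = sigma_sets (space M) ?G"
    unfolding F_def natural_filtration_def by (rule sets_measure_of) auto
  ultimately have "B \<in> sets (vimage_algebra (space M) marks (root_alg s))" using assms(2) by blast
  then show ?thesis using that unfolding sets_vimage_algebra2[OF sp] by blast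
qed

lemma subalgebra_natural_filtration: "subalgebra M (natural_filtration M (X\<^sub>1 u \<epsilon>) s)"
  unfolding subalgebra_def
proof
  show "space (natural_filtration M (X\<^sub>1 u \<epsilon>) s) = space M"
    unfolding natural_filtration_def by (rule space_measure_of) auto
  show "sets (natural_filtration M (X\<^sub>1 u \<epsilon>) s) \<subseteq> events"
  proof
    fix B assume "B \<in> sets (natural_filtration M (X\<^sub>1 u \<epsilon>) s)"
    then obtain B' where "B' \<in> sets (root_alg s)" "B = marks -` B' \<inter> space M"
      by (rule natural_filtration_marks)
    then show "B \<in> events" using measurable_sets[OF measurable_marks] root_alg_subset by blast
  qed
qed

lemma measurable_X\<^sub>1: "0 \<le> t \<Longrightarrow> X\<^sub>1 u \<epsilon> t \<in> borel_measurable M"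
  unfolding X\<^sub>1_marks[abs_def] by (rule measurable_compose[OF measurable_marks borel_measurable_mass])

lemma measurable_X\<^sub>1_natural_filtration:
  assumes "0 \<le> s"
  shows "X\<^sub>1 u \<epsilon> s \<in> borel_measurable (natural_filtration M (X\<^sub>1 u \<epsilon>) s)"
proof (rule measurableI)
  fix A :: "real set" assume "A \<in> sets borel"
  then have "X\<^sub>1 u \<epsilon> s -` A \<inter> space M \<in> {X\<^sub>1 u \<epsilon> r -` A \<inter> space M | r A. 0 \<le> r \<and> r \<le> s \<and> A \<in> sets borel}"
    using assms by blast
  moreover have "space (natural_filtration M (X\<^sub>1 u \<epsilon>) s) = space M"
    using subalgebra_natural_filtration by (simp add: subalgebra_def)
  moreover have "sets (natural_filtration M (X\<^sub>1 u \<epsilon>) s) =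
      sigma_sets (space M) {X\<^sub>1 u \<epsilon> r -` A \<inter> space M | r A. 0 \<le> r \<and> r \<le> s \<and> A \<in> sets borel}"
    unfolding natural_filtration_def by (rule sets_measure_of) auto
  ultimately show "X\<^sub>1 u \<epsilon> s -` A \<inter> space (natural_filtration M (X\<^sub>1 u \<epsilon>) s) \<in> sets (natural_filtration M (X\<^sub>1 u \<epsilon>) s)"
    by (simp only: sigma_sets.Basic)
qed simp

lemma cond_exp_X\<^sub>1:
  assumes s: "0 \<le> s" and t: "0 \<le> t" and A: "A \<in> sets borel"
  shows "AE \<omega> in M. real_cond_exp M (natural_filtration M (X\<^sub>1 u \<epsilon>) s) (\<lambda>\<omega>. indicator A (X\<^sub>1 u \<epsilon> (s + t) \<omega>)) \<omega>
    = measure (mass_kernel t (X\<^sub>1 u \<epsilon> s \<omega>)) A"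
proof -
  let ?F = "natural_filtration M (X\<^sub>1 u \<epsilon>) s"
  let ?k = "\<lambda>\<omega>. measure (mass_kernel t (X\<^sub>1 u \<epsilon> s \<omega>)) A"
  have st: "0 \<le> s + t" using s t by simp
  interpret F: finite_measure_subalgebra M ?F
    by unfold_locales (rule subalgebra_natural_filtration)
  have kF: "?k \<in> borel_measurable ?F"
    by (rule measurable_compose[OF measurable_X\<^sub>1_natural_filtration[OF s] borel_measurable_mass_kernel(2)[OF t A]])
  have kM: "?k \<in> borel_measurable M"
    by (rule measurable_from_subalg[OF subalgebra_natural_filtration kF])
  have iM: "(\<lambda>\<omega>. indicator A (X\<^sub>1 u \<epsilon> (s + t) \<omega>) :: real) \<in> borel_measurable M"
    by (rule measurable_compose[OF measurable_X\<^sub>1[OF st] borel_measurable_indicator[OF A]])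
  show ?thesis
  proof (rule F.real_cond_exp_charact[OF _ _ _ kF])
    show "integrable M (\<lambda>\<omega>. indicator A (X\<^sub>1 u \<epsilon> (s + t) \<omega>) :: real)"
      by (rule integrable_const_bound[where B=1, OF _ iM]) (auto simp: indicator_def)
    have "measure (mass_kernel t x) A \<le> 1" for x
      by (rule prob_space.prob_le_1[OF prob_space_mass_kernel[OF t]])
    then show "integrable M ?k" by (intro integrable_const_bound[where B=1, OF _ kM]) auto
    fix B assume "B \<in> sets ?F"
    then obtain B' where B': "B' \<in> sets (root_alg s)" and B: "B = marks -` B' \<inter> space M"
      by (rule natural_filtration_marks)
    have B'r: "B' \<in> sets rrt" using B' root_alg_subset by blast
    have ind: "indicator B \<omega> = (indicator B' (marks \<omega>) :: real)" if "\<omega> \<in> space M" for \<omega>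
      using that by (simp add: B indicator_def)
    have m1: "(\<lambda>z. indicator B' z * indicator A (mass (s + t) z) :: real) \<in> borel_measurable rrt"
      by (intro borel_measurable_times borel_measurable_indicator B'r
          measurable_compose[OF borel_measurable_mass[OF st] borel_measurable_indicator[OF A]])
    have m2: "(\<lambda>z. indicator B' z * measure (mass_kernel t (mass s z)) A) \<in> borel_measurable rrt"
      by (intro borel_measurable_times borel_measurable_indicator B'r
          measurable_compose[OF borel_measurable_mass[OF s] borel_measurable_mass_kernel(2)[OF t A]])
    have "(\<integral> \<omega>\<in>B. (indicator A (X\<^sub>1 u \<epsilon> (s + t) \<omega>) :: real) \<partial>M) = (\<integral> \<omega>. indicator B' (marks \<omega>) * indicator A (mass (s + t) (marks \<omega>)) \<partial>M)"
      unfolding set_lebesgue_integral_def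
      by (intro Bochner_Integration.integral_cong refl) (simp add: ind X\<^sub>1_marks)
    also have "\<dots> = (\<integral> z. indicator B' z * indicator A (mass (s + t) z) \<partial>rrt)" by (rule integral_marks(2)[OF m1])
    also have "\<dots> = (\<integral> z. indicator B' z * measure (mass_kernel t (mass s z)) A \<partial>rrt)"
      by (rule integral_mass_transition[OF s t A B'])
    also have "\<dots> = (\<integral> \<omega>. indicator B' (marks \<omega>) * measure (mass_kernel t (mass s (marks \<omega>))) A \<partial>M)"
      by (rule integral_marks(2)[OF m2, symmetric])
    also have "\<dots> = (\<integral> \<omega>\<in>B. ?k \<omega> \<partial>M)"
      unfolding set_lebesgue_integral_def
      by (intro Bochner_Integration.integral_cong refl) (simp add: ind X\<^sub>1_marks)
    finally show "(\<integral> \<omega>\<in>B. indicator A (X\<^sub>1 u \<epsilon> (s + t) \<omega>) \<partial>M) = (\<integral> \<omega>\<in>B. ?k \<omega> \<partial>M)" .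
  qed
qed

lemma markov_process_X\<^sub>1:
  "markov_process M {0<..} (X\<^sub>1 u \<epsilon>) (\<lambda>t x. distr M borel (\<lambda>\<omega>. x powr exp (- t) * X\<^sub>1 u \<epsilon> t \<omega>))"
proof (rule markov_process_cong)
  show "mass_kernel t x = distr M borel (\<lambda>\<omega>. x powr exp (- t) * X\<^sub>1 u \<epsilon> t \<omega>)" if "0 \<le> t" for t x
    unfolding mass_kernel_def X\<^sub>1_marks using that by (intro distr_marks_comp[symmetric]) simp
  have "AE \<omega> in M. X\<^sub>1 u \<epsilon> t \<omega> \<in> {0<..}" if "0 \<le> t" for t
    using AE_marks[OF AE_mass_pos[OF that]] by (simp add: X\<^sub>1_marks)
  then show "markov_process M {0<..} (X\<^sub>1 u \<epsilon>) mass_kernel"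
    unfolding markov_process_def
    by (intro conjI allI impI ballI markov_semigroup_mass_kernel measurable_X\<^sub>1 cond_exp_X\<^sub>1)
qed

lemma measurable_L: "0 \<le> t \<Longrightarrow> L u \<epsilon> t \<in> borel_measurable M"
  unfolding L_marks[abs_def] by (rule measurable_compose[OF measurable_marks borel_measurable_levy])

lemma indep_increments_L:
  assumes \<tau>: "0 \<le> \<tau> 0" "\<And>k. k < n \<Longrightarrow> \<tau> k \<le> \<tau> (Suc k)"
  shows "indep_vars (\<lambda>_. borel) (\<lambda>k \<omega>. L u \<epsilon> (\<tau> (Suc k)) \<omega> - L u \<epsilon> (\<tau> k) \<omega>) {..<n}"
proof (cases "n = 0")
  case True
  then show ?thesis by (simp add: indep_vars_def indep_sets_def)
next
  case False
  have \<tau>_nonneg: "0 \<le> \<tau> k" if "k \<le> n" for k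
    using that by (induction k) (use \<tau> order_trans in \<open>auto simp: Suc_le_eq\<close>)
  let ?I = "\<lambda>k z. levy (\<tau> (Suc k)) z - levy (\<tau> k) z"
  have mI: "?I k \<in> borel_measurable rrt" if "k < n" for k
    using \<tau>_nonneg[of k] \<tau>_nonneg[of "Suc k"] that by simp
  show ?thesis
    unfolding L_marks
  proof (subst indep_vars_finite[where E="\<lambda>_. sets borel"])
    show "random_variable borel (\<lambda>\<omega>. ?I k (marks \<omega>))" if "k \<in> {..<n}" for k
      using that by (intro measurable_compose[OF measurable_marks mI]) simp
    show "sets (borel :: real measure) = sigma_sets (space borel) (sets borel)"
      by (rule sets.sigma_sets_eq[symmetric])
    show "\<forall>D\<in>{..<n} \<rightarrow> sets borel. prob (\<Inter>k\<in>{..<n}. (\<lambda>\<omega>. ?I k (marks \<omega>)) -` D k \<inter> space M) =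
        (\<Prod>k<n. prob ((\<lambda>\<omega>. ?I k (marks \<omega>)) -` D k \<inter> space M))"
    proof
      fix D assume "D \<in> {..<n} \<rightarrow> sets (borel :: real measure)"
      then have D: "D k \<in> sets borel" if "k < n" for k using that by auto
      have one: "{z \<in> space rrt. ?I k z \<in> D k} \<in> sets rrt" if "k < n" for k
        using measurable_sets[OF mI[OF that] D[OF that]] by (simp add: vimage_def Int_def conj_commute)
      have "{z \<in> space rrt. \<forall>k\<in>{..<n}. ?I k z \<in> D k} \<in> sets rrt"
        by (rule sets.sets_Collect_finite_All[OF one]) simp_all
      then have all: "{z \<in> space rrt. \<forall>k<n. ?I k z \<in> D k} \<in> sets rrt" unfolding Ball_def lessThan_iff .
      have "(\<Inter>k\<in>{..<n}. (\<lambda>\<omega>. ?I k (marks \<omega>)) -` D k \<inter> space M) = {\<omega> \<in> space M. \<forall>k<n. ?I k (marks \<omega>) \<in> D k}"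
        using False by auto
      then have "prob (\<Inter>k\<in>{..<n}. (\<lambda>\<omega>. ?I k (marks \<omega>)) -` D k \<inter> space M) =
          rrt.prob {z \<in> space rrt. \<forall>k<n. ?I k z \<in> D k}"
        using prob_marks[OF all] by (simp only:)
      also have "\<dots> = (\<Prod>k<n. rrt.prob {z \<in> space rrt. ?I k z \<in> D k})"
        by (rule prob_levy_increments[OF \<tau> D])
      also have "\<dots> = (\<Prod>k<n. prob ((\<lambda>\<omega>. ?I k (marks \<omega>)) -` D k \<inter> space M))"
      proof (rule prod.cong[OF refl])
        fix k assume "k \<in> {..<n}"
        then have "prob {\<omega> \<in> space M. ?I k (marks \<omega>) \<in> D k} = rrt.prob {z \<in> space rrt. ?I k z \<in> D k}"
          by (intro prob_marks one) simp
        moreover have "{\<omega> \<in> space M. ?I k (marks \<omega>) \<in> D k} = (\<lambda>\<omega>. ?I k (marks \<omega>)) -` D k \<inter> space M" by auto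
        ultimately show "rrt.prob {z \<in> space rrt. ?I k z \<in> D k} = prob ((\<lambda>\<omega>. ?I k (marks \<omega>)) -` D k \<inter> space M)" by (simp only:)
      qed
      finally show "prob (\<Inter>k\<in>{..<n}. (\<lambda>\<omega>. ?I k (marks \<omega>)) -` D k \<inter> space M) =
        (\<Prod>k<n. prob ((\<lambda>\<omega>. ?I k (marks \<omega>)) -` D k \<inter> space M))" .
    qed
  qed (use False in \<open>auto simp: Int_stable_def\<close>)
qed

lemma spectrally_negative_levy_process_L: "spectrally_negative_levy_process M (L u \<epsilon>)"
  unfolding spectrally_negative_levy_process_def levy_process_def
proof (intro conjI allI impI)
  have good: "AE \<omega> in M. good (marks \<omega>)" by (rule AE_marks[OF AE_good])
  show "AE \<omega> in M. L u \<epsilon> 0 \<omega> = 0"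
    using good by eventually_elim (simp add: L_marks good_levy_0)
  show "AE \<omega> in M. cadlag (\<lambda>t. L u \<epsilon> t \<omega>)"
    using good by eventually_elim (simp add: L_marks good_cadlag_levy(1))
  show "AE \<omega> in M. \<forall>t>0. \<forall>l. ((\<lambda>s. L u \<epsilon> s \<omega>) \<longlongrightarrow> l) (at_left t) \<longrightarrow> L u \<epsilon> t \<omega> \<le> l"
    using good by eventually_elim (use good_cadlag_levy(2) in \<open>simp add: L_marks\<close>)
  fix s t :: real assume s: "0 \<le> s" and t: "0 \<le> t"
  have "distr M borel (\<lambda>\<omega>. L u \<epsilon> (s + t) \<omega> - L u \<epsilon> s \<omega>) = distr rrt borel (\<lambda>z. levy (s + t) z - levy s z)"
    unfolding L_marks using s t by (intro distr_marks_comp) simp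
  moreover have "distr M borel (\<lambda>\<omega>. L u \<epsilon> (0 + t) \<omega> - L u \<epsilon> 0 \<omega>) = distr rrt borel (\<lambda>z. levy (0 + t) z - levy 0 z)"
    unfolding L_marks using t by (intro distr_marks_comp) simp
  ultimately show "distr M borel (\<lambda>\<omega>. L u \<epsilon> (s + t) \<omega> - L u \<epsilon> s \<omega>) = distr M borel (\<lambda>\<omega>. L u \<epsilon> t \<omega> - L u \<epsilon> 0 \<omega>)"
    using distr_levy_increment[OF s t] distr_levy_increment[OF order.refl t] by simp
qed (use measurable_L indep_increments_L in auto)

lemma distributed_X\<^sub>1:
  assumes "0 < t"
  shows "distributed M lborel (X\<^sub>1 u \<epsilon> t) (\<lambda>x. ennreal (mittag_leffler_density t x))"
proof -
  have m: "mass t \<in> rrt \<rightarrow>\<^sub>M lborel" using assms by simp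
  have "distr M lborel (X\<^sub>1 u \<epsilon> t) = distr rrt lborel (mass t)"
    unfolding X\<^sub>1_marks[abs_def] by (rule distr_marks_comp[OF m])
  moreover have "X\<^sub>1 u \<epsilon> t \<in> M \<rightarrow>\<^sub>M lborel" using measurable_X\<^sub>1[of t] assms by simp
  ultimately show ?thesis using distributed_mass[OF assms] by (simp add: distributed_def)
qed

end

theorem theorem2:
  fixes M :: "'a measure" and u :: "nat \<Rightarrow> 'a \<Rightarrow> nat" and \<epsilon> :: "nat \<Rightarrow> 'a \<Rightarrow> real"
  assumes "random_tree_destruction M u \<epsilon>"
  shows
    "(\<forall>t\<ge>0. AE \<omega> in M. scaled_count u \<epsilon> t \<omega> \<longlonglongrightarrow> X\<^sub>1 u \<epsilon> t \<omega> \<and> 0 < X\<^sub>1 u \<epsilon> t \<omega>)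
   \<and> (\<forall>t>0. (\<forall>x>0. summable (mittag_leffler_term t x) \<and> 0 \<le> mittag_leffler_density t x)
          \<and> distributed M lborel (X\<^sub>1 u \<epsilon> t) (\<lambda>x. ennreal (mittag_leffler_density t x)))
   \<and> (\<forall>t\<ge>0. \<forall>q\<ge>0. integrable M (\<lambda>\<omega>. X\<^sub>1 u \<epsilon> t \<omega> powr q)
          \<and> (\<integral>\<omega>. X\<^sub>1 u \<epsilon> t \<omega> powr q \<partial>M) = Gamma (q + 1) / Gamma (exp (- t) * q + 1))
   \<and> markov_process M {0<..} (X\<^sub>1 u \<epsilon>)
          (\<lambda>t x. distr M borel (\<lambda>\<omega>. x powr exp (- t) * X\<^sub>1 u \<epsilon> t \<omega>))
   \<and> (AE \<omega> in M. \<forall>t\<ge>0. set_integrable lborel {0..t} (\<lambda>s. Y u \<epsilon> s \<omega>))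
   \<and> spectrally_negative_levy_process M (L u \<epsilon>)
   \<and> (\<forall>q\<ge>0. integrable M (\<lambda>\<omega>. exp (q * L u \<epsilon> 1 \<omega>))
          \<and> ln (\<integral>\<omega>. exp (q * L u \<epsilon> 1 \<omega>) \<partial>M) = q * Digamma (q + 1))"
proof -
  interpret random_tree_destruction M u \<epsilon> by (rule assms)
  have conv: "AE \<omega> in M. scaled_count u \<epsilon> t \<omega> \<longlonglongrightarrow> X\<^sub>1 u \<epsilon> t \<omega> \<and> 0 < X\<^sub>1 u \<epsilon> t \<omega>" if "0 \<le> t" for t
    using AE_marks[OF AE_good]
    by eventually_elim (use good_convergent(2,3)[OF _ that] in \<open>simp add: X\<^sub>1_marks scaled_count_marks\<close>)
  have moments: "integrable M (\<lambda>\<omega>. X\<^sub>1 u \<epsilon> t \<omega> powr q)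
      \<and> (\<integral>\<omega>. X\<^sub>1 u \<epsilon> t \<omega> powr q \<partial>M) = Gamma (q + 1) / Gamma (exp (- t) * q + 1)"
    if "0 \<le> t" "0 \<le> q" for t q
  proof -
    have m: "(\<lambda>z. mass t z powr q) \<in> borel_measurable rrt" using that by simp
    show ?thesis using integral_marks[OF m] moments_mass[of t q] that by (simp add: X\<^sub>1_marks)
  qed
  have path: "AE \<omega> in M. \<forall>t\<ge>0. set_integrable lborel {0..t} (\<lambda>s. Y u \<epsilon> s \<omega>)"
    using AE_marks[OF AE_good] by eventually_elim (simp add: Y_marks good_set_integrable)
  have cumulant: "integrable M (\<lambda>\<omega>. exp (q * L u \<epsilon> 1 \<omega>))
      \<and> ln (\<integral>\<omega>. exp (q * L u \<epsilon> 1 \<omega>) \<partial>M) = q * Digamma (q + 1)" if "0 \<le> q" for q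
  proof -
    have m: "(\<lambda>z. exp (q * levy 1 z)) \<in> borel_measurable rrt" by simp
    show ?thesis using integral_marks[OF m] cumulant_levy[OF that] by (simp add: L_marks)
  qed
  show ?thesis
    by (intro conjI allI impI conv summable_mittag_leffler_term mittag_leffler_density_nonneg distributed_X\<^sub>1
        moments[THEN conjunct1] moments[THEN conjunct2] markov_process_X\<^sub>1 path
        spectrally_negative_levy_process_L cumulant[THEN conjunct1] cumulant[THEN conjunct2])
qed

end
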